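(* For every constant $\gamma>0$ there is an algorithm that PAC learns the class ${\sf FORMULA}[n^{2-\gamma}]\circ{\sf XOR}$ of $n$-variate Boolean functions to accuracy $\varepsilon$ and confidence $\delta$ in time $\mathrm{poly}\big(2^{n/\log n},1/\varepsilon,\log(1/\delta)\big)$.
   Context: A de Morgan formula is a rooted tree whose internal gates are AND, OR (fan-in 2) and NOT (fan-in 1) and whose leaves are labelled by inputs; its size is the number of leaves. ${\sf FORMULA}[s]\circ{\sf XOR}$ is the class of functions $F(g_1(x),\dots,g_s(x))$ where $F$ is a de Morgan formula of size at most $s$ and each $g_i$ is a parity $x\mapsto\bigoplus_{i\in S}x_i$ ($S\subseteq[n]$) or its negation. PAC learning: for a function $f$ and a distribution $\mathcal{D}$ over $\{0,1\}^n$, ${\rm EX}(f,\mathcal{D})$ returns independent samples $(x,f(x))$ with $x\sim\mathcal{D}$. An algorithm $A$ PAC learns a class $\mathcal{C}$ if for every $n$, every $f\in\mathcal{C}$ on $n$ variables, every distribution $\mathcal{D}$ over $\{0,1\}^n$ and every $\varepsilon,\delta>0$, $A$ with access to ${\rm EX}(f,\mathcal{D})$ and input $(1^n,\varepsilon,\delta)$ outputs, with probability at least $1-\delta$, a description of a hypothesis $h$ with $\Pr_{x\sim\mathcal{D}}[h(x)=f(x)]\ge1-\varepsilon$. *)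

theory Defs
  imports "HOL-Probability.Probability"
begin

datatype formula = Leaf nat | NotF formula | AndF formula formula | OrF formula formula

fun leaves :: "formula \<Rightarrow> nat" where
  "leaves (Leaf i) = 1"
| "leaves (NotF F) = leaves F"
| "leaves (AndF F G) = leaves F + leaves G"
| "leaves (OrF F G) = leaves F + leaves G"

fun feval :: "formula \<Rightarrow> (nat \<Rightarrow> bool) \<Rightarrow> bool" where
  "feval (Leaf i) y = y i"
| "feval (NotF F) y = (\<not> feval F y)"
| "feval (AndF F G) y = (feval F y \<and> feval G y)"
| "feval (OrF F G) y = (feval F y \<or> feval G y)"

text \<open>Parity of the bits of x indexed by S, possibly negated (b = True).
  Inputs in {0,1}^n are bool lists of length n, variable x_i is x ! i (0-based).\<close>
definition parity :: "nat set \<Rightarrow> bool \<Rightarrow> bool list \<Rightarrow> bool" where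
  "parity S b x = (odd (card {i \<in> S. x ! i}) \<noteq> b)"

definition formula_xor :: "nat \<Rightarrow> real \<Rightarrow> (bool list \<Rightarrow> bool) set" where
  "formula_xor n s = {f. \<exists>F (S :: nat \<Rightarrow> nat set) (b :: nat \<Rightarrow> bool).
       real (leaves F) \<le> s \<and> (\<forall>i. S i \<subseteq> {..<n}) \<and>
       (\<forall>x. length x = n \<longrightarrow> f x = feval F (\<lambda>i. parity (S i) (b i) x))}"

datatype sym = Blank | Zero | One | Sep
datatype move = MvL | MvR | MvS

record tm =
  tm_states :: nat
  tm_trans :: "nat \<Rightarrow> sym \<Rightarrow> nat \<times> sym \<times> move"

text \<open>Start state 0, halting state 1; finitely many states.\<close>
definition tm_wf :: "tm \<Rightarrow> bool" where
  "tm_wf M = (2 \<le> tm_states M \<and>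
     (\<forall>q < tm_states M. \<forall>s. fst (tm_trans M q s) < tm_states M))"

type_synonym config = "nat \<times> (int \<Rightarrow> sym) \<times> int"

definition mv :: "move \<Rightarrow> int" where
  "mv m = (case m of MvL \<Rightarrow> -1 | MvR \<Rightarrow> 1 | MvS \<Rightarrow> 0)"

definition tm_step :: "tm \<Rightarrow> config \<Rightarrow> config" where
  "tm_step M c = (case c of (q, t, p) \<Rightarrow>
     if q = 1 then (q, t, p)
     else (case tm_trans M q (t p) of (q', s, m) \<Rightarrow> (q', t(p := s), p + mv m)))"

definition tm_init :: "sym list \<Rightarrow> config" where
  "tm_init w = (0, (\<lambda>i. if 0 \<le> i \<and> nat i < length w then w ! nat i else Blank), 0)"

definition tape_out :: "(int \<Rightarrow> sym) \<Rightarrow> sym list" where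
  "tape_out t = map (\<lambda>i. t (int i)) [0..<(LEAST i. t (int i) = Blank)]"

definition tm_run :: "tm \<Rightarrow> nat \<Rightarrow> sym list \<Rightarrow> sym list option" where
  "tm_run M T w = (case (tm_step M ^^ T) (tm_init w) of (q, t, p) \<Rightarrow>
     if q = 1 then Some (tape_out t) else None)"

definition enc_bits :: "bool list \<Rightarrow> sym list" where
  "enc_bits bs = map (\<lambda>b. if b then One else Zero) bs"

fun bin :: "nat \<Rightarrow> bool list" where
  "bin n = (if n = 0 then [] else odd n # bin (n div 2))"

definition learner_input ::
  "nat \<Rightarrow> real \<Rightarrow> real \<Rightarrow> (bool list \<times> bool) list \<Rightarrow> bool list \<Rightarrow> sym list" where
  "learner_input n \<epsilon> \<delta> smp r =
     replicate n One @ [Sep] @ enc_bits (bin (nat \<lceil>1 / \<epsilon>\<rceil>)) @ [Sep]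
     @ enc_bits (bin (nat \<lceil>1 / \<delta>\<rceil>)) @ [Sep]
     @ concat (map (\<lambda>(x, y). enc_bits x @ enc_bits [y] @ [Sep]) smp) @ [Sep] @ enc_bits r"

definition hyp :: "tm \<Rightarrow> (nat \<Rightarrow> nat) \<Rightarrow> sym list \<Rightarrow> bool list \<Rightarrow> bool" where
  "hyp E B w x = (tm_run E (B (length w + length x)) (enc_bits x @ [Sep] @ w) = Some [One])"

fun iid :: "nat \<Rightarrow> 'a pmf \<Rightarrow> 'a list pmf" where
  "iid 0 D = return_pmf []"
| "iid (Suc m) D = bind_pmf D (\<lambda>x. map_pmf (\<lambda>xs. x # xs) (iid m D))"

definition learn_time :: "real \<Rightarrow> nat \<Rightarrow> nat \<Rightarrow> real \<Rightarrow> real \<Rightarrow> real" where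
  "learn_time c k n \<epsilon> \<delta> =
     c * (2 powr (real n / log 2 (real n)) + 1 / \<epsilon> + max 1 (log 2 (1 / \<delta>))) ^ k"

end

theory Submission
  imports Defs "HOL-Probability.Probability" "HOL-Real_Asymp.Real_Asymp"
begin

text \<open>The learning machine does nothing but halt: its hypothesis is its own input, the
  examples together with the coin tosses. All work is left to the evaluator, which classifies a
  point by simulating a learning procedure on the stored data in time polynomial in the length of
  that data. What remains is a bound on sample size: 2^(O(n / log n)) times a polynomial in the
  other parameters must suffice for a procedure that is polynomial in the sample.

  Weak correlation. A de Morgan formula with s leaves has a solution of the dual adversary problem
  of cost sqrt s (\<open>adv_formula\<close>). It yields a product of two reflections on a space of
  dimension 2s + 1, one fixed and one reading the leaves, whose amplitude averaged over O(sqrt s)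
  steps separates true from false inputs by a constant (\<open>formula_sign_poly\<close>). If the
  leaves are parities, each step multiplies by characters, so the average is a combination of
  characters with coefficient sum (2s + 1)^(O(sqrt s)). Averaging then gives, under every
  distribution, a parity whose correlation with f is at least about the inverse of that number
  (\<open>parity_correlation\<close>). For s = n^(2 - \<gamma>) this is 2^(-O(n^(1 - \<gamma>/2) log
  n)).

  Using the correlation without finding the parity. Split the coordinates into a blocks. Xor a point
  with an equally reduced example that agrees with it on the next block, and repeat for all blocks,
  in the manner of Blum, Kalai and Wasserman. In the end all coordinates are zero, every character
  equals 1, and the label carried along is a guess whose bias is roughly the 2^a-th power of the
  correlation, whichever parity was responsible (\<open>levels_bound\<close>,
  \<open>round_bound\<close>). With a close to (log n) / \<kappa> and \<kappa> >= 4 / \<gamma> (for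
  \<gamma> at most 1), 2^a is O(n^(\<gamma>/4)); the bias is 2^(-o(n / log n)), and the buckets of
  one level number 2^(O(n / log n)).

  Boosting. Every example carries a random threshold, and a round uses only examples whose margin,
  correct minus wrong guesses so far, is below their threshold. The expected positive part of
  threshold minus margin is a potential that falls by the bias times the accepted mass, up to the
  small probability of a tie; hence the accepted mass is small on average over the rounds
  (\<open>rounds_bound\<close>, \<open>ravg_mean\<close>). A majority over all rounds of m
  independent runs, with a Chernoff bound over the runs, gives accuracy and confidence
  (\<open>learner_correct\<close>).

  Machines. A small register language is compiled to one-tape machines (\<open>compile\<close>),
  bounded arithmetic expressions are compiled to that language, and a table of bits filled in order
  of address gives the evaluator (\<open>evaluator_exists\<close>). The procedure above is written
  as such a table (\<open>program_correct\<close>, \<open>interpreter_correct\<close>). Finally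
  \<open>cost_bound\<close>, \<open>learner_bounds\<close> and \<open>scale_exists\<close> fit the
  parameters into the time bound.\<close>

section \<open>Characters and the Fourier L1 norm\<close>

definition sg :: "bool \<Rightarrow> real" where "sg b = (if b then -1 else 1)"

definition chr :: "nat set \<Rightarrow> bool list \<Rightarrow> real" where
  "chr S x = (\<Prod>i\<in>S. sg (x ! i))"

lemma sg_simps [simp]: "sg True = -1" "sg False = 1" "sg b * sg b = 1" "\<bar>sg b\<bar> = 1"
  by (auto simp: sg_def)

lemma sg_neq: "sg (a \<noteq> b) = sg a * sg b"
  by (auto simp: sg_def)

lemma abs_chr [simp]: "\<bar>chr S x\<bar> = 1"
  by (simp add: chr_def abs_prod)

lemma sg_parity:
  assumes "finite S" shows "sg (parity S b x) = sg b * chr S x"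
proof -
  have "sg (odd (card {i \<in> S. x ! i})) = chr S x"
    using assms
  proof (induction S)
    case empty then show ?case by (simp add: chr_def)
  next
    case (insert i S)
    show ?case
    proof (cases "x ! i")
      case True
      then have "{k \<in> insert i S. x ! k} = insert i {k \<in> S. x ! k}" by auto
      then have "card {k \<in> insert i S. x ! k} = Suc (card {k \<in> S. x ! k})" using insert(1,2) by simp
      then show ?thesis using insert True by (simp add: chr_def sg_def split: if_splits)
    next
      case False
      then have "{k \<in> insert i S. x ! k} = {k \<in> S. x ! k}" by auto
      then show ?thesis using insert False by (simp add: chr_def)
    qed
  qed
  then show ?thesis unfolding parity_def sg_neq by simp
qed

text \<open>Factors over the common indices square to one, so characters multiply like their index
  sets under symmetric difference.\<close>

lemma chr_mult:
  assumes "finite S" "finite S'"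
  shows "chr S x * chr S' x = chr (sym_diff S S') x"
proof -
  have "chr S x = chr (S \<inter> S') x * chr (S - S') x"
    unfolding chr_def using assms(1) by (rule prod.Int_Diff)
  moreover have "chr S' x = chr (S \<inter> S') x * chr (S' - S) x"
    unfolding chr_def using assms(2) by (subst Int_commute) (rule prod.Int_Diff)
  moreover have "chr (S \<inter> S') x * chr (S \<inter> S') x = 1"
    using abs_mult_self_eq[of "chr (S \<inter> S') x"] by simp
  moreover have "chr (sym_diff S S') x = chr (S - S') x * chr (S' - S) x"
    unfolding chr_def using assms by (subst prod.union_disjoint) auto

  ultimately show ?thesis by algebra
qed

text \<open>An upper bound on the Fourier L1 norm of \<open>g\<close> on inputs of length
  \<open>n\<close>. Asking only for some coefficients, instead of computing the transform, makes
  every closure property a matter of exhibiting coefficients.\<close>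

definition spectral :: "nat \<Rightarrow> real \<Rightarrow> (bool list \<Rightarrow> real) \<Rightarrow> bool" where
  "spectral n L g \<longleftrightarrow> (\<exists>c. (\<forall>x. length x = n \<longrightarrow> g x = (\<Sum>S\<in>Pow {..<n}. c S * chr S x)) \<and>
     (\<Sum>S\<in>Pow {..<n}. \<bar>c S\<bar>) \<le> L)"

lemma spectralE:
  assumes "spectral n L g"
  obtains c where "\<And>x. length x = n \<Longrightarrow> g x = (\<Sum>S\<in>Pow {..<n}. c S * chr S x)"
    "(\<Sum>S\<in>Pow {..<n}. \<bar>c S\<bar>) \<le> L"
  using assms unfolding spectral_def by blast

lemma spectral_mono: "spectral n L g \<Longrightarrow> L \<le> L' \<Longrightarrow> spectral n L' g"
  unfolding spectral_def by force

lemma spectral_const: "spectral n \<bar>r\<bar> (\<lambda>x. r)"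
  unfolding spectral_def
proof (intro exI[of _ "\<lambda>S. if S = {} then r else 0"] conjI allI impI)
  fix x :: "bool list"
  have "(\<Sum>S\<in>Pow {..<n}. (if S = {} then r else 0) * chr S x) = (\<Sum>S\<in>Pow {..<n}. if S = {} then r else 0)"
    by (rule sum.cong) (auto simp: chr_def)
  then show "r = (\<Sum>S\<in>Pow {..<n}. (if S = {} then r else 0) * chr S x)" by simp
qed (simp add: if_distrib[of abs] cong: if_cong)

lemma spectral_add:
  assumes "spectral n L g" "spectral n L' g'" shows "spectral n (L + L') (\<lambda>x. g x + g' x)"
proof -
  obtain c where c: "\<And>x. length x = n \<Longrightarrow> g x = (\<Sum>S\<in>Pow {..<n}. c S * chr S x)"
    "(\<Sum>S\<in>Pow {..<n}. \<bar>c S\<bar>) \<le> L"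
    by (rule spectralE[OF assms(1)]) blast
  obtain c' where c': "\<And>x. length x = n \<Longrightarrow> g' x = (\<Sum>S\<in>Pow {..<n}. c' S * chr S x)"
    "(\<Sum>S\<in>Pow {..<n}. \<bar>c' S\<bar>) \<le> L'"
    by (rule spectralE[OF assms(2)]) blast
  have "(\<Sum>S\<in>Pow {..<n}. \<bar>c S + c' S\<bar>) \<le> (\<Sum>S\<in>Pow {..<n}. \<bar>c S\<bar> + \<bar>c' S\<bar>)"
    by (rule sum_mono) auto
  then have "(\<Sum>S\<in>Pow {..<n}. \<bar>c S + c' S\<bar>) \<le> L + L'"
    using c(2) c'(2) by (simp add: sum.distrib)
  then show ?thesis unfolding spectral_def
    by (intro exI[of _ "\<lambda>S. c S + c' S"]) (simp add: c(1) c'(1) algebra_simps sum.distrib)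
qed

lemma spectral_scale:
  assumes "spectral n L g"
  shows "spectral n (\<bar>r\<bar> * L) (\<lambda>x. r * g x)"
proof -
  obtain c where c: "\<And>x. length x = n \<Longrightarrow> g x = (\<Sum>S\<in>Pow {..<n}. c S * chr S x)"
    "(\<Sum>S\<in>Pow {..<n}. \<bar>c S\<bar>) \<le> L"
    by (rule spectralE[OF assms(1)]) blast
  have "(\<Sum>S\<in>Pow {..<n}. \<bar>r * c S\<bar>) = \<bar>r\<bar> * (\<Sum>S\<in>Pow {..<n}. \<bar>c S\<bar>)"
    by (simp add: abs_mult sum_distrib_left)
  then have "(\<Sum>S\<in>Pow {..<n}. \<bar>r * c S\<bar>) \<le> \<bar>r\<bar> * L" using c(2) by (simp add: mult_left_mono)
  then show ?thesis unfolding spectral_def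
    by (intro exI[of _ "\<lambda>S. r * c S"]) (simp add: c(1) sum_distrib_left mult_ac)
qed

lemma spectral_sum:
  assumes "finite I" "\<And>i. i \<in> I \<Longrightarrow> spectral n (L i) (g i)"
  shows "spectral n (\<Sum>i\<in>I. L i) (\<lambda>x. \<Sum>i\<in>I. g i x)"
  using assms
proof (induction I)
  case empty then show ?case using spectral_const[of n 0] by simp
next
  case (insert i I) then show ?case by (simp add: spectral_add)
qed

text \<open>Multiplication by a character permutes the characters, hence leaves the sum of absolute
  coefficients as it is. This is why a parity at a leaf costs no more than a variable.\<close>

lemma spectral_chr:
  assumes "spectral n L g" "S \<subseteq> {..<n}" shows "spectral n L (\<lambda>x. chr S x * g x)"
proof -
  obtain c where c: "\<And>x. length x = n \<Longrightarrow> g x = (\<Sum>S\<in>Pow {..<n}. c S * chr S x)"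
    "(\<Sum>S\<in>Pow {..<n}. \<bar>c S\<bar>) \<le> L"
    by (rule spectralE[OF assms(1)]) blast
  have fin: "finite S" using assms(2) finite_subset by blast
  have sd: "sym_diff S (sym_diff S S') = S'" for S' by auto
  have bij: "bij_betw (sym_diff S) (Pow {..<n}) (Pow {..<n})"
    by (rule bij_betw_byWitness[where f' = "sym_diff S"]) (use assms(2) sd in auto)
  show ?thesis unfolding spectral_def
  proof (intro exI[of _ "\<lambda>S'. c (sym_diff S S')"] conjI allI impI)
    fix x :: "bool list" assume "length x = n"
    have "chr S x * g x = (\<Sum>S'\<in>Pow {..<n}. c S' * chr (sym_diff S S') x)"
      using fin by (auto simp: c(1)[OF \<open>length x = n\<close>] sum_distrib_left chr_mult[symmetric] finite_subset[of _ "{..<n}"] intro!: sum.cong)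
    also have "\<dots> = (\<Sum>S'\<in>Pow {..<n}. c (sym_diff S S') * chr S' x)"
      using sum.reindex_bij_betw[OF bij, of "\<lambda>S'. c S' * chr (sym_diff S S') x"] by (simp only: sd)
    finally show "chr S x * g x = (\<Sum>S'\<in>Pow {..<n}. c (sym_diff S S') * chr S' x)" .
  next
    show "(\<Sum>S'\<in>Pow {..<n}. \<bar>c (sym_diff S S')\<bar>) \<le> L"
      using c(2) sum.reindex_bij_betw[OF bij, of "\<lambda>S'. \<bar>c S'\<bar>"] by simp
  qed
qed

section \<open>Dual adversary solutions for de Morgan formulas\<close>

text \<open>A feasible point of the dual of the general adversary bound with objective sqrt s: one
  real number per leaf \<open>p\<close>, where leaf \<open>p\<close> reads the variable
  \<open>idx p\<close>. Leaves are kept apart even when they read the same variable.\<close>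

definition adv :: "nat \<Rightarrow> ((nat \<Rightarrow> bool) \<Rightarrow> bool) \<Rightarrow> (nat \<Rightarrow> nat) \<Rightarrow> ((nat \<Rightarrow> bool) \<Rightarrow> nat \<Rightarrow> real) \<Rightarrow> bool" where
  "adv s f idx v \<longleftrightarrow> (\<forall>y. (\<Sum>p<s. (v y p)\<^sup>2) \<le> sqrt (real s)) \<and>
     (\<forall>y z. f y \<noteq> f z \<longrightarrow> (\<Sum>p<s. if y (idx p) \<noteq> z (idx p) then v y p * v z p else 0) = 1)"

lemma sum_lessThan_add:
  fixes g :: "nat \<Rightarrow> 'a::comm_monoid_add"
  shows "(\<Sum>p<s + t. g p) = (\<Sum>p<s. g p) + (\<Sum>p<t. g (s + p))"
  by (induction t) (simp_all add: add.assoc)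

text \<open>AND (\<open>c\<close> = True) and OR (\<open>c\<close> = False) at once: the gate has
  value \<open>c\<close> exactly if both children do. Solutions compose so that squared costs add,
  which turns sqrt s1 and sqrt s2 into sqrt (s1 + s2).\<close>

lemma adv_gate:
  assumes "adv s1 f1 i1 v1" "adv s2 f2 i2 v2" "s1 > 0" "s2 > 0"
    and f: "\<And>y. (f y = c) = (f1 y = c \<and> f2 y = c)"
  shows "\<exists>i v. adv (s1 + s2) f i v"
proof -
  define W where "W = sqrt (real (s1 + s2))"
  \<comment> \<open>The weights balance both sides. With both children in use the cost is (s1 + s2)
    / W = W; with one child divided by its weight it is sqrt s1 / \<open>a1\<close>^2 = W, and
    likewise for the second.\<close>
  define a1 where "a1 = sqrt (sqrt s1 / W)"
  define a2 where "a2 = sqrt (sqrt s2 / W)"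
  have W: "W > 0" "W * W = real s1 + real s2" using assms(3) by (simp_all add: W_def)
  have pos: "a1 > 0" "a2 > 0" using W assms(3,4) by (simp_all add: a1_def a2_def)
  have a: "a1\<^sup>2 = sqrt s1 / W" "a2\<^sup>2 = sqrt s2 / W" using W by (simp_all add: a1_def a2_def)
  define i where "i p = (if p < s1 then i1 p else i2 (p - s1))" for p
  \<comment> \<open>An input with gate value \<open>c\<close> uses all leaves; any other input uses
    a single child whose value differs from \<open>c\<close>, the first if possible. On a pair with
    different gate values the weights \<open>a1\<close> and 1 / \<open>a1\<close> cancel and the
    condition of that one child remains.\<close>
  define v where "v y p = (if f y = c then (if p < s1 then a1 * v1 y p else a2 * v2 y (p - s1))
     else if f1 y \<noteq> c then (if p < s1 then v1 y p / a1 else 0)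
     else (if p < s1 then 0 else v2 y (p - s1) / a2))" for y p
  have A1: "(\<Sum>p<s1. (v1 y p)\<^sup>2) \<le> sqrt s1" "f1 y \<noteq> f1 z \<Longrightarrow>
      (\<Sum>p<s1. if y (i1 p) \<noteq> z (i1 p) then v1 y p * v1 z p else 0) = 1" for y z
    using assms(1) by (auto simp: adv_def)
  have A2: "(\<Sum>p<s2. (v2 y p)\<^sup>2) \<le> sqrt s2" "f2 y \<noteq> f2 z \<Longrightarrow>
      (\<Sum>p<s2. if y (i2 p) \<noteq> z (i2 p) then v2 y p * v2 z p else 0) = 1" for y z
    using assms(2) by (auto simp: adv_def)
  have cost: "(\<Sum>p<s1 + s2. (v y p)\<^sup>2) \<le> W" for y
  proof -
    consider "f y = c" | "f y \<noteq> c" "f1 y \<noteq> c" | "f y \<noteq> c" "f1 y = c" by blast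
    then show ?thesis
    proof cases
      case 1
      have "(\<Sum>p<s1 + s2. (v y p)\<^sup>2) = a1\<^sup>2 * (\<Sum>p<s1. (v1 y p)\<^sup>2) + a2\<^sup>2 * (\<Sum>p<s2. (v2 y p)\<^sup>2)"
        using 1 by (simp add: sum_lessThan_add v_def power_mult_distrib sum_distrib_left)
      also have "\<dots> \<le> a1\<^sup>2 * sqrt s1 + a2\<^sup>2 * sqrt s2"
        by (intro add_mono mult_left_mono A1 A2) auto
      also have "\<dots> = (real s1 + real s2) / W" by (simp add: a add_divide_distrib)
      also have "\<dots> = W" using W by (simp add: field_simps)
      finally show ?thesis .
    next
      case 2
      have "(\<Sum>p<s1 + s2. (v y p)\<^sup>2) = (\<Sum>p<s1. (v1 y p)\<^sup>2) / a1\<^sup>2"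
        using 2 by (simp add: sum_lessThan_add v_def power_divide sum_divide_distrib)
      also have "\<dots> \<le> sqrt s1 / a1\<^sup>2" by (intro divide_right_mono A1) auto
      also have "\<dots> = W" using assms(3) W by (simp add: a)
      finally show ?thesis .
    next
      case 3
      have "(\<Sum>p<s1 + s2. (v y p)\<^sup>2) = (\<Sum>p<s2. (v2 y p)\<^sup>2) / a2\<^sup>2"
        using 3 by (simp add: sum_lessThan_add v_def power_divide sum_divide_distrib)
      also have "\<dots> \<le> sqrt s2 / a2\<^sup>2" by (intro divide_right_mono A2) auto
      also have "\<dots> = W" using assms(4) W by (simp add: a)
      finally show ?thesis .
    qed
  qed
  have main: "(\<Sum>p<s1 + s2. if y (i p) \<noteq> z (i p) then v y p * v z p else 0) = 1"
    if "f y = c" "f z \<noteq> c" for y z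
  proof (cases "f1 z = c")
    case False
    have "(\<Sum>p<s1 + s2. if y (i p) \<noteq> z (i p) then v y p * v z p else 0)
       = (\<Sum>p<s1. if y (i1 p) \<noteq> z (i1 p) then v1 y p * v1 z p else 0)"
      using that False pos by (simp add: sum_lessThan_add v_def i_def cong: if_cong)
    then show ?thesis using A1(2)[of y z] that(1) f False by auto
  next
    case True
    have "(\<Sum>p<s1 + s2. if y (i p) \<noteq> z (i p) then v y p * v z p else 0)
       = (\<Sum>p<s2. if y (i2 p) \<noteq> z (i2 p) then v2 y p * v2 z p else 0)"
      using that True pos by (simp add: sum_lessThan_add v_def i_def cong: if_cong)
    then show ?thesis using A2(2)[of y z] that f True by auto
  qed
  have "adv (s1 + s2) f i v" unfolding adv_def
  proof (intro conjI allI impI)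
    fix y show "(\<Sum>p<s1 + s2. (v y p)\<^sup>2) \<le> sqrt (real (s1 + s2))" using cost by (simp add: W_def)
  next
    fix y z assume "f y \<noteq> f z"
    then consider "f y = c" "f z \<noteq> c" | "f z = c" "f y \<noteq> c" by blast
    then show "(\<Sum>p<s1 + s2. if y (i p) \<noteq> z (i p) then v y p * v z p else 0) = 1"
    proof cases
      case 1 then show ?thesis by (rule main)
    next
      case 2
      have "(\<Sum>p<s1 + s2. if y (i p) \<noteq> z (i p) then v y p * v z p else 0)
        = (\<Sum>p<s1 + s2. if z (i p) \<noteq> y (i p) then v z p * v y p else 0)"
        by (rule sum.cong) (auto simp: mult.commute)
      then show ?thesis using main[OF 2] by simp
    qed
  qed
  then show ?thesis by blast
qed

lemma leaves_pos: "leaves F > 0"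
  by (induction F) auto

lemma adv_formula: "\<exists>i v. adv (leaves F) (feval F) i v"
proof (induction F)
  case (Leaf j)
  have "adv 1 (\<lambda>y. y j) (\<lambda>_. j) (\<lambda>_ _. 1)" by (auto simp: adv_def)
  then show ?case by auto
next
  case (NotF F)
  then show ?case by (simp add: adv_def)
next
  case (AndF F G)
  then obtain i1 v1 i2 v2 where "adv (leaves F) (feval F) i1 v1" "adv (leaves G) (feval G) i2 v2" by blast
  from adv_gate[OF this leaves_pos leaves_pos, of _ True] show ?case by simp
next
  case (OrF F G)
  then obtain i1 v1 i2 v2 where "adv (leaves F) (feval F) i1 v1" "adv (leaves G) (feval G) i2 v2" by blast
  from adv_gate[OF this leaves_pos leaves_pos, of _ False] show ?case by simp
qed


section \<open>Orthogonal projections for functions on a finite index set\<close>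

definition ip :: "'i set \<Rightarrow> ('i \<Rightarrow> real) \<Rightarrow> ('i \<Rightarrow> real) \<Rightarrow> real" where
  "ip B u w = (\<Sum>i\<in>B. u i * w i)"

lemma ip_sym: "ip B u w = ip B w u"
  by (simp add: ip_def mult.commute)

lemma ip_lin: "ip B (\<lambda>i. a * u i + b * w i) z = a * ip B u z + b * ip B w z"
  by (simp add: ip_def sum.distrib sum_distrib_left algebra_simps)

lemma ip_lin': "ip B z (\<lambda>i. a * u i + b * w i) = a * ip B z u + b * ip B z w"
  by (simp add: ip_def sum.distrib sum_distrib_left algebra_simps)

lemma ip_nonneg: "ip B u u \<ge> 0"
  by (simp add: ip_def sum_nonneg)

lemma abs_le_norm:
  assumes "finite B" "i \<in> B" shows "\<bar>u i\<bar> \<le> sqrt (ip B u u)"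
proof -
  have "(u i)\<^sup>2 \<le> ip B u u" unfolding ip_def power2_eq_square
    using assms by (intro member_le_sum) auto
  then show ?thesis by (metis real_sqrt_abs real_sqrt_le_iff)
qed

text \<open>The orthogonal projection onto the span of \<open>V\<close>, given by the properties
  used later: self-adjoint, idempotent, linear, supported on \<open>B\<close>, identity on
  \<open>V\<close>, zero on the orthogonal complement of \<open>V\<close>.\<close>

definition proj_on :: "'i set \<Rightarrow> ('i \<Rightarrow> real) set \<Rightarrow> (('i \<Rightarrow> real) \<Rightarrow> 'i \<Rightarrow> real) \<Rightarrow> bool" where
  "proj_on B V P \<longleftrightarrow>
     (\<forall>u w. ip B (P u) w = ip B u (P w)) \<and> (\<forall>u. P (P u) = P u) \<and>
     (\<forall>a b u w. P (\<lambda>i. a * u i + b * w i) = (\<lambda>i. a * P u i + b * P w i)) \<and>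
     (\<forall>u i. i \<notin> B \<longrightarrow> P u i = 0) \<and> (\<forall>\<psi>\<in>V. P \<psi> = \<psi>) \<and>
     (\<forall>w. (\<forall>\<psi>\<in>V. ip B \<psi> w = 0) \<longrightarrow> P w = (\<lambda>_. 0))"

text \<open>One Gram-Schmidt step per vector: the part \<open>d\<close> of the new vector orthogonal
  to the old span supplies one more rank-one projection.\<close>

lemma proj_on_exists:
  assumes "finite V" "finite B" "\<And>\<psi> i. \<psi> \<in> V \<Longrightarrow> i \<notin> B \<Longrightarrow> \<psi> i = 0"
  shows "\<exists>P. proj_on B V P"
  using assms(1,3)
proof (induction V)
  case empty
  have "proj_on B {} (\<lambda>_ _. 0)" by (simp add: proj_on_def ip_def)
  then show ?case by blast
next
  case (insert \<psi> V)
  then obtain P where P: "proj_on B V P" by auto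
  have sym: "ip B (P u) w = ip B u (P w)" and idem: "P (P u) = P u"
    and lin: "P (\<lambda>i. a * u i + b * w i) = (\<lambda>i. a * P u i + b * P w i)"
    and supp: "i \<notin> B \<Longrightarrow> P u i = 0" for u w a b i
    using P by (auto simp: proj_on_def)
  have fixV: "\<phi> \<in> V \<Longrightarrow> P \<phi> = \<phi>" and kill: "(\<forall>\<psi>\<in>V. ip B \<psi> w = 0) \<Longrightarrow> P w = (\<lambda>_. 0)" for \<phi> w
    using P by (auto simp: proj_on_def)
  define d where "d = (\<lambda>i. 1 * \<psi> i + (-1) * P \<psi> i)"
  have Pd: "P d = (\<lambda>_. 0)" unfolding d_def by (subst lin) (simp add: idem)
  have dP: "ip B d (P u) = 0" for u
    using sym[of d u] Pd by (simp add: ip_def)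
  have dsupp: "i \<notin> B \<Longrightarrow> d i = 0" for i using insert.prems supp by (simp add: d_def)
  define D where "D = ip B d d"
  \<comment> \<open>If the new vector already lies in the span, then \<open>D\<close> = 0 and
    \<open>d\<close> vanishes, so the added term is zero and no case distinction is needed
    here.\<close>
  define Q where "Q u = (\<lambda>i. P u i + (ip B d u / D) * d i)" for u
  have D0: "d = (\<lambda>_. 0)" if "D = 0"
  proof
    fix i
    have "\<forall>i\<in>B. d i * d i = 0" using that assms(2) unfolding D_def ip_def
      by (subst (asm) sum_nonneg_eq_0_iff) auto
    then show "d i = 0" using dsupp[of i] by (cases "i \<in> B") auto
  qed
  have dpsi: "ip B d \<psi> = D"
  proof -
    have "D = 1 * ip B d \<psi> + (-1) * ip B d (P \<psi>)" unfolding D_def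
      by (subst (2) d_def) (rule ip_lin')
    then show ?thesis by (simp add: dP)
  qed
  have Qlin: "Q (\<lambda>i. a * u i + b * w i) = (\<lambda>i. a * Q u i + b * Q w i)" for a b u w
    unfolding Q_def lin ip_lin' by (auto simp: algebra_simps add_divide_distrib)
  have ipQ: "ip B (Q u) w = ip B (P u) w + (ip B d u / D) * ip B d w" for u w
    unfolding Q_def using ip_lin[of B 1 "P u" "ip B d u / D" d w] by simp
  have dQ: "ip B d (Q u) = ip B d u" for u
  proof (cases "D = 0")
    case True then show ?thesis using D0 by (simp add: ip_def)
  next
    case False
    then show ?thesis using ipQ[of u d] by (simp add: ip_sym[of B "Q u"] ip_sym[of B "P u"] dP D_def)
  qed
  have PQ: "P (Q u) = P u" for u
    unfolding Q_def using lin[of 1 "P u" "ip B d u / D" d] by (simp add: idem Pd)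
  have "proj_on B (insert \<psi> V) Q" unfolding proj_on_def
  proof (intro conjI allI impI ballI)
    fix u w
    have "ip B u (Q w) = ip B (Q w) u" by (rule ip_sym)
    moreover have "ip B (P w) u = ip B (P u) w" unfolding sym[of u w] by (rule ip_sym)
    ultimately show "ip B (Q u) w = ip B u (Q w)" by (simp add: ipQ)
  next
    fix u have "Q (Q u) = (\<lambda>i. P (Q u) i + (ip B d (Q u) / D) * d i)" by (rule Q_def)
    then show "Q (Q u) = Q u" unfolding PQ dQ by (simp add: Q_def)
  next
    fix u i assume "i \<notin> B" then show "Q u i = 0" by (simp add: Q_def supp dsupp)
  next
    fix \<phi> assume "\<phi> \<in> insert \<psi> V"
    then consider "\<phi> = \<psi>" | "\<phi> \<in> V" by blast
    then show "Q \<phi> = \<phi>"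
    proof cases
      case 1
      show ?thesis
      proof (cases "D = 0")
        case True
        then show ?thesis using D0 unfolding 1 Q_def d_def by (simp add: fun_eq_iff)
      next
        case False
        then show ?thesis unfolding 1 Q_def dpsi by (auto simp: d_def)
      qed
    next
      case 2
      then show ?thesis using fixV[OF 2] dP[of \<phi>] by (simp add: Q_def)
    qed
  next
    fix w assume h: "\<forall>\<phi>\<in>insert \<psi> V. ip B \<phi> w = 0"
    then have "P w = (\<lambda>_. 0)" using kill by simp
    moreover have "ip B d w = 0"
    proof -
      have "ip B d w = 1 * ip B \<psi> w + (-1) * ip B (P \<psi>) w" unfolding d_def by (rule ip_lin)
      also have "\<dots> = 0" using h sym[of \<psi> w] \<open>P w = _\<close> by (simp add: ip_def)
      finally show ?thesis .
    qed
    ultimately show "Q w = (\<lambda>_. 0)" by (simp add: Q_def)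
  qed (rule Qlin)
  then show ?case by blast
qed


section \<open>From formulas to sign representations and correlated parities\<close>

lemma ip_nonneg_mult_le:
  assumes "finite B" shows "\<bar>ip B u w\<bar> \<le> sqrt (ip B u u) * sqrt (ip B w w)"
proof -
  have "(ip B u w)\<^sup>2 \<le> ip B u u * ip B w w"
    using Cauchy_Schwarz_ineq_sum[of u w B] by (simp add: ip_def power2_eq_square)
  then show ?thesis by (metis real_sqrt_abs real_sqrt_le_iff real_sqrt_mult)
qed

text \<open>A span-program walk: a true input has a vector fixed by the walk with large overlap with
  \<open>e\<close>, while for a false input \<open>e\<close> is half of w - U w for some short
  vector w. Averaging <e, U^k e> over k < K therefore gives a large value in the first case and a
  telescoping, small one in the second.\<close>

lemma formula_sign_poly:
  fixes S :: "nat \<Rightarrow> nat set" and b :: "nat \<Rightarrow> bool"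
  assumes S: "\<And>i. S i \<subseteq> {..<n}"
    and f: "\<And>x. length x = n \<Longrightarrow> f x = feval F (\<lambda>i. parity (S i) (b i) x)"
    and K: "12 * sqrt (leaves F) \<le> real K"
  shows "\<exists>g. spectral n (real (2 * leaves F + 1) ^ K + 1/2) g \<and>
    (\<forall>x. length x = n \<longrightarrow> (if f x then g x \<ge> 1/4 else g x \<le> -1/4))"
proof -
  define s where "s = leaves F"
  define W where "W = sqrt (real s)"
  have s: "s > 0" unfolding s_def by (rule leaves_pos)
  have W1: "W \<ge> 1" using s by (simp add: W_def)
  have KW: "12 * W \<le> real K" using K by (simp add: W_def s_def)
  then have K0: "real K > 0" using W1 by linarith
  obtain idx v where "adv s (feval F) idx v" using adv_formula unfolding s_def by blast
  then have cost: "(\<Sum>p<s. (v y p)\<^sup>2) \<le> W"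
    and cross: "feval F y \<noteq> feval F z \<Longrightarrow>
      (\<Sum>p<s. if y (idx p) \<noteq> z (idx p) then v y p * v z p else 0) = 1" for y z
    by (auto simp: adv_def W_def)
  define lit where "lit x i = parity (S i) (b i) x" for x i
  \<comment> \<open>Coordinate \<open>None\<close> carries the start vector \<open>e\<close>;
    coordinate \<open>Some (p, c)\<close> stands for the claim that leaf \<open>p\<close> reads
    value \<open>c\<close>.\<close>
  define B where "B = insert None (Some ` ({..<s} \<times> (UNIV :: bool set)))"
  have finB: "finite B" by (simp add: B_def)
  have cardB: "card B = 2 * s + 1"
    by (simp add: B_def card_image card_insert_if image_iff card_cartesian_product)
  have sumB: "(\<Sum>i\<in>B. h i) = h None + (\<Sum>p<s. h (Some (p, True)) + h (Some (p, False)))"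
    for h :: "(nat \<times> bool) option \<Rightarrow> real"
    by (simp add: B_def sum.insert image_iff sum.reindex sum.cartesian_product' UNIV_bool add.commute)
  \<comment> \<open>The scale trades the two kinds of witness against each other: squared norm at
    most 8/7 for true inputs, norm at most 3 W for false ones.\<close>
  define al where "al = 1 / sqrt (7 * W)"
  have al: "al > 0" "al\<^sup>2 = 1 / (7 * W)" using W1 by (simp_all add: al_def power_divide)
  \<comment> \<open>\<open>\<psi> x\<close> lives on the correct claims of x and \<open>w x\<close>
    on the wrong ones. Their supports for two inputs meet exactly at leaves where the inputs differ,
    so the adversary condition makes the inner product of \<open>\<psi> y\<close> and
    \<open>w x\<close> equal to 1 - 1 = 0 for y true and x false.\<close>
  define \<psi> where "\<psi> x i = (case i of None \<Rightarrow> 1 | Some (p, c) \<Rightarrow>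
     if p < s \<and> lit x (idx p) = c then al * v (lit x) p else 0)" for x i
  define w where "w x i = (case i of None \<Rightarrow> 1 | Some (p, c) \<Rightarrow>
     if p < s \<and> lit x (idx p) \<noteq> c then - v (lit x) p / al else 0)" for x i
  define e where "e i = (case i of None \<Rightarrow> 1 | Some _ \<Rightarrow> (0::real))" for i :: "(nat \<times> bool) option"
  \<comment> \<open>The span is taken over all true inputs, so the projection and the reflection
    \<open>R\<close> do not depend on the input; only \<open>ob\<close> does.\<close>
  define V where "V = \<psi> ` {x. length x = n \<and> f x}"
  have finV: "finite V" unfolding V_def
    using finite_lists_length_eq[of "UNIV :: bool set" n] by (auto intro: finite_subset[rotated])
  have supp: "i \<notin> B \<Longrightarrow> \<psi> x i = 0" "i \<notin> B \<Longrightarrow> w x i = 0" "i \<notin> B \<Longrightarrow> e i = 0" for i x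
    by (auto simp: \<psi>_def w_def e_def B_def split: option.splits)
  obtain P where P: "proj_on B V P"
    using proj_on_exists[OF finV finB] supp(1) by (auto simp: V_def)
  have Psym: "ip B (P u) z = ip B u (P z)" and idem: "P (P u) = P u"
    and lin: "P (\<lambda>i. a * u i + c * z i) = (\<lambda>i. a * P u i + c * P z i)"
    and suppP: "i \<notin> B \<Longrightarrow> P u i = 0" for u z a c i
    using P by (auto simp: proj_on_def)
  have fixV: "\<phi> \<in> V \<Longrightarrow> P \<phi> = \<phi>" and kill: "(\<forall>\<psi>\<in>V. ip B \<psi> z = 0) \<Longrightarrow> P z = (\<lambda>_. 0)" for \<phi> z
    using P by (auto simp: proj_on_def)
  define R where "R u = (\<lambda>i. 2 * P u i + (-1) * u i)" for u
  define ob where "ob x i = (case i of None \<Rightarrow> 1 | Some (p, c) \<Rightarrow> if lit x (idx p) = c then 1 else (-1::real))"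
    for x and i :: "(nat \<times> bool) option"
  define U where "U x u = (\<lambda>i. ob x i * R u i)" for x u
  have obsq: "ob x i * ob x i = 1" for x i by (auto simp: ob_def split: option.splits)
  have RR: "ip B (R u) (R z) = ip B u z" for u z
  proof -
    have "ip B (R u) (R z) = 2 * (2 * ip B (P u) (P z) - ip B u (P z)) - (2 * ip B (P u) z - ip B u z)"
      unfolding R_def ip_lin ip_lin' by simp
    also have "ip B (P u) (P z) = ip B u (P z)" by (simp add: Psym idem)
    finally show ?thesis by (simp add: Psym)
  qed
  have UU: "ip B (U x u) (U x z) = ip B u z" for x u z
  proof -
    have "ip B (U x u) (U x z) = ip B (R u) (R z)" unfolding ip_def U_def
    proof (rule sum.cong)
      fix i show "ob x i * R u i * (ob x i * R z i) = R u i * R z i"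
        using obsq[of x i] by algebra
    qed simp
    then show ?thesis by (simp add: RR)
  qed
  have Ulin: "U x (\<lambda>i. a * u i + c * z i) = (\<lambda>i. a * U x u i + c * U x z i)" for x a u c z
    unfolding U_def R_def lin by (auto simp: algebra_simps)
  have Uklin: "(U x ^^ k) (\<lambda>i. a * u i + c * z i) = (\<lambda>i. a * (U x ^^ k) u i + c * (U x ^^ k) z i)"
    for x k a u c z by (induction k) (simp_all add: Ulin)
  have UUk: "ip B ((U x ^^ k) u) ((U x ^^ k) z) = ip B u z" for x k u z
    by (induction k) (simp_all add: UU)
  have eN: "ip B e u = u None" for u by (simp add: ip_def sumB e_def)

  define dl where "dl i j = (if i = j then 1 else 0 :: real)" for i j :: "(nat \<times> bool) option"
  have dl: "ip B (dl i) u = u i" if "i \<in> B" for i u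
    using that finB by (simp add: ip_def dl_def if_distrib[of "\<lambda>t. t * _"] cong: if_cong)
  \<comment> \<open>Row \<open>i\<close> of the reflection is the image of a standard basis vector.
    A reflection preserves length, so its entries are at most 1 in absolute value.\<close>
  have Rent: "R u i = (\<Sum>j\<in>B. R (dl i) j * u j)" and Rle: "\<bar>R (dl i) j\<bar> \<le> 1"
    if "i \<in> B" "j \<in> B" for i j u
  proof -
    have "P u i = ip B (P (dl i)) u" using dl[OF that(1), of "P u"] by (simp add: Psym)
    moreover have "u i = ip B (dl i) u" using dl[OF that(1)] by simp
    ultimately have "R u i = 2 * ip B (P (dl i)) u + (-1) * ip B (dl i) u" by (simp add: R_def)
    also have "\<dots> = ip B (R (dl i)) u" unfolding R_def by (rule ip_lin[symmetric])
    finally show "R u i = (\<Sum>j\<in>B. R (dl i) j * u j)" by (simp add: ip_def)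
    have "\<bar>R (dl i) j\<bar> \<le> sqrt (ip B (R (dl i)) (R (dl i)))" by (rule abs_le_norm[OF finB that(2)])
    also have "\<dots> = 1" by (simp add: RR dl[OF that(1)]) (simp add: dl_def)
    finally show "\<bar>R (dl i) j\<bar> \<le> 1" .
  qed
  \<comment> \<open>One step of the walk sums 2s + 1 old coordinates with coefficients of size at
    most 1 and then multiplies by 1 or by a signed character, so the norm bound grows by a factor 2s
    + 1 only.\<close>
  have spec: "spectral n (real (2 * s + 1) ^ k) (\<lambda>x. (U x ^^ k) e i)" if "i \<in> B" for k i
    using that
  proof (induction k arbitrary: i)
    case 0
    have "spectral n 1 (\<lambda>x. e i)"
      by (rule spectral_mono[OF spectral_const]) (auto simp: e_def split: option.splits)
    then show ?case by simp
  next
    case (Suc k)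
    have "spectral n (\<Sum>j\<in>B. \<bar>R (dl i) j\<bar> * real (2 * s + 1) ^ k)
        (\<lambda>x. \<Sum>j\<in>B. R (dl i) j * (U x ^^ k) e j)"
      by (intro spectral_sum spectral_scale Suc.IH finB)
    then have "spectral n (\<Sum>j\<in>B. \<bar>R (dl i) j\<bar> * real (2 * s + 1) ^ k) (\<lambda>x. R ((U x ^^ k) e) i)"
      using Rent[OF Suc.prems Suc.prems] by simp
    moreover have "(\<Sum>j\<in>B. \<bar>R (dl i) j\<bar> * real (2 * s + 1) ^ k) \<le> (\<Sum>j\<in>B. 1 * real (2 * s + 1) ^ k)"
      by (intro sum_mono mult_right_mono Rle Suc.prems) auto
    ultimately have A: "spectral n (real (2 * s + 1) ^ Suc k) (\<lambda>x. R ((U x ^^ k) e) i)"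
      by (elim spectral_mono) (simp add: cardB)
    have unf: "(U x ^^ Suc k) e i = ob x i * R ((U x ^^ k) e) i" for x
      unfolding funpow.simps comp_apply by (subst U_def) (rule refl)
    show ?case
    proof (cases i)
      case None
      then have "ob x i = 1" for x by (simp add: ob_def)
      then show ?thesis using A unfolding unf by simp
    next
      case (Some pc)
      obtain p c where pc: "pc = (p, c)" by (cases pc)
      have "ob x i = (- sg (b (idx p)) * sg c * - 1) * chr (S (idx p)) x" for x
      proof -
        have "ob x i = sg (lit x (idx p)) * sg c" by (auto simp: Some pc ob_def sg_def)
        then show ?thesis unfolding lit_def using sg_parity[of "S (idx p)" "b (idx p)" x]
          finite_subset[OF S[of "idx p"]] by simp
      qed
      moreover have "spectral n (\<bar>sg (b (idx p)) * sg c\<bar> * real (2 * s + 1) ^ Suc k)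
         (\<lambda>x. (sg (b (idx p)) * sg c) * (chr (S (idx p)) x * R ((U x ^^ k) e) i))"
        by (intro spectral_scale spectral_chr A S)
      ultimately show ?thesis unfolding unf by (simp add: abs_mult mult_ac)
    qed
  qed

  \<comment> \<open>\<open>e\<close> splits into (1/M) \<open>\<psi> x\<close> and an orthogonal
    rest \<open>r\<close> of squared norm 1 - 1/M. The first part is fixed by the walk and the rest
    loses at most its squared norm, leaving 2/M - 1, which is at least 3/4 for M at most
    8/7.\<close>
  have yes: "(U x ^^ k) e None \<ge> 3/4" if x: "length x = n" "f x" for x k
  proof -
    have "P (\<psi> x) = \<psi> x" using x by (intro fixV) (auto simp: V_def)
    then have "R (\<psi> x) = \<psi> x" by (auto simp: R_def)
    then have "U x (\<psi> x) = \<psi> x"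
      by (auto simp: U_def ob_def \<psi>_def fun_eq_iff split: option.splits)
    then have fx: "(U x ^^ k) (\<psi> x) = \<psi> x" by (induction k) auto
    define M where "M = ip B (\<psi> x) (\<psi> x)"
    have "M = 1 + (\<Sum>p<s. (al * v (lit x) p)\<^sup>2)"
      unfolding M_def ip_def sumB
      by (auto simp: \<psi>_def power2_eq_square intro!: sum.cong)
    also have "(\<Sum>p<s. (al * v (lit x) p)\<^sup>2) = al\<^sup>2 * (\<Sum>p<s. (v (lit x) p)\<^sup>2)"
      by (simp add: power_mult_distrib sum_distrib_left)
    finally have M: "M = 1 + al\<^sup>2 * (\<Sum>p<s. (v (lit x) p)\<^sup>2)" .
    have "al\<^sup>2 * (\<Sum>p<s. (v (lit x) p)\<^sup>2) \<le> al\<^sup>2 * W" by (intro mult_left_mono cost) auto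
    also have "\<dots> = 1/7" using W1 by (simp add: al)
    finally have M8: "M \<le> 8/7" unfolding M by simp
    have M1: "M \<ge> 1" unfolding M by (simp add: sum_nonneg)
    define r where "r = (\<lambda>i. 1 * e i + (- 1 / M) * \<psi> x i)"
    have re: "e = (\<lambda>i. (1 / M) * \<psi> x i + 1 * r i)" by (auto simp: r_def)
    have psi0: "\<psi> x None = 1" by (simp add: \<psi>_def)
    have e1: "ip B e (\<psi> x) = 1" by (simp add: eN psi0)
    have rp: "ip B r (\<psi> x) = 0" unfolding r_def ip_lin using M1 by (simp add: e1 M_def[symmetric])
    have rr: "ip B r r = 1 - 1 / M"
    proof -
      have "ip B r r = 1 * ip B r e + (-1 / M) * ip B r (\<psi> x)"
        by (subst (2) r_def) (rule ip_lin')
      also have "\<dots> = ip B e r" by (simp add: rp ip_sym)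
      also have "\<dots> = 1 - 1 / M" by (simp add: eN) (simp add: r_def e_def psi0)
      finally show ?thesis .
    qed
    have "(U x ^^ k) e = (\<lambda>i. (1 / M) * (U x ^^ k) (\<psi> x) i + 1 * (U x ^^ k) r i)"
      by (subst re) (rule Uklin)
    then have "ip B e ((U x ^^ k) e) = (1 / M) * ip B e (\<psi> x) + 1 * ip B e ((U x ^^ k) r)"
      unfolding fx by (simp only: ip_lin')
    moreover have "ip B e ((U x ^^ k) r) = (1 / M) * ip B (\<psi> x) ((U x ^^ k) r) + 1 * ip B r ((U x ^^ k) r)"
      by (subst re) (rule ip_lin)
    moreover have "ip B (\<psi> x) ((U x ^^ k) r) = 0"
      using UUk[of k x "\<psi> x" r] rp by (simp add: fx ip_sym)
    ultimately have eq: "(U x ^^ k) e None = 1 / M + ip B r ((U x ^^ k) r)"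
      unfolding e1 eN[of "(U x ^^ k) e"] by simp
    have "\<bar>ip B r ((U x ^^ k) r)\<bar> \<le> sqrt (ip B r r) * sqrt (ip B ((U x ^^ k) r) ((U x ^^ k) r))"
      by (rule ip_nonneg_mult_le[OF finB])
    also have "\<dots> = ip B r r" by (simp add: UUk ip_nonneg)
    finally have "\<bar>ip B r ((U x ^^ k) r)\<bar> \<le> 1 - 1 / M" by (simp only: rr)
    moreover have "2 / M = 1 / M + 1 / M" by simp
    ultimately have "(U x ^^ k) e None \<ge> 2 / M - 1" using eq by linarith
    moreover have "2 / M \<ge> 2 / (8/7)" using M8 M1 by (intro divide_left_mono) auto
    ultimately show ?thesis by simp
  qed
  \<comment> \<open>The projection kills \<open>w x\<close>, so U w = w - 2 e. The sum over k
    telescopes to half the difference of the entries at \<open>None\<close> of w and U^K w, both at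
    most 3 W; the assumption K >= 12 W makes this at most K / 4.\<close>
  have no: "\<bar>\<Sum>k<K. (U x ^^ k) e None\<bar> \<le> K / 4" if x: "length x = n" "\<not> f x" for x
  proof -
    have ort: "ip B \<phi> (w x) = 0" if phi: "\<phi> \<in> V" for \<phi>
    proof -
      obtain y where y: "length y = n" "f y" "\<phi> = \<psi> y" using phi by (auto simp: V_def)
      have ne: "feval F (lit x) \<noteq> feval F (lit y)" using x y f unfolding lit_def by auto
      have "ip B \<phi> (w x) = 1 - (\<Sum>p<s. if lit x (idx p) \<noteq> lit y (idx p) then v (lit x) p * v (lit y) p else 0)"
        unfolding y(3) ip_def sumB sum_negf[symmetric] diff_conv_add_uminus using al(1)
        by (auto simp: \<psi>_def w_def intro!: sum.cong)
      then show ?thesis using cross[OF ne] by simp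
    qed
    then have "P (w x) = (\<lambda>_. 0)" by (intro kill) auto
    then have "R (w x) = (\<lambda>i. - w x i)" by (auto simp: R_def)
    then have Uw: "U x (w x) = (\<lambda>i. 1 * w x i + (-2) * e i)"
      by (auto simp: U_def ob_def w_def e_def fun_eq_iff split: option.splits)
    have step: "2 * (U x ^^ k) e None = (U x ^^ k) (w x) None - (U x ^^ Suc k) (w x) None" for k
    proof -
      have "(U x ^^ Suc k) (w x) = (U x ^^ k) (U x (w x))" by (simp only: funpow_Suc_right comp_apply)
      also have "\<dots> = (\<lambda>i. 1 * (U x ^^ k) (w x) i + (-2) * (U x ^^ k) e i)" unfolding Uw by (rule Uklin)
      finally show ?thesis by simp
    qed
    have "2 * (\<Sum>k<K. (U x ^^ k) e None) = (\<Sum>k<K. (U x ^^ k) (w x) None - (U x ^^ Suc k) (w x) None)"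
      unfolding sum_distrib_left step ..
    also have "\<dots> = w x None - (U x ^^ K) (w x) None"
      using sum_lessThan_telescope'[of "\<lambda>k. (U x ^^ k) (w x) None" K] by simp
    finally have tel: "2 * (\<Sum>k<K. (U x ^^ k) e None) = w x None - (U x ^^ K) (w x) None" .
    have NB: "None \<in> B" by (simp add: B_def)
    have ww: "ip B (w x) (w x) \<le> 9 * (W * W)"
    proof -
      have "ip B (w x) (w x) = 1 + (\<Sum>p<s. (v (lit x) p / al)\<^sup>2)"
        unfolding ip_def sumB by (auto simp: w_def power2_eq_square intro!: sum.cong)
      also have "(\<Sum>p<s. (v (lit x) p / al)\<^sup>2) = (\<Sum>p<s. (v (lit x) p)\<^sup>2) / al\<^sup>2"
        by (simp add: power_divide sum_divide_distrib)
      also have "\<dots> \<le> W / al\<^sup>2" by (intro divide_right_mono cost) auto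
      also have "\<dots> = 7 * (W * W)" using W1 by (simp add: al)
      finally have "ip B (w x) (w x) \<le> 1 + 7 * (W * W)" by simp
      moreover have "1 \<le> W * W" using mult_mono[OF W1 W1] W1 by simp
      ultimately show ?thesis by simp
    qed
    have "sqrt (ip B (w x) (w x)) \<le> sqrt (9 * (W * W))" using ww by simp
    also have "\<dots> = 3 * W" using W1 by (simp add: real_sqrt_mult)
    finally have sq: "sqrt (ip B (w x) (w x)) \<le> 3 * W" .
    have "\<bar>w x None\<bar> \<le> 3 * W" using abs_le_norm[OF finB NB, of "w x"] sq by linarith
    moreover have "\<bar>(U x ^^ K) (w x) None\<bar> \<le> 3 * W"
      using abs_le_norm[OF finB NB, of "(U x ^^ K) (w x)"] sq by (simp add: UUk)
    ultimately show ?thesis using tel KW by linarith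
  qed
  \<comment> \<open>The averages are at least 3/4 or at most 1/4; centring at 1/2 leaves a margin of
    1/4 on either side.\<close>
  define g where "g x = (1 / K) * (\<Sum>k<K. (U x ^^ k) e None) + (- 1 / 2)" for x
  have "spectral n (\<Sum>k<K. real (2 * s + 1) ^ k) (\<lambda>x. \<Sum>k<K. (U x ^^ k) e None)"
    by (intro spectral_sum spec) (auto simp: B_def)
  moreover have "(\<Sum>k<K. real (2 * s + 1) ^ k) \<le> (\<Sum>k<K. real (2 * s + 1) ^ K)"
    by (intro sum_mono power_increasing) auto
  ultimately have "spectral n (real K * real (2 * s + 1) ^ K) (\<lambda>x. \<Sum>k<K. (U x ^^ k) e None)"
    by (elim spectral_mono) simp
  then have "spectral n (\<bar>1 / K\<bar> * (real K * real (2 * s + 1) ^ K) + \<bar>- 1 / 2\<bar>) g"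
    unfolding g_def by (intro spectral_add spectral_scale spectral_const)
  then have "spectral n (real (2 * s + 1) ^ K + 1/2) g" using K0 by simp
  moreover have "if f x then g x \<ge> 1/4 else g x \<le> -1/4" if x: "length x = n" for x
  proof (cases "f x")
    case True
    have "(\<Sum>k<K. 3/4) \<le> (\<Sum>k<K. (U x ^^ k) e None)" by (intro sum_mono yes x True)
    then have "real K * (3/4) \<le> (\<Sum>k<K. (U x ^^ k) e None)" by simp
    then show ?thesis using True K0 by (simp add: g_def field_simps)
  next
    case False
    then show ?thesis using no[OF x False] K0 by (simp add: g_def field_simps abs_le_iff)
  qed
  ultimately show ?thesis unfolding s_def by blast
qed

text \<open>Expand the expectation of f times its sign polynomial into characters. If all
  correlations were small, the L1 bound on the coefficients would push the expectation below the
  margin 1/4. The distribution is arbitrary, which is what boosting needs.\<close>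

lemma parity_correlation:
  fixes D :: "bool list pmf"
  assumes f: "f \<in> formula_xor n s" and D: "set_pmf D \<subseteq> {x. length x = n}" and K: "12 * sqrt s \<le> real K"
  shows "\<exists>S\<subseteq>{..<n}. \<bar>measure_pmf.expectation D (\<lambda>x. sg (f x) * chr S x)\<bar> \<ge> 1 / (16 * (2 * s + 1) ^ K)"
proof -
  obtain F S b where F: "real (leaves F) \<le> s" "\<And>i. S i \<subseteq> {..<n}"
    "\<And>x. length x = n \<Longrightarrow> f x = feval F (\<lambda>i. parity (S i) (b i) x)"
    using f unfolding formula_xor_def by auto
  have "12 * sqrt (leaves F) \<le> 12 * sqrt s" using F(1) by simp
  then have "12 * sqrt (leaves F) \<le> K" using K by linarith
  from formula_sign_poly[OF F(2,3) this] obtain g where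
    g: "spectral n (real (2 * leaves F + 1) ^ K + 1/2) g"
    "\<And>x. length x = n \<Longrightarrow> (if f x then g x \<ge> 1/4 else g x \<le> -1/4)" by blast
  define L where "L = (2 * s + 1) ^ K"
  have "real (2 * leaves F + 1) ^ K \<le> L" unfolding L_def using F(1) by (intro power_mono) auto
  moreover have "real (2 * leaves F + 1) ^ K \<ge> 1" by (rule one_le_power) simp
  ultimately have L: "L \<ge> 1" "real (2 * leaves F + 1) ^ K + 1/2 \<le> 2 * L" by linarith+
  obtain c where c: "\<And>x. length x = n \<Longrightarrow> g x = (\<Sum>S\<in>Pow {..<n}. c S * chr S x)"
    "(\<Sum>S\<in>Pow {..<n}. \<bar>c S\<bar>) \<le> 2 * L"
    by (rule spectralE[OF spectral_mono[OF g(1) L(2)]]) blast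
  let ?E = "measure_pmf.expectation D"
  have fin: "finite (set_pmf D)"
    using D finite_lists_length_eq[of "UNIV :: bool set" n] by (auto intro: finite_subset)
  have int: "integrable (measure_pmf D) h" for h :: "bool list \<Rightarrow> real"
    by (rule integrable_measure_pmf_finite[OF fin])
  show ?thesis
  proof (rule ccontr)
    assume "\<not> ?thesis"
    then have small: "\<bar>?E (\<lambda>x. sg (f x) * chr S x)\<bar> < 1 / (16 * L)" if "S \<subseteq> {..<n}" for S
      using that unfolding L_def by (meson not_less)
    \<comment> \<open>The minus sign comes from the convention that True has sign -1, whereas
      \<open>g\<close> is positive on true inputs.\<close>
    have "1/4 \<le> ?E (\<lambda>x. - (sg (f x) * g x))"
    proof -
      have "?E (\<lambda>x. 1/4) \<le> ?E (\<lambda>x. - (sg (f x) * g x))"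
      proof (rule integral_mono_AE[OF int int])
        show "AE x in D. 1/4 \<le> - (sg (f x) * g x)"
          unfolding AE_measure_pmf_iff
        proof
          fix x assume "x \<in> set_pmf D"
          then have "length x = n" using D by blast
          from g(2)[OF this] show "1/4 \<le> - (sg (f x) * g x)" by (auto simp: sg_def split: if_splits)
        qed
      qed
      then show ?thesis by simp
    qed
    also have "\<dots> = ?E (\<lambda>x. \<Sum>S\<in>Pow {..<n}. - c S * (sg (f x) * chr S x))"
    proof (rule integral_cong_AE)
      show "AE x in D. - (sg (f x) * g x) = (\<Sum>S\<in>Pow {..<n}. - c S * (sg (f x) * chr S x))"
        using D c(1) by (auto simp: AE_measure_pmf_iff sum_distrib_left sum_negf mult_ac)
    qed auto
    also have "\<dots> = (\<Sum>S\<in>Pow {..<n}. - c S * ?E (\<lambda>x. sg (f x) * chr S x))"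
      by (subst Bochner_Integration.integral_sum[OF int]) simp
    also have "\<dots> \<le> (\<Sum>S\<in>Pow {..<n}. \<bar>c S\<bar> * (1 / (16 * L)))"
    proof (rule sum_mono)
      fix S assume "S \<in> Pow {..<n}"
      then have "\<bar>c S\<bar> * \<bar>?E (\<lambda>x. sg (f x) * chr S x)\<bar> \<le> \<bar>c S\<bar> * (1 / (16 * L))"
        using small[of S] by (intro mult_left_mono) auto
      then show "- c S * ?E (\<lambda>x. sg (f x) * chr S x) \<le> \<bar>c S\<bar> * (1 / (16 * L))"
        unfolding abs_mult[symmetric] by linarith
    qed
    also have "\<dots> = (\<Sum>S\<in>Pow {..<n}. \<bar>c S\<bar>) * (1 / (16 * L))" by (simp add: sum_divide_distrib)
    also have "\<dots> \<le> 2 * L * (1 / (16 * L))" using c(2) L(1) by (intro mult_right_mono) auto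
    also have "\<dots> = 1/8" using L(1) by simp
    finally show False by simp
  qed
qed

section \<open>Expectations over finitely supported distributions\<close>

abbreviation fin :: "'a pmf \<Rightarrow> bool" where "fin p \<equiv> finite (set_pmf p)"

text \<open>A finite sum instead of an integral: linearity and exchange of expectations then hold
  without integrability conditions, and finiteness of the support is needed only where total mass or
  another form of expectation enters.\<close>

definition EE :: "'a pmf \<Rightarrow> ('a \<Rightarrow> real) \<Rightarrow> real" where
  "EE p g = (\<Sum>x\<in>set_pmf p. pmf p x * g x)"

lemma EE_eq: "fin p \<Longrightarrow> measure_pmf.expectation p g = EE p g"
  by (subst integral_measure_pmf[of "set_pmf p"]) (auto simp: EE_def)

lemma EE_prob: "fin p \<Longrightarrow> measure_pmf.prob p A = EE p (\<lambda>x. of_bool (x \<in> A))"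
proof -
  assume "fin p"
  then have "EE p (\<lambda>x. of_bool (x \<in> A)) = measure_pmf.expectation p (indicator A)"
    by (subst EE_eq) (auto simp: EE_def indicator_def of_bool_def)
  then show ?thesis by simp
qed

lemma EE_cong: "(\<And>x. x \<in> set_pmf p \<Longrightarrow> g x = h x) \<Longrightarrow> EE p g = EE p h"
  unfolding EE_def by (rule sum.cong) auto

lemma EE_mono: "(\<And>x. x \<in> set_pmf p \<Longrightarrow> g x \<le> h x) \<Longrightarrow> EE p g \<le> EE p h"
  unfolding EE_def by (intro sum_mono mult_left_mono) auto

lemma EE_add: "EE p (\<lambda>x. g x + h x) = EE p g + EE p h"
  by (simp add: EE_def sum.distrib algebra_simps)

lemma EE_diff: "EE p (\<lambda>x. g x - h x) = EE p g - EE p h"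
  by (simp add: EE_def sum_subtractf algebra_simps)

lemma EE_mult: "EE p (\<lambda>x. c * g x) = c * EE p g"
  by (simp add: EE_def sum_distrib_left mult.left_commute)

lemma EE_mult': "EE p (\<lambda>x. g x * c) = EE p g * c"
  by (simp add: EE_def sum_distrib_right mult.assoc)

lemma EE_sum: "EE p (\<lambda>x. \<Sum>i\<in>I. g i x) = (\<Sum>i\<in>I. EE p (g i))"
  unfolding EE_def sum_distrib_left by (rule sum.swap)

lemma EE_const: "fin p \<Longrightarrow> EE p (\<lambda>x. c) = c"
  by (simp add: EE_def sum_pmf_eq_1 flip: sum_distrib_right)

lemma EE_nonneg: "(\<And>x. x \<in> set_pmf p \<Longrightarrow> 0 \<le> g x) \<Longrightarrow> 0 \<le> EE p g"
  unfolding EE_def by (intro sum_nonneg) auto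

lemma EE_le1: "fin p \<Longrightarrow> (\<And>x. x \<in> set_pmf p \<Longrightarrow> g x \<le> c) \<Longrightarrow> EE p g \<le> c"
  using EE_mono[of p g "\<lambda>_. c"] by (simp add: EE_const)

lemma EE_bind: "fin p \<Longrightarrow> (\<And>x. x \<in> set_pmf p \<Longrightarrow> fin (f x)) \<Longrightarrow> EE (bind_pmf p f) g = EE p (\<lambda>x. EE (f x) g)"
proof -
  assume f: "fin p" "\<And>x. x \<in> set_pmf p \<Longrightarrow> fin (f x)"
  have "EE (bind_pmf p f) g = measure_pmf.expectation (bind_pmf p f) g"
    by (rule EE_eq[symmetric]) (use f in auto)
  also have "\<dots> = (\<Sum>x\<in>set_pmf p. pmf p x *\<^sub>R measure_pmf.expectation (f x) g)"
    by (rule pmf_expectation_bind) (use f in auto)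
  also have "\<dots> = EE p (\<lambda>x. EE (f x) g)" unfolding EE_def[of p]
    by (rule sum.cong) (simp_all add: EE_eq f(2))
  finally show ?thesis .
qed

lemma EE_map: "fin p \<Longrightarrow> EE (map_pmf h p) g = EE p (\<lambda>x. g (h x))"
  by (subst (1 2) EE_eq[symmetric]) auto

lemma EE_pair: "fin p \<Longrightarrow> fin q \<Longrightarrow> EE (pair_pmf p q) g = EE p (\<lambda>x. EE q (\<lambda>y. g (x, y)))"
  unfolding pair_pmf_def by (simp add: EE_bind) (simp add: EE_def)

lemma EE_swap: "EE p (\<lambda>x. EE q (\<lambda>y. g x y)) = EE q (\<lambda>y. EE p (\<lambda>x. g x y))"
  unfolding EE_def sum_distrib_left by (subst sum.swap) (simp add: mult_ac)

lemma set_iid: "xs \<in> set_pmf (iid k D) \<longleftrightarrow> length xs = k \<and> set xs \<subseteq> set_pmf D"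
  by (induction k arbitrary: xs) (auto simp: length_Suc_conv image_iff)

lemma fin_iid [simp]: "fin D \<Longrightarrow> fin (iid k D)"
  by (induction k) auto

lemma EE_iid_Suc: "fin D \<Longrightarrow> EE (iid (Suc k) D) g = EE D (\<lambda>x. EE (iid k D) (\<lambda>xs. g (x # xs)))"
  by (simp add: EE_bind EE_map)

lemma EE_iid_0: "EE (iid 0 D) g = g []"
  by (simp add: EE_def)

lemma EE_iid_append:
  "fin D \<Longrightarrow> EE (iid (k + l) D) g = EE (iid k D) (\<lambda>xs. EE (iid l D) (\<lambda>ys. g (xs @ ys)))"
proof (induction k arbitrary: g)
  case 0 then show ?case by (simp only: EE_iid_0 add_0 append_Nil)
next
  case (Suc k) then show ?case by (simp only: add_Suc EE_iid_Suc append_Cons)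
qed

lemma EE_iid_take:
  assumes "fin D" "k \<le> l" shows "EE (iid l D) (\<lambda>xs. g (take k xs)) = EE (iid k D) g"
proof -
  have "EE (iid (k + (l - k)) D) (\<lambda>xs. g (take k xs)) = EE (iid k D) (\<lambda>xs. EE (iid (l - k) D) (\<lambda>ys. g xs))"
    unfolding EE_iid_append[OF assms(1)] by (intro EE_cong) (auto simp: set_iid)
  then show ?thesis using assms by (simp add: EE_const)
qed

definition chunk :: "nat \<Rightarrow> nat \<Rightarrow> 'a list \<Rightarrow> 'a list" where
  "chunk k i xs = take k (drop (i * k) xs)"

lemma length_chunk: "Suc i * k \<le> length xs \<Longrightarrow> length (chunk k i xs) = k"
  by (simp add: chunk_def)

lemma set_chunk: "set (chunk k i xs) \<subseteq> set xs"
  unfolding chunk_def by (meson set_take_subset set_drop_subset order_trans)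

lemma chunk_append1: "Suc i * k \<le> length xs \<Longrightarrow> chunk k i (xs @ ys) = chunk k i xs"
  by (simp add: chunk_def)

lemma chunk_append2: "length xs = l * k \<Longrightarrow> chunk k (l + i) (xs @ ys) = chunk k i ys"
  by (simp add: chunk_def algebra_simps)

text \<open>Disjoint stretches of an independent stream are independent; this is the only place
  where the runs of the procedure are multiplied.\<close>

lemma EE_iid_prod:
  assumes "fin D" shows "EE (iid (k * M) D) (\<lambda>zs. \<Prod>j<k. g (chunk M j zs)) = (EE (iid M D) g) ^ k"
proof (induction k)
  case 0 show ?case by (simp add: EE_def)
next
  case (Suc k)
  have "EE (iid (Suc k * M) D) (\<lambda>zs. \<Prod>j<Suc k. g (chunk M j zs))
    = EE (iid (k * M + M) D) (\<lambda>zs. (\<Prod>j<k. g (chunk M j zs)) * g (chunk M k zs))"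
    by (simp add: add.commute)
  also have "\<dots> = EE (iid (k * M) D) (\<lambda>xs. EE (iid M D) (\<lambda>ys. (\<Prod>j<k. g (chunk M j xs)) * g ys))"
    unfolding EE_iid_append[OF assms]
  proof (intro EE_cong)
    fix xs ys assume xy: "xs \<in> set_pmf (iid (k * M) D)" "ys \<in> set_pmf (iid M D)"
    then have l: "length xs = k * M" "length ys = M" by (auto simp: set_iid)
    have "(\<Prod>j<k. g (chunk M j (xs @ ys))) = (\<Prod>j<k. g (chunk M j xs))"
    proof (rule prod.cong)
      fix j assume "j \<in> {..<k}"
      then have "Suc j * M \<le> k * M" by (intro mult_le_mono1) auto
      then show "g (chunk M j (xs @ ys)) = g (chunk M j xs)" using l by (simp add: chunk_append1)
    qed simp
    moreover have "chunk M k (xs @ ys) = ys" using chunk_append2[OF l(1), of 0 ys] l(2) by (simp add: chunk_def)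
    ultimately show "(\<Prod>j<k. g (chunk M j (xs @ ys))) * g (chunk M k (xs @ ys)) = (\<Prod>j<k. g (chunk M j xs)) * g ys"
      by simp
  qed
  also have "\<dots> = (EE (iid M D) g) ^ Suc k"
    by (simp add: EE_mult EE_mult' Suc)
  finally show ?case .
qed

text \<open>Each trial either hits, with expected contribution \<open>EE P hit\<close>, or hands
  over to the remaining trials with probability \<open>q\<close>. Unrolling gives a truncated
  geometric series.\<close>

lemma EE_first_hit:
  fixes \<phi> :: "'a \<Rightarrow> 'b option" and \<psi> :: "'b \<Rightarrow> real" and Q :: "'b \<Rightarrow> bool"
  assumes "fin P"
  defines "hit \<equiv> \<lambda>x. case \<phi> x of None \<Rightarrow> 0 | Some w \<Rightarrow> if Q w then \<psi> w else 0"
  defines "q \<equiv> 1 - EE P (\<lambda>x. case \<phi> x of None \<Rightarrow> 0 | Some w \<Rightarrow> of_bool (Q w))"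
  shows "EE (iid m P) (\<lambda>us. case find Q (List.map_filter \<phi> us) of None \<Rightarrow> 0 | Some w \<Rightarrow> \<psi> w)
    = EE P hit * (\<Sum>i<m. q ^ i)"
proof (induction m)
  case 0 show ?case by (simp add: EE_def map_filter_simps)
next
  case (Suc m)
  define F where "F us = (case find Q (List.map_filter \<phi> us) of None \<Rightarrow> 0 | Some w \<Rightarrow> \<psi> w)" for us
  define r where "r x = (case \<phi> x of None \<Rightarrow> 0 | Some w \<Rightarrow> (of_bool (Q w) :: real))" for x
  have F: "F (x # us) = hit x + (1 - r x) * F us" for x us
    by (auto simp: F_def hit_def r_def map_filter_simps split: option.splits)
  have "EE (iid (Suc m) P) F = EE P (\<lambda>x. EE (iid m P) (\<lambda>us. hit x + (1 - r x) * F us))"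
    by (simp only: EE_iid_Suc[OF assms(1)] F)
  also have "\<dots> = EE P (\<lambda>x. hit x + (1 - r x) * EE (iid m P) F)"
    using assms(1) by (simp add: EE_add EE_mult EE_const)
  also have "\<dots> = EE P hit + q * EE (iid m P) F"
    using assms(1) by (simp add: EE_add EE_mult' EE_diff EE_const q_def r_def)
  also have "EE (iid m P) F = EE P hit * (\<Sum>i<m. q ^ i)" using Suc by (simp add: F_def[abs_def])
  also have "EE P hit + q * \<dots> = EE P hit * (\<Sum>i<Suc m. q ^ i)"
    by (simp add: sum.lessThan_Suc_shift sum_distrib_left algebra_simps del: sum.lessThan_Suc)
  finally show ?case by (simp add: F_def[abs_def])
qed

text \<open>By Bernoulli, (1 + mP)(1 - P)^m is at most (1 - P^2)^m, hence at most 1.\<close>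

lemma mult_power_le_inverse:
  fixes P :: real assumes "0 \<le> P" "P \<le> 1" "m > 0" shows "P * (1 - P) ^ m \<le> 1 / real m"
proof -
  have "(1 + real m * P) * (1 - P) ^ m \<le> (1 + P) ^ m * (1 - P) ^ m"
    using assms by (intro mult_right_mono Bernoulli_inequality) auto
  also have "\<dots> = (1 - P * P) ^ m" by (simp add: power_mult_distrib[symmetric] algebra_simps)
  also have "\<dots> \<le> 1" using assms mult_le_one[of P P] by (intro power_le_one) auto
  finally have "real m * (P * (1 - P) ^ m) + (1 - P) ^ m \<le> 1" by (simp add: algebra_simps)
  moreover have "(1 - P) ^ m \<ge> 0" using assms by simp
  ultimately have "real m * (P * (1 - P) ^ m) \<le> 1" by linarith
  then show ?thesis using assms(3) by (simp add: field_simps)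
qed

text \<open>For many trials the left side approaches e^2 / P. That quotient is replaced by its
  tangent 2te - t^2 P, obtained by completing a square, because an expression linear in e and P can
  be summed over buckets and averaged over earlier samples. The term 1/m pays for buckets too light
  to be hit.\<close>

lemma bucket_bound:
  fixes e P t :: real
  assumes "\<bar>e\<bar> \<le> P" "P \<le> 1" "m > 0"
  shows "e\<^sup>2 * (\<Sum>i<m. (1 - P) ^ i) \<ge> 2 * t * e - t\<^sup>2 * P - 1 / real m"
proof (cases "P = 0")
  case True then show ?thesis using assms by simp
next
  case False
  then have P: "P > 0" using assms by linarith
  define \<delta> where "\<delta> = (1 - P) ^ m"
  have \<delta>: "0 \<le> \<delta>" using assms by (simp add: \<delta>_def)
  have "(1 - (1 - P)) * (\<Sum>i<m. (1 - P) ^ i) = 1 - (1 - P) ^ m"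
    by (rule one_diff_power_eq[symmetric])
  then have S: "(\<Sum>i<m. (1 - P) ^ i) = (1 - \<delta>) / P" using P by (simp add: \<delta>_def field_simps)
  have "0 \<le> P * (e / P - t)\<^sup>2" using P by simp
  also have "\<dots> = e\<^sup>2 / P - 2 * t * e + t\<^sup>2 * P" using P by (simp add: power2_eq_square field_simps)
  finally have 1: "e\<^sup>2 / P \<ge> 2 * t * e - t\<^sup>2 * P" by simp
  have "e\<^sup>2 \<le> P\<^sup>2" using assms(1) by (metis abs_ge_zero power2_abs power_mono)
  then have "e\<^sup>2 / P \<le> P" using P by (simp add: power2_eq_square divide_simps)
  then have "e\<^sup>2 / P * \<delta> \<le> P * \<delta>" using \<delta> by (rule mult_right_mono)
  also have "\<dots> \<le> 1 / real m" unfolding \<delta>_def using assms P by (intro mult_power_le_inverse) auto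
  finally have 2: "e\<^sup>2 / P * \<delta> \<le> 1 / real m" .
  have "e\<^sup>2 * ((1 - \<delta>) / P) = e\<^sup>2 / P - e\<^sup>2 / P * \<delta>"
    by (simp add: right_diff_distrib diff_divide_distrib)
  then show ?thesis unfolding S using 1 2 by linarith
qed


section \<open>Bucket elimination and margins\<close>

text \<open>An example as a bit list with its label appended as coordinate \<open>n\<close>,
  together with its boosting threshold.\<close>

type_synonym item = "bool list \<times> nat"

text \<open>Agreement on block \<open>l\<close> when \<open>n\<close> coordinates are cut into
  \<open>a\<close> nearly equal blocks: i lies in block l iff the floor of i a / n is l, written
  without division so that a machine can test it by products.\<close>

definition agree :: "nat \<Rightarrow> nat \<Rightarrow> nat \<Rightarrow> bool list \<Rightarrow> bool list \<Rightarrow> bool" where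
  "agree n a l v u \<longleftrightarrow> (\<forall>i<n. l * n \<le> i * a \<and> i * a < Suc l * n \<longrightarrow> v ! i = u ! i)"

definition xorv :: "bool list \<Rightarrow> bool list \<Rightarrow> bool list" where
  "xorv v u = map2 (\<noteq>) v u"

lemma length_xorv [simp]: "length (xorv v u) = min (length v) (length u)"
  by (simp add: xorv_def)

lemma nth_xorv: "i < length v \<Longrightarrow> i < length u \<Longrightarrow> xorv v u ! i = (v ! i \<noteq> u ! i)"
  by (simp add: xorv_def)

definition rstep :: "nat \<Rightarrow> nat \<Rightarrow> nat \<Rightarrow> (item \<Rightarrow> bool list option) \<Rightarrow> item list \<Rightarrow> bool list \<Rightarrow> bool list option" where
  "rstep n a l \<phi> us v = (case find (\<lambda>w. agree n a l v w) (List.map_filter \<phi> us) of None \<Rightarrow> None | Some w \<Rightarrow> Some (xorv v w))"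

text \<open>At level \<open>l\<close> the point is matched with the first usable example of the
  batch \<open>ch l\<close>; that example has itself been reduced through the lower levels with the
  same lower batches. Each level thus has one batch, shared by the point and by its potential
  partners. \<open>None\<close> marks a point without a partner.\<close>

fun reduce :: "nat \<Rightarrow> nat \<Rightarrow> (nat \<Rightarrow> item list) \<Rightarrow> (item \<Rightarrow> bool) \<Rightarrow> nat \<Rightarrow> bool list \<Rightarrow> bool list option" where
  "reduce n a ch acc 0 v = Some v"
| "reduce n a ch acc (Suc l) v = Option.bind (reduce n a ch acc l v)
     (rstep n a l (\<lambda>x. if acc x then reduce n a ch acc l (fst x) else None) (ch l))"

fun val :: "nat \<Rightarrow> bool list option \<Rightarrow> int" where
  "val n None = 0"
| "val n (Some v) = (if v ! n then -1 else 1)"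

text \<open>For a point carrying its true label, a cleared label is a correct guess (+1), a set one
  a wrong guess (-1), and a discarded point scores 0. Round \<open>r\<close> admits as partners only
  examples whose margin so far is below their own threshold.\<close>

fun margin :: "nat \<Rightarrow> nat \<Rightarrow> (nat \<Rightarrow> nat \<Rightarrow> item list) \<Rightarrow> nat \<Rightarrow> bool list \<Rightarrow> int" where
  "margin n a ch 0 v = 0"
| "margin n a ch (Suc r) v = margin n a ch r v +
     val n (reduce n a (ch r) (\<lambda>x. margin n a ch r (fst x) < int (snd x)) a v)"

lemma reduce_cong: "(\<And>k. k < l \<Longrightarrow> ch k = ch' k) \<Longrightarrow> reduce n a ch acc l v = reduce n a ch' acc l v"
proof (induction l arbitrary: v)
  case (Suc l)
  then have eq: "reduce n a ch acc l = reduce n a ch' acc l" by auto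
  show ?case unfolding reduce.simps eq Suc.prems[OF lessI] ..
qed simp

lemma margin_cong: "(\<And>k l. k < r \<Longrightarrow> l < a \<Longrightarrow> ch k l = ch' k l) \<Longrightarrow> margin n a ch r v = margin n a ch' r v"
proof (induction r arbitrary: v)
  case (Suc r)
  then have "margin n a ch r = margin n a ch' r" by auto
  moreover have "reduce n a (ch r) acc a v = reduce n a (ch' r) acc a v" for acc
    by (rule reduce_cong) (simp add: Suc.prems)
  ultimately show ?case by simp
qed simp

definition lenok :: "nat \<Rightarrow> item list \<Rightarrow> bool" where
  "lenok n us \<longleftrightarrow> (\<forall>x\<in>set us. length (fst x) = Suc n)"

lemma map_filter_find:
  "find Q (List.map_filter \<phi> us) = Some w \<Longrightarrow> (\<exists>x\<in>set us. \<phi> x = Some w) \<and> Q w"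
proof (induction us)
  case (Cons x us)
  then show ?case by (cases "\<phi> x") (auto simp: map_filter_simps split: if_splits)
qed (simp add: map_filter_simps)

text \<open>Blocks cleared earlier stay clear since the partner has them cleared too, and the
  current block is cleared by agreement. After \<open>a\<close> levels only the label coordinate can
  be nonzero.\<close>

lemma reduce_props:
  assumes "\<And>k. k < l \<Longrightarrow> lenok n (ch k)" "length v = Suc n" "reduce n a ch acc l v = Some w"
  shows "length w = Suc n \<and> (\<forall>i<n. i * a < l * n \<longrightarrow> \<not> w ! i)"
  using assms
proof (induction l arbitrary: v w)
  case (Suc l)
  obtain u where u: "reduce n a ch acc l v = Some u"
    "rstep n a l (\<lambda>x. if acc x then reduce n a ch acc l (fst x) else None) (ch l) u = Some w"
    using Suc.prems(3) by (auto simp: bind_eq_Some_conv)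
  obtain w0 where w0: "find (\<lambda>w. agree n a l u w) (List.map_filter (\<lambda>x. if acc x then reduce n a ch acc l (fst x) else None) (ch l)) = Some w0"
    and w: "w = xorv u w0" using u(2) by (auto simp: rstep_def split: option.splits)
  from map_filter_find[OF w0] obtain x where x: "x \<in> set (ch l)" "acc x" "reduce n a ch acc l (fst x) = Some w0"
    "agree n a l u w0" by (auto split: if_splits)
  have U: "length u = Suc n \<and> (\<forall>i<n. i * a < l * n \<longrightarrow> \<not> u ! i)"
    using Suc.IH[OF Suc.prems(1,2) u(1)] by simp
  have "length (fst x) = Suc n" using Suc.prems(1)[of l] x(1) by (auto simp: lenok_def)
  from Suc.IH[OF Suc.prems(1) this x(3)] have W: "length w0 = Suc n \<and> (\<forall>i<n. i * a < l * n \<longrightarrow> \<not> w0 ! i)" by simp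
  show ?case
  proof (intro conjI allI impI)
    show "length w = Suc n" using U W by (simp add: w)
    fix i assume i: "i < n" "i * a < Suc l * n"
    have wi: "w ! i = (u ! i \<noteq> w0 ! i)" unfolding w using U W i(1) by (intro nth_xorv) auto
    show "\<not> w ! i"
    proof (cases "i * a < l * n")
      case True then show ?thesis using U W i wi by auto
    next
      case False
      then have "u ! i = w0 ! i" using x(4) i by (auto simp: agree_def)
      then show ?thesis using wi by simp
    qed
  qed
qed simp

text \<open>The label is carried as the last coordinate, which no bucket looks at.\<close>
lemma agree_append: "length x = n \<Longrightarrow> agree n a l (x @ [y]) w = agree n a l (x @ [z]) w"
  by (auto simp: agree_def nth_append)

text \<open>Partners are chosen by looking at the first \<open>n\<close> coordinates alone, so both
  labellings of a point follow the same path and end with opposite labels.\<close>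

lemma reduce_label:
  assumes "length x = n" "\<And>k. k < l \<Longrightarrow> lenok n (ch k)"
  shows "(reduce n a ch acc l (x @ [True]) = None \<and> reduce n a ch acc l (x @ [False]) = None) \<or>
    (\<exists>u b. length u = n \<and> reduce n a ch acc l (x @ [True]) = Some (u @ [\<not> b]) \<and>
      reduce n a ch acc l (x @ [False]) = Some (u @ [b]))"
  using assms(2)
proof (induction l)
  case 0 then show ?case using assms(1) by auto
next
  case (Suc l)
  let ?\<phi> = "\<lambda>x. if acc x then reduce n a ch acc l (fst x) else None"
  from Suc consider "reduce n a ch acc l (x @ [True]) = None" "reduce n a ch acc l (x @ [False]) = None"
    | u b where "length u = n" "reduce n a ch acc l (x @ [True]) = Some (u @ [\<not> b])"
      "reduce n a ch acc l (x @ [False]) = Some (u @ [b])" by (metis less_Suc_eq)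
  then show ?case
  proof cases
    case 1 then show ?thesis by simp
  next
    case 2
    have ag: "(\<lambda>w. agree n a l (u @ [\<not> b]) w) = (\<lambda>w. agree n a l (u @ [b]) w)"
      by (rule ext) (rule agree_append[OF 2(1)])
    show ?thesis
    proof (cases "find (\<lambda>w. agree n a l (u @ [b]) w) (List.map_filter ?\<phi> (ch l))")
      case None
      then show ?thesis using 2 by (simp add: rstep_def ag)
    next
      case (Some w)
      from map_filter_find[OF this] obtain x' where x': "x' \<in> set (ch l)" "?\<phi> x' = Some w" by blast
      have "length (fst x') = Suc n" using Suc.prems[of l] x'(1) by (auto simp: lenok_def)
      moreover have "reduce n a ch acc l (fst x') = Some w" using x'(2) by (auto split: if_splits)
      ultimately have "length w = Suc n" using reduce_props[of l n ch "fst x'" a acc w] Suc.prems by simp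
      then obtain w1 c where w: "w = w1 @ [c]" "length w1 = n" by (metis length_Suc_conv_rev)
      have "xorv (u @ [d]) w = xorv u w1 @ [d \<noteq> c]" for d using w 2(1) by (simp add: xorv_def)
      then show ?thesis using 2 w Some
        by (intro disjI2 exI[of _ "xorv u w1"] exI[of _ "b \<noteq> c"]) (auto simp: rstep_def ag)
    qed
  qed
qed

text \<open>Every round changes sign with the label. A point of unknown label can therefore be
  classified by running it with label False and reading the sign.\<close>

lemma margin_label:
  assumes "length x = n" "\<And>k l. k < r \<Longrightarrow> l < a \<Longrightarrow> lenok n (ch k l)"
  shows "margin n a ch r (x @ [True]) = - margin n a ch r (x @ [False])"
  using assms(2)
proof (induction r)
  case (Suc r)
  let ?acc = "\<lambda>x. margin n a ch r (fst x) < int (snd x)"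
  have "val n (reduce n a (ch r) ?acc a (x @ [True])) = - val n (reduce n a (ch r) ?acc a (x @ [False]))"
    using reduce_label[OF assms(1), of a "ch r" a ?acc] Suc.prems by (auto simp: nth_append)
  then show ?case using Suc by simp
qed simp

text \<open>The sign telling whether the parity on \<open>S\<close> matches the carried label. It is
  multiplicative under xor, which is what drives the elimination.\<close>

definition psi :: "nat \<Rightarrow> nat set \<Rightarrow> bool list \<Rightarrow> real" where
  "psi n S v = sg (v ! n) * chr S v"

lemma abs_psi [simp]: "\<bar>psi n S v\<bar> = 1"
  by (simp add: psi_def abs_mult)

lemma psi_xorv:
  assumes "length v = Suc n" "length w = Suc n" "S \<subseteq> {..<n}"
  shows "psi n S (xorv v w) = psi n S v * psi n S w"
proof -
  have "chr S (xorv v w) = (\<Prod>i\<in>S. sg (v ! i) * sg (w ! i))"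
    unfolding chr_def
  proof (rule prod.cong)
    fix i assume "i \<in> S"
    then have "i < Suc n" using assms(3) by auto
    then show "sg (xorv v w ! i) = sg (v ! i) * sg (w ! i)"
      using assms by (simp only: nth_xorv sg_neq)
  qed simp
  then have 1: "chr S (xorv v w) = chr S v * chr S w" by (simp only: chr_def prod.distrib)
  have "xorv v w ! n = (v ! n \<noteq> w ! n)" using assms by (intro nth_xorv) auto
  then have "sg (xorv v w ! n) = sg (v ! n) * sg (w ! n)" by (simp only: sg_neq)
  then show ?thesis unfolding psi_def 1 by simp
qed

definition opsi :: "nat \<Rightarrow> nat set \<Rightarrow> bool list option \<Rightarrow> real" where
  "opsi n S u = (case u of None \<Rightarrow> 0 | Some v \<Rightarrow> psi n S v)"

definition block :: "nat \<Rightarrow> nat \<Rightarrow> nat \<Rightarrow> nat set" where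
  "block n a l = {i. i < n \<and> l * n \<le> i * a \<and> i * a < Suc l * n}"

definition key :: "nat \<Rightarrow> nat \<Rightarrow> nat \<Rightarrow> bool list \<Rightarrow> nat set" where
  "key n a l v = {i \<in> block n a l. v ! i}"

lemma agree_key: "agree n a l v w \<longleftrightarrow> key n a l w = key n a l v"
  by (auto simp: agree_def key_def block_def)

lemma finite_block: "finite (block n a l)"
  by (simp add: block_def)

text \<open>Point and partner come from the same bucket \<open>z\<close>, and their signs multiply.
  So bucket \<open>z\<close> contributes the square of its signed mass \<open>e z\<close> times a
  geometric sum: nonnegative, and by \<open>bucket_bound\<close> summed over at most 2^b buckets
  close to the square of the old correlation divided by the mass.\<close>

lemma level_bound:
  fixes \<phi> :: "item \<Rightarrow> bool list option"
  assumes P: "fin P" and len: "\<And>x v. x \<in> set_pmf P \<Longrightarrow> \<phi> x = Some v \<Longrightarrow> length v = Suc n"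
    and S: "S \<subseteq> {..<n}" and m: "m > 0" and b: "card (block n a l) \<le> b"
    and p: "EE P (\<lambda>x. of_bool (\<phi> x \<noteq> None)) \<le> p"
  defines "G \<equiv> EE P (\<lambda>x. opsi n S (\<phi> x))"
    and "G' \<equiv> EE (iid m P) (\<lambda>us. EE P (\<lambda>x. opsi n S (Option.bind (\<phi> x) (rstep n a l \<phi> us))))"
  shows "G' \<ge> 0" "G' \<ge> 2 * t * G - t\<^sup>2 * p - 2 ^ b / real m"
proof -
  let ?Z = "Pow (block n a l)"
  define k where "k = key n a l"
  define hit where "hit z x = (case \<phi> x of None \<Rightarrow> 0 | Some w \<Rightarrow> if k w = z then psi n S w else 0)" for z x
  define occ where "occ z x = (case \<phi> x of None \<Rightarrow> (0::real) | Some w \<Rightarrow> of_bool (k w = z))" for z x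
  define e where "e z = EE P (hit z)" for z
  define Pr where "Pr z = EE P (occ z)" for z
  define T where "T z = e z * (\<Sum>i<m. (1 - Pr z) ^ i)" for z
  have kZ: "k w \<in> ?Z" for w by (auto simp: k_def key_def)
  have finZ: "finite ?Z" by (simp add: finite_block)
  \<comment> \<open>For a fixed point the partner is the first of m draws with the same key, so
    \<open>EE_first_hit\<close> gives its expected sign; the indicator of the point's own bucket
    turns the result into a sum over all buckets.\<close>
  have inner: "EE (iid m P) (\<lambda>us. opsi n S (Option.bind (\<phi> x) (rstep n a l \<phi> us))) = (\<Sum>z\<in>?Z. hit z x * T z)"
    if x: "x \<in> set_pmf P" for x
  proof (cases "\<phi> x")
    case None
    then show ?thesis by (simp add: opsi_def hit_def EE_def)
  next
    case (Some v)
    have lv: "length v = Suc n" using len[OF x Some] .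
    have "EE (iid m P) (\<lambda>us. opsi n S (Option.bind (\<phi> x) (rstep n a l \<phi> us)))
       = EE (iid m P) (\<lambda>us. psi n S v * (case find (\<lambda>w. agree n a l v w) (List.map_filter \<phi> us) of None \<Rightarrow> 0 | Some w \<Rightarrow> psi n S w))"
    proof (rule EE_cong)
      fix us assume "us \<in> set_pmf (iid m P)"
      then have us: "set us \<subseteq> set_pmf P" by (simp add: set_iid)
      show "opsi n S (Option.bind (\<phi> x) (rstep n a l \<phi> us)) =
        psi n S v * (case find (\<lambda>w. agree n a l v w) (List.map_filter \<phi> us) of None \<Rightarrow> 0 | Some w \<Rightarrow> psi n S w)"
      proof (cases "find (\<lambda>w. agree n a l v w) (List.map_filter \<phi> us)")
        case None then show ?thesis by (simp add: Some rstep_def opsi_def)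
      next
        case (Some w)
        from map_filter_find[OF this] obtain y where "y \<in> set us" "\<phi> y = Some w" by blast
        then have "length w = Suc n" using len us by blast
        then show ?thesis using Some \<open>\<phi> x = Some v\<close> psi_xorv[OF lv _ S] by (simp add: rstep_def opsi_def)
      qed
    qed
    also have "\<dots> = psi n S v * T (k v)"
      unfolding EE_mult EE_first_hit[OF P] agree_key T_def e_def Pr_def hit_def[abs_def] occ_def[abs_def] k_def ..
    also have "\<dots> = (\<Sum>z\<in>?Z. if z = k v then psi n S v * T z else 0)"
      using kZ[of v] finZ by simp
    also have "\<dots> = (\<Sum>z\<in>?Z. hit z x * T z)"
      by (rule sum.cong) (auto simp: hit_def Some)
    finally show ?thesis .
  qed
  have "G' = EE P (\<lambda>x. EE (iid m P) (\<lambda>us. opsi n S (Option.bind (\<phi> x) (rstep n a l \<phi> us))))"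
    unfolding G'_def by (rule EE_swap)
  also have "\<dots> = EE P (\<lambda>x. \<Sum>z\<in>?Z. hit z x * T z)" by (rule EE_cong) (rule inner)
  also have "\<dots> = (\<Sum>z\<in>?Z. e z * T z)" by (simp add: EE_sum EE_mult' e_def)
  finally have G': "G' = (\<Sum>z\<in>?Z. (e z)\<^sup>2 * (\<Sum>i<m. (1 - Pr z) ^ i))"
    by (simp add: T_def power2_eq_square mult.assoc)
  have occ: "0 \<le> occ z x" "occ z x \<le> 1" "\<bar>hit z x\<bar> = occ z x" for z x
    by (auto simp: occ_def hit_def split: option.splits)
  have Pr1: "Pr z \<le> 1" for z unfolding Pr_def using occ by (intro EE_le1 P) auto
  have eP: "\<bar>e z\<bar> \<le> Pr z" for z
  proof -
    have "e z \<le> Pr z" unfolding e_def Pr_def using occ(3)[of z] by (intro EE_mono) (metis abs_ge_self)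
    moreover have "- e z \<le> Pr z"
      unfolding e_def Pr_def EE_mult[of P "-1", simplified, symmetric]
      using occ(3)[of z] by (intro EE_mono) (metis abs_ge_minus_self)
    ultimately show ?thesis by linarith
  qed
  show "G' \<ge> 0" unfolding G'
    using Pr1 by (intro sum_nonneg mult_nonneg_nonneg) auto
  have eG: "(\<Sum>z\<in>?Z. e z) = G"
    unfolding e_def G_def EE_sum[symmetric]
  proof (rule EE_cong)
    fix x show "(\<Sum>z\<in>?Z. hit z x) = opsi n S (\<phi> x)"
    proof (cases "\<phi> x")
      case (Some v)
      have "(\<Sum>z\<in>?Z. hit z x) = (\<Sum>z\<in>?Z. if z = k v then psi n S v else 0)"
        by (rule sum.cong) (auto simp: hit_def Some)
      then show ?thesis using kZ[of v] finZ by (simp add: opsi_def Some)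
    qed (simp add: hit_def opsi_def)
  qed
  have "(\<Sum>z\<in>?Z. Pr z) = EE P (\<lambda>x. of_bool (\<phi> x \<noteq> None))"
    unfolding Pr_def EE_sum[symmetric]
  proof (rule EE_cong)
    fix x show "(\<Sum>z\<in>?Z. occ z x) = of_bool (\<phi> x \<noteq> None)"
    proof (cases "\<phi> x")
      case (Some v)
      have "(\<Sum>z\<in>?Z. occ z x) = (\<Sum>z\<in>?Z. if z = k v then 1 else 0)"
        by (rule sum.cong) (auto simp: occ_def Some)
      then show ?thesis using kZ[of v] finZ by (simp add: Some)
    qed (simp add: occ_def)
  qed
  then have PrG: "(\<Sum>z\<in>?Z. Pr z) \<le> p" using p by simp
  have "G' \<ge> (\<Sum>z\<in>?Z. 2 * t * e z - t\<^sup>2 * Pr z - 1 / real m)"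
    unfolding G' by (intro sum_mono bucket_bound eP Pr1 m)
  also have "(\<Sum>z\<in>?Z. 2 * t * e z - t\<^sup>2 * Pr z - 1 / real m)
     = 2 * t * G - t\<^sup>2 * (\<Sum>z\<in>?Z. Pr z) - real (card ?Z) / real m"
    by (simp add: sum_subtractf sum_distrib_left[symmetric] eG)
  finally have "G' \<ge> 2 * t * G - t\<^sup>2 * (\<Sum>z\<in>?Z. Pr z) - real (card ?Z) / real m" .
  moreover have "t\<^sup>2 * (\<Sum>z\<in>?Z. Pr z) \<le> t\<^sup>2 * p" using PrG by (intro mult_left_mono) auto
  moreover have "real (card ?Z) / real m \<le> 2 ^ b / real m"
  proof (rule divide_right_mono)
    have "card ?Z \<le> 2 ^ b" using b by (simp add: card_Pow finite_block)
    then show "real (card ?Z) \<le> 2 ^ b" by (metis of_nat_le_iff of_nat_numeral of_nat_power)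
  qed simp
  ultimately show "G' \<ge> 2 * t * G - t\<^sup>2 * p - 2 ^ b / real m" by linarith
qed

section \<open>Analysis of one run: levels, rounds and the boosting potential\<close>

text \<open>The assumption \<open>weak\<close> is required for every acceptance rule, with
  correlation relative to the accepted mass, because boosting changes the distribution from round to
  round. The parity may depend on the rule.\<close>

locale sampler =
  fixes n a m :: nat and P :: "item pmf" and b :: nat and \<eta> :: real
  assumes P: "fin P" and lenP: "\<And>x. x \<in> set_pmf P \<Longrightarrow> length (fst x) = Suc n"
    and m: "m > 0" and a: "a > 0" and b: "\<And>l. card (block n a l) \<le> b"
    and \<eta>: "0 < \<eta>" "\<eta> \<le> 1"
    and weak: "\<And>acc. EE P (\<lambda>x. of_bool (acc x)) > 0 \<Longrightarrow> \<exists>S\<subseteq>{..<n}.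
        \<bar>EE P (\<lambda>x. of_bool (acc x) * psi n S (fst x))\<bar> \<ge> \<eta> * EE P (\<lambda>x. of_bool (acc x))"
begin

definition ph :: "(item \<Rightarrow> bool) \<Rightarrow> nat \<Rightarrow> item list \<Rightarrow> item \<Rightarrow> bool list option" where
  "ph acc l us x = (if acc x then reduce n a (\<lambda>k. chunk m k us) acc l (fst x) else None)"

lemma lenok_chunk: "set us \<subseteq> set_pmf P \<Longrightarrow> lenok n (chunk m k us)"
  using set_chunk[of m k us] lenP by (auto simp: lenok_def)

lemma ph_len: "set us \<subseteq> set_pmf P \<Longrightarrow> x \<in> set_pmf P \<Longrightarrow> ph acc l us x = Some v \<Longrightarrow> length v = Suc n"
  using reduce_props[of l n "\<lambda>k. chunk m k us" "fst x" a acc v] lenok_chunk lenP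
  by (auto simp: ph_def split: if_splits)

lemma ph_append:
  assumes "length xs = l * m" "length ys = m"
  shows "ph acc (Suc l) (xs @ ys) x = Option.bind (ph acc l xs x) (rstep n a l (ph acc l xs) ys)"
proof -
  have red: "reduce n a (\<lambda>k. chunk m k (xs @ ys)) acc l = reduce n a (\<lambda>k. chunk m k xs) acc l"
  proof (rule ext, rule reduce_cong)
    fix k assume "k < l"
    then have "Suc k * m \<le> l * m" by (intro mult_le_mono1) auto
    then show "chunk m k (xs @ ys) = chunk m k xs" using assms(1) by (simp add: chunk_append1)
  qed
  have "chunk m l (xs @ ys) = ys" using chunk_append2[OF assms(1), of 0 ys] assms(2) by (simp add: chunk_def)
  then have "reduce n a (\<lambda>k. chunk m k (xs @ ys)) acc (Suc l) v =
     Option.bind (reduce n a (\<lambda>k. chunk m k xs) acc l v) (rstep n a l (ph acc l xs) ys)" for v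
    by (simp only: reduce.simps red ph_def[abs_def])
  then show ?thesis by (simp add: ph_def)
qed

lemma ph_some: "EE P (\<lambda>x. of_bool (ph acc l us x \<noteq> None)) \<le> EE P (\<lambda>x. of_bool (acc x))"
  by (rule EE_mono) (simp add: ph_def)

lemma EE_split: "EE (iid (Suc l * m) P) g = EE (iid (l * m) P) (\<lambda>xs. EE (iid m P) (\<lambda>ys. g (xs @ ys)))"
  using EE_iid_append[OF P, of "l * m" m] by (simp add: add.commute)

text \<open>Condition on the batches of the lower levels and apply \<open>level_bound\<close> to the
  fresh batch. The bound is linear in the old correlation, so it survives averaging over those
  batches; \<open>t\<close> is fixed beforehand.\<close>

lemma level_step:
  assumes S: "S \<subseteq> {..<n}"
  shows "EE (iid (Suc l * m) P) (\<lambda>us. EE P (\<lambda>x. opsi n S (ph acc (Suc l) us x))) \<ge> 0"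
    "EE (iid (Suc l * m) P) (\<lambda>us. EE P (\<lambda>x. opsi n S (ph acc (Suc l) us x))) \<ge>
      2 * t * EE (iid (l * m) P) (\<lambda>us. EE P (\<lambda>x. opsi n S (ph acc l us x)))
       - t\<^sup>2 * EE P (\<lambda>x. of_bool (acc x)) - 2 ^ b / real m"
proof -
  let ?p = "EE P (\<lambda>x. of_bool (acc x))"
  have eq: "EE (iid (Suc l * m) P) (\<lambda>us. EE P (\<lambda>x. opsi n S (ph acc (Suc l) us x))) =
    EE (iid (l * m) P) (\<lambda>xs. EE (iid m P) (\<lambda>ys. EE P (\<lambda>x. opsi n S (Option.bind (ph acc l xs x) (rstep n a l (ph acc l xs) ys)))))"
    unfolding EE_split by (intro EE_cong) (simp add: set_iid ph_append)
  have in1: "EE (iid m P) (\<lambda>ys. EE P (\<lambda>x. opsi n S (Option.bind (ph acc l xs x) (rstep n a l (ph acc l xs) ys)))) \<ge> 0"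
    and in2: "EE (iid m P) (\<lambda>ys. EE P (\<lambda>x. opsi n S (Option.bind (ph acc l xs x) (rstep n a l (ph acc l xs) ys)))) \<ge>
      2 * t * EE P (\<lambda>x. opsi n S (ph acc l xs x)) - t\<^sup>2 * ?p - 2 ^ b / real m"
    if "xs \<in> set_pmf (iid (l * m) P)" for xs
  proof -
    have xs: "set xs \<subseteq> set_pmf P" using that by (simp add: set_iid)
    note lb = level_bound[where \<phi> = "ph acc l xs" and n = n and P = P and p = ?p and a = a and l = l, OF P ph_len[OF xs] S m b ph_some]
    show "EE (iid m P) (\<lambda>ys. EE P (\<lambda>x. opsi n S (Option.bind (ph acc l xs x) (rstep n a l (ph acc l xs) ys)))) \<ge> 0"
      by (rule lb(1))
    show "EE (iid m P) (\<lambda>ys. EE P (\<lambda>x. opsi n S (Option.bind (ph acc l xs x) (rstep n a l (ph acc l xs) ys)))) \<ge>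
      2 * t * EE P (\<lambda>x. opsi n S (ph acc l xs x)) - t\<^sup>2 * ?p - 2 ^ b / real m"
      by (rule lb(2))
  qed
  show "EE (iid (Suc l * m) P) (\<lambda>us. EE P (\<lambda>x. opsi n S (ph acc (Suc l) us x))) \<ge> 0"
    unfolding eq by (intro EE_nonneg in1)
  have "EE (iid (l * m) P) (\<lambda>xs. 2 * t * EE P (\<lambda>x. opsi n S (ph acc l xs x)) - t\<^sup>2 * ?p - 2 ^ b / real m)
    \<le> EE (iid (Suc l * m) P) (\<lambda>us. EE P (\<lambda>x. opsi n S (ph acc (Suc l) us x)))"
    unfolding eq by (intro EE_mono in2)
  then show "EE (iid (Suc l * m) P) (\<lambda>us. EE P (\<lambda>x. opsi n S (ph acc (Suc l) us x))) \<ge>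
      2 * t * EE (iid (l * m) P) (\<lambda>us. EE P (\<lambda>x. opsi n S (ph acc l us x)))
       - t\<^sup>2 * EE P (\<lambda>x. of_bool (acc x)) - 2 ^ b / real m"
    using P by (simp add: EE_diff EE_mult EE_const)
qed

text \<open>Relative to the accepted mass the correlation is about squared per level. Writing it as
  twice a power of \<eta> / 2 leaves slack to absorb the loss 2^b / m each time.\<close>

lemma levels_bound:
  assumes S: "S \<subseteq> {..<n}" and p: "p = EE P (\<lambda>x. of_bool (acc x))" "p > 0"
    and w: "\<bar>EE P (\<lambda>x. of_bool (acc x) * psi n S (fst x))\<bar> \<ge> \<eta> * p"
    and B: "2 ^ b / real m \<le> p * (\<eta> / 2) ^ (2 ^ a)"
  shows "Suc l \<le> a \<Longrightarrow> EE (iid (Suc l * m) P) (\<lambda>us. EE P (\<lambda>x. opsi n S (ph acc (Suc l) us x))) \<ge> p * (2 * (\<eta> / 2) ^ (2 ^ Suc l))"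
proof (induction l)
  case 0
  let ?G = "EE P (\<lambda>x. of_bool (acc x) * psi n S (fst x))"
  have G: "EE (iid (0 * m) P) (\<lambda>us. EE P (\<lambda>x. opsi n S (ph acc 0 us x))) = ?G"
    by (simp add: EE_def[of "return_pmf _"], rule EE_cong) (simp add: ph_def opsi_def)
  have "(\<eta> / 2) ^ (2 ^ a) \<le> (\<eta> / 2) ^ (2 ^ 1)" using \<eta> 0 by (intro power_decreasing power_increasing) auto
  then have "p * (\<eta> / 2) ^ (2 ^ a) \<le> p * (\<eta> / 2)\<^sup>2" using p(2) by (intro mult_left_mono) auto
  then have B': "2 ^ b / real m \<le> p * (\<eta> / 2)\<^sup>2" using B by simp
  have "(\<eta> * p)\<^sup>2 \<le> ?G\<^sup>2" using w p(2) \<eta> by (metis abs_le_square_iff abs_of_nonneg less_eq_real_def mult_nonneg_nonneg)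
  then have "(\<eta> * p)\<^sup>2 / p \<le> ?G\<^sup>2 / p" using p(2) by (simp add: divide_right_mono)
  then have g: "p * \<eta>\<^sup>2 \<le> ?G\<^sup>2 / p" using p(2) by (simp add: power2_eq_square mult_ac)
  \<comment> \<open>The optimal t is the relative correlation. It may be negative at this level, and
    squaring repairs the sign.\<close>
  have "EE (iid (Suc 0 * m) P) (\<lambda>us. EE P (\<lambda>x. opsi n S (ph acc (Suc 0) us x))) \<ge>
    2 * (?G / p) * ?G - (?G / p)\<^sup>2 * p - 2 ^ b / real m"
    using level_step(2)[OF S, of "?G / p" 0 acc] unfolding G p(1)[symmetric] by blast
  moreover have "2 * (?G / p) * ?G - (?G / p)\<^sup>2 * p = ?G\<^sup>2 / p" using p(2) by (simp add: power2_eq_square)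
  ultimately have "EE (iid (Suc 0 * m) P) (\<lambda>us. EE P (\<lambda>x. opsi n S (ph acc (Suc 0) us x))) \<ge>
    p * \<eta>\<^sup>2 - p * (\<eta> / 2)\<^sup>2" using g B' by linarith
  moreover have "p * \<eta>\<^sup>2 - p * (\<eta> / 2)\<^sup>2 \<ge> p * (2 * (\<eta> / 2)\<^sup>2)"
    using p(2) \<eta> by (simp add: power2_eq_square)
  ultimately show ?case by simp
next
  case (Suc l)
  let ?h = "(\<eta> / 2) ^ (2 ^ Suc l)"
  have h: "?h \<ge> 0" using \<eta> by simp
  have hh: "(\<eta> / 2) ^ (2 ^ Suc (Suc l)) = ?h\<^sup>2" by (simp add: power_mult[symmetric] mult.commute)
  have "(\<eta> / 2) ^ (2 ^ a) \<le> (\<eta> / 2) ^ (2 ^ Suc (Suc l))" using \<eta> Suc.prems by (intro power_decreasing power_increasing) auto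
  then have "p * (\<eta> / 2) ^ (2 ^ a) \<le> p * ?h\<^sup>2" unfolding hh using p(2) by (intro mult_left_mono) auto
  then have B': "2 ^ b / real m \<le> p * ?h\<^sup>2" using B by simp
  let ?E = "\<lambda>l. EE (iid (l * m) P) (\<lambda>us. EE P (\<lambda>x. opsi n S (ph acc l us x)))"
  have "2 * (2 * ?h) * (p * (2 * ?h)) \<le> 2 * (2 * ?h) * ?E (Suc l)"
    using Suc h by (intro mult_left_mono) auto
  \<comment> \<open>With t = 2h the three terms are 8 p h^2 - 4 p h^2 - p h^2, which exceeds the
    required 2 p h^2.\<close>
  moreover have "?E (Suc (Suc l)) \<ge> 2 * (2 * ?h) * ?E (Suc l) - (2 * ?h)\<^sup>2 * p - 2 ^ b / real m"
    using level_step(2)[OF S, of "2 * ?h" "Suc l" acc] unfolding p(1) by blast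
  moreover have "2 * (2 * ?h) * (p * (2 * ?h)) - (2 * ?h)\<^sup>2 * p - p * ?h\<^sup>2 \<ge> p * (2 * ?h\<^sup>2)"
    using p(2) by (simp add: power2_eq_square)
  ultimately show ?case unfolding hh using B' by linarith
qed

text \<open>If the accepted mass exceeds \<epsilon>, \<open>levels_bound\<close> applies; otherwise
  the right side is not positive and it is enough that the correlation after a level is
  nonnegative.\<close>

lemma round_bound:
  assumes B: "2 ^ b / real m \<le> \<epsilon> * (\<eta> / 2) ^ (2 ^ a)" and \<epsilon>: "\<epsilon> > 0"
  shows "EE (iid (a * m) P) (\<lambda>us. EE P (\<lambda>x. if acc x then real_of_int (val n (reduce n a (\<lambda>k. chunk m k us) acc a (fst x))) else 0))
    \<ge> (\<eta> / 2) ^ (2 ^ a) * (EE P (\<lambda>x. of_bool (acc x)) - \<epsilon>)"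
proof -
  let ?p = "EE P (\<lambda>x. of_bool (acc x))" and ?\<beta> = "(\<eta> / 2) ^ (2 ^ a)"
  let ?L = "EE (iid (a * m) P) (\<lambda>us. EE P (\<lambda>x. if acc x then real_of_int (val n (reduce n a (\<lambda>k. chunk m k us) acc a (fst x))) else 0))"
  obtain l where l: "a = Suc l" using a by (cases a) auto
  have \<beta>: "?\<beta> > 0" using \<eta> by simp
  \<comment> \<open>After all levels the first \<open>n\<close> coordinates are zero, so every
    character is 1 and the guess has the same sign for all \<open>S\<close>. The correlated parity
    is used in the analysis only; the procedure never identifies it.\<close>
  have eq: "?L = EE (iid (Suc l * m) P) (\<lambda>us. EE P (\<lambda>x. opsi n S (ph acc (Suc l) us x)))"
    if S: "S \<subseteq> {..<n}" for S
    unfolding l[symmetric]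
  proof (intro EE_cong)
    fix us x assume u: "us \<in> set_pmf (iid (a * m) P)" "x \<in> set_pmf P"
    then have us: "set us \<subseteq> set_pmf P" by (simp add: set_iid)
    show "(if acc x then real_of_int (val n (reduce n a (\<lambda>k. chunk m k us) acc a (fst x))) else 0) = opsi n S (ph acc a us x)"
    proof (cases "reduce n a (\<lambda>k. chunk m k us) acc a (fst x)")
      case None then show ?thesis by (simp add: ph_def opsi_def)
    next
      case (Some w)
      from reduce_props[of a n "\<lambda>k. chunk m k us" "fst x" a acc w] Some
      have "\<forall>i<n. i * a < a * n \<longrightarrow> \<not> w ! i" using lenok_chunk[OF us] lenP[OF u(2)] by simp
      then have "\<not> w ! i" if "i < n" for i using that a by (simp add: mult.commute)
      then have "chr S w = 1" unfolding chr_def using S by (intro prod.neutral) auto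
      then show ?thesis using Some by (simp add: ph_def opsi_def psi_def sg_def)
    qed
  qed
  have nn: "?L \<ge> 0" unfolding eq[OF empty_subsetI] by (rule level_step(1)) simp
  show ?thesis
  proof (cases "?p \<ge> \<epsilon>")
    case False
    then have "?\<beta> * (?p - \<epsilon>) \<le> 0" using \<beta> by (simp add: mult_le_0_iff)
    then show ?thesis using nn by linarith
  next
    case True
    then have p: "?p > 0" using \<epsilon> by linarith
    obtain S where S: "S \<subseteq> {..<n}" "\<bar>EE P (\<lambda>x. of_bool (acc x) * psi n S (fst x))\<bar> \<ge> \<eta> * ?p"
      using weak[OF p] by blast
    have "\<epsilon> * ?\<beta> \<le> ?p * ?\<beta>" using True \<beta> by (intro mult_right_mono) auto
    then have "2 ^ b / real m \<le> ?p * ?\<beta>" using B by linarith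
    from levels_bound[OF S(1) refl p S(2) this, of l]
    have "EE (iid (Suc l * m) P) (\<lambda>us. EE P (\<lambda>x. opsi n S (ph acc (Suc l) us x))) \<ge> ?p * (2 * (\<eta> / 2) ^ (2 ^ Suc l))"
      by (simp only: l)
    then have "?L \<ge> ?p * (2 * ?\<beta>)" unfolding eq[OF S(1)] by (simp only: l[symmetric])
    moreover have "?p * (2 * ?\<beta>) \<ge> ?\<beta> * (?p - \<epsilon>)"
    proof -
      have "?p * ?\<beta> \<ge> 0" "\<epsilon> * ?\<beta> \<ge> 0" using p \<beta> \<epsilon> by simp_all
      moreover have "?p * (2 * ?\<beta>) - ?\<beta> * (?p - \<epsilon>) = ?p * ?\<beta> + \<epsilon> * ?\<beta>" by (simp add: algebra_simps)
      ultimately show ?thesis by linarith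
    qed
    ultimately show ?thesis by linarith
  qed
qed

definition chs :: "item list \<Rightarrow> nat \<Rightarrow> nat \<Rightarrow> item list" where
  "chs zs r l = chunk m (r * a + l) zs"

abbreviation mg :: "item list \<Rightarrow> nat \<Rightarrow> bool list \<Rightarrow> int" where
  "mg zs \<equiv> margin n a (chs zs)"

text \<open>Rounds read disjoint stretches of the stream, so the margins after \<open>r\<close>
  rounds are fixed by a prefix and what follows is fresh.\<close>

lemma mg_take:
  assumes "r * (a * m) \<le> length xs" shows "mg (xs @ ys) r v = mg xs r v"
proof (rule margin_cong)
  fix k l assume "k < r" "l < a"
  then have "Suc k * a \<le> r * a" by (intro mult_le_mono1) simp
  then have "Suc (k * a + l) \<le> r * a" using \<open>l < a\<close> by simp
  then have "Suc (k * a + l) * m \<le> r * a * m" by (rule mult_le_mono1)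
  then show "chs (xs @ ys) k l = chs xs k l" unfolding chs_def using assms
    by (intro chunk_append1) (simp add: mult.assoc)
qed

lemma mg_Suc:
  assumes "length xs = r * (a * m)"
  shows "mg (xs @ ys) (Suc r) v = mg xs r v +
    val n (reduce n a (\<lambda>k. chunk m k ys) (\<lambda>x. mg xs r (fst x) < int (snd x)) a v)"
proof -
  have "chs (xs @ ys) r = (\<lambda>l. chunk m l ys)"
    unfolding chs_def using assms by (intro ext chunk_append2) (simp add: mult.assoc)
  moreover have "mg (xs @ ys) r = mg xs r" using mg_take assms by auto
  ultimately show ?thesis by simp
qed

text \<open>Potential argument with the mean of max 0 (threshold - margin). A round lowers it by the
  guesses on accepted examples, which \<open>round_bound\<close> makes large, and can raise it only
  at ties between margin and threshold. A spread-out threshold keeps ties below \<alpha>; it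
  replaces the soft reweighting of other boosting schemes.\<close>

lemma rounds_bound:
  assumes B: "2 ^ b / real m \<le> \<epsilon> * (\<eta> / 2) ^ (2 ^ a)" and \<epsilon>: "\<epsilon> > 0"
    and atom: "\<And>N :: bool list \<Rightarrow> int. EE P (\<lambda>x. of_bool (int (snd x) = N (fst x))) \<le> \<alpha>"
  shows "EE (iid (R * (a * m)) P) (\<lambda>zs. EE P (\<lambda>x. real_of_int (max 0 (int (snd x) - mg zs R (fst x)))))
    + (\<Sum>r<R. (\<eta> / 2) ^ (2 ^ a) * (EE (iid (r * (a * m)) P) (\<lambda>zs. EE P (\<lambda>x. of_bool (mg zs r (fst x) < int (snd x)))) - \<epsilon>))
    \<le> EE P (\<lambda>x. real (snd x)) + real R * \<alpha>"
proof (induction R)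
  case 0
  show ?case by (simp add: EE_def)
next
  case (Suc R)
  let ?\<beta> = "(\<eta> / 2) ^ (2 ^ a)"
  let ?\<Phi> = "\<lambda>R zs. EE P (\<lambda>x. real_of_int (max 0 (int (snd x) - mg zs R (fst x))))"
  let ?p = "\<lambda>R zs. EE P (\<lambda>x. of_bool (mg zs R (fst x) < int (snd x)))"
  let ?v = "\<lambda>xs ys x. val n (reduce n a (\<lambda>k. chunk m k ys) (\<lambda>x. mg xs R (fst x) < int (snd x)) a (fst x))"
  have "EE (iid (Suc R * (a * m)) P) (?\<Phi> (Suc R)) =
    EE (iid (R * (a * m)) P) (\<lambda>xs. EE (iid (a * m) P) (\<lambda>ys. ?\<Phi> (Suc R) (xs @ ys)))"
    using EE_iid_append[OF P, of "R * (a * m)" "a * m"] by (simp add: add.commute)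
  also have "\<dots> \<le> EE (iid (R * (a * m)) P) (\<lambda>xs. ?\<Phi> R xs - ?\<beta> * (?p R xs - \<epsilon>) + \<alpha>)"
  proof (rule EE_mono)
    fix xs assume "xs \<in> set_pmf (iid (R * (a * m)) P)"
    then have len: "length xs = R * (a * m)" by (simp add: set_iid)
    have "EE (iid (a * m) P) (\<lambda>ys. ?\<Phi> (Suc R) (xs @ ys)) \<le>
      EE (iid (a * m) P) (\<lambda>ys. ?\<Phi> R xs - EE P (\<lambda>x. if mg xs R (fst x) < int (snd x) then real_of_int (?v xs ys x) else 0) + \<alpha>)"
    proof (rule EE_mono)
      fix ys :: "item list"
      have "?\<Phi> (Suc R) (xs @ ys) \<le> EE P (\<lambda>x. real_of_int (max 0 (int (snd x) - mg xs R (fst x)))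
         - (if mg xs R (fst x) < int (snd x) then real_of_int (?v xs ys x) else 0)
         + of_bool (int (snd x) = mg xs R (fst x)))"
      proof (rule EE_mono)
        fix x :: item
        have v: "?v xs ys x \<in> {-1, 0, 1}"
          by (cases "reduce n a (\<lambda>k. chunk m k ys) (\<lambda>x. mg xs R (fst x) < int (snd x)) a (fst x)") auto
        \<comment> \<open>Margins are integers and change by at most 1. Below the threshold the
          positive part moves by exactly the guess, above it stays 0, and only equality can produce
          a new unit.\<close>
        have pt: "real_of_int (max 0 (t - (N + h))) \<le> real_of_int (max 0 (t - N)) - (if N < t then real_of_int h else 0) + of_bool (t = N)"
          if "h \<in> {-1, 0, 1}" for t N h :: int
          using that by (auto simp: max_def)
        show "real_of_int (max 0 (int (snd x) - mg (xs @ ys) (Suc R) (fst x))) \<le> real_of_int (max 0 (int (snd x) - mg xs R (fst x)))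
         - (if mg xs R (fst x) < int (snd x) then real_of_int (?v xs ys x) else 0)
         + of_bool (int (snd x) = mg xs R (fst x))"
          unfolding mg_Suc[OF len] by (rule pt[OF v])
      qed
      then show "?\<Phi> (Suc R) (xs @ ys) \<le> ?\<Phi> R xs - EE P (\<lambda>x. if mg xs R (fst x) < int (snd x) then real_of_int (?v xs ys x) else 0) + \<alpha>"
        using atom[of "mg xs R"] by (simp add: EE_add EE_diff)
    qed
    also have "\<dots> = ?\<Phi> R xs - EE (iid (a * m) P) (\<lambda>ys. EE P (\<lambda>x. if mg xs R (fst x) < int (snd x) then real_of_int (?v xs ys x) else 0)) + \<alpha>"
      using P by (simp add: EE_add EE_diff EE_const)
    also have "\<dots> \<le> ?\<Phi> R xs - ?\<beta> * (?p R xs - \<epsilon>) + \<alpha>"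
      using round_bound[OF B \<epsilon>, of "\<lambda>x. mg xs R (fst x) < int (snd x)"] by simp
    finally show "EE (iid (a * m) P) (\<lambda>ys. ?\<Phi> (Suc R) (xs @ ys)) \<le> ?\<Phi> R xs - ?\<beta> * (?p R xs - \<epsilon>) + \<alpha>" .
  qed
  also have "\<dots> = EE (iid (R * (a * m)) P) (?\<Phi> R) - ?\<beta> * (EE (iid (R * (a * m)) P) (?p R) - \<epsilon>) + \<alpha>"
    using P by (simp add: EE_add EE_diff EE_const EE_mult)
  finally have "EE (iid (Suc R * (a * m)) P) (?\<Phi> (Suc R)) \<le>
    EE (iid (R * (a * m)) P) (?\<Phi> R) - ?\<beta> * (EE (iid (R * (a * m)) P) (?p R) - \<epsilon>) + \<alpha>" .
  moreover have "real (Suc R) * \<alpha> = real R * \<alpha> + \<alpha>" by (simp add: algebra_simps)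
  ultimately show ?case using Suc unfolding sum.lessThan_Suc by linarith
qed

definition ravg :: "nat \<Rightarrow> item list \<Rightarrow> real" where
  "ravg R zs = (\<Sum>r<R. EE P (\<lambda>x. of_bool (mg zs r (fst x) \<le> 0))) / real R"

lemma ravg_01: "0 \<le> ravg R zs" "ravg R zs \<le> 1"
proof -
  have "EE P (\<lambda>x. of_bool (mg zs r (fst x) \<le> 0)) \<le> 1" for r by (intro EE_le1 P) simp
  then have "(\<Sum>r<R. EE P (\<lambda>x. of_bool (mg zs r (fst x) \<le> 0))) \<le> (\<Sum>r<R. 1)" by (intro sum_mono)
  then show "ravg R zs \<le> 1" by (cases "R = 0") (auto simp: ravg_def)
  show "0 \<le> ravg R zs" unfolding ravg_def by (intro divide_nonneg_nonneg sum_nonneg EE_nonneg) auto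
qed

text \<open>The potential stays nonnegative and starts at most at \<open>H\<close>, so the accepted
  mass is small on average over the rounds. By \<open>half\<close>, a nonpositive margin is accepted
  often enough for its probability to be controlled by accepted mass.\<close>

lemma ravg_mean:
  assumes B: "2 ^ b / real m \<le> \<epsilon> * (\<eta> / 2) ^ (2 ^ a)" and \<epsilon>: "\<epsilon> > 0"
    and atom: "\<And>N :: bool list \<Rightarrow> int. EE P (\<lambda>x. of_bool (int (snd x) = N (fst x))) \<le> \<alpha>"
    and half: "\<And>N :: bool list \<Rightarrow> int. EE P (\<lambda>x. of_bool (N (fst x) \<le> 0)) \<le> 2 * EE P (\<lambda>x. of_bool (N (fst x) < int (snd x)))"
    and top: "\<And>x. x \<in> set_pmf P \<Longrightarrow> snd x \<le> H" and R: "R > 0"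
  shows "EE (iid (R * (a * m)) P) (ravg R) \<le> 2 * (\<epsilon> + (real H / real R + \<alpha>) / (\<eta> / 2) ^ (2 ^ a))"
proof -
  let ?\<beta> = "(\<eta> / 2) ^ (2 ^ a)" and ?D = "iid (R * (a * m)) P"
  let ?p = "\<lambda>r zs. EE P (\<lambda>x. of_bool (mg zs r (fst x) < int (snd x)))"
  have \<beta>: "?\<beta> > 0" using \<eta> by simp
  have "EE P (\<lambda>x. real (snd x)) \<le> real H" using top by (intro EE_le1 P) simp
  moreover have "0 \<le> EE ?D (\<lambda>zs. EE P (\<lambda>x. real_of_int (max 0 (int (snd x) - mg zs R (fst x)))))"
    by (intro EE_nonneg) auto
  ultimately have "(\<Sum>r<R. ?\<beta> * (EE (iid (r * (a * m)) P) (?p r) - \<epsilon>)) \<le> real H + real R * \<alpha>"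
    using rounds_bound[OF B \<epsilon> atom, of R] by linarith
  then have "?\<beta> * ((\<Sum>r<R. EE (iid (r * (a * m)) P) (?p r)) - real R * \<epsilon>) \<le> real H + real R * \<alpha>"
    by (simp add: sum_distrib_left[symmetric] sum_subtractf)
  then have "(\<Sum>r<R. EE (iid (r * (a * m)) P) (?p r)) - real R * \<epsilon> \<le> (real H + real R * \<alpha>) / ?\<beta>"
    using \<beta> by (simp add: pos_le_divide_eq mult.commute)
  then have s: "(\<Sum>r<R. EE (iid (r * (a * m)) P) (?p r)) \<le> real R * \<epsilon> + (real H + real R * \<alpha>) / ?\<beta>" by simp
  \<comment> \<open>The sum above has a stream of its own length for each round; a longer stream
    gives the same mean since later samples are ignored.\<close>
  have tk: "EE ?D (?p r) = EE (iid (r * (a * m)) P) (?p r)" if "r < R" for r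
  proof -
    have le: "r * (a * m) \<le> R * (a * m)" using that by (intro mult_le_mono1) simp
    have "EE ?D (?p r) = EE ?D (\<lambda>zs. ?p r (take (r * (a * m)) zs))"
    proof (rule EE_cong)
      fix zs assume "zs \<in> set_pmf ?D"
      then have "length zs = R * (a * m)" by (simp add: set_iid)
      then have "mg (take (r * (a * m)) zs @ drop (r * (a * m)) zs) r v = mg (take (r * (a * m)) zs) r v" for v
        using le by (intro mg_take) simp
      then show "?p r zs = ?p r (take (r * (a * m)) zs)" by (simp only: append_take_drop_id)
    qed
    then show ?thesis using EE_iid_take[OF P le] by simp
  qed
  have "EE ?D (ravg R) = (\<Sum>r<R. EE ?D (\<lambda>zs. EE P (\<lambda>x. of_bool (mg zs r (fst x) \<le> 0)))) / real R"
    unfolding ravg_def divide_inverse EE_mult' EE_sum ..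
  also have "\<dots> \<le> (\<Sum>r<R. 2 * EE (iid (r * (a * m)) P) (?p r)) / real R"
  proof (intro divide_right_mono sum_mono)
    fix r assume "r \<in> {..<R}"
    then have "2 * EE (iid (r * (a * m)) P) (?p r) = EE ?D (\<lambda>zs. 2 * ?p r zs)" by (simp add: tk EE_mult)
    then show "EE ?D (\<lambda>zs. EE P (\<lambda>x. of_bool (mg zs r (fst x) \<le> 0))) \<le> 2 * EE (iid (r * (a * m)) P) (?p r)"
      by (simp only:) (intro EE_mono half)
  qed simp
  also have "\<dots> = 2 * (\<Sum>r<R. EE (iid (r * (a * m)) P) (?p r)) / real R"
    by (simp add: sum_distrib_left)
  also have "\<dots> \<le> 2 * (real R * \<epsilon> + (real H + real R * \<alpha>) / ?\<beta>) / real R"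
    using s by (intro divide_right_mono mult_left_mono) auto
  also have "\<dots> = 2 * (\<epsilon> + (real H / real R + \<alpha>) / ?\<beta>)"
  proof -
    have "2 * (real R * \<epsilon> + (real H + real R * \<alpha>) / c) / real R = 2 * (\<epsilon> + (real H / real R + \<alpha>) / c)"
      if "c > 0" for c :: real using R that by (simp add: field_simps)
    from this[OF \<beta>] show ?thesis .
  qed
  finally show ?thesis .
qed

text \<open>A Chernoff bound for the sum of the average errors of independent runs.\<close>
lemma runs_tail:
  assumes \<mu>: "EE (iid M P) g \<le> \<mu>" and g: "\<And>zs. 0 \<le> g zs" "\<And>zs. g zs \<le> 1"
  shows "EE (iid (k * M) P) (\<lambda>zs. of_bool ((\<Sum>j<k. g (chunk M j zs)) > 4 * \<mu> * real k)) \<le> exp (- 2 * \<mu> * real k)"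
proof -
  have e: "EE (iid M P) (\<lambda>zs. exp (g zs)) \<le> exp (2 * \<mu>)"
  proof -
    have "exp (g zs) \<le> 1 + 2 * g zs" for zs
    proof -
      have "exp (g zs) \<le> 1 + g zs + (g zs)\<^sup>2" by (rule exp_bound) (use g in auto)
      moreover have "(g zs)\<^sup>2 \<le> g zs * 1" unfolding power2_eq_square using g by (intro mult_left_mono) auto
      ultimately show ?thesis by simp
    qed
    then have "EE (iid M P) (\<lambda>zs. exp (g zs)) \<le> EE (iid M P) (\<lambda>zs. 1 + 2 * g zs)" by (intro EE_mono)
    also have "\<dots> = 1 + 2 * EE (iid M P) g" using P by (simp add: EE_add EE_mult EE_const)
    also have "\<dots> \<le> 1 + 2 * \<mu>" using \<mu> by simp
    also have "\<dots> \<le> exp (2 * \<mu>)" by (rule exp_ge_add_one_self)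
    finally show ?thesis .
  qed
  have e0: "0 \<le> EE (iid M P) (\<lambda>zs. exp (g zs))" by (intro EE_nonneg) simp
  have "EE (iid (k * M) P) (\<lambda>zs. of_bool ((\<Sum>j<k. g (chunk M j zs)) > 4 * \<mu> * real k)) \<le>
    EE (iid (k * M) P) (\<lambda>zs. (\<Prod>j<k. exp (g (chunk M j zs))) * exp (- (4 * \<mu> * real k)))"
  proof (rule EE_mono)
    fix zs
    have "(\<Prod>j<k. exp (g (chunk M j zs))) * exp (- (4 * \<mu> * real k)) = exp ((\<Sum>j<k. g (chunk M j zs)) - 4 * \<mu> * real k)"
      by (simp add: exp_sum[symmetric] exp_add[symmetric] exp_diff exp_minus divide_inverse)
    moreover have "of_bool (s > c) \<le> exp (s - c)" for s c :: real
      using one_le_exp_iff[of "s - c"] by (cases "s > c") auto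
    ultimately show "of_bool ((\<Sum>j<k. g (chunk M j zs)) > 4 * \<mu> * real k) \<le> (\<Prod>j<k. exp (g (chunk M j zs))) * exp (- (4 * \<mu> * real k))"
      by simp
  qed
  also have "\<dots> = (EE (iid M P) (\<lambda>zs. exp (g zs))) ^ k * exp (- (4 * \<mu> * real k))"
    unfolding EE_mult' EE_iid_prod[OF P, of k M "\<lambda>zs. exp (g zs)"] ..
  also have "\<dots> \<le> exp (2 * \<mu>) ^ k * exp (- (4 * \<mu> * real k))"
    by (intro mult_right_mono power_mono e e0) auto
  also have "\<dots> = exp (- 2 * \<mu> * real k)"
    by (simp add: exp_of_nat_mult[symmetric] exp_add[symmetric] algebra_simps)
  finally show ?thesis .
qed

end

section \<open>Majority vote over rounds and runs\<close>

definition labelled :: "bool list pmf \<Rightarrow> (bool list \<Rightarrow> bool) \<Rightarrow> nat pmf \<Rightarrow> item pmf" where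
  "labelled D f \<Theta> = map_pmf (\<lambda>(x, t). (x @ [f x], t)) (pair_pmf D \<Theta>)"

text \<open>The votes for True: a negative margin under the assumed label False. There are m runs on
  disjoint stretches of the sample, each with m^2 rounds of \<open>a\<close> batches of size m.
  Voting over all rounds suits a bound that is only an average over rounds.\<close>

definition votes :: "nat \<Rightarrow> nat \<Rightarrow> nat \<Rightarrow> item list \<Rightarrow> bool list \<Rightarrow> nat" where
  "votes n a m zs x = (\<Sum>j<m. \<Sum>r<m * m.
     of_bool (margin n a (\<lambda>r l. chunk m (r * a + l) (chunk (m * m * (a * m)) j zs)) r (x @ [False]) < 0))"

definition predict :: "nat \<Rightarrow> nat \<Rightarrow> nat \<Rightarrow> item list \<Rightarrow> bool list \<Rightarrow> bool" where
  "predict n a m zs x \<longleftrightarrow> m * (m * m) < 2 * votes n a m zs x"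

lemma EE_labelled:
  "fin D \<Longrightarrow> fin \<Theta> \<Longrightarrow> EE (labelled D f \<Theta>) g = EE D (\<lambda>x. EE \<Theta> (\<lambda>t. g (x @ [f x], t)))"
  by (simp add: labelled_def EE_map EE_pair)

lemma EE_cond:
  assumes "fin P" "set_pmf P \<inter> A \<noteq> {}"
  shows "EE (cond_pmf P A) g = EE P (\<lambda>x. of_bool (x \<in> A) * g x) / EE P (\<lambda>x. of_bool (x \<in> A))"
proof -
  have "EE (cond_pmf P A) g = (\<Sum>x\<in>set_pmf P. (if x \<in> A then pmf P x / measure P A else 0) * g x)"
    unfolding EE_def set_cond_pmf[OF assms(2)] pmf_cond[OF assms(2)]
    by (rule sum.mono_neutral_left) (use assms(1) in auto)
  also have "\<dots> = (\<Sum>x\<in>set_pmf P. pmf P x * (of_bool (x \<in> A) * g x) / measure P A)"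
    by (rule sum.cong) auto
  finally show ?thesis using assms(1) by (simp add: EE_prob sum_divide_distrib EE_def[of P "\<lambda>x. of_bool (x \<in> A) * g x"])
qed

lemma chr_append: "S \<subseteq> {..<length x} \<Longrightarrow> chr S (x @ ys) = chr S x"
  unfolding chr_def by (rule prod.cong) (auto simp: nth_append)

text \<open>Accepted examples, with label and threshold removed, follow some distribution on points,
  and \<open>parity_correlation\<close> holds for any. Dividing by the accepted mass translates back
  from the conditional distribution.\<close>

lemma weak_parity:
  assumes f: "f \<in> formula_xor n s" and D: "set_pmf D \<subseteq> {x. length x = n}" and K: "12 * sqrt s \<le> real K"
    and P: "fin P" "\<And>y. y \<in> set_pmf P \<Longrightarrow> \<exists>x t. y = (x @ [f x], t) \<and> length x = n"
    and p: "EE P (\<lambda>x. of_bool (acc x)) > 0"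
  shows "\<exists>S\<subseteq>{..<n}. \<bar>EE P (\<lambda>x. of_bool (acc x) * psi n S (fst x))\<bar> \<ge>
     1 / (16 * (2 * s + 1) ^ K) * EE P (\<lambda>x. of_bool (acc x))"
proof -
  let ?p = "EE P (\<lambda>x. of_bool (acc x))" and ?A = "{x. acc x}"
  have ne: "set_pmf P \<inter> ?A \<noteq> {}"
  proof
    assume "set_pmf P \<inter> ?A = {}"
    then have "?p = EE P (\<lambda>x. 0)" by (intro EE_cong) auto
    then show False using p by (simp add: EE_def)
  qed
  define D' where "D' = map_pmf (\<lambda>y. butlast (fst y)) (cond_pmf P ?A)"
  have fc: "fin (cond_pmf P ?A)" using P(1) set_cond_pmf[OF ne] by simp
  have "set_pmf D' \<subseteq> {x. length x = n}"
    using P(2) set_cond_pmf[OF ne] by (fastforce simp: D'_def)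
  from parity_correlation[OF f this K] obtain S where S: "S \<subseteq> {..<n}"
    "1 / (16 * (2 * s + 1) ^ K) \<le> \<bar>measure_pmf.expectation D' (\<lambda>x. sg (f x) * chr S x)\<bar>" by blast
  have "measure_pmf.expectation D' (\<lambda>x. sg (f x) * chr S x) = EE D' (\<lambda>x. sg (f x) * chr S x)"
    using fc by (intro EE_eq) (simp add: D'_def)
  also have "\<dots> = EE (cond_pmf P ?A) (\<lambda>y. sg (f (butlast (fst y))) * chr S (butlast (fst y)))"
    using fc by (simp add: D'_def EE_map)
  also have "\<dots> = EE (cond_pmf P ?A) (\<lambda>y. psi n S (fst y))"
  proof (rule EE_cong)
    fix y assume "y \<in> set_pmf (cond_pmf P ?A)"
    then obtain x t where "y = (x @ [f x], t)" "length x = n" using P(2) set_cond_pmf[OF ne] by blast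
    then show "sg (f (butlast (fst y))) * chr S (butlast (fst y)) = psi n S (fst y)"
      using S(1) chr_append[of S x "[f x]"] by (simp add: psi_def nth_append)
  qed
  also have "\<dots> = EE P (\<lambda>x. of_bool (acc x) * psi n S (fst x)) / ?p"
    using EE_cond[OF P(1) ne] by simp
  finally have "1 / (16 * (2 * s + 1) ^ K) \<le> \<bar>EE P (\<lambda>x. of_bool (acc x) * psi n S (fst x)) / ?p\<bar>" using S(2) by simp
  then have "1 / (16 * (2 * s + 1) ^ K) * ?p \<le> \<bar>EE P (\<lambda>x. of_bool (acc x) * psi n S (fst x))\<bar>"
    using p unfolding abs_divide by (simp only: abs_of_pos pos_le_divide_eq)
  then show ?thesis using S(1) by blast
qed

text \<open>\<open>ravg_mean\<close> bounds the mean error of a run by \<mu>, the tail bound makes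
  the mean over the runs at most 4 \<mu> outside a rare event, and passing to the majority costs
  another factor 2.\<close>

theorem learner_correct:
  assumes f: "f \<in> formula_xor n s" and D: "set_pmf D \<subseteq> {x. length x = n}" and K: "12 * sqrt s \<le> real K"
    and m: "m > 0" and a: "a > 0" and b: "\<And>l. card (block n a l) \<le> b"
    and \<eta>: "\<eta> = 1 / (16 * (2 * s + 1) ^ K)"
    and \<Theta>: "set_pmf \<Theta> \<subseteq> {..H}" "\<And>k. pmf \<Theta> k \<le> \<alpha>" "pmf \<Theta> 0 \<le> 1/2"
    and \<epsilon>: "\<epsilon> > 0" and B: "2 ^ b / real m \<le> \<epsilon> * (\<eta> / 2) ^ (2 ^ a)"
    and \<mu>: "2 * (\<epsilon> + (real H / real (m * m) + \<alpha>) / (\<eta> / 2) ^ (2 ^ a)) \<le> \<mu>"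
  shows "measure_pmf.prob (iid (m * (m * m * (a * m))) (labelled D f \<Theta>))
     {zs. measure_pmf.prob D {x. predict n a m zs x \<noteq> f x} \<le> 8 * \<mu>} \<ge> 1 - exp (- 2 * \<mu> * real m)"
proof -
  define P where "P = labelled D f \<Theta>"
  define R where "R = m * m"
  define M where "M = R * (a * m)"
  have finD: "fin D" using D finite_lists_length_eq[of "UNIV :: bool set" n] by (auto intro: finite_subset)
  have fin\<Theta>: "fin \<Theta>" using \<Theta>(1) finite_subset by blast
  have finP: "fin P" using finD fin\<Theta> by (simp add: P_def labelled_def)
  have PP: "\<exists>x t. y = (x @ [f x], t) \<and> length x = n \<and> t \<le> H" if "y \<in> set_pmf P" for y
    using that D \<Theta>(1) by (auto simp: P_def labelled_def)
  have s: "s \<ge> 0" using f by (auto simp: formula_xor_def intro: order_trans[OF of_nat_0_le_iff])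
  have one: "(2 * s + 1) ^ K \<ge> 1" using s by (intro one_le_power) simp
  interpret sampler n a m P b \<eta>
  proof
    show "fin P" by (rule finP)
    show "length (fst x) = Suc n" if "x \<in> set_pmf P" for x using PP[OF that] by auto
    show "m > 0" "a > 0" "card (block n a l) \<le> b" for l by fact+
    show "0 < \<eta>" "\<eta> \<le> 1" using one by (simp_all add: \<eta>)
    show "\<exists>S\<subseteq>{..<n}. \<bar>EE P (\<lambda>x. of_bool (acc x) * psi n S (fst x))\<bar> \<ge> \<eta> * EE P (\<lambda>x. of_bool (acc x))"
      if "EE P (\<lambda>x. of_bool (acc x)) > 0" for acc
      unfolding \<eta> by (rule weak_parity[OF f D K finP _ that]) (use PP in blast)
  qed
  \<comment> \<open>For a fixed point the margin is a fixed integer, while the threshold is drawn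
    independently of the point.\<close>
  have atom: "EE P (\<lambda>x. of_bool (int (snd x) = N (fst x))) \<le> \<alpha>" for N :: "bool list \<Rightarrow> int"
    unfolding P_def EE_labelled[OF finD fin\<Theta>]
  proof (rule EE_le1[OF finD])
    fix x
    let ?c = "N (x @ [f x])"
    have "EE \<Theta> (\<lambda>t. of_bool (int t = ?c)) = measure_pmf.prob \<Theta> {t. int t = ?c}"
      by (simp add: EE_prob[OF fin\<Theta>])
    also have "\<dots> \<le> measure_pmf.prob \<Theta> {nat ?c}" by (rule measure_pmf.finite_measure_mono) auto
    also have "\<dots> \<le> \<alpha>" using \<Theta>(2) by (simp add: measure_pmf_single)
    finally show "EE \<Theta> (\<lambda>t. of_bool (int (snd (x @ [f x], t)) = N (fst (x @ [f x], t)))) \<le> \<alpha>" by simp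
  qed
  \<comment> \<open>A nonpositive margin lies below every positive threshold, and the threshold is
    positive with probability at least 1/2.\<close>
  have half: "EE P (\<lambda>x. of_bool (N (fst x) \<le> 0)) \<le> 2 * EE P (\<lambda>x. of_bool (N (fst x) < int (snd x)))"
    for N :: "bool list \<Rightarrow> int"
    unfolding EE_mult[symmetric] unfolding P_def EE_labelled[OF finD fin\<Theta>]
  proof (rule EE_mono)
    fix x
    let ?c = "N (x @ [f x])"
    have "(if ?c \<le> 0 then 1 else 0) \<le> 2 * EE \<Theta> (\<lambda>t. of_bool (?c < int t))"
    proof (cases "?c \<le> 0")
      case True
      have "1 - pmf \<Theta> 0 = EE \<Theta> (\<lambda>t. 1 - of_bool (t \<in> {0}))"
        using fin\<Theta> by (simp only: EE_diff EE_const EE_prob[symmetric] measure_pmf_single)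
      also have "\<dots> \<le> EE \<Theta> (\<lambda>t. of_bool (?c < int t))" using True by (intro EE_mono) auto
      finally show ?thesis using True \<Theta>(3) by simp
    next
      case False
      have "0 \<le> EE \<Theta> (\<lambda>t. of_bool (?c < int t))" by (intro EE_nonneg) simp
      then show ?thesis using False by simp
    qed
    then show "EE \<Theta> (\<lambda>t. of_bool (N (fst (x @ [f x], t)) \<le> 0)) \<le> EE \<Theta> (\<lambda>t. 2 * of_bool (N (fst (x @ [f x], t)) < int (snd (x @ [f x], t))))"
      using fin\<Theta> by (cases "?c \<le> 0") (simp_all add: EE_const EE_mult)
  qed
  have "EE (iid (R * (a * m)) P) (ravg R) \<le> 2 * (\<epsilon> + (real H / real R + \<alpha>) / (\<eta> / 2) ^ (2 ^ a))"
  proof (rule ravg_mean[OF B \<epsilon> atom half])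
    show "snd x \<le> H" if "x \<in> set_pmf P" for x using PP[OF that] by auto
  qed (use m in \<open>simp add: R_def\<close>)
  then have mean: "EE (iid M P) (ravg R) \<le> \<mu>" using \<mu> unfolding M_def R_def by linarith
  have tail: "EE (iid (m * M) P) (\<lambda>zs. of_bool ((\<Sum>j<m. ravg R (chunk M j zs)) > 4 * \<mu> * real m)) \<le> exp (- 2 * \<mu> * real m)"
    by (rule runs_tail[OF mean]) (rule ravg_01)+
  \<comment> \<open>A wrong majority means that at least half of the m * R margins at the true label
    are nonpositive; this is Markov's inequality for the number of such margins.\<close>
  have err: "real m * measure_pmf.prob D {x. predict n a m zs x \<noteq> f x} \<le> 2 * (\<Sum>j<m. ravg R (chunk M j zs))"
    if zs: "zs \<in> set_pmf (iid (m * M) P)" for zs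
  proof -
    let ?w = "\<lambda>x. \<Sum>j<m. \<Sum>r<R. of_bool (mg (chunk M j zs) r (x @ [f x]) \<le> 0) :: real"
    have lab: "mg (chunk M j zs) r (x @ [True]) = - mg (chunk M j zs) r (x @ [False])" if "length x = n" for x j r
    proof (rule margin_label[OF that])
      fix k l show "lenok n (chs (chunk M j zs) k l)"
        unfolding chs_def using zs set_chunk[of M j zs] by (intro lenok_chunk) (auto simp: set_iid)
    qed
    have vt: "real (votes n a m zs x) = (\<Sum>j<m. \<Sum>r<R. of_bool (mg (chunk M j zs) r (x @ [False]) < 0))" for x
      by (simp add: votes_def R_def M_def chs_def[abs_def])
    have cnt: "(\<Sum>j<m. \<Sum>r<R. (1::real)) = real m * real R" by simp
    have pt: "real m * real R * of_bool (predict n a m zs x \<noteq> f x) \<le> 2 * ?w x" if "x \<in> set_pmf D" for x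
    proof -
      have x: "length x = n" using that D by auto
      consider "predict n a m zs x = f x" | "f x" "\<not> predict n a m zs x" | "\<not> f x" "predict n a m zs x" by blast
      then show ?thesis
      proof cases
        case 1
        have "?w x \<ge> 0" by (intro sum_nonneg) simp
        then show ?thesis using 1 by simp
      next
        case 2
        have "?w x = (\<Sum>j<m. \<Sum>r<R. 1 - of_bool (mg (chunk M j zs) r (x @ [False]) < 0))"
          using 2 lab[OF x] by (intro sum.cong refl) auto
        also have "\<dots> = real m * real R - real (votes n a m zs x)" by (simp only: sum_subtractf cnt vt)
        finally have "?w x = real m * real R - real (votes n a m zs x)" .
        moreover have "real (2 * votes n a m zs x) \<le> real (m * (m * m))" using 2 by (simp only: predict_def not_less of_nat_le_iff)
        ultimately show ?thesis using 2 by (simp add: R_def)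
      next
        case 3
        have "real (votes n a m zs x) \<le> ?w x" unfolding vt using 3 by (intro sum_mono) auto
        moreover have "real (m * (m * m)) < real (2 * votes n a m zs x)" using 3 by (simp only: predict_def of_nat_less_iff)
        ultimately show ?thesis using 3 by (simp add: R_def)
      qed
    qed
    have "real m * real R * measure_pmf.prob D {x. predict n a m zs x \<noteq> f x} =
       EE D (\<lambda>x. real m * real R * of_bool (predict n a m zs x \<noteq> f x))"
      by (simp add: EE_prob[OF finD] EE_mult)
    also have "\<dots> \<le> EE D (\<lambda>x. 2 * ?w x)" by (intro EE_mono pt)
    also have "\<dots> = 2 * (\<Sum>j<m. \<Sum>r<R. EE P (\<lambda>x. of_bool (mg (chunk M j zs) r (fst x) \<le> 0)))"
      by (simp only: EE_mult EE_sum P_def EE_labelled[OF finD fin\<Theta>] fst_conv EE_const[OF fin\<Theta>])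
    also have "\<dots> = real R * (2 * (\<Sum>j<m. ravg R (chunk M j zs)))"
    proof -
      have "real R > 0" using m by (simp add: R_def)
      then have "(\<Sum>r<R. EE P (\<lambda>x. of_bool (mg z r (fst x) \<le> 0))) = real R * ravg R z" for z
        by (simp only: ravg_def) simp
      then show ?thesis by (simp only: sum_distrib_left[symmetric] mult.left_commute)
    qed
    finally have "real R * (real m * measure_pmf.prob D {x. predict n a m zs x \<noteq> f x}) \<le> real R * (2 * (\<Sum>j<m. ravg R (chunk M j zs)))"
      by (simp add: mult_ac)
    then show ?thesis by (rule mult_left_le_imp_le) (use m in \<open>simp add: R_def\<close>)
  qed
  let ?Good = "{zs. measure_pmf.prob D {x. predict n a m zs x \<noteq> f x} \<le> 8 * \<mu>}"
  have "1 - exp (- 2 * \<mu> * real m) \<le> EE (iid (m * M) P) (\<lambda>zs. 1 - of_bool ((\<Sum>j<m. ravg R (chunk M j zs)) > 4 * \<mu> * real m))"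
    using tail finP by (simp add: EE_diff EE_const)
  also have "\<dots> \<le> EE (iid (m * M) P) (\<lambda>zs. of_bool (zs \<in> ?Good))"
  proof (rule EE_mono)
    fix zs assume zs: "zs \<in> set_pmf (iid (m * M) P)"
    show "1 - of_bool ((\<Sum>j<m. ravg R (chunk M j zs)) > 4 * \<mu> * real m) \<le> (of_bool (zs \<in> ?Good) :: real)"
    proof (cases "zs \<in> ?Good")
      case False
      then have "8 * \<mu> * real m < measure_pmf.prob D {x. predict n a m zs x \<noteq> f x} * real m"
        using m by (intro mult_strict_right_mono) auto
      then have "(\<Sum>j<m. ravg R (chunk M j zs)) > 4 * \<mu> * real m" using err[OF zs] by (simp add: mult.commute)
      then show ?thesis by simp
    qed simp
  qed
  also have "\<dots> = measure_pmf.prob (iid (m * M) P) ?Good" using finP by (simp add: EE_prob)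
  finally show ?thesis unfolding M_def R_def P_def .
qed

section \<open>Machines with an arbitrary finite state type\<close>

definition gstep :: "('q \<Rightarrow> sym \<Rightarrow> 'q \<times> sym \<times> move) \<Rightarrow> 'q \<Rightarrow> 'q \<times> (int \<Rightarrow> sym) \<times> int \<Rightarrow> 'q \<times> (int \<Rightarrow> sym) \<times> int" where
  "gstep \<delta> h c = (case c of (q, t, p) \<Rightarrow>
     if q = h then c else (case \<delta> q (t p) of (q', s, m) \<Rightarrow> (q', t(p := s), p + mv m)))"

text \<open>Number the states of a finite closed set so that start and halting state receive 0 and
  1. This lets the compiler use structured states.\<close>

lemma tm_of_finite:
  assumes "finite Q" "q0 \<in> Q" "h \<in> Q" "q0 \<noteq> h" and closed: "\<And>q s. q \<in> Q \<Longrightarrow> fst (\<delta> q s) \<in> Q"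
  shows "\<exists>M f. tm_wf M \<and> (\<forall>q\<in>Q. f q = (1::nat) \<longleftrightarrow> q = h) \<and>
    (\<forall>T t p. \<exists>q\<in>Q. (gstep \<delta> h ^^ T) (q0, t, p) = (q, snd ((gstep \<delta> h ^^ T) (q0, t, p))) \<and>
       (tm_step M ^^ T) (0, t, p) = (f q, snd ((gstep \<delta> h ^^ T) (q0, t, p))))"
proof -
  define Q' where "Q' = Q - {q0, h}"
  have finQ': "finite Q'" using assms(1) by (simp add: Q'_def)
  obtain g where g: "bij_betw g Q' {0..<card Q'}" using ex_bij_betw_finite_nat[OF finQ'] by blast
  define f where "f q = (if q = q0 then 0 else if q = h then 1 else g q + 2)" for q
  have Q: "Q = insert q0 (insert h Q')" using assms by (auto simp: Q'_def)
  have nin: "q0 \<notin> Q'" "h \<notin> Q'" by (auto simp: Q'_def)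
  then have cQ: "card Q = card Q' + 2" unfolding Q using finQ' assms(4) by simp
  have inj: "inj_on f Q"
    unfolding Q using assms(4) bij_betw_imp_inj_on[OF g] nin by (auto simp: inj_on_def f_def)
  have img: "f q < card Q" if "q \<in> Q" for q
  proof -
    have "q \<in> Q' \<Longrightarrow> g q < card Q'" using bij_betwE[OF g] by auto
    moreover have "q = q0 \<or> q = h \<or> q \<in> Q'" using that unfolding Q by blast
    ultimately show ?thesis unfolding cQ by (auto simp: f_def)
  qed
  have fQ: "f ` Q = {..<card Q}"
    using inj img by (intro card_subset_eq) (simp_all add: card_image image_subset_iff)
  define M where "M = \<lparr>tm_states = card Q, tm_trans = (\<lambda>i s. case \<delta> (inv_into Q f i) s of (q', s', m) \<Rightarrow> (f q', s', m))\<rparr>"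
  have "tm_wf M"
    unfolding tm_wf_def
  proof (intro conjI allI impI)
    show "2 \<le> tm_states M" by (simp add: M_def cQ)
    fix i s assume "i < tm_states M"
    then have "i \<in> f ` Q" by (simp add: M_def fQ)
    then have "inv_into Q f i \<in> Q" by (rule inv_into_into)
    then show "fst (tm_trans M i s) < tm_states M"
      using closed[of "inv_into Q f i" s] img by (auto simp: M_def split: prod.splits)
  qed
  moreover have f1: "f q = 1 \<longleftrightarrow> q = h" if "q \<in> Q" for q
    using that assms(4) by (auto simp: f_def)
  moreover have "\<exists>q\<in>Q. (gstep \<delta> h ^^ T) (q0, t, p) = (q, snd ((gstep \<delta> h ^^ T) (q0, t, p))) \<and>
       (tm_step M ^^ T) (0, t, p) = (f q, snd ((gstep \<delta> h ^^ T) (q0, t, p)))" for T t p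
  proof (induction T)
    case 0 then show ?case using assms(2) by (auto simp: f_def)
  next
    case (Suc T)
    then obtain q t' p' where q: "q \<in> Q" "(gstep \<delta> h ^^ T) (q0, t, p) = (q, t', p')"
      "(tm_step M ^^ T) (0, t, p) = (f q, t', p')" by (metis prod.collapse)
    obtain q' s' m where d: "\<delta> q (t' p') = (q', s', m)" by (cases "\<delta> q (t' p')")
    then have Q': "q' \<in> Q" using closed[OF q(1), of "t' p'"] by simp
    have tr: "tm_trans M (f q) (t' p') = (f q', s', m)"
      using d by (simp add: M_def inv_into_f_f[OF inj q(1)])
    define c where "c = (if q = h then (t', p') else (t'(p' := s'), p' + mv m))"
    define r where "r = (if q = h then h else q')"
    have "gstep \<delta> h (q, t', p') = (r, c)" by (simp add: gstep_def d c_def r_def)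
    then have 1: "(gstep \<delta> h ^^ Suc T) (q0, t, p) = (r, c)" by (simp add: q(2))
    have "tm_step M (f q, t', p') = (f r, c)" using f1[OF q(1)] by (auto simp: tm_step_def tr c_def r_def)
    then have 2: "(tm_step M ^^ Suc T) (0, t, p) = (f r, c)" by (simp add: q(3))
    have "r \<in> Q" using Q' assms(3) by (simp add: r_def)
    then show ?case unfolding 1 2 by auto
  qed
  ultimately show ?thesis by blast
qed

section \<open>A register language and its compilation to one tape\<close>

text \<open>Registers hold numbers up to the input length N and serve as counters and as pointers
  into an array of N work bits. Increment saturates at N, and writing or testing through a register
  equal to N has no effect or fails.\<close>

datatype op = Inc nat | Zer nat | Top nat | Wr nat bool | TEq nat nat | TAtt nat nat
datatype com = Do op | Seq com com | Cond op com com | Loop op com | Halt bool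

type_synonym store = "(nat \<Rightarrow> nat) \<times> (nat \<Rightarrow> bool)"

definition att :: "(nat \<Rightarrow> sym) \<Rightarrow> (nat \<Rightarrow> bool) \<Rightarrow> nat \<Rightarrow> nat \<Rightarrow> bool" where
  "att inp A j i = (if j = 0 then A i else if j = 1 then inp i = One else inp i = Sep)"

fun osem :: "nat \<Rightarrow> (nat \<Rightarrow> sym) \<Rightarrow> op \<Rightarrow> store \<Rightarrow> store \<times> bool" where
  "osem N inp (Inc h) (v, A) = ((v(h := min N (Suc (v h))), A), False)"
| "osem N inp (Zer h) (v, A) = ((v(h := 0), A), False)"
| "osem N inp (Top h) (v, A) = ((v(h := N), A), False)"
| "osem N inp (Wr h c) (v, A) = ((v, if v h < N then A(v h := c) else A), False)"
| "osem N inp (TEq i j) (v, A) = ((v, A), v i = v j)"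
| "osem N inp (TAtt h j) (v, A) = ((v, A), v h < N \<and> att inp A j (v h))"

text \<open>The comparison needs i < j because a single pass meets the pebble of \<open>i\<close>
  before that of \<open>j\<close> in each block and carries it in its one-bit flag.\<close>

fun okop :: "nat \<Rightarrow> op \<Rightarrow> bool" where
  "okop K (Inc h) = (h < K)"
| "okop K (Zer h) = (h < K)"
| "okop K (Top h) = (h < K)"
| "okop K (Wr h c) = (h < K)"
| "okop K (TEq i j) = (i < j \<and> j < K)"
| "okop K (TAtt h j) = (h < K \<and> j < 3)"

fun istest :: "op \<Rightarrow> bool" where
  "istest (TEq i j) = True"
| "istest (TAtt h j) = True"
| "istest _ = False"

fun okcom :: "nat \<Rightarrow> com \<Rightarrow> bool" where
  "okcom K (Do p) = okop K p"
| "okcom K (Seq a b) = (okcom K a \<and> okcom K b)"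
| "okcom K (Cond p a b) = (istest p \<and> okop K p \<and> okcom K a \<and> okcom K b)"
| "okcom K (Loop p a) = (istest p \<and> okop K p \<and> okcom K a)"
| "okcom K (Halt b) = True"

text \<open>The last component of the cost counts primitive sweeps; \<open>Loop p c\<close> repeats \<open>c\<close> until the test \<open>p\<close> succeeds.\<close>
inductive bs :: "nat \<Rightarrow> (nat \<Rightarrow> sym) \<Rightarrow> com \<Rightarrow> store \<Rightarrow> nat \<Rightarrow> store \<Rightarrow> bool" for N inp where
  bs_Do: "bs N inp (Do p) s 1 (fst (osem N inp p s))"
| bs_Seq: "bs N inp a s t s' \<Longrightarrow> bs N inp b s' t' s'' \<Longrightarrow> bs N inp (Seq a b) s (Suc (t + t')) s''"
| bs_CondT: "snd (osem N inp p s) \<Longrightarrow> bs N inp a (fst (osem N inp p s)) t s' \<Longrightarrow> bs N inp (Cond p a b) s (Suc t) s'"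
| bs_CondF: "\<not> snd (osem N inp p s) \<Longrightarrow> bs N inp b (fst (osem N inp p s)) t s' \<Longrightarrow> bs N inp (Cond p a b) s (Suc t) s'"
| bs_LoopT: "snd (osem N inp p s) \<Longrightarrow> bs N inp (Loop p a) s 1 (fst (osem N inp p s))"
| bs_LoopF: "\<not> snd (osem N inp p s) \<Longrightarrow> bs N inp a (fst (osem N inp p s)) t s' \<Longrightarrow>
    bs N inp (Loop p a) s' t' s'' \<Longrightarrow> bs N inp (Loop p a) s (Suc (t + t')) s''"

text \<open>Each input cell becomes a block of \<open>K + 3\<close> bits: one pebble bit per register, the work bit, and two
  bits telling whether the input symbol is \<open>One\<close> or \<open>Sep\<close>. A primitive operation is a single left-to-right
  pass of a Mealy machine with two bits of memory (a flag and the test result).\<close>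
fun mealy :: "nat \<Rightarrow> op \<Rightarrow> nat \<Rightarrow> bool \<times> bool \<Rightarrow> bool \<Rightarrow> (bool \<times> bool) \<times> bool" where
  "mealy K (Inc h) r (f, z) b = (if r = h then ((b, z), f) else ((f, z), b))"
| "mealy K (Zer h) r (f, z) b = (if r = h then ((False, z), f) else ((f, z), b))"
| "mealy K (Top h) r (f, z) b = (if r = h then ((f, z), False) else ((f, z), b))"
| "mealy K (Wr h c) r (f, z) b = (if r = h then ((b, z), b) else if r = K \<and> f then ((f, z), c) else ((f, z), b))"
| "mealy K (TEq i j) r (f, z) b = (if r = i then ((b, z), b) else if r = j then ((f, z \<and> f = b), b) else ((f, z), b))"
| "mealy K (TAtt h j) r (f, z) b = (if r = h then ((b, z), b) else if r = K + j then ((f, z \<or> f \<and> b), b) else ((f, z), b))"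

fun mealy0 :: "op \<Rightarrow> bool \<times> bool" where
  "mealy0 (Zer h) = (True, False)"
| "mealy0 (TEq i j) = (False, True)"
| "mealy0 _ = (False, False)"

fun mst :: "nat \<Rightarrow> op \<Rightarrow> (nat \<Rightarrow> bool) \<Rightarrow> nat \<Rightarrow> bool \<times> bool" where
  "mst K p \<beta> 0 = mealy0 p"
| "mst K p \<beta> (Suc k) = fst (mealy K p (k mod (K + 3)) (mst K p \<beta> k) (\<beta> k))"

definition mout :: "nat \<Rightarrow> op \<Rightarrow> (nat \<Rightarrow> bool) \<Rightarrow> nat \<Rightarrow> bool" where
  "mout K p \<beta> k = snd (mealy K p (k mod (K + 3)) (mst K p \<beta> k) (\<beta> k))"

fun bitat :: "nat \<Rightarrow> (nat \<Rightarrow> sym) \<Rightarrow> store \<Rightarrow> nat \<Rightarrow> nat \<Rightarrow> bool" where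
  "bitat K inp (v, A) i r = (if r < K then v r = i else att inp A (r - K) i)"

definition bits :: "nat \<Rightarrow> (nat \<Rightarrow> sym) \<Rightarrow> store \<Rightarrow> nat \<Rightarrow> bool" where
  "bits K inp s k = bitat K inp s (k div (K + 3)) (k mod (K + 3))"

text \<open>Value N is allowed: such a register has its pebble in none of the N blocks. Hence
  \<open>Top\<close> simply erases the pebble, and an increment past the last block drops
  it.\<close>

definition okst :: "nat \<Rightarrow> nat \<Rightarrow> store \<Rightarrow> bool" where
  "okst K N s = (\<forall>h<K. fst s h \<le> N)"

lemma okst_osem: "okst K N s \<Longrightarrow> okst K N (fst (osem N inp p s))"
  by (cases s; cases p) (auto simp: okst_def)

text \<open>The flag delays the pebble bit by one block: up to register \<open>h\<close> it
  remembers the previous block, afterwards the current one. Here k mod (K + 3) is the position in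
  the block and k div (K + 3) the block.\<close>

lemma sweep_Inc:
  assumes \<beta>: "\<And>k. \<beta> k = bitat K inp (v, A) (k div (K + 3)) (k mod (K + 3))" and "h < K"
  shows "fst (mst K (Inc h) \<beta> k) =
    (if k mod (K + 3) \<le> h then Suc (v h) = k div (K + 3) else v h = k div (K + 3))"
proof (induction k)
  case (Suc k)
  obtain f z where m: "mst K (Inc h) \<beta> k = (f, z)" by fastforce
  then show ?case using Suc assms(2-) \<beta>[of k] by (auto simp: mod_Suc div_Suc)
qed simp

lemma sweep_Zer:
  assumes "h < K"
  shows "fst (mst K (Zer h) \<beta> k) = (k mod (K + 3) \<le> h \<and> k div (K + 3) = 0)"
proof (induction k)
  case (Suc k)
  obtain f z where m: "mst K (Zer h) \<beta> k = (f, z)" by fastforce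
  then show ?case using Suc assms by (auto simp: mod_Suc div_Suc)
qed simp

lemma sweep_Wr:
  assumes \<beta>: "\<And>k. \<beta> k = bitat K inp (v, A) (k div (K + 3)) (k mod (K + 3))" and "h < K" "h < k mod (K + 3)"
  shows "fst (mst K (Wr h c) \<beta> k) = (v h = k div (K + 3))"
  using assms(3)
proof (induction k)
  case (Suc k)
  obtain f z where m: "mst K (Wr h c) \<beta> k = (f, z)" by fastforce
  then show ?case using Suc assms(2) \<beta>[of k] by (auto simp: mod_Suc div_Suc split: if_splits)
qed simp

text \<open>The result stays True while no block seen so far holds exactly one of the two pebbles;
  two absent pebbles count as equal, which is right since both registers then equal N.\<close>

lemma sweep_TEq:
  assumes \<beta>: "\<And>k. \<beta> k = bitat K inp (v, A) (k div (K + 3)) (k mod (K + 3))" and "i < j" "j < K"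
  shows "(i < k mod (K + 3) \<longrightarrow> fst (mst K (TEq i j) \<beta> k) = (v i = k div (K + 3))) \<and>
    snd (mst K (TEq i j) \<beta> k) =
      (\<forall>l < (if j < k mod (K + 3) then Suc (k div (K + 3)) else k div (K + 3)). (v i = l) = (v j = l))"
proof (induction k)
  case (Suc k)
  obtain f z where m: "mst K (TEq i j) \<beta> k = (f, z)" by fastforce
  then show ?case using Suc assms(2-) \<beta>[of k]
    by (auto simp: mod_Suc div_Suc less_Suc_eq split: if_splits)
qed simp

lemma sweep_TAtt:
  assumes \<beta>: "\<And>k. \<beta> k = bitat K inp (v, A) (k div (K + 3)) (k mod (K + 3))" and "h < K" "j < 3"
  shows "(h < k mod (K + 3) \<longrightarrow> fst (mst K (TAtt h j) \<beta> k) = (v h = k div (K + 3))) \<and>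
    snd (mst K (TAtt h j) \<beta> k) =
      (v h < (if K + j < k mod (K + 3) then Suc (k div (K + 3)) else k div (K + 3)) \<and> att inp A j (v h))"
proof (induction k)
  case (Suc k)
  obtain f z where m: "mst K (TAtt h j) \<beta> k = (f, z)" by fastforce
  define r i where "r = k mod (K + 3)" and "i = k div (K + 3)"
  have r: "r < K + 3" by (simp add: r_def)
  have b: "r = K + j \<Longrightarrow> \<beta> k = att inp A j i" "r < K \<Longrightarrow> \<beta> k = (v r = i)"
    using \<beta>[of k] by (auto simp: r_def i_def)
  have S: "Suc k mod (K + 3) = (if r = K + 2 then 0 else Suc r)"
    "Suc k div (K + 3) = (if r = K + 2 then Suc i else i)"
    by (auto simp: r_def i_def mod_Suc div_Suc)
  have m': "mst K (TAtt h j) \<beta> (Suc k) = fst (mealy K (TAtt h j) r (f, z) (\<beta> k))"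
    by (simp add: m r_def)
  have IH: "h < r \<Longrightarrow> f = (v h = i)" "z = (v h < (if K + j < r then Suc i else i) \<and> att inp A j (v h))"
    using Suc m by (auto simp: r_def i_def)
  consider "r < h" | "r = h" | "h < r" "r < K + j" | "r = K + j" | "K + j < r" by linarith
  then show ?case
  proof cases
    case 4
    have "f = (v h = i)" using IH(1) 4 assms(2) by auto
    then show ?thesis using 4 assms(2-) r b IH(2) unfolding S m' by (auto simp: less_Suc_eq)
  next
    case 5
    have "f = (v h = i)" using IH(1) 5 assms(2) by auto
    then show ?thesis using 5 assms(2-) r IH(2) unfolding S m' by (auto simp: less_Suc_eq)
  qed (unfold S m', insert assms(2-) r b IH, auto)
qed simp

lemma sweep_out:
  assumes ok: "okop K p" "okst K N s" and k: "k < N * (K + 3)"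
  shows "mout K p (bits K inp s) k = bits K inp (fst (osem N inp p s)) k"
proof -
  obtain v A where s: "s = (v, A)" by (cases s)
  obtain f z where m: "mst K p (bits K inp s) k = (f, z)" by fastforce
  have \<beta>: "bits K inp s k = bitat K inp (v, A) (k div (K + 3)) (k mod (K + 3))" for k
    by (simp add: bits_def s)
  have iN: "k div (K + 3) < N" using k by (simp add: less_mult_imp_div_less)
  have W: "k mod (K + 3) < K + 3" by simp
  have mo: "mout K p (bits K inp s) k =
      snd (mealy K p (k mod (K + 3)) (f, z) (bitat K inp (v, A) (k div (K + 3)) (k mod (K + 3))))"
    by (simp only: mout_def m \<beta>)
  show ?thesis
  proof (cases p)
    case (Inc h)
    have "f = (if k mod (K + 3) \<le> h then Suc (v h) = k div (K + 3) else v h = k div (K + 3))"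
      using sweep_Inc[OF \<beta>, of h k] m ok Inc by simp
    then show ?thesis unfolding mo using ok iN by (auto simp: Inc s bits_def okst_def min_def)
  next
    case (Zer h)
    have "f = (k mod (K + 3) \<le> h \<and> k div (K + 3) = 0)"
      using sweep_Zer[of h K "bits K inp s" k] m ok Zer by simp
    then show ?thesis unfolding mo using ok by (auto simp: Zer s bits_def)
  next
    case (Top h)
    then show ?thesis unfolding mo using ok iN by (auto simp: s bits_def)
  next
    case (Wr h c)
    have "h < k mod (K + 3) \<Longrightarrow> f = (v h = k div (K + 3))"
      using sweep_Wr[OF \<beta>, of h k c] m ok Wr by simp
    then show ?thesis unfolding mo using ok iN by (auto simp: Wr s bits_def att_def)
  qed (unfold mo, auto simp: s bits_def)
qed

lemma sweep_res:
  assumes ok: "okop K p" "okst K N s" and t: "istest p"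
  shows "snd (mst K p (bits K inp s) (N * (K + 3))) = snd (osem N inp p s)"
proof -
  obtain v A where s: "s = (v, A)" by (cases s)
  have \<beta>: "bits K inp s k = bitat K inp (v, A) (k div (K + 3)) (k mod (K + 3))" for k
    by (simp add: bits_def s)
  have z: "(N * (K + 3)) div (K + 3) = N" "(N * (K + 3)) mod (K + 3) = 0" by simp_all
  show ?thesis
  proof (cases p)
    case (TEq i j)
    then have ij: "i < j" "j < K" and le: "v i \<le> N" "v j \<le> N" using ok by (auto simp: s okst_def)
    have "(\<forall>l<N. (v i = l) = (v j = l)) = (v i = v j)" using le by (metis le_neq_implies_less)
    then show ?thesis using sweep_TEq[OF \<beta> ij, of "N * (K + 3)"] unfolding z by (simp add: TEq s)
  next
    case (TAtt h j)
    then have hj: "h < K" "j < 3" using ok by auto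
    show ?thesis using sweep_TAtt[OF \<beta> hj, of "N * (K + 3)"] unfolding z by (simp add: TAtt s)
  qed (use t in auto)
qed

text \<open>\<open>I\<close>, \<open>Gw\<close>, \<open>Hb\<close>, \<open>J\<close> build the work
  area, \<open>F\<close> writes the answer. \<open>Dp\<close> dispatches on the list of commands
  still to be run, so the control stack lives in the state; \<open>Sw\<close> performs a pass with
  its two possible continuations, \<open>Rt\<close> walks home.\<close>

datatype st = Hlt | I0 | I1 | I2 | Gw "bool list" | Hb | J1 | J2 | J3 | F1 | F2 | F3
  | Dp "com list" | Sw op nat "bool \<times> bool" "com list" "com list" | Rt "com list"

definition bsym :: "bool \<Rightarrow> sym" where "bsym b = (if b then One else Zero)"

lemma bsym_simps [simp]: "bsym b \<noteq> Blank" "bsym b \<noteq> Sep" "(bsym b = One) = b"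
  by (auto simp: bsym_def)

text \<open>A fresh block: no pebbles, so all registers start at N, and work bit False.\<close>

definition blk :: "nat \<Rightarrow> sym \<Rightarrow> bool list" where
  "blk K \<sigma> = replicate (Suc K) False @ [\<sigma> = One, \<sigma> = Sep]"

text \<open>An input cell is blanked as a marker while its block is appended at the left end of the
  tape, then overwritten by \<open>One\<close>. So when the input is used up, the only
  \<open>Sep\<close> on the way back is the home mark at -1.\<close>

fun delta :: "nat \<Rightarrow> com \<Rightarrow> st \<Rightarrow> sym \<Rightarrow> st \<times> sym \<times> move" where
  "delta K c0 I0 s = (I1, s, MvL)"
| "delta K c0 I1 s = (I2, Sep, MvR)"
| "delta K c0 I2 s = (if s = Blank then (J1, Blank, MvL) else (Gw (blk K s), Blank, MvL))"
| "delta K c0 (Gw bl) s = (if s \<noteq> Blank then (Gw bl, s, MvL)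
     else if tl bl = [] then (Hb, bsym (hd bl), MvR) else (Gw (tl bl), bsym (hd bl), MvL))"
| "delta K c0 Hb s = (if s \<noteq> Blank then (Hb, s, MvR) else (I2, One, MvR))"
| "delta K c0 J1 s = (if s = Sep then (J2, Sep, MvR) else (J1, s, MvL))"
| "delta K c0 J2 s = (J3, Blank, MvL)"
| "delta K c0 J3 s = (Dp [c0], s, MvL)"
| "delta K c0 F1 s = (F2, s, MvR)"
| "delta K c0 F2 s = (F3, One, MvR)"
| "delta K c0 F3 s = (Hlt, Blank, MvS)"
| "delta K c0 (Dp []) s = (Hlt, s, MvS)"
| "delta K c0 (Dp (Do p # k)) s = (Sw p 0 (mealy0 p) k k, s, MvS)"
| "delta K c0 (Dp (Seq a b # k)) s = (Dp (a # b # k), s, MvS)"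
| "delta K c0 (Dp (Cond p a b # k)) s = (Sw p 0 (mealy0 p) (a # k) (b # k), s, MvS)"
| "delta K c0 (Dp (Loop p a # k)) s = (Sw p 0 (mealy0 p) k (a # Loop p a # k), s, MvS)"
| "delta K c0 (Dp (Halt b # k)) s = (if b then (F1, s, MvR) else (Hlt, s, MvS))"
| "delta K c0 (Sw p r c kT kF) s = (if s = Blank then (Rt (if snd c then kT else kF), s, MvR)
     else (case mealy K p r c (s = One) of (c', b) \<Rightarrow>
       (Sw p (if Suc r = K + 3 then 0 else Suc r) c' kT kF, bsym b, MvL)))"
| "delta K c0 (Rt k) s = (if s = Sep then (Dp k, s, MvL) else (Rt k, s, MvR))"
| "delta K c0 Hlt s = (Hlt, s, MvS)"

abbreviation gs :: "nat \<Rightarrow> com \<Rightarrow> st \<times> (int \<Rightarrow> sym) \<times> int \<Rightarrow> st \<times> (int \<Rightarrow> sym) \<times> int" where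
  "gs K c0 \<equiv> gstep (delta K c0) Hlt"

definition sweeps :: "nat \<Rightarrow> op \<Rightarrow> com list \<Rightarrow> com list \<Rightarrow> st set" where
  "sweeps K p kT kF = (\<lambda>(r, c). Sw p r c kT kF) ` ({..<K + 3} \<times> UNIV) \<union> {Rt kT, Rt kF}"

text \<open>Only these continuation lists can arise from a fixed program: a loop pushes itself back
  once and sequencing pushes its second half. Finiteness of this set makes the states
  numberable.\<close>

fun reach :: "nat \<Rightarrow> com \<Rightarrow> com list \<Rightarrow> st set" where
  "reach K (Do p) k = {Dp (Do p # k)} \<union> sweeps K p k k"
| "reach K (Seq a b) k = {Dp (Seq a b # k)} \<union> reach K a (b # k) \<union> reach K b k"
| "reach K (Cond p a b) k = {Dp (Cond p a b # k)} \<union> sweeps K p (a # k) (b # k) \<union> reach K a k \<union> reach K b k"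
| "reach K (Loop p a) k = {Dp (Loop p a # k)} \<union> sweeps K p k (a # Loop p a # k) \<union> reach K a (Loop p a # k)"
| "reach K (Halt b) k = {Dp (Halt b # k)}"

definition fixed :: "nat \<Rightarrow> st set" where
  "fixed K = {Hlt, I0, I1, I2, Hb, J1, J2, J3, F1, F2, F3} \<union>
     Gw ` {bl. set bl \<subseteq> UNIV \<and> length bl \<le> K + 3}"

lemma finite_reach: "finite (reach K c k)"
  by (induction c arbitrary: k) (auto simp: sweeps_def)

lemma finite_fixed: "finite (fixed K)"
  unfolding fixed_def using finite_lists_length_le[of "UNIV :: bool set" "K + 3"] by simp

lemma reach_start: "Dp (c # k) \<in> reach K c k"
  by (cases c) auto

lemma sweeps_closed:
  assumes "q \<in> sweeps K p kT kF"
  shows "fst (delta K c0 q s) \<in> sweeps K p kT kF \<union> {Dp kT, Dp kF}"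
proof -
  consider r c where "q = Sw p r c kT kF" "r < K + 3" | "q = Rt kT" | "q = Rt kF"
    using assms by (auto simp: sweeps_def)
  then show ?thesis
  proof cases
    case 1
    obtain c' b where "mealy K p r c (s = One) = (c', b)" by fastforce
    then show ?thesis using 1 by (auto simp: sweeps_def image_iff)
  qed (auto simp: sweeps_def)
qed

lemma sweeps_start: "Sw p 0 c kT kF \<in> sweeps K p kT kF"
  by (auto simp: sweeps_def)

lemma reach_closed:
  "q \<in> reach K c k \<Longrightarrow> fst (delta K c0 q s) \<in> reach K c k \<union> {Dp k, F1, Hlt}"
proof (induction c arbitrary: k)
  case (Do p)
  then consider "q = Dp (Do p # k)" | "q \<in> sweeps K p k k" by auto
  then show ?case using sweeps_closed[of q K p k k c0 s] sweeps_start by cases auto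
next
  case (Seq a b)
  then consider "q = Dp (Seq a b # k)" | "q \<in> reach K a (b # k)" | "q \<in> reach K b k" by auto
  then show ?case using Seq.IH(1)[of "b # k"] Seq.IH(2)[of k] reach_start[of a "b # k" K] reach_start[of b k K]
    by cases auto
next
  case (Cond p a b)
  then consider "q = Dp (Cond p a b # k)" | "q \<in> sweeps K p (a # k) (b # k)" | "q \<in> reach K a k" | "q \<in> reach K b k"
    by auto
  then show ?case using Cond.IH[of k] reach_start[of a k K] reach_start[of b k K]
      sweeps_closed[of q K p "a # k" "b # k" c0 s] sweeps_start[of p _ "a # k" "b # k" K]
    by cases auto
next
  case (Loop p a)
  then consider "q = Dp (Loop p a # k)" | "q \<in> sweeps K p k (a # Loop p a # k)" | "q \<in> reach K a (Loop p a # k)"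
    by auto
  then show ?case using Loop.IH[of "Loop p a # k"] reach_start[of a "Loop p a # k" K]
      sweeps_closed[of q K p k "a # Loop p a # k" c0 s] sweeps_start[of p _ k "a # Loop p a # k" K]
    by cases auto
next
  case (Halt b) then show ?case by auto
qed

lemma states_closed:
  assumes "q \<in> fixed K \<union> reach K c0 [] \<union> {Dp []}"
  shows "fst (delta K c0 q s) \<in> fixed K \<union> reach K c0 [] \<union> {Dp []}"
proof -
  have "fst (delta K c0 q s) \<in> fixed K \<union> {Dp [c0]}" if "q \<in> fixed K"
  proof -
    have Gw: "Gw bl \<in> fixed K \<longleftrightarrow> length bl \<le> K + 3" for bl by (auto simp: fixed_def)
    from that consider bl where "q = Gw bl" "length bl \<le> K + 3" | "q \<in> {Hlt, I0, I1, I2, Hb, J1, J2, J3, F1, F2, F3}"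
      by (auto simp: fixed_def)
    then show ?thesis
    proof cases
      case 1
      then have "fst (delta K c0 q s) \<in> {Gw bl, Gw (tl bl), Hb}" by simp
      then show ?thesis using 1 by (auto simp: Gw) (simp add: fixed_def)
    next
      case 2
      have "length (blk K s) = K + 3" by (simp add: blk_def)
      then show ?thesis using 2 Gw[of "blk K s"] by (cases "s = Blank"; cases "s = Sep") (auto simp: fixed_def)
    qed
  qed
  moreover have "fst (delta K c0 q s) \<in> reach K c0 [] \<union> {Dp [], F1, Hlt}" if "q \<in> reach K c0 []"
    using that by (rule reach_closed)
  moreover have "{F1, Hlt} \<subseteq> fixed K" by (simp add: fixed_def)
  ultimately show ?thesis using assms reach_start[of c0 "[]" K] by auto
qed


text \<open>At most \<open>n\<close> steps instead of exactly \<open>n\<close>: bounds compose by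
  addition and can be weakened at will.\<close>

definition rch :: "nat \<Rightarrow> com \<Rightarrow> nat \<Rightarrow> st \<times> (int \<Rightarrow> sym) \<times> int \<Rightarrow> st \<times> (int \<Rightarrow> sym) \<times> int \<Rightarrow> bool" where
  "rch K c0 n c c' \<longleftrightarrow> (\<exists>t\<le>n. (gs K c0 ^^ t) c = c')"

lemma rch_refl: "rch K c0 n c c"
  unfolding rch_def by (rule exI[of _ 0]) simp

lemma rch_trans: "rch K c0 n c c' \<Longrightarrow> rch K c0 m c' c'' \<Longrightarrow> rch K c0 (n + m) c c''"
  unfolding rch_def by (elim exE conjE, rule_tac x = "ta + t" in exI) (auto simp: funpow_add)

lemma rch_mono: "rch K c0 n c c' \<Longrightarrow> n \<le> m \<Longrightarrow> rch K c0 m c c'"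
  unfolding rch_def by (blast intro: le_trans)

lemma rch_funpow: "(gs K c0 ^^ n) c = c' \<Longrightarrow> rch K c0 n c c'"
  unfolding rch_def by blast

lemma gs_step:
  "q \<noteq> Hlt \<Longrightarrow> delta K c0 q x = (q', s, m) \<Longrightarrow> t p = x \<Longrightarrow> gs K c0 (q, t, p) = (q', t(p := s), p + mv m)"
  by (simp add: gstep_def)

lemma rch_step:
  assumes "q \<noteq> Hlt" "delta K c0 q x = (q', s, m)" "t p = x" "rch K c0 n (q', t(p := s), p + mv m) c"
  shows "rch K c0 (Suc n) (q, t, p) c"
proof -
  have "rch K c0 1 (q, t, p) (q', t(p := s), p + mv m)"
    by (rule rch_funpow) (simp add: gs_step[where t = t and p = p, OF assms(1-3)])
  from rch_trans[OF this assms(4)] show ?thesis by simp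
qed

lemma rch_stay:
  assumes "rch K c0 n (q', t, p) c" "q \<noteq> Hlt" "delta K c0 q (t p) = (q', t p, MvS)"
  shows "rch K c0 (Suc n) (q, t, p) c"
  using rch_step[where t = t and p = p, OF assms(2,3) refl] assms(1) by (simp add: mv_def)

lemma move_left:
  assumes "q \<noteq> Hlt" "\<And>i. i < n \<Longrightarrow> delta K c0 q (t (p - int i)) = (q, t (p - int i), MvL)"
  shows "(gs K c0 ^^ n) (q, t, p) = (q, t, p - int n)"
  using assms(2)
proof (induction n)
  case (Suc n)
  then show ?case using gs_step[where t = t and p = "p - int n", OF assms(1) Suc.prems[OF lessI] refl] by (simp add: mv_def)
qed simp

lemma move_right:
  assumes "q \<noteq> Hlt" "\<And>i. i < n \<Longrightarrow> delta K c0 q (t (p + int i)) = (q, t (p + int i), MvR)"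
  shows "(gs K c0 ^^ n) (q, t, p) = (q, t, p + int n)"
  using assms(2)
proof (induction n)
  case (Suc n)
  then show ?case using gs_step[where t = t and p = "p + int n", OF assms(1) Suc.prems[OF lessI] refl] by (simp add: mv_def)
qed simp

text \<open>Work bits run leftwards from cell -2, \<open>Sep\<close> at -1 is the home mark, and
  cell 0 is kept blank so that the output is empty until the very end.\<close>

definition tp :: "nat \<Rightarrow> (int \<Rightarrow> sym) \<Rightarrow> (nat \<Rightarrow> bool) \<Rightarrow> int \<Rightarrow> sym" where
  "tp M rest \<beta> j = (if j \<le> -2 then (if nat (-2 - j) < M then bsym (\<beta> (nat (-2 - j))) else Blank)
     else if j = -1 then Sep else if j = 0 then Blank else rest j)"

lemma tp_at: "tp M rest \<beta> (-2 - int k) = (if k < M then bsym (\<beta> k) else Blank)"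
  by (simp add: tp_def)

lemma sweep_run:
  assumes "k \<le> M"
  shows "(gs K c0 ^^ k) (Sw p 0 (mealy0 p) kT kF, tp M rest \<beta>, -2) =
    (Sw p (k mod (K + 3)) (mst K p \<beta> k) kT kF,
     tp M rest (\<lambda>i. if i < k then mout K p \<beta> i else \<beta> i), -2 - int k)"
  using assms
proof (induction k)
  case (Suc k)
  let ?t = "\<lambda>k. tp M rest (\<lambda>i. if i < k then mout K p \<beta> i else \<beta> i)"
  have at: "?t k (-2 - int k) = bsym (\<beta> k)" using Suc.prems by (simp only: tp_at) simp
  have r: "(if Suc (k mod (K + 3)) = K + 3 then 0 else Suc (k mod (K + 3))) = Suc k mod (K + 3)"
    by (simp add: mod_Suc)
  have d: "delta K c0 (Sw p (k mod (K + 3)) (mst K p \<beta> k) kT kF) (?t k (-2 - int k)) =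
    (Sw p (Suc k mod (K + 3)) (mst K p \<beta> (Suc k)) kT kF, bsym (mout K p \<beta> k), MvL)"
    unfolding at r[symmetric] by (simp add: mout_def split: prod.splits)
  have u: "(?t k)(-2 - int k := bsym (mout K p \<beta> k)) = ?t (Suc k)"
  proof
    fix j
    show "((?t k)(-2 - int k := bsym (mout K p \<beta> k))) j = ?t (Suc k) j"
    proof (cases "j \<le> -2")
      case True
      then obtain l where l: "j = -2 - int l" by (metis add.commute diff_add_cancel diff_ge_0_iff_ge zero_le_imp_eq_int minus_diff_eq diff_minus_eq_add uminus_add_conv_diff)
      then show ?thesis using Suc.prems by (simp add: tp_at less_Suc_eq)
    next
      case False
      then show ?thesis by (simp add: tp_def)
    qed
  qed
  have "(gs K c0 ^^ Suc k) (Sw p 0 (mealy0 p) kT kF, tp M rest \<beta>, -2) =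
    gs K c0 (Sw p (k mod (K + 3)) (mst K p \<beta> k) kT kF, ?t k, -2 - int k)"
    using Suc by simp
  also have "\<dots> = (Sw p (Suc k mod (K + 3)) (mst K p \<beta> (Suc k)) kT kF, ?t (Suc k), -2 - int k + mv MvL)"
    by (subst gs_step[where t = "?t k" and p = "-2 - int k", OF _ d refl]) (simp_all only: u st.distinct not_False_eq_True)
  finally show ?case by (simp add: mv_def)
qed simp

text \<open>M moves out, M moves back, and one step at each turn.\<close>

lemma sweep_full:
  "rch K c0 (2 * M + 2) (Sw p 0 (mealy0 p) kT kF, tp M rest \<beta>, -2)
    (Dp (if snd (mst K p \<beta> M) then kT else kF), tp M rest (mout K p \<beta>), -2)"
proof -
  let ?k = "if snd (mst K p \<beta> M) then kT else kF"
  let ?t = "tp M rest (mout K p \<beta>)"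
  have eq: "tp M rest (\<lambda>i. if i < M then mout K p \<beta> i else \<beta> i) = ?t"
    by (auto simp: tp_def fun_eq_iff)
  have 1: "rch K c0 M (Sw p 0 (mealy0 p) kT kF, tp M rest \<beta>, -2)
    (Sw p (M mod (K + 3)) (mst K p \<beta> M) kT kF, ?t, -2 - int M)"
    using sweep_run[of M M K c0 p kT kF rest \<beta>] unfolding eq by (intro rch_funpow) simp
  have b: "?t (-2 - int M) = Blank" by (simp only: tp_at) simp
  then have d: "delta K c0 (Sw p (M mod (K + 3)) (mst K p \<beta> M) kT kF) (?t (-2 - int M)) = (Rt ?k, ?t (-2 - int M), MvR)"
    by simp
  have "(gs K c0 ^^ M) (Rt ?k, ?t, -1 - int M) = (Rt ?k, ?t, -1 - int M + int M)"
  proof (rule move_right)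
    fix i assume "i < M"
    then have "-1 - int M + int i = -2 - int (M - 1 - i)" by simp
    then have "?t (-1 - int M + int i) = bsym (mout K p \<beta> (M - 1 - i))"
      using \<open>i < M\<close> by (simp only: tp_at) simp
    then show "delta K c0 (Rt ?k) (?t (-1 - int M + int i)) = (Rt ?k, ?t (-1 - int M + int i), MvR)"
      by simp
  qed simp
  then have mid: "(gs K c0 ^^ M) (Rt ?k, ?t, -1 - int M) = (Rt ?k, ?t, -1)" by simp
  have s: "?t (-1) = Sep" by (simp add: tp_def)
  then have "delta K c0 (Rt ?k) (?t (-1)) = (Dp ?k, ?t (-1), MvL)" by simp
  from rch_step[where t = ?t and p = "-1", OF _ this refl rch_refl] have 3: "rch K c0 1 (Rt ?k, ?t, -1) (Dp ?k, ?t, -2)"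
    by (simp add: mv_def)
  have "rch K c0 (M + 1) (Rt ?k, ?t, -1 - int M) (Dp ?k, ?t, -2)"
    by (rule rch_trans[OF rch_funpow[OF mid] 3])
  then have "rch K c0 (Suc (M + 1)) (Sw p (M mod (K + 3)) (mst K p \<beta> M) kT kF, ?t, -2 - int M) (Dp ?k, ?t, -2)"
    by (intro rch_step[where t = ?t and p = "-2 - int M", OF _ d refl]) (simp_all add: mv_def)
  from rch_trans[OF 1 this] show ?thesis by (rule rch_mono) simp
qed

lemma op_run:
  assumes "okop K p" "okst K N s"
  shows "rch K c0 (2 * (N * (K + 3)) + 2) (Sw p 0 (mealy0 p) kT kF, tp (N * (K + 3)) rest (bits K inp s), -2)
    (Dp (if snd (mst K p (bits K inp s) (N * (K + 3))) then kT else kF),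
      tp (N * (K + 3)) rest (bits K inp (fst (osem N inp p s))), -2)"
proof -
  have "tp (N * (K + 3)) rest (mout K p (bits K inp s)) = tp (N * (K + 3)) rest (bits K inp (fst (osem N inp p s)))"
    using sweep_out[OF assms] by (auto simp: tp_def fun_eq_iff)
  then show ?thesis using sweep_full[of K c0 "N * (K + 3)" p kT kF rest "bits K inp s"] by simp
qed

text \<open>A primitive operation takes at most one pass plus dispatch, 2 N (K + 3) + 3 steps;
  sequencing and branching are charged the same amount per unit of cost.\<close>

lemma bs_run:
  assumes "bs N inp c s t s'" "okcom K c" "okst K N s"
  shows "okst K N s' \<and> (\<forall>k. rch K c0 (t * (2 * (N * (K + 3)) + 3))
    (Dp (c # k), tp (N * (K + 3)) rest (bits K inp s), -2) (Dp k, tp (N * (K + 3)) rest (bits K inp s'), -2))"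
  using assms
proof (induction rule: bs.induct)
  case (bs_Do p s)
  then have "rch K c0 (2 * (N * (K + 3)) + 2) (Sw p 0 (mealy0 p) k k, tp (N * (K + 3)) rest (bits K inp s), -2)
    (Dp k, tp (N * (K + 3)) rest (bits K inp (fst (osem N inp p s))), -2)" for k
    using op_run[of K p N s c0 k k rest inp] by simp
  then have "rch K c0 (Suc (2 * (N * (K + 3)) + 2)) (Dp (Do p # k), tp (N * (K + 3)) rest (bits K inp s), -2)
    (Dp k, tp (N * (K + 3)) rest (bits K inp (fst (osem N inp p s))), -2)" for k
    by (rule rch_stay) simp_all
  then show ?case using bs_Do okst_osem by (simp add: numeral_3_eq_3)
next
  case (bs_Seq a s t s' b t' s'')
  let ?\<tau> = "2 * (N * (K + 3)) + 3" and ?T = "\<lambda>s. tp (N * (K + 3)) rest (bits K inp s)"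
  show ?case
  proof (intro conjI allI)
    show "okst K N s''" using bs_Seq by simp
    fix k
    have "rch K c0 (t * ?\<tau> + t' * ?\<tau>) (Dp (a # b # k), ?T s, -2) (Dp k, ?T s'', -2)"
      using bs_Seq by (intro rch_trans[of K c0 "t * ?\<tau>" _ "(Dp (b # k), ?T s', -2)"]) auto
    then have "rch K c0 (Suc (t * ?\<tau> + t' * ?\<tau>)) (Dp (Seq a b # k), ?T s, -2) (Dp k, ?T s'', -2)"
      by (rule rch_stay) simp_all
    then show "rch K c0 (Suc (t + t') * ?\<tau>) (Dp (Seq a b # k), ?T s, -2) (Dp k, ?T s'', -2)"
      by (rule rch_mono) (simp add: algebra_simps)
  qed
next
  case (bs_CondT p s a t s' b)
  let ?\<tau> = "2 * (N * (K + 3)) + 3" and ?T = "\<lambda>s. tp (N * (K + 3)) rest (bits K inp s)"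
  show ?case
  proof (intro conjI allI)
    show "okst K N s'" using bs_CondT okst_osem by simp
    fix k
    have res: "snd (mst K p (bits K inp s) (N * (K + 3)))"
      using sweep_res[of K p N s inp] bs_CondT by simp
    have A: "rch K c0 (2 * (N * (K + 3)) + 2) (Sw p 0 (mealy0 p) (a # k) (b # k), ?T s, -2) (Dp (a # k), ?T (fst (osem N inp p s)), -2)"
      using op_run[of K p N s c0 "a # k" "b # k" rest inp] res bs_CondT(4-) by simp
    have B: "rch K c0 (t * ?\<tau>) (Dp (a # k), ?T (fst (osem N inp p s)), -2) (Dp k, ?T s', -2)"
      using bs_CondT okst_osem by simp
    have "rch K c0 ((2 * (N * (K + 3)) + 2) + t * ?\<tau>) (Sw p 0 (mealy0 p) (a # k) (b # k), ?T s, -2) (Dp k, ?T s', -2)"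
      by (rule rch_trans[OF A B])
    then have "rch K c0 (Suc ((2 * (N * (K + 3)) + 2) + t * ?\<tau>)) (Dp (Cond p a b # k), ?T s, -2) (Dp k, ?T s', -2)"
      by (rule rch_stay) simp_all
    then show "rch K c0 (Suc t * ?\<tau>) (Dp (Cond p a b # k), ?T s, -2) (Dp k, ?T s', -2)"
      by (rule rch_mono) simp
  qed
next
  case (bs_CondF p s b t s' a)
  let ?\<tau> = "2 * (N * (K + 3)) + 3" and ?T = "\<lambda>s. tp (N * (K + 3)) rest (bits K inp s)"
  show ?case
  proof (intro conjI allI)
    show "okst K N s'" using bs_CondF okst_osem by simp
    fix k
    have res: "\<not> snd (mst K p (bits K inp s) (N * (K + 3)))"
      using sweep_res[of K p N s inp] bs_CondF by simp
    have A: "rch K c0 (2 * (N * (K + 3)) + 2) (Sw p 0 (mealy0 p) (a # k) (b # k), ?T s, -2) (Dp (b # k), ?T (fst (osem N inp p s)), -2)"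
      using op_run[of K p N s c0 "a # k" "b # k" rest inp] res bs_CondF(4-) by simp
    have B: "rch K c0 (t * ?\<tau>) (Dp (b # k), ?T (fst (osem N inp p s)), -2) (Dp k, ?T s', -2)"
      using bs_CondF okst_osem by simp
    have "rch K c0 ((2 * (N * (K + 3)) + 2) + t * ?\<tau>) (Sw p 0 (mealy0 p) (a # k) (b # k), ?T s, -2) (Dp k, ?T s', -2)"
      by (rule rch_trans[OF A B])
    then have "rch K c0 (Suc ((2 * (N * (K + 3)) + 2) + t * ?\<tau>)) (Dp (Cond p a b # k), ?T s, -2) (Dp k, ?T s', -2)"
      by (rule rch_stay) simp_all
    then show "rch K c0 (Suc t * ?\<tau>) (Dp (Cond p a b # k), ?T s, -2) (Dp k, ?T s', -2)"
      by (rule rch_mono) simp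
  qed
next
  case (bs_LoopT p s a)
  let ?\<tau> = "2 * (N * (K + 3)) + 3" and ?T = "\<lambda>s. tp (N * (K + 3)) rest (bits K inp s)"
  have res: "snd (mst K p (bits K inp s) (N * (K + 3)))"
    using sweep_res[of K p N s inp] bs_LoopT by simp
  have "rch K c0 (2 * (N * (K + 3)) + 2) (Sw p 0 (mealy0 p) k (a # Loop p a # k), ?T s, -2) (Dp k, ?T (fst (osem N inp p s)), -2)" for k
    using op_run[of K p N s c0 k "a # Loop p a # k" rest inp] res bs_LoopT by simp
  then have "rch K c0 (Suc (2 * (N * (K + 3)) + 2)) (Dp (Loop p a # k), ?T s, -2) (Dp k, ?T (fst (osem N inp p s)), -2)" for k
    by (rule rch_stay) simp_all
  then show ?case using bs_LoopT okst_osem by (simp add: numeral_3_eq_3)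
next
  case (bs_LoopF p s a t s' t' s'')
  let ?\<tau> = "2 * (N * (K + 3)) + 3" and ?T = "\<lambda>s. tp (N * (K + 3)) rest (bits K inp s)"
  show ?case
  proof (intro conjI allI)
    show "okst K N s''" using bs_LoopF okst_osem by simp
    fix k
    have res: "\<not> snd (mst K p (bits K inp s) (N * (K + 3)))"
      using sweep_res[of K p N s inp] bs_LoopF by simp
    have A: "rch K c0 (2 * (N * (K + 3)) + 2) (Sw p 0 (mealy0 p) k (a # Loop p a # k), ?T s, -2) (Dp (a # Loop p a # k), ?T (fst (osem N inp p s)), -2)"
      using op_run[of K p N s c0 k "a # Loop p a # k" rest inp] res bs_LoopF(6-) by simp
    have B: "rch K c0 (t * ?\<tau>) (Dp (a # Loop p a # k), ?T (fst (osem N inp p s)), -2) (Dp (Loop p a # k), ?T s', -2)"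
      using bs_LoopF okst_osem by simp
    have C: "rch K c0 (t' * ?\<tau>) (Dp (Loop p a # k), ?T s', -2) (Dp k, ?T s'', -2)"
      using bs_LoopF okst_osem by simp
    have "rch K c0 ((2 * (N * (K + 3)) + 2) + (t * ?\<tau> + t' * ?\<tau>)) (Sw p 0 (mealy0 p) k (a # Loop p a # k), ?T s, -2) (Dp k, ?T s'', -2)"
      by (rule rch_trans[OF A rch_trans[OF B C]])
    then have "rch K c0 (Suc ((2 * (N * (K + 3)) + 2) + (t * ?\<tau> + t' * ?\<tau>))) (Dp (Loop p a # k), ?T s, -2) (Dp k, ?T s'', -2)"
      by (rule rch_stay) simp_all
    then show "rch K c0 (Suc (t + t') * ?\<tau>) (Dp (Loop p a # k), ?T s, -2) (Dp k, ?T s'', -2)"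
      by (rule rch_mono) (simp add: algebra_simps)
  qed
qed

text \<open>The tape while copying: \<open>k\<close> bits written on the left, \<open>i\<close>
  input cells consumed, and \<open>b\<close> telling whether cell \<open>i\<close> is blanked as the
  marker.\<close>

definition tk :: "nat \<Rightarrow> nat \<Rightarrow> bool \<Rightarrow> (nat \<Rightarrow> bool) \<Rightarrow> (int \<Rightarrow> sym) \<Rightarrow> int \<Rightarrow> sym" where
  "tk k i b \<beta> t0 j = (if j \<le> -2 then (if nat (-2 - j) < k then bsym (\<beta> (nat (-2 - j))) else Blank)
     else if j = -1 then Sep else if 0 \<le> j \<and> j < int i then One
     else if j = int i \<and> b then Blank else t0 j)"

lemma int_le_m2: "j \<le> (-2::int) \<Longrightarrow> \<exists>l. j = -2 - int l"
  by (rule exI[of _ "nat (-2 - j)"]) simp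

lemma blk_nth:
  assumes "r < K + 3" shows "blk K \<sigma> ! r = (if r \<le> K then False else if r = K + 1 then \<sigma> = One else \<sigma> = Sep)"
proof -
  consider "r \<le> K" | "r = K + 1" | "r = K + 2" using assms by linarith
  then show ?thesis by cases (auto simp: blk_def nth_append simp del: replicate.simps)
qed

lemma write_block:
  fixes K :: nat and \<beta> :: "nat \<Rightarrow> bool"
  assumes j: "j \<le> K + 2" and \<beta>: "\<And>r. r < K + 3 \<Longrightarrow> \<beta> (k + r) = bl ! r" and bl: "length bl = K + 3"
  shows "(gs K c0 ^^ j) (Gw bl, tk k i b \<beta> t0, -2 - int k) = (Gw (drop j bl), tk (k + j) i b \<beta> t0, -2 - int (k + j))"
  using j
proof (induction j)
  case (Suc j)
  let ?t = "tk (k + j) i b \<beta> t0" and ?p = "-2 - int (k + j)"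
  have bk: "?t ?p = Blank" by (simp add: tk_def)
  have tl: "tl (drop j bl) = drop (Suc j) bl" by (simp add: drop_Suc tl_drop)
  have ne: "drop (Suc j) bl \<noteq> []" using Suc.prems bl by simp
  have hd: "hd (drop j bl) = \<beta> (k + j)" using Suc.prems bl \<beta>[of j] by (simp add: hd_drop_conv_nth)
  have d: "delta K c0 (Gw (drop j bl)) Blank = (Gw (drop (Suc j) bl), bsym (\<beta> (k + j)), MvL)"
    using ne by (simp add: tl hd)
  have u: "?t(?p := bsym (\<beta> (k + j))) = tk (k + Suc j) i b \<beta> t0"
  proof
    fix l show "(?t(?p := bsym (\<beta> (k + j)))) l = tk (k + Suc j) i b \<beta> t0 l"
    proof (cases "l \<le> -2")
      case True
      then obtain m where "l = -2 - int m" using int_le_m2 by blast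
      then show ?thesis by (auto simp: tk_def less_Suc_eq)
    qed (simp add: tk_def)
  qed
  have "(gs K c0 ^^ Suc j) (Gw bl, tk k i b \<beta> t0, -2 - int k) = gs K c0 (Gw (drop j bl), ?t, ?p)"
    using Suc by simp
  also have "\<dots> = (Gw (drop (Suc j) bl), tk (k + Suc j) i b \<beta> t0, ?p + mv MvL)"
    by (subst gs_step[where t = ?t and p = ?p, OF _ d bk]) (simp_all only: u st.distinct not_False_eq_True)
  finally show ?case by (simp add: mv_def)
qed simp

text \<open>The head finds the left end as the first blank beyond the written bits and finds its way
  back by the blanked cell. Both trips cross about i (K + 4) cells, whence quadratic time for the
  whole copy.\<close>

lemma copy_cell:
  fixes K :: nat
  assumes nb: "t0 (int i) \<noteq> Blank" and \<beta>: "\<And>r. r < K + 3 \<Longrightarrow> \<beta> (i * (K + 3) + r) = blk K (t0 (int i)) ! r"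
  shows "rch K c0 (2 * Suc i * (K + 5)) (I2, tk (i * (K + 3)) i False \<beta> t0, int i)
    (I2, tk (Suc i * (K + 3)) (Suc i) False \<beta> t0, int (Suc i))"
proof -
  define k where "k = i * (K + 3)"
  let ?bl = "blk K (t0 (int i))"
  have bl: "length ?bl = K + 3" by (simp add: blk_def)
  let ?T = "\<lambda>k. tk k i True \<beta> t0"
  have at: "tk k i False \<beta> t0 (int i) = t0 (int i)" by (simp add: tk_def)
  have d1: "delta K c0 I2 (t0 (int i)) = (Gw ?bl, Blank, MvL)" using nb by simp
  have u1: "(tk k i False \<beta> t0)(int i := Blank) = ?T k" by (auto simp: tk_def fun_eq_iff)
  have "(gs K c0 ^^ (Suc i + k)) (Gw ?bl, ?T k, int i - 1) = (Gw ?bl, ?T k, int i - 1 - int (Suc i + k))"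
  proof (rule move_left)
    fix l assume l: "l < Suc i + k"
    have "?T k (int i - 1 - int l) \<noteq> Blank"
    proof (cases "int i - 1 - int l \<le> -2")
      case True
      then obtain m where m: "int i - 1 - int l = -2 - int m" using int_le_m2 by blast
      then have "m < k" using l by linarith
      then show ?thesis unfolding m by (simp add: tk_def)
    qed (auto simp: tk_def)
    then show "delta K c0 (Gw ?bl) (?T k (int i - 1 - int l)) = (Gw ?bl, ?T k (int i - 1 - int l), MvL)" by simp
  qed simp
  then have r2: "rch K c0 (Suc i + k) (Gw ?bl, ?T k, int i - 1) (Gw ?bl, ?T k, -2 - int k)"
    by (intro rch_funpow) simp
  have \<beta>': "\<beta> (k + r) = ?bl ! r" if "r < K + 3" for r using \<beta>[OF that] by (simp add: k_def)
  have r3: "rch K c0 (K + 2) (Gw ?bl, ?T k, -2 - int k)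
      (Gw (drop (K + 2) ?bl), ?T (k + (K + 2)), -2 - int (k + (K + 2)))"
    by (rule rch_funpow, rule write_block[OF _ \<beta>' bl]) auto
  let ?k = "k + (K + 2)" and ?k' = "k + (K + 3)"
  have b4: "?T ?k (-2 - int ?k) = Blank" by (simp add: tk_def)
  have "length (tl (drop (K + 2) ?bl)) = 0" using bl by simp
  then have tl: "tl (drop (K + 2) ?bl) = []" unfolding length_0_conv .
  have hd: "hd (drop (K + 2) ?bl) = \<beta> ?k" using bl \<beta>'[of "K + 2"] by (simp add: hd_drop_conv_nth)
  have d4: "delta K c0 (Gw (drop (K + 2) ?bl)) Blank = (Hb, bsym (\<beta> ?k), MvR)"
    by (simp only: delta.simps tl hd) simp
  have u4: "(?T ?k)(-2 - int ?k := bsym (\<beta> ?k)) = ?T ?k'"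
  proof
    fix l show "((?T ?k)(-2 - int ?k := bsym (\<beta> ?k))) l = ?T ?k' l"
    proof (cases "l \<le> -2")
      case True
      then obtain m where m: "l = -2 - int m" using int_le_m2 by blast
      have "m < ?k' \<longleftrightarrow> m < ?k \<or> m = ?k" by auto
      then show ?thesis unfolding m by (auto simp: tk_def)
    qed (simp add: tk_def)
  qed
  have "(gs K c0 ^^ (i + ?k')) (Hb, ?T ?k', - int ?k') = (Hb, ?T ?k', - int ?k' + int (i + ?k'))"
    if "k + (K + 3) = ?k'"
  proof (rule move_right)
    fix l assume l: "l < i + ?k'"
    have "?T ?k' (- int ?k' + int l) \<noteq> Blank"
    proof (cases "- int ?k' + int l \<le> -2")
      case True
      then obtain m where m: "- int ?k' + int l = -2 - int m" using int_le_m2 by blast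
      then have "m < ?k'" by linarith
      then show ?thesis unfolding m by (simp add: tk_def)
    next
      case False
      have "- int ?k' + int l < int i" using l by linarith
      then show ?thesis using False by (simp add: tk_def)
    qed
    then show "delta K c0 Hb (?T ?k' (- int ?k' + int l)) = (Hb, ?T ?k' (- int ?k' + int l), MvR)" by simp
  qed simp
  then have r5: "rch K c0 (i + ?k') (Hb, ?T ?k', - int ?k') (Hb, ?T ?k', int i)"
    by (intro rch_funpow) simp
  have b6: "?T ?k' (int i) = Blank" by (simp add: tk_def)
  have d6: "delta K c0 Hb Blank = (I2, One, MvR)" by simp
  have u6: "(?T ?k')(int i := One) = tk ?k' (Suc i) False \<beta> t0" by (auto simp: tk_def fun_eq_iff)
  have r6: "rch K c0 (Suc 0) (Hb, ?T ?k', int i) (I2, tk ?k' (Suc i) False \<beta> t0, int (Suc i))"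
    by (rule rch_step[where t = "?T ?k'" and p = "int i", OF _ d6 b6])
      (simp_all add: u6 mv_def rch_refl add.commute)
  have r4: "rch K c0 (Suc (i + ?k' + Suc 0)) (Gw (drop (K + 2) ?bl), ?T ?k, -2 - int ?k)
     (I2, tk ?k' (Suc i) False \<beta> t0, int (Suc i))"
  proof (rule rch_step[where t = "?T ?k" and p = "-2 - int ?k", OF _ d4 b4])
    have p: "-2 - int ?k + mv MvR = - int ?k'" by (simp add: mv_def)
    show "rch K c0 (i + ?k' + Suc 0) (Hb, (?T ?k)(-2 - int ?k := bsym (\<beta> ?k)), -2 - int ?k + mv MvR)
      (I2, tk ?k' (Suc i) False \<beta> t0, int (Suc i))"
      unfolding u4 p by (rule rch_trans[OF r5 r6])
  qed simp
  have "rch K c0 (Suc (Suc i + k + (K + 2 + Suc (i + ?k' + Suc 0)))) (I2, tk k i False \<beta> t0, int i)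
     (I2, tk ?k' (Suc i) False \<beta> t0, int (Suc i))"
    by (rule rch_step[where t = "tk k i False \<beta> t0" and p = "int i", OF _ d1 at])
      (use rch_trans[OF r2 rch_trans[OF r3 r4]] in \<open>simp_all add: u1 mv_def\<close>)
  moreover have k': "?k' = Suc i * (K + 3)" by (simp add: k_def)
  ultimately have "rch K c0 (Suc (Suc i + k + (K + 2 + Suc (i + ?k' + Suc 0)))) (I2, tk k i False \<beta> t0, int i)
     (I2, tk (Suc i * (K + 3)) (Suc i) False \<beta> t0, int (Suc i))" by (simp only: k')
  then show ?thesis unfolding k_def by (rule rch_mono) (simp add: algebra_simps)
qed

lemma copy_all:
  fixes K :: nat
  assumes nb: "\<And>i. i < N \<Longrightarrow> t0 (int i) \<noteq> Blank" and inp: "\<And>i. i < N \<Longrightarrow> inp i = t0 (int i)"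
  shows "i \<le> N \<Longrightarrow> rch K c0 (i * (2 * Suc N * (K + 5))) (I2, tk 0 0 False (bits K inp (\<lambda>_. N, \<lambda>_. False)) t0, 0)
    (I2, tk (i * (K + 3)) i False (bits K inp (\<lambda>_. N, \<lambda>_. False)) t0, int i)"
proof (induction i)
  case 0 show ?case by (simp add: rch_refl)
next
  case (Suc i)
  let ?\<beta> = "bits K inp (\<lambda>_. N, \<lambda>_. False)"
  have \<beta>: "?\<beta> (i * (K + 3) + r) = blk K (t0 (int i)) ! r" if r: "r < K + 3" for r
  proof -
    have "(i * (K + 3) + r) div (K + 3) = i" "(i * (K + 3) + r) mod (K + 3) = r" using r by simp_all
    then show ?thesis using Suc.prems inp[of i] r unfolding blk_nth[OF r] by (auto simp: bits_def att_def)
  qed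
  have "rch K c0 (2 * Suc i * (K + 5)) (I2, tk (i * (K + 3)) i False ?\<beta> t0, int i)
     (I2, tk (Suc i * (K + 3)) (Suc i) False ?\<beta> t0, int (Suc i))"
    using Suc.prems by (intro copy_cell nb \<beta>) auto
  then have "rch K c0 (2 * Suc N * (K + 5)) (I2, tk (i * (K + 3)) i False ?\<beta> t0, int i)
     (I2, tk (Suc i * (K + 3)) (Suc i) False ?\<beta> t0, int (Suc i))"
    by (rule rch_mono) (use Suc.prems in \<open>intro mult_le_mono, auto\<close>)
  with Suc show ?case using rch_trans[of K c0 "i * (2 * Suc N * (K + 5))" _ _ "2 * Suc N * (K + 5)"]
    by (simp add: add.commute)
qed

lemma startup:
  fixes K :: nat
  assumes nb: "\<And>i. i < N \<Longrightarrow> t0 (int i) \<noteq> Blank" and inp: "\<And>i. i < N \<Longrightarrow> inp i = t0 (int i)"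
    and neg: "\<And>j. j < 0 \<Longrightarrow> t0 j = Blank" and bN: "t0 (int N) = Blank"
  shows "\<exists>rest. rch K c0 (N * (2 * Suc N * (K + 5)) + N + 6) (I0, t0, 0)
    (Dp [c0], tp (N * (K + 3)) rest (bits K inp (\<lambda>_. N, \<lambda>_. False)), -2)"
proof -
  let ?\<beta> = "bits K inp (\<lambda>_. N, \<lambda>_. False)"
  let ?t = "tk (N * (K + 3)) N False ?\<beta> t0"
  define rest where "rest j = (if j < int N then One else t0 j)" for j
  let ?f = "tp (N * (K + 3)) rest ?\<beta>"
  have u0: "t0(-1 := Sep) = tk 0 0 False ?\<beta> t0" using neg by (auto simp: tk_def fun_eq_iff)
  have r1: "rch K c0 (N * (2 * Suc N * (K + 5))) (I2, tk 0 0 False ?\<beta> t0, 0) (I2, ?t, int N)"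
    using copy_all[where N = N and ?t0.0 = t0 and inp = inp, OF nb inp] by simp
  have "?t (int N) = Blank" using bN by (simp add: tk_def)
  then have r2: "rch K c0 (Suc 0) (I2, ?t, int N) (J1, ?t, int N - 1)"
    by (intro rch_step[where t = ?t and p = "int N" and x = Blank and s = Blank and m = MvL and q' = J1])
      (simp_all add: mv_def rch_refl fun_upd_idem)
  have "(gs K c0 ^^ N) (J1, ?t, int N - 1) = (J1, ?t, int N - 1 - int N)"
  proof (rule move_left)
    fix i assume "i < N"
    then have "?t (int N - 1 - int i) = One" by (simp add: tk_def)
    then show "delta K c0 J1 (?t (int N - 1 - int i)) = (J1, ?t (int N - 1 - int i), MvL)" by simp
  qed simp
  then have r3: "rch K c0 N (J1, ?t, int N - 1) (J1, ?t, -1)" by (intro rch_funpow) simp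
  have "?t (-1) = Sep" by (simp add: tk_def)
  then have r4: "rch K c0 (Suc 0) (J1, ?t, -1) (J2, ?t, 0)"
    by (intro rch_step[where t = ?t and p = "-1" and x = Sep and s = Sep and m = MvR and q' = J2])
      (simp_all add: mv_def rch_refl fun_upd_idem)
  have u5: "?t(0 := Blank) = ?f" using bN by (auto simp: tk_def tp_def rest_def fun_eq_iff)
  have r5: "rch K c0 (Suc 0) (J2, ?t, 0) (J3, ?f, -1)"
    by (rule rch_step[where t = ?t and p = 0 and x = "?t 0" and s = Blank and m = MvL and q' = J3])
      (simp_all add: mv_def rch_refl u5)
  have r6: "rch K c0 (Suc 0) (J3, ?f, -1) (Dp [c0], ?f, -2)"
    by (rule rch_step[where t = ?f and p = "-1" and x = "?f (-1)" and s = "?f (-1)" and m = MvL and q' = "Dp [c0]"])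
      (simp_all add: mv_def rch_refl)
  note r = rch_trans[OF r1 rch_trans[OF r2 rch_trans[OF r3 rch_trans[OF r4 rch_trans[OF r5 r6]]]]]
  let ?n = "N * (2 * Suc N * (K + 5)) + (Suc 0 + (N + (Suc 0 + (Suc 0 + Suc 0))))"
  have "rch K c0 (Suc ?n) (I1, t0, -1) (Dp [c0], ?f, -2)"
    by (rule rch_step[where t = t0 and p = "-1" and x = "t0 (-1)" and s = Sep and m = MvR and q' = I2])
      (use r in \<open>simp_all add: mv_def u0\<close>)
  then have "rch K c0 (Suc (Suc ?n)) (I0, t0, 0) (Dp [c0], ?f, -2)"
    by (intro rch_step[where t = t0 and p = 0 and x = "t0 0" and s = "t0 0" and m = MvL and q' = I1])
      (simp_all add: mv_def)
  then have "rch K c0 (N * (2 * Suc N * (K + 5)) + N + 6) (I0, t0, 0) (Dp [c0], ?f, -2)"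
    by (rule rch_mono) simp
  then show ?thesis by blast
qed

text \<open>A negative answer leaves cell 0 blank, so the output is empty; a positive one writes
  \<open>One\<close> there and a blank behind it to cut off what is left of the input.\<close>

lemma finish:
  fixes M :: nat
  shows "\<exists>t p. rch K c0 4 (Dp [Halt b], tp M rest \<beta>, -2) (Hlt, t, p) \<and> tape_out t = (if b then [One] else [])"
proof (cases b)
  case False
  let ?t = "tp M rest \<beta>"
  have "rch K c0 (Suc 0) (Dp [Halt b], ?t, -2) (Hlt, ?t, -2)"
    by (rule rch_stay[OF rch_refl]) (use False in simp_all)
  then have 1: "rch K c0 4 (Dp [Halt b], ?t, -2) (Hlt, ?t, -2)" by (rule rch_mono) simp
  have "(LEAST i. ?t (int i) = Blank) = 0" by (rule Least_equality) (auto simp: tp_def)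
  then have 2: "tape_out ?t = (if b then [One] else [])" using False by (simp add: tape_out_def)
  show ?thesis using 1 2 by blast
next
  case True
  let ?t = "tp M rest \<beta>"
  let ?f = "?t(0 := One, 1 := Blank)"
  have r3: "rch K c0 (Suc 0) (F3, ?t(0 := One), 1) (Hlt, ?f, 1)"
    by (rule rch_step[where t = "?t(0 := One)" and p = 1 and s = Blank and m = MvS and q' = Hlt, OF _ _ refl])
      (simp_all add: mv_def rch_refl)
  have r2: "rch K c0 (Suc (Suc 0)) (F2, ?t, 0) (Hlt, ?f, 1)"
    by (rule rch_step[where t = ?t and p = 0 and s = One and m = MvR and q' = F3, OF _ _ refl])
      (use r3 in \<open>simp_all add: mv_def\<close>)
  have r1: "rch K c0 (Suc (Suc (Suc 0))) (F1, ?t, -1) (Hlt, ?f, 1)"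
    by (rule rch_step[where t = ?t and p = "-1" and s = "?t (-1)" and m = MvR and q' = F2, OF _ _ refl])
      (use r2 in \<open>simp_all add: mv_def\<close>)
  have "rch K c0 (Suc (Suc (Suc (Suc 0)))) (Dp [Halt b], ?t, -2) (Hlt, ?f, 1)"
    by (rule rch_step[where t = ?t and p = "-2" and s = "?t (-2)" and m = MvR and q' = F1, OF _ _ refl])
      (use r1 True in \<open>simp_all add: mv_def\<close>)
  then have 1: "rch K c0 4 (Dp [Halt b], ?t, -2) (Hlt, ?f, 1)" by (simp add: numeral_eq_Suc)
  have "(LEAST i. ?f (int i) = Blank) = 1"
  proof (rule Least_equality)
    fix y assume "?f (int y) = Blank"
    then show "1 \<le> y" by (cases y) auto
  qed simp
  then have 2: "tape_out ?f = (if b then [One] else [])" using True by (simp add: tape_out_def)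
  show ?thesis using 1 2 by blast
qed

lemma halted: "(gs K c0 ^^ n) (Hlt, t, p) = (Hlt, t, p)"
  by (induction n) (simp_all add: gstep_def)

text \<open>The word may contain blanks, since the evaluator has to halt on every string; the
  machine sees the part before the first blank, and N is the length of that part.\<close>

theorem compile:
  assumes ok: "okcom K prog" "istest p" "okop K p"
  shows "\<exists>E. tm_wf E \<and> (\<forall>u N inp t s'. N = length (takeWhile (\<lambda>s. s \<noteq> Blank) u) \<longrightarrow>
     inp = (\<lambda>i. if i < length u then u ! i else Blank) \<longrightarrow>
     bs N inp prog (\<lambda>_. N, \<lambda>_. False) t s' \<longrightarrow>
     (\<forall>T \<ge> N * (2 * Suc N * (K + 5)) + N + (t + 1) * (2 * (N * (K + 3)) + 3) + 20.
        tm_run E T u = Some (if snd (osem N inp p s') then [One] else [])))"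
proof -
  define c0 where "c0 = Seq prog (Cond p (Halt True) (Halt False))"
  define Q where "Q = fixed K \<union> reach K c0 [] \<union> {Dp []}"
  have "\<exists>M f. tm_wf M \<and> (\<forall>q\<in>Q. f q = (1::nat) \<longleftrightarrow> q = Hlt) \<and>
    (\<forall>T t p. \<exists>q\<in>Q. (gs K c0 ^^ T) (I0, t, p) = (q, snd ((gs K c0 ^^ T) (I0, t, p))) \<and>
       (tm_step M ^^ T) (0, t, p) = (f q, snd ((gs K c0 ^^ T) (I0, t, p))))"
  proof (rule tm_of_finite)
    show "finite Q" unfolding Q_def using finite_fixed finite_reach by simp
    show "I0 \<in> Q" "Hlt \<in> Q" by (simp_all add: Q_def fixed_def)
    fix q s assume "q \<in> Q" then show "fst (delta K c0 q s) \<in> Q" unfolding Q_def by (rule states_closed)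
  qed simp
  then obtain M f where M: "tm_wf M" and f: "\<And>q. q \<in> Q \<Longrightarrow> f q = (1::nat) \<longleftrightarrow> q = Hlt"
    and sim: "\<And>T t p. \<exists>q\<in>Q. (gs K c0 ^^ T) (I0, t, p) = (q, snd ((gs K c0 ^^ T) (I0, t, p))) \<and>
       (tm_step M ^^ T) (0, t, p) = (f q, snd ((gs K c0 ^^ T) (I0, t, p)))" by blast
  have "tm_run M T u = Some (if snd (osem N inp p s') then [One] else [])"
    if N: "N = length (takeWhile (\<lambda>s. s \<noteq> Blank) u)" and inp: "inp = (\<lambda>i. if i < length u then u ! i else Blank)"
      and run: "bs N inp prog (\<lambda>_. N, \<lambda>_. False) t s'"
      and T: "T \<ge> N * (2 * Suc N * (K + 5)) + N + (t + 1) * (2 * (N * (K + 3)) + 3) + 20"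
    for u N inp t s' T
  proof -
    let ?W = "2 * (N * (K + 3)) + 3"
    define t0 where "t0 = (\<lambda>i. if 0 \<le> i \<and> nat i < length u then u ! nat i else Blank)"
    have Nle: "N \<le> length u" unfolding N by (rule length_takeWhile_le)
    have nb: "t0 (int i) \<noteq> Blank" if "i < N" for i
    proof -
      have "u ! i = takeWhile (\<lambda>s. s \<noteq> Blank) u ! i" using that unfolding N by (simp add: takeWhile_nth)
      moreover have "takeWhile (\<lambda>s. s \<noteq> Blank) u ! i \<in> set (takeWhile (\<lambda>s. s \<noteq> Blank) u)"
        using that unfolding N by (rule nth_mem)
      ultimately have "u ! i \<noteq> Blank" by (auto dest: set_takeWhileD)
      then show ?thesis using that Nle by (simp add: t0_def)
    qed
    have bN: "t0 (int N) = Blank"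
      using nth_length_takeWhile[of "\<lambda>s. s \<noteq> Blank" u] unfolding t0_def N by auto
    have "\<exists>rest. rch K c0 (N * (2 * Suc N * (K + 5)) + N + 6) (I0, t0, 0)
        (Dp [c0], tp (N * (K + 3)) rest (bits K inp (\<lambda>_. N, \<lambda>_. False)), -2)"
      by (rule startup[where ?t0.0 = t0 and N = N]) (use nb bN in \<open>simp_all add: t0_def inp\<close>)
    then obtain rest where r1: "rch K c0 (N * (2 * Suc N * (K + 5)) + N + 6) (I0, t0, 0)
        (Dp [c0], tp (N * (K + 3)) rest (bits K inp (\<lambda>_. N, \<lambda>_. False)), -2)" by blast
    let ?T = "\<lambda>s. tp (N * (K + 3)) rest (bits K inp s)"
    let ?b = "snd (osem N inp p s')"
    have st: "okst K N (\<lambda>_. N, \<lambda>_. False)" by (simp add: okst_def)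
    have st': "okst K N s'" using bs_run[OF run ok(1) st] by blast
    have r2: "rch K c0 (t * ?W) (Dp [prog, Cond p (Halt True) (Halt False)], ?T (\<lambda>_. N, \<lambda>_. False), -2)
       (Dp [Cond p (Halt True) (Halt False)], ?T s', -2)"
      using bs_run[OF run ok(1) st] by blast
    have "rch K c0 (2 * (N * (K + 3)) + 2) (Sw p 0 (mealy0 p) [Halt True] [Halt False], ?T s', -2)
       (Dp [Halt ?b], ?T (fst (osem N inp p s')), -2)"
      using op_run[OF ok(3) st', of c0 "[Halt True]" "[Halt False]" rest inp]
      unfolding sweep_res[OF ok(3) st' ok(2)] by (cases ?b) simp_all
    then have r3: "rch K c0 (Suc (2 * (N * (K + 3)) + 2)) (Dp [Cond p (Halt True) (Halt False)], ?T s', -2)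
       (Dp [Halt ?b], ?T (fst (osem N inp p s')), -2)"
      by (rule rch_stay) simp_all
    obtain tf pf where r4: "rch K c0 4 (Dp [Halt ?b], ?T (fst (osem N inp p s')), -2) (Hlt, tf, pf)"
      and out: "tape_out tf = (if ?b then [One] else [])" using finish by blast
    have "rch K c0 (Suc (t * ?W + (Suc (2 * (N * (K + 3)) + 2) + 4))) (Dp [c0], ?T (\<lambda>_. N, \<lambda>_. False), -2) (Hlt, tf, pf)"
      by (rule rch_stay[OF rch_trans[OF r2 rch_trans[OF r3 r4]]]) (simp_all add: c0_def)
    from rch_trans[OF r1 this] have "rch K c0 T (I0, t0, 0) (Hlt, tf, pf)"
      by (rule rch_mono) (rule order_trans[OF _ T], simp)
    then obtain n where n: "n \<le> T" "(gs K c0 ^^ n) (I0, t0, 0) = (Hlt, tf, pf)" by (auto simp: rch_def)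
    have fin: "(gs K c0 ^^ T) (I0, t0, 0) = (Hlt, tf, pf)"
    proof -
      have "(gs K c0 ^^ T) (I0, t0, 0) = (gs K c0 ^^ (T - n)) ((gs K c0 ^^ n) (I0, t0, 0))"
        using n(1) by (metis comp_apply funpow_add le_add_diff_inverse2)
      then show ?thesis by (simp only: n(2) halted)
    qed
    obtain q where q: "q \<in> Q" "(gs K c0 ^^ T) (I0, t0, 0) = (q, snd ((gs K c0 ^^ T) (I0, t0, 0)))"
       "(tm_step M ^^ T) (0, t0, 0) = (f q, snd ((gs K c0 ^^ T) (I0, t0, 0)))" using sim by blast
    have "q = Hlt" using q(2) fin by simp
    then have "(tm_step M ^^ T) (0, t0, 0) = (1, tf, pf)" using q(3) f[OF q(1)] fin by simp
    then show ?thesis unfolding tm_run_def tm_init_def t0_def[symmetric] using out by simp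
  qed
  then show ?thesis using M by blast
qed

section \<open>Bounded arithmetic expressions and their running time\<close>

datatype exp = XV nat | X1 | XLen | XAdd exp exp | XMul exp exp | XLt exp exp | XSum nat exp exp | XAt nat exp

text \<open>All values are cut off at N so that they fit a register. Bounded sums provide
  quantifiers and counting, and \<open>XAt\<close> reads the input or the bit table.\<close>

fun ev :: "nat \<Rightarrow> (nat \<Rightarrow> sym) \<Rightarrow> (nat \<Rightarrow> bool) \<Rightarrow> exp \<Rightarrow> (nat \<Rightarrow> nat) \<Rightarrow> nat" where
  "ev N inp A (XV x) e = min N (e x)"
| "ev N inp A X1 e = min N 1"
| "ev N inp A XLen e = N"
| "ev N inp A (XAdd a b) e = min N (ev N inp A a e + ev N inp A b e)"
| "ev N inp A (XMul a b) e = min N (ev N inp A a e * ev N inp A b e)"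
| "ev N inp A (XLt a b) e = (if ev N inp A a e < ev N inp A b e then min N 1 else 0)"
| "ev N inp A (XSum x a b) e = min N (\<Sum>i<ev N inp A a e. ev N inp A b (e(x := i)))"
| "ev N inp A (XAt j a) e = (if ev N inp A a e < N \<and> att inp A j (ev N inp A a e) then min N 1 else 0)"

lemma ev_le [simp]: "ev N inp A a e \<le> N"
  by (cases a) auto

definition cpy :: "nat \<Rightarrow> nat \<Rightarrow> com" where
  "cpy i d = Seq (Do (Zer d)) (Loop (TEq i d) (Do (Inc d)))"

definition addto :: "nat \<Rightarrow> nat \<Rightarrow> nat \<Rightarrow> com" where
  "addto i j t = Seq (Do (Zer t)) (Loop (TEq j t) (Seq (Do (Inc i)) (Do (Inc t))))"

text \<open>The result goes to register \<open>d\<close>, registers from \<open>d\<close> on are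
  scratch, and \<rho> places variables below \<open>d\<close>. A comparison a < b is found by
  counting to b and raising the result when the counter meets a.\<close>

fun cx :: "exp \<Rightarrow> (nat \<Rightarrow> nat) \<Rightarrow> nat \<Rightarrow> com" where
  "cx (XV x) \<rho> d = cpy (\<rho> x) d"
| "cx X1 \<rho> d = Seq (Do (Zer d)) (Do (Inc d))"
| "cx XLen \<rho> d = Do (Top d)"
| "cx (XAdd a b) \<rho> d = Seq (cx a \<rho> d) (Seq (cx b \<rho> (d + 1)) (addto d (d + 1) (d + 2)))"
| "cx (XMul a b) \<rho> d = Seq (cx a \<rho> (d + 1)) (Seq (cx b \<rho> (d + 2)) (Seq (Do (Zer d)) (Seq (Do (Zer (d + 3)))
     (Loop (TEq (d + 1) (d + 3)) (Seq (addto d (d + 2) (d + 4)) (Do (Inc (d + 3))))))))"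
| "cx (XLt a b) \<rho> d = Seq (cx a \<rho> (d + 1)) (Seq (cx b \<rho> (d + 2)) (Seq (Do (Zer d)) (Seq (Do (Zer (d + 3)))
     (Loop (TEq (d + 2) (d + 3)) (Seq (Cond (TEq (d + 1) (d + 3)) (Do (Inc d)) (Do (Zer (d + 4)))) (Do (Inc (d + 3))))))))"
| "cx (XSum x a b) \<rho> d = Seq (cx a \<rho> (d + 1)) (Seq (Do (Zer d)) (Seq (Do (Zer (d + 2)))
     (Loop (TEq (d + 1) (d + 2)) (Seq (cx b (\<rho>(x := d + 2)) (d + 3)) (Seq (addto d (d + 3) (d + 4)) (Do (Inc (d + 2))))))))"
| "cx (XAt j a) \<rho> d = Seq (cx a \<rho> (d + 1)) (Seq (Do (Zer d)) (Cond (TAtt (d + 1) j) (Do (Inc d)) (Do (Zer (d + 2)))))"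

fun rg :: "exp \<Rightarrow> nat" where
  "rg (XAdd a b) = rg a + rg b + 5"
| "rg (XMul a b) = rg a + rg b + 5"
| "rg (XLt a b) = rg a + rg b + 5"
| "rg (XSum x a b) = rg a + rg b + 5"
| "rg (XAt j a) = rg a + 5"
| "rg _ = 1"

fun okexp :: "exp \<Rightarrow> bool" where
  "okexp (XAdd a b) = (okexp a \<and> okexp b)"
| "okexp (XMul a b) = (okexp a \<and> okexp b)"
| "okexp (XLt a b) = (okexp a \<and> okexp b)"
| "okexp (XSum x a b) = (okexp a \<and> okexp b)"
| "okexp (XAt j a) = (j < 3 \<and> okexp a)"
| "okexp _ = True"

lemma okcom_cx:
  "okexp a \<Longrightarrow> (\<And>x. \<rho> x < d) \<Longrightarrow> d + rg a \<le> K \<Longrightarrow> okcom K (cx a \<rho> d)"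
proof (induction a arbitrary: \<rho> d)
  case (XSum x a b)
  have "(\<rho>(x := d + 2)) y < d + 3" for y using XSum.prems(2)[of y] by auto
  then have "okcom K (cx b (\<rho>(x := d + 2)) (d + 3))" using XSum by (intro XSum.IH(2)) auto
  moreover have "okcom K (cx a \<rho> (d + 1))" using XSum.prems by (intro XSum.IH(1)) (auto simp: less_SucI)
  ultimately show ?case using XSum.prems by (auto simp: addto_def)
next
  case (XAdd a b)
  then have "okcom K (cx a \<rho> d)" "okcom K (cx b \<rho> (d + 1))"
    by (intro XAdd.IH; auto simp: less_SucI)+
  then show ?case using XAdd.prems by (auto simp: addto_def)
next
  case (XMul a b)
  then have "okcom K (cx a \<rho> (d + 1))" "okcom K (cx b \<rho> (d + 2))"
    by (intro XMul.IH; auto simp: less_SucI)+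
  then show ?case using XMul.prems by (auto simp: addto_def)
next
  case (XLt a b)
  then have "okcom K (cx a \<rho> (d + 1))" "okcom K (cx b \<rho> (d + 2))"
    by (intro XLt.IH; auto simp: less_SucI)+
  then show ?case using XLt.prems by auto
next
  case (XAt j a)
  then have "okcom K (cx a \<rho> (d + 1))" by (intro XAt.IH) (auto simp: less_SucI)
  then show ?case using XAt.prems by auto
qed (auto simp: cpy_def)

definition bsl :: "nat \<Rightarrow> (nat \<Rightarrow> sym) \<Rightarrow> com \<Rightarrow> store \<Rightarrow> nat \<Rightarrow> store \<Rightarrow> bool" where
  "bsl N inp c s T s' \<longleftrightarrow> (\<exists>t\<le>T. bs N inp c s t s')"

lemma bsl_mono: "bsl N inp c s T s' \<Longrightarrow> T \<le> T' \<Longrightarrow> bsl N inp c s T' s'"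
  unfolding bsl_def by (blast intro: le_trans)

lemma bsl_Do: "s' = fst (osem N inp p s) \<Longrightarrow> bsl N inp (Do p) s 1 s'"
  unfolding bsl_def using bs_Do by blast

lemma bsl_Seq:
  assumes "bsl N inp a s T s'" "bsl N inp b s' T' s''"
  shows "bsl N inp (Seq a b) s (Suc (T + T')) s''"
proof -
  obtain t t' where "t \<le> T" "bs N inp a s t s'" "t' \<le> T'" "bs N inp b s' t' s''"
    using assms unfolding bsl_def by blast
  then show ?thesis unfolding bsl_def
    by (intro exI[of _ "Suc (t + t')"] conjI bs_Seq) auto
qed

lemma bsl_Cond:
  assumes "fst (osem N inp p s) = s"
    "snd (osem N inp p s) \<Longrightarrow> bsl N inp a s T s'" "\<not> snd (osem N inp p s) \<Longrightarrow> bsl N inp b s T s'"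
  shows "bsl N inp (Cond p a b) s (Suc T) s'"
proof (cases "snd (osem N inp p s)")
  case True
  then obtain t where "t \<le> T" "bs N inp a s t s'" using assms(2) unfolding bsl_def by blast
  then show ?thesis using True assms(1) unfolding bsl_def
    by (intro exI[of _ "Suc t"] conjI bs_CondT) auto
next
  case False
  then obtain t where "t \<le> T" "bs N inp b s t s'" using assms(3) unfolding bsl_def by blast
  then show ?thesis using False assms(1) unfolding bsl_def
    by (intro exI[of _ "Suc t"] conjI bs_CondF) auto
qed

lemma bsl_loop:
  assumes body: "\<And>i s. i < n \<Longrightarrow> I i s \<Longrightarrow> \<exists>s'. bsl N inp c s T s' \<and> I (Suc i) s'"
    and reg: "\<And>i s. I i s \<Longrightarrow> fst s j = n \<and> fst s k = i"
    and start: "I 0 s"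
  shows "\<exists>s'. bsl N inp (Loop (TEq j k) c) s (n * Suc T + 1) s' \<and> I n s'"
proof -
  have "i \<le> n \<Longrightarrow> I (n - i) s \<Longrightarrow> \<exists>s'. bsl N inp (Loop (TEq j k) c) s (i * Suc T + 1) s' \<and> I n s'" for i s
  proof (induction i arbitrary: s)
    case 0
    obtain v A where s: "s = (v, A)" by (cases s)
    have "snd (osem N inp (TEq j k) s)" using reg[OF 0(2)] by (simp add: s)
    then have "bs N inp (Loop (TEq j k) c) s 1 (fst (osem N inp (TEq j k) s))" by (rule bs_LoopT)
    then show ?case using 0 by (intro exI[of _ s]) (auto simp: bsl_def s)
  next
    case (Suc i)
    obtain v A where s: "s = (v, A)" by (cases s)
    obtain s' where s': "bsl N inp c s T s'" "I (Suc (n - Suc i)) s'"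
      using body[of "n - Suc i" s] Suc.prems by auto
    then have "I (n - i) s'" using Suc.prems by (simp add: Suc_diff_Suc)
    then obtain s'' where s'': "bsl N inp (Loop (TEq j k) c) s' (i * Suc T + 1) s''" "I n s''"
      using Suc.IH[of s'] Suc.prems(1) by auto
    obtain t t' where t: "t \<le> T" "bs N inp c s t s'" "t' \<le> i * Suc T + 1" "bs N inp (Loop (TEq j k) c) s' t' s''"
      using s' s'' unfolding bsl_def by blast
    have "\<not> snd (osem N inp (TEq j k) s)" using reg[OF Suc.prems(2)] Suc.prems(1) by (simp add: s)
    moreover have "fst (osem N inp (TEq j k) s) = s" by (simp add: s)
    ultimately have "bs N inp (Loop (TEq j k) c) s (Suc (t + t')) s''" using t by (intro bs_LoopF) auto
    then have "bsl N inp (Loop (TEq j k) c) s (Suc i * Suc T + 1) s''"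
      unfolding bsl_def using t by (intro exI[of _ "Suc (t + t')"]) auto
    then show ?case using s'' by blast
  qed
  from this[of n s] start show ?thesis by simp
qed

definition inR :: "nat \<Rightarrow> (nat \<Rightarrow> nat) \<Rightarrow> bool" where
  "inR N v \<longleftrightarrow> (\<forall>h. v h \<le> N)"

lemma cpy_run:
  assumes "inR N v" "i < d"
  shows "bsl N inp (cpy i d) (v, A) (2 * N + 4) (v(d := v i), A)"
proof -
  have "\<exists>s'. bsl N inp (Loop (TEq i d) (Do (Inc d))) (v(d := 0), A) (v i * Suc 1 + 1) s' \<and> s' = (v(d := v i), A)"
  proof (rule bsl_loop)
    fix k s assume k: "k < v i" "s = (v(d := k), A)"
    have "v i \<le> N" using assms(1) by (simp add: inR_def)
    then have mn: "min N (Suc k) = Suc k" using k(1) by simp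
    have "bsl N inp (Do (Inc d)) s 1 (v(d := Suc k), A)" by (rule bsl_Do) (simp add: k(2) mn)
    then show "\<exists>s'. bsl N inp (Do (Inc d)) s 1 s' \<and> s' = (v(d := Suc k), A)" by blast
  qed (use assms in auto)
  then have "bsl N inp (cpy i d) (v, A) (Suc (1 + (v i * Suc 1 + 1))) (v(d := v i), A)"
    unfolding cpy_def by (intro bsl_Seq[OF bsl_Do]) auto
  moreover have "v i \<le> N" using assms by (simp add: inR_def)
  ultimately show ?thesis by (elim bsl_mono) simp
qed

lemma addto_run:
  assumes "inR N v" "i < j" "j < t"
  shows "bsl N inp (addto i j t) (v, A) (4 * N + 4) (v(i := min N (v i + v j), t := v j), A)"
proof -
  have "\<exists>s'. bsl N inp (Loop (TEq j t) (Seq (Do (Inc i)) (Do (Inc t)))) (v(t := 0), A) (v j * Suc 3 + 1) s' \<and>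
    s' = (v(i := min N (v i + v j), t := v j), A)"
  proof (rule bsl_loop)
    fix k s assume k: "k < v j" "s = (v(i := min N (v i + k), t := k), A)"
    have "v j \<le> N" using assms(1) by (simp add: inR_def)
    then have 1: "min N (Suc k) = Suc k" using k(1) by simp
    have "bsl N inp (Seq (Do (Inc i)) (Do (Inc t))) s (Suc (1 + 1)) (v(i := min N (v i + Suc k), t := Suc k), A)"
      unfolding k(2) using assms 1 by (intro bsl_Seq[OF bsl_Do[OF refl] bsl_Do]) (auto simp: fun_eq_iff)
    then show "\<exists>s'. bsl N inp (Seq (Do (Inc i)) (Do (Inc t))) s 3 s' \<and> s' = (v(i := min N (v i + Suc k), t := Suc k), A)"
      by (auto simp: numeral_eq_Suc)
  next
    show "(v(t := 0), A) = (v(i := min N (v i + 0), t := 0), A)" 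
      using assms min_absorb2[of "v i" N] by (auto simp: inR_def fun_eq_iff)
  qed (use assms in auto)
  then have "bsl N inp (addto i j t) (v, A) (Suc (1 + (v j * Suc 3 + 1))) (v(i := min N (v i + v j), t := v j), A)"
    unfolding addto_def by (intro bsl_Seq[OF bsl_Do]) auto
  moreover have "v j \<le> N" using assms by (simp add: inR_def)
  ultimately show ?thesis by (elim bsl_mono) simp
qed

fun tc :: "exp \<Rightarrow> nat \<Rightarrow> nat" where
  "tc (XAdd a b) N = tc a N + tc b N + (4 * N + 10)"
| "tc (XMul a b) N = tc a N + tc b N + (N * (4 * N + 10) + 10)"
| "tc (XLt a b) N = tc a N + tc b N + (N * 10 + 10)"
| "tc (XSum x a b) N = tc a N + (N * (tc b N + (4 * N + 10)) + 10)"
| "tc (XAt j a) N = tc a N + 10"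
| "tc _ N = 2 * N + 4"

text \<open>The frame condition on registers below \<open>d\<close> keeps variables and pending
  intermediate results intact; the bit array is not touched.\<close>

definition evalsto :: "nat \<Rightarrow> (nat \<Rightarrow> sym) \<Rightarrow> com \<Rightarrow> nat \<Rightarrow> (nat \<Rightarrow> nat) \<Rightarrow> (nat \<Rightarrow> bool) \<Rightarrow> nat \<Rightarrow> nat \<Rightarrow> bool" where
  "evalsto N inp c d v A T r \<longleftrightarrow>
     (\<exists>v'. bsl N inp c (v, A) T (v', A) \<and> inR N v' \<and> v' d = r \<and> (\<forall>h<d. v' h = v h))"

lemma cx_run:
  assumes "inR N v" "\<And>x. \<rho> x < d"
  shows "evalsto N inp (cx a \<rho> d) d v A (tc a N) (ev N inp A a (\<lambda>x. v (\<rho> x)))"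
  using assms
proof (induction a arbitrary: \<rho> d v)
  case (XV x)
  then have "v (\<rho> x) \<le> N" by (simp add: inR_def)
  then show ?case using cpy_run[OF XV(1) XV(2), of inp x A] XV(1) unfolding evalsto_def
    by (intro exI[of _ "v(d := v (\<rho> x))"]) (auto simp: inR_def)
next
  case X1
  have "bsl N inp (cx X1 \<rho> d) (v, A) (Suc (1 + 1)) (v(d := min N 1), A)"
    unfolding cx.simps by (intro bsl_Seq[OF bsl_Do[OF refl] bsl_Do]) simp
  then have "bsl N inp (cx X1 \<rho> d) (v, A) (tc X1 N) (v(d := min N 1), A)" by (rule bsl_mono) simp
  then show ?case using X1(1) unfolding evalsto_def
    by (intro exI[of _ "v(d := min N 1)"]) (auto simp: inR_def)
next
  case XLen
  have "bsl N inp (cx XLen \<rho> d) (v, A) 1 (v(d := N), A)" unfolding cx.simps by (rule bsl_Do) simp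
  then have "bsl N inp (cx XLen \<rho> d) (v, A) (tc XLen N) (v(d := N), A)" by (rule bsl_mono) simp
  then show ?case using XLen(1) unfolding evalsto_def
    by (intro exI[of _ "v(d := N)"]) (auto simp: inR_def)
next
  case (XAdd a b)
  obtain v1 where 1: "bsl N inp (cx a \<rho> d) (v, A) (tc a N) (v1, A)" "inR N v1"
    "v1 d = ev N inp A a (\<lambda>x. v (\<rho> x))" "\<forall>h<d. v1 h = v h"
    using XAdd.IH(1)[where \<rho> = \<rho> and d = d and v = v, OF XAdd.prems] unfolding evalsto_def by auto
  have eq: "(\<lambda>x. v1 (\<rho> x)) = (\<lambda>x. v (\<rho> x))" using 1(4) XAdd.prems(2) by auto
  have "\<rho> x < d + 1" for x using XAdd.prems(2)[of x] by simp
  then obtain v2 where 2: "bsl N inp (cx b \<rho> (d + 1)) (v1, A) (tc b N) (v2, A)" "inR N v2"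
    "v2 (d + 1) = ev N inp A b (\<lambda>x. v (\<rho> x))" "\<forall>h<d + 1. v2 h = v1 h"
    using XAdd.IH(2)[where \<rho> = \<rho> and d = "d + 1" and v = v1, OF 1(2)] unfolding evalsto_def eq by auto
  let ?v = "v2(d := min N (v2 d + v2 (d + 1)), d + 2 := v2 (d + 1))"
  have 3: "bsl N inp (addto d (d + 1) (d + 2)) (v2, A) (4 * N + 4) (?v, A)"
    by (rule addto_run[OF 2(2)]) auto
  have "bsl N inp (cx (XAdd a b) \<rho> d) (v, A) (tc (XAdd a b) N) (?v, A)"
    unfolding cx.simps by (rule bsl_mono[OF bsl_Seq[OF 1(1) bsl_Seq[OF 2(1) 3]]]) simp
  then show ?case using 1 2 unfolding evalsto_def
    by (intro exI[of _ ?v]) (auto simp: inR_def)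
next
  case (XMul a b)
  have \<rho>: "\<rho> x < d + 1" "\<rho> x < d + 2" for x using XMul.prems(2)[of x] by simp_all
  obtain v1 where 1: "bsl N inp (cx a \<rho> (d + 1)) (v, A) (tc a N) (v1, A)" "inR N v1"
    "v1 (d + 1) = ev N inp A a (\<lambda>x. v (\<rho> x))" "\<forall>h<d + 1. v1 h = v h"
    using XMul.IH(1)[where \<rho> = \<rho> and d = "d + 1" and v = v, OF XMul.prems(1) \<rho>(1)] unfolding evalsto_def by auto
  have eq: "(\<lambda>x. v1 (\<rho> x)) = (\<lambda>x. v (\<rho> x))" using 1(4) \<rho> by auto
  obtain v2 where 2: "bsl N inp (cx b \<rho> (d + 2)) (v1, A) (tc b N) (v2, A)" "inR N v2"
    "v2 (d + 2) = ev N inp A b (\<lambda>x. v (\<rho> x))" "\<forall>h<d + 2. v2 h = v1 h"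
    using XMul.IH(2)[where \<rho> = \<rho> and d = "d + 2" and v = v1, OF 1(2) \<rho>(2)] unfolding evalsto_def eq by auto
  define p where "p = v2 (d + 1)" define q where "q = v2 (d + 2)"
  let ?s = "(v2(d := 0, d + 3 := 0), A)"
  define I where "I k s \<longleftrightarrow> snd s = A \<and> inR N (fst s) \<and> fst s (d + 1) = p \<and> fst s (d + 3) = k \<and>
    fst s (d + 2) = q \<and> fst s d = min N (k * q) \<and> (\<forall>h<d. fst s h = v h)" for k and s :: store
  have pN: "p \<le> N" using 2(2) by (simp add: inR_def p_def)
  have "\<exists>s'. bsl N inp (Loop (TEq (d + 1) (d + 3)) (Seq (addto d (d + 2) (d + 4)) (Do (Inc (d + 3))))) ?s
     (p * Suc (4 * N + 6) + 1) s' \<and> I p s'"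
  proof (rule bsl_loop)
    fix k s assume k: "k < p" "I k s"
    let ?v = "fst s"
    have s: "s = (?v, A)" using k(2) by (auto simp: I_def prod_eq_iff)
    let ?v1 = "?v(d := min N (?v d + ?v (d + 2)), d + 4 := ?v (d + 2))"
    have "bsl N inp (addto d (d + 2) (d + 4)) s (4 * N + 4) (?v1, A)"
      by (subst s, rule addto_run) (use k in \<open>auto simp: I_def\<close>)
    moreover have "bsl N inp (Do (Inc (d + 3))) (?v1, A) 1 (?v1(d + 3 := Suc k), A)"
      using k pN by (intro bsl_Do) (auto simp: I_def)
    ultimately have "bsl N inp (Seq (addto d (d + 2) (d + 4)) (Do (Inc (d + 3)))) s (Suc (4 * N + 4 + 1)) (?v1(d + 3 := Suc k), A)"
      by (rule bsl_Seq)
    moreover have "I (Suc k) (?v1(d + 3 := Suc k), A)"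
      using k pN by (auto simp: I_def inR_def min_def)
    ultimately show "\<exists>s'. bsl N inp (Seq (addto d (d + 2) (d + 4)) (Do (Inc (d + 3)))) s (4 * N + 6) s' \<and> I (Suc k) s'"
      by (intro exI conjI) (auto simp: numeral_eq_Suc)
  next
    show "I 0 ?s" using 1 2 by (auto simp: I_def p_def q_def inR_def)
  qed (auto simp: I_def)
  then obtain s' where L: "bsl N inp (Loop (TEq (d + 1) (d + 3)) (Seq (addto d (d + 2) (d + 4)) (Do (Inc (d + 3))))) ?s
     (p * Suc (4 * N + 6) + 1) s'" "I p s'" by blast
  have s': "s' = (fst s', A)" using L(2) by (auto simp: I_def prod_eq_iff)
  have "bsl N inp (cx (XMul a b) \<rho> d) (v, A) (Suc (tc a N + Suc (tc b N + Suc (1 + Suc (1 + (p * Suc (4 * N + 6) + 1)))))) s'"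
    unfolding cx.simps
    by (intro bsl_Seq[OF 1(1)] bsl_Seq[OF 2(1)] bsl_Seq[OF bsl_Do[OF refl]]) (use L in auto)
  moreover have "p * Suc (4 * N + 6) \<le> N * (4 * N + 10)" using pN by (intro mult_le_mono) auto
  ultimately have "bsl N inp (cx (XMul a b) \<rho> d) (v, A) (tc (XMul a b) N) s'" by (elim bsl_mono) simp
  then show ?case unfolding evalsto_def using L(2) s' 1 2
    by (intro exI[of _ "fst s'"]) (auto simp: I_def p_def q_def)
next
  case (XLt a b)
  have \<rho>: "\<rho> x < d + 1" "\<rho> x < d + 2" for x using XLt.prems(2)[of x] by simp_all
  obtain v1 where 1: "bsl N inp (cx a \<rho> (d + 1)) (v, A) (tc a N) (v1, A)" "inR N v1"
    "v1 (d + 1) = ev N inp A a (\<lambda>x. v (\<rho> x))" "\<forall>h<d + 1. v1 h = v h"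
    using XLt.IH(1)[where \<rho> = \<rho> and d = "d + 1" and v = v, OF XLt.prems(1) \<rho>(1)] unfolding evalsto_def by auto
  have eq: "(\<lambda>x. v1 (\<rho> x)) = (\<lambda>x. v (\<rho> x))" using 1(4) \<rho> by auto
  obtain v2 where 2: "bsl N inp (cx b \<rho> (d + 2)) (v1, A) (tc b N) (v2, A)" "inR N v2"
    "v2 (d + 2) = ev N inp A b (\<lambda>x. v (\<rho> x))" "\<forall>h<d + 2. v2 h = v1 h"
    using XLt.IH(2)[where \<rho> = \<rho> and d = "d + 2" and v = v1, OF 1(2) \<rho>(2)] unfolding evalsto_def eq by auto
  define p where "p = v2 (d + 1)" define q where "q = v2 (d + 2)"
  let ?s = "(v2(d := 0, d + 3 := 0), A)"
  let ?c = "Seq (Cond (TEq (d + 1) (d + 3)) (Do (Inc d)) (Do (Zer (d + 4)))) (Do (Inc (d + 3)))"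
  define I where "I k s \<longleftrightarrow> snd s = A \<and> inR N (fst s) \<and> fst s (d + 2) = q \<and> fst s (d + 3) = k \<and>
    fst s (d + 1) = p \<and> fst s d = (if p < k then min N 1 else 0) \<and> (\<forall>h<d. fst s h = v h)" for k and s :: store
  have qN: "q \<le> N" using 2(2) by (simp add: inR_def q_def)
  have "\<exists>s'. bsl N inp (Loop (TEq (d + 2) (d + 3)) ?c) ?s (q * Suc 4 + 1) s' \<and> I q s'"
  proof (rule bsl_loop)
    fix k s assume k: "k < q" "I k s"
    let ?v = "fst s"
    have s: "s = (?v, A)" using k(2) by (auto simp: I_def prod_eq_iff)
    let ?v1 = "if p = k then ?v(d := min N 1) else ?v(d + 4 := 0)"
    have "bsl N inp (Cond (TEq (d + 1) (d + 3)) (Do (Inc d)) (Do (Zer (d + 4)))) s (Suc 1) (?v1, A)"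
      by (subst s, rule bsl_Cond; (rule bsl_Do)?) (use k in \<open>auto simp: I_def\<close>)
    moreover have "bsl N inp (Do (Inc (d + 3))) (?v1, A) 1 (?v1(d + 3 := Suc k), A)"
      using k qN by (intro bsl_Do) (auto simp: I_def)
    ultimately have "bsl N inp ?c s (Suc (Suc 1 + 1)) (?v1(d + 3 := Suc k), A)"
      by (rule bsl_Seq)
    moreover have "I (Suc k) (?v1(d + 3 := Suc k), A)"
      using k qN by (auto simp: I_def inR_def less_Suc_eq)
    ultimately show "\<exists>s'. bsl N inp ?c s 4 s' \<and> I (Suc k) s'"
      by (intro exI conjI) (auto simp: numeral_eq_Suc)
  next
    show "I 0 ?s" using 1 2 by (auto simp: I_def p_def q_def inR_def)
  qed (auto simp: I_def)
  then obtain s' where L: "bsl N inp (Loop (TEq (d + 2) (d + 3)) ?c) ?s (q * Suc 4 + 1) s'" "I q s'" by blast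
  have s': "s' = (fst s', A)" using L(2) by (auto simp: I_def prod_eq_iff)
  have "bsl N inp (cx (XLt a b) \<rho> d) (v, A) (Suc (tc a N + Suc (tc b N + Suc (1 + Suc (1 + (q * Suc 4 + 1)))))) s'"
    unfolding cx.simps
    by (intro bsl_Seq[OF 1(1)] bsl_Seq[OF 2(1)] bsl_Seq[OF bsl_Do[OF refl]]) (use L in auto)
  then have "bsl N inp (cx (XLt a b) \<rho> d) (v, A) (tc (XLt a b) N) s'" using qN by (elim bsl_mono) simp
  then show ?case unfolding evalsto_def using L(2) s' 1 2
    by (intro exI[of _ "fst s'"]) (auto simp: I_def p_def q_def)
next
  case (XSum x a b)
  have \<rho>: "\<rho> x < d + 1" for x using XSum.prems(2)[of x] by simp
  obtain v1 where 1: "bsl N inp (cx a \<rho> (d + 1)) (v, A) (tc a N) (v1, A)" "inR N v1"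
    "v1 (d + 1) = ev N inp A a (\<lambda>x. v (\<rho> x))" "\<forall>h<d + 1. v1 h = v h"
    using XSum.IH(1)[where \<rho> = \<rho> and d = "d + 1" and v = v, OF XSum.prems(1) \<rho>(1)] unfolding evalsto_def by auto
  define p where "p = v1 (d + 1)"
  define B where "B i = ev N inp A b ((\<lambda>x. v (\<rho> x))(x := i))" for i
  have BN: "B i \<le> N" for i by (simp add: B_def)
  let ?s = "(v1(d := 0, d + 2 := 0), A)"
  let ?c = "Seq (cx b (\<rho>(x := d + 2)) (d + 3)) (Seq (addto d (d + 3) (d + 4)) (Do (Inc (d + 2))))"
  define I where "I k s \<longleftrightarrow> snd s = A \<and> inR N (fst s) \<and> fst s (d + 1) = p \<and> fst s (d + 2) = k \<and>
    fst s d = min N (\<Sum>i<k. B i) \<and> (\<forall>h<d. fst s h = v h)" for k and s :: store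
  have pN: "p \<le> N" using 1(2) by (simp add: inR_def p_def)
  have "\<exists>s'. bsl N inp (Loop (TEq (d + 1) (d + 2)) ?c) ?s (p * Suc (tc b N + 4 * N + 7) + 1) s' \<and> I p s'"
  proof (rule bsl_loop)
    fix k s assume k: "k < p" "I k s"
    let ?v = "fst s"
    have s: "s = (?v, A)" using k(2) by (auto simp: I_def prod_eq_iff)
    have \<rho>': "(\<rho>(x := d + 2)) y < d + 3" for y using XSum.prems(2)[of y] by auto
    have eq: "(\<lambda>y. ?v ((\<rho>(x := d + 2)) y)) = (\<lambda>x. v (\<rho> x))(x := k)"
      using k(2) XSum.prems(2) by (auto simp: I_def)
    have "inR N ?v" using k(2) by (simp add: I_def)
    then obtain v2 where 2: "bsl N inp (cx b (\<rho>(x := d + 2)) (d + 3)) s (tc b N) (v2, A)" "inR N v2"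
      "v2 (d + 3) = B k" "\<forall>h<d + 3. v2 h = ?v h"
      using XSum.IH(2)[where v = ?v and \<rho> = "\<rho>(x := d + 2)" and d = "d + 3"] \<rho>' unfolding evalsto_def eq B_def s[symmetric] by auto
    let ?v1 = "v2(d := min N (v2 d + v2 (d + 3)), d + 4 := v2 (d + 3))"
    have "bsl N inp (addto d (d + 3) (d + 4)) (v2, A) (4 * N + 4) (?v1, A)"
      by (rule addto_run[OF 2(2)]) auto
    moreover have "bsl N inp (Do (Inc (d + 2))) (?v1, A) 1 (?v1(d + 2 := Suc k), A)"
      using k pN 2 by (intro bsl_Do) (auto simp: I_def)
    ultimately have "bsl N inp ?c s (Suc (tc b N + Suc (4 * N + 4 + 1))) (?v1(d + 2 := Suc k), A)"
      by (intro bsl_Seq[OF 2(1)]) (rule bsl_Seq)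
    moreover have "I (Suc k) (?v1(d + 2 := Suc k), A)"
      using k pN 2 BN by (auto simp: I_def inR_def)
    ultimately show "\<exists>s'. bsl N inp ?c s (tc b N + 4 * N + 7) s' \<and> I (Suc k) s'"
      by (intro exI conjI) (auto simp: numeral_eq_Suc)
  next
    show "I 0 ?s" using 1 by (auto simp: I_def p_def inR_def)
  qed (auto simp: I_def)
  then obtain s' where L: "bsl N inp (Loop (TEq (d + 1) (d + 2)) ?c) ?s (p * Suc (tc b N + 4 * N + 7) + 1) s'" "I p s'"
    by blast
  have s': "s' = (fst s', A)" using L(2) by (auto simp: I_def prod_eq_iff)
  have "bsl N inp (cx (XSum x a b) \<rho> d) (v, A)
     (Suc (tc a N + Suc (1 + Suc (1 + (p * Suc (tc b N + 4 * N + 7) + 1))))) s'"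
    unfolding cx.simps
    by (intro bsl_Seq[OF 1(1)] bsl_Seq[OF bsl_Do[OF refl]]) (use L in auto)
  moreover have "p * Suc (tc b N + 4 * N + 7) \<le> N * (tc b N + (4 * N + 10))" using pN by (intro mult_le_mono) auto
  ultimately have "bsl N inp (cx (XSum x a b) \<rho> d) (v, A) (tc (XSum x a b) N) s'" by (elim bsl_mono) simp
  then show ?case unfolding evalsto_def using L(2) s' 1
    by (intro exI[of _ "fst s'"]) (auto simp: I_def p_def B_def)
next
  case (XAt j a)
  have \<rho>: "\<rho> x < d + 1" for x using XAt.prems(2)[of x] by simp
  obtain v1 where 1: "bsl N inp (cx a \<rho> (d + 1)) (v, A) (tc a N) (v1, A)" "inR N v1"
    "v1 (d + 1) = ev N inp A a (\<lambda>x. v (\<rho> x))" "\<forall>h<d + 1. v1 h = v h"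
    using XAt.IH[where \<rho> = \<rho> and d = "d + 1" and v = v, OF XAt.prems(1) \<rho>(1)] unfolding evalsto_def by auto
  let ?c = "v1 (d + 1) < N \<and> att inp A j (v1 (d + 1))"
  let ?v = "if ?c then v1(d := min N 1) else v1(d := 0, d + 2 := 0)"
  have "bsl N inp (Cond (TAtt (d + 1) j) (Do (Inc d)) (Do (Zer (d + 2)))) (v1(d := 0), A) (Suc 1) (?v, A)"
    by (rule bsl_Cond; (rule bsl_Do)?) auto
  then have "bsl N inp (cx (XAt j a) \<rho> d) (v, A) (Suc (tc a N + Suc (1 + Suc 1))) (?v, A)"
    unfolding cx.simps by (intro bsl_Seq[OF 1(1)] bsl_Seq[OF bsl_Do]) auto
  then have "bsl N inp (cx (XAt j a) \<rho> d) (v, A) (tc (XAt j a) N) (?v, A)" by (rule bsl_mono) simp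
  then show ?case unfolding evalsto_def using 1
    by (intro exI[of _ ?v]) (auto simp: inR_def)
qed


text \<open>The base N + 2 is at least 2, so constants and sums are absorbed by a larger
  exponent.\<close>

definition polyb :: "(nat \<Rightarrow> nat) \<Rightarrow> bool" where
  "polyb f \<longleftrightarrow> (\<exists>k. \<forall>N. f N \<le> (N + 2) ^ k)"

lemma polyb_mono: "polyb g \<Longrightarrow> (\<And>N. f N \<le> g N) \<Longrightarrow> polyb f"
  unfolding polyb_def by (meson le_trans)

lemma polyb_const: "polyb (\<lambda>N. c)"
  unfolding polyb_def
proof (intro exI allI)
  fix N :: nat
  have "c \<le> 2 ^ c" by (simp add: less_imp_le)
  also have "\<dots> \<le> (N + 2) ^ c" by (rule power_mono) auto
  finally show "c \<le> (N + 2) ^ c" .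
qed

lemma polyb_id: "polyb (\<lambda>N. N)"
  unfolding polyb_def by (rule exI[of _ 1]) simp

lemma polyb_mult:
  assumes "polyb f" "polyb g" shows "polyb (\<lambda>N. f N * g N)"
proof -
  obtain k l where "\<And>N. f N \<le> (N + 2) ^ k" "\<And>N. g N \<le> (N + 2) ^ l" using assms unfolding polyb_def by blast
  then have "f N * g N \<le> (N + 2) ^ (k + l)" for N by (simp add: power_add mult_le_mono)
  then show ?thesis unfolding polyb_def by blast
qed

lemma polyb_add:
  assumes "polyb f" "polyb g" shows "polyb (\<lambda>N. f N + g N)"
proof -
  obtain k l where kl: "\<And>N. f N \<le> (N + 2) ^ k" "\<And>N. g N \<le> (N + 2) ^ l" using assms unfolding polyb_def by blast
  have "f N + g N \<le> (N + 2) ^ (Suc (k + l))" for N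
  proof -
    have "f N \<le> (N + 2) ^ (k + l)" using kl(1)[of N] by (rule le_trans) (rule power_increasing, auto)
    moreover have "g N \<le> (N + 2) ^ (k + l)" using kl(2)[of N] by (rule le_trans) (rule power_increasing, auto)
    ultimately have "f N + g N \<le> 2 * (N + 2) ^ (k + l)" by simp
    also have "\<dots> \<le> (N + 2) * (N + 2) ^ (k + l)" by (rule mult_le_mono1) simp
    finally show ?thesis by simp
  qed
  then show ?thesis unfolding polyb_def by blast
qed

lemmas polyb_intros = polyb_add polyb_mult polyb_const polyb_id

lemma polyb_tc: "polyb (tc a)"
proof (induction a)
  case (XAdd a b) then show ?case by (intro polyb_mono[OF _ eq_refl[OF tc.simps(1)]] polyb_intros)
next
  case (XMul a b) then show ?case by (intro polyb_mono[OF _ eq_refl[OF tc.simps(2)]] polyb_intros)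
next
  case (XLt a b) then show ?case by (intro polyb_mono[OF _ eq_refl[OF tc.simps(3)]] polyb_intros)
next
  case (XSum x a b) then show ?case by (intro polyb_mono[OF _ eq_refl[OF tc.simps(4)]] polyb_intros)
next
  case (XAt j a) then show ?case by (intro polyb_mono[OF _ eq_refl[OF tc.simps(5)]] polyb_intros)
qed (intro polyb_mono[OF _ eq_refl[OF tc.simps(6)]] polyb_mono[OF _ eq_refl[OF tc.simps(7)]]
  polyb_mono[OF _ eq_refl[OF tc.simps(8)]] polyb_intros)+

text \<open>Course-of-values recursion on the work bits: bit \<open>i\<close> is computed from the bits below \<open>i\<close>.\<close>
fun memo :: "nat \<Rightarrow> (nat \<Rightarrow> sym) \<Rightarrow> exp \<Rightarrow> nat \<Rightarrow> nat \<Rightarrow> bool" where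
  "memo N inp a 0 = (\<lambda>_. False)"
| "memo N inp a (Suc i) = (memo N inp a i)(i := ev N inp (memo N inp a i) a (\<lambda>_. i) \<noteq> 0)"

text \<open>Register 0 holds N and register 1 the index of the bit being filled; every free variable
  is read from register 1. When the loop ends register 1 equals N, so the answer expression sees N.
  Register 3 is zero for the final comparison with register 2.\<close>

definition prog :: "exp \<Rightarrow> exp \<Rightarrow> com" where
  "prog a r = Seq (Do (Top 0)) (Seq (Do (Zer 1)) (Seq (Loop (TEq 0 1)
     (Seq (cx a (\<lambda>_. 1) 2) (Seq (Do (Zer 3)) (Seq (Cond (TEq 2 3) (Do (Wr 1 False)) (Do (Wr 1 True))) (Do (Inc 1))))))
     (Seq (cx r (\<lambda>_. 1) 2) (Do (Zer 3)))))"

lemma prog_run: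
  "\<exists>v. bsl N inp (prog a r) (\<lambda>_. N, \<lambda>_. False) (N * (tc a N + 20) + tc r N + 20) (v, memo N inp a N) \<and>
     v 2 = ev N inp (memo N inp a N) r (\<lambda>_. N) \<and> v 3 = 0"
proof -
  let ?c = "Seq (cx a (\<lambda>_. 1) 2) (Seq (Do (Zer 3)) (Seq (Cond (TEq 2 3) (Do (Wr 1 False)) (Do (Wr 1 True))) (Do (Inc 1))))"
  define I where "I k s \<longleftrightarrow> inR N (fst s) \<and> snd s = memo N inp a k \<and> fst s 0 = N \<and> fst s 1 = k" for k and s :: store
  have "\<exists>s'. bsl N inp (Loop (TEq 0 1) ?c) ((\<lambda>_. N)(1 := 0), \<lambda>_. False) (N * Suc (tc a N + 8) + 1) s' \<and> I N s'"
  proof (rule bsl_loop)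
    fix k s assume k: "k < N" "I k s"
    let ?v = "fst s" and ?A = "memo N inp a k"
    have s: "s = (?v, ?A)" using k(2) by (auto simp: I_def prod_eq_iff)
    have eq: "(\<lambda>x::nat. ?v 1) = (\<lambda>_. k)" using k(2) by (auto simp: I_def)
    have "inR N ?v" using k(2) by (simp add: I_def)
    then obtain v1 where 1: "bsl N inp (cx a (\<lambda>_. 1) 2) s (tc a N) (v1, ?A)" "inR N v1"
      "v1 2 = ev N inp ?A a (\<lambda>_. k)" "\<forall>h<2. v1 h = ?v h"
      using cx_run[of N ?v "\<lambda>_. 1" 2 inp a ?A] unfolding evalsto_def eq s[symmetric] by auto
    have v1: "v1 0 = N" "v1 1 = k" using 1(4) k(2) by (auto simp: I_def)
    let ?A' = "memo N inp a (Suc k)"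
    let ?v2 = "v1(3 := 0)"
    have C: "bsl N inp (Cond (TEq 2 3) (Do (Wr 1 False)) (Do (Wr 1 True))) (?v2, ?A) (Suc 1) (?v2, ?A')"
      by (rule bsl_Cond; (rule bsl_Do)?) (use k v1 1(3) in auto)
    have D: "bsl N inp (Do (Inc 1)) (?v2, ?A') 1 (?v2(1 := Suc k), ?A')"
      using k v1 by (intro bsl_Do) auto
    have "bsl N inp ?c s (Suc (tc a N + Suc (1 + Suc (Suc 1 + 1)))) (?v2(1 := Suc k), ?A')"
      by (rule bsl_Seq[OF 1(1) bsl_Seq[OF bsl_Do bsl_Seq[OF C D]]]) simp
    then have "bsl N inp ?c s (tc a N + 8) (?v2(1 := Suc k), ?A')" by (rule bsl_mono) simp
    moreover have "I (Suc k) (?v2(1 := Suc k), ?A')"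
      using k v1 1(2) by (auto simp: I_def inR_def)
    ultimately show "\<exists>s'. bsl N inp ?c s (tc a N + 8) s' \<and> I (Suc k) s'" by blast
  qed (auto simp: I_def inR_def)
  then obtain s' where L: "bsl N inp (Loop (TEq 0 1) ?c) ((\<lambda>_. N)(1 := 0), \<lambda>_. False) (N * Suc (tc a N + 8) + 1) s'"
    "I N s'" by blast
  let ?v = "fst s'" and ?A = "memo N inp a N"
  have s: "s' = (?v, ?A)" using L(2) by (auto simp: I_def prod_eq_iff)
  have eq: "(\<lambda>x::nat. ?v 1) = (\<lambda>_. N)" using L(2) by (auto simp: I_def)
  have "inR N ?v" using L(2) by (simp add: I_def)
  then obtain v1 where 1: "bsl N inp (cx r (\<lambda>_. 1) 2) s' (tc r N) (v1, ?A)" "inR N v1"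
    "v1 2 = ev N inp ?A r (\<lambda>_. N)" "\<forall>h<2. v1 h = ?v h"
    using cx_run[of N ?v "\<lambda>_. 1" 2 inp r ?A] unfolding evalsto_def eq s[symmetric] by auto
  have "bsl N inp (prog a r) (\<lambda>_. N, \<lambda>_. False)
     (Suc (1 + Suc (1 + Suc ((N * Suc (tc a N + 8) + 1) + Suc (tc r N + 1))))) (v1(3 := 0), ?A)"
    unfolding prog_def
    by (rule bsl_Seq[OF bsl_Do[OF refl] bsl_Seq[OF bsl_Do[OF refl] bsl_Seq[OF _ bsl_Seq[OF 1(1) bsl_Do]]]])
      (use L(1) in \<open>auto simp: fun_upd_idem\<close>)
  moreover have "N * Suc (tc a N + 8) \<le> N * (tc a N + 20)" by simp
  ultimately have "bsl N inp (prog a r) (\<lambda>_. N, \<lambda>_. False) (N * (tc a N + 20) + tc r N + 20) (v1(3 := 0), ?A)"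
    by (elim bsl_mono) linarith
  then show ?thesis using 1(3) by (intro exI[of _ "v1(3 := 0)"]) auto
qed

text \<open>The expressions are fixed, so the nesting of loops is bounded and the running time is
  polynomial in N. The machine accepts when the answer expression is zero, because equality is the
  test at hand.\<close>

theorem evaluator_exists:
  assumes "okexp a" "okexp r"
  shows "\<exists>E k. tm_wf E \<and> (\<forall>u N inp. N = length (takeWhile (\<lambda>s. s \<noteq> Blank) u) \<longrightarrow>
     inp = (\<lambda>i. if i < length u then u ! i else Blank) \<longrightarrow>
     (\<forall>T \<ge> (N + 2) ^ k. tm_run E T u =
        Some (if ev N inp (memo N inp a N) r (\<lambda>_. N) = 0 then [One] else [])))"
proof -
  define K where "K = rg a + rg r + 10"
  have "okcom K (cx a (\<lambda>_. 1) 2)" "okcom K (cx r (\<lambda>_. 1) 2)"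
    by (rule okcom_cx; use assms in \<open>simp add: K_def\<close>)+
  then have ok: "okcom K (prog a r)" by (simp add: prog_def K_def)
  have ok3: "okop K (TEq 2 3)" by (simp add: K_def)
  have "istest (TEq 2 3)" by simp
  from compile[OF ok this ok3] obtain E where E: "tm_wf E" and run: "\<forall>u N inp t s'. N = length (takeWhile (\<lambda>s. s \<noteq> Blank) u) \<longrightarrow>
     inp = (\<lambda>i. if i < length u then u ! i else Blank) \<longrightarrow>
     bs N inp (prog a r) (\<lambda>_. N, \<lambda>_. False) t s' \<longrightarrow>
     (\<forall>T \<ge> N * (2 * Suc N * (K + 5)) + N + (t + 1) * (2 * (N * (K + 3)) + 3) + 20.
        tm_run E T u = Some (if snd (osem N inp (TEq 2 3) s') then [One] else []))"
    by (elim exE conjE)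
  define bd where "bd N = N * (2 * (N + 1) * (K + 5)) + N +
     ((N * (tc a N + 20) + tc r N + 20) + 1) * (2 * (N * (K + 3)) + 3) + 20" for N
  have "polyb bd" unfolding bd_def by (intro polyb_intros polyb_tc)
  then obtain k where k: "\<And>N. bd N \<le> (N + 2) ^ k" unfolding polyb_def by blast
  have "tm_run E T u = Some (if ev N inp (memo N inp a N) r (\<lambda>_. N) = 0 then [One] else [])"
    if N: "N = length (takeWhile (\<lambda>s. s \<noteq> Blank) u)" and inp: "inp = (\<lambda>i. if i < length u then u ! i else Blank)"
      and T: "T \<ge> (N + 2) ^ k" for u N inp T
  proof -
    obtain v t where v: "t \<le> N * (tc a N + 20) + tc r N + 20"
      "bs N inp (prog a r) (\<lambda>_. N, \<lambda>_. False) t (v, memo N inp a N)"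
      "v 2 = ev N inp (memo N inp a N) r (\<lambda>_. N)" "v 3 = 0"
      using prog_run[of N inp a r] unfolding bsl_def by blast
    have "(t + 1) * (2 * (N * (K + 3)) + 3) \<le> ((N * (tc a N + 20) + tc r N + 20) + 1) * (2 * (N * (K + 3)) + 3)"
      using v(1) by (intro mult_le_mono1) simp
    then have "N * (2 * Suc N * (K + 5)) + N + (t + 1) * (2 * (N * (K + 3)) + 3) + 20 \<le> bd N"
      unfolding bd_def by simp
    then have "T \<ge> N * (2 * Suc N * (K + 5)) + N + (t + 1) * (2 * (N * (K + 3)) + 3) + 20"
      using k[of N] T by linarith
    from run[rule_format, OF N inp v(2) this] show ?thesis using v(3,4) by simp
  qed
  then show ?thesis using E by blast
qed

section \<open>Logic and counting with truncated expressions\<close>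

text \<open>Truth is positivity, so addition acts as or, multiplication as and, a bounded sum as an
  existential quantifier, and truncation at N >= 1 does not matter.\<close>

abbreviation tr :: "nat \<Rightarrow> (nat \<Rightarrow> sym) \<Rightarrow> (nat \<Rightarrow> bool) \<Rightarrow> exp \<Rightarrow> (nat \<Rightarrow> nat) \<Rightarrow> bool" where
  "tr N inp A a e \<equiv> 0 < ev N inp A a e"

lemma min_mult_min: "min N (min N p * x) = min N (p * x :: nat)"
proof (cases "p \<le> N \<or> x = 0")
  case True then show ?thesis by (auto simp: min_absorb2)
next
  case False
  then have "N * 1 \<le> p * x" by (intro mult_le_mono) auto
  moreover have "N * 1 \<le> N * x" using False by (intro mult_le_mono) auto
  ultimately show ?thesis using False by (simp add: min_absorb1)
qed

definition eNot :: "exp \<Rightarrow> exp" where "eNot a = XLt a X1"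
definition eEq :: "exp \<Rightarrow> exp \<Rightarrow> exp" where "eEq a b = XMul (eNot (XLt a b)) (eNot (XLt b a))"
definition eAll :: "nat \<Rightarrow> exp \<Rightarrow> exp \<Rightarrow> exp" where "eAll x a b = eNot (XSum x a (eNot b))"
definition eXor :: "exp \<Rightarrow> exp \<Rightarrow> exp" where "eXor a b = XAdd (XMul a (eNot b)) (XMul (eNot a) b)"

fun epow :: "exp \<Rightarrow> nat \<Rightarrow> exp" where
  "epow a 0 = X1"
| "epow a (Suc k) = XMul (epow a k) a"

lemma ok_derived [simp]:
  "okexp (eNot a) = okexp a" "okexp (eEq a b) = (okexp a \<and> okexp b)" "okexp (eAll x a b) = (okexp a \<and> okexp b)"
  "okexp (eXor a b) = (okexp a \<and> okexp b)" "okexp a \<Longrightarrow> okexp (epow a k)"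
  by (auto simp: eNot_def eEq_def eAll_def eXor_def) (induction k, auto)

context
  fixes N :: nat and inp :: "nat \<Rightarrow> sym" and A :: "nat \<Rightarrow> bool"
  assumes N: "N \<ge> 1"
begin

lemma ev_1: "ev N inp A X1 e = 1" using N by simp
lemma ev_lt: "ev N inp A (XLt a b) e = of_bool (ev N inp A a e < ev N inp A b e)" using N by simp
lemma ev_not: "ev N inp A (eNot a) e = of_bool (ev N inp A a e = 0)" using N by (simp add: eNot_def)
lemma ev_at: "ev N inp A (XAt j a) e = of_bool (ev N inp A a e < N \<and> att inp A j (ev N inp A a e))" using N by simp
lemma ev_mul01: "ev N inp A a e = of_bool p \<Longrightarrow> ev N inp A b e = of_bool q \<Longrightarrow> ev N inp A (XMul a b) e = of_bool (p \<and> q)"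
  using N by simp
lemma ev_add: "ev N inp A a e = x \<Longrightarrow> ev N inp A b e = y \<Longrightarrow> x + y \<le> N \<Longrightarrow> ev N inp A (XAdd a b) e = x + y" by simp
lemma ev_mul: "ev N inp A a e = x \<Longrightarrow> ev N inp A b e = y \<Longrightarrow> x * y \<le> N \<Longrightarrow> ev N inp A (XMul a b) e = x * y" by simp
lemma ev_var: "e x \<le> N \<Longrightarrow> ev N inp A (XV x) e = e x" by simp

text \<open>A sum of 0/1 terms counts indices below k, and k is itself a value at most N; so the
  truncation never bites.\<close>

lemma ev_count:
  assumes "ev N inp A a e = k" "\<And>i. i < k \<Longrightarrow> ev N inp A b (e(x := i)) = of_bool (Q i)"
  shows "ev N inp A (XSum x a b) e = card {i. i < k \<and> Q i}"
proof -
  have "(\<Sum>i<k. ev N inp A b (e(x := i))) = (\<Sum>i<k. of_bool (Q i))" using assms(2) by (intro sum.cong) auto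
  also have "\<dots> = card {i. i < k \<and> Q i}" by (simp add: Int_def lessThan_def)
  finally have eq: "(\<Sum>i<k. ev N inp A b (e(x := i))) = card {i. i < k \<and> Q i}" .
  have "card {i. i < k \<and> Q i} \<le> card {..<k}" by (rule card_mono) auto
  also have "k \<le> N" using assms(1) ev_le by metis
  finally have "card {i. i < k \<and> Q i} \<le> N" by simp
  then show ?thesis by (simp add: assms(1) eq)
qed

lemma tr_not: "tr N inp A (eNot a) e \<longleftrightarrow> \<not> tr N inp A a e" by (simp add: ev_not)
lemma tr_lt: "tr N inp A (XLt a b) e \<longleftrightarrow> ev N inp A a e < ev N inp A b e" by (simp only: ev_lt) simp
lemma tr_mul: "tr N inp A (XMul a b) e \<longleftrightarrow> tr N inp A a e \<and> tr N inp A b e" using N by simp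
lemma tr_add: "tr N inp A (XAdd a b) e \<longleftrightarrow> tr N inp A a e \<or> tr N inp A b e" using N by simp
lemma tr_sum: "tr N inp A (XSum x a b) e \<longleftrightarrow> (\<exists>i<ev N inp A a e. tr N inp A b (e(x := i)))"
  using N by (auto simp: sum_eq_0_iff lessThan_def simp flip: neq0_conv)
lemma tr_all: "tr N inp A (eAll x a b) e \<longleftrightarrow> (\<forall>i<ev N inp A a e. tr N inp A b (e(x := i)))"
  unfolding eAll_def tr_not tr_sum by auto
lemma tr_eq: "tr N inp A (eEq a b) e \<longleftrightarrow> ev N inp A a e = ev N inp A b e"
  unfolding eEq_def tr_mul tr_not tr_lt by auto
lemma tr_xor: "tr N inp A (eXor a b) e \<longleftrightarrow> tr N inp A a e \<noteq> tr N inp A b e"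
  unfolding eXor_def tr_mul tr_not tr_add by auto
lemma tr_at: "tr N inp A (XAt j a) e \<longleftrightarrow> ev N inp A a e < N \<and> att inp A j (ev N inp A a e)"
  by (simp only: ev_at) simp

lemma ev_pow: "ev N inp A (epow a k) e = min N (ev N inp A a e ^ k)"
proof (induction k)
  case 0 then show ?case using N by simp
next
  case (Suc k)
  let ?x = "ev N inp A a e"
  have "min N (min N (?x ^ k) * ?x) = min N (?x ^ k * ?x)" by (rule min_mult_min)
  then show ?case using Suc by (simp add: mult.commute)
qed

end

section \<open>The learning procedure as a table of bits\<close>

lemma memo_below: "u < i \<Longrightarrow> i \<le> j \<Longrightarrow> memo N inp a i u = memo N inp a j u"
proof (induction j)
  case (Suc j)
  then show ?case by (cases "i = Suc j") auto
qed simp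

lemma memo_above: "i \<le> u \<Longrightarrow> \<not> memo N inp a i u"
  by (induction i) auto

lemma memo_at: "i < N \<Longrightarrow> memo N inp a N i = (ev N inp (memo N inp a i) a (\<lambda>_. i) \<noteq> 0)"
  using memo_below[of i "Suc i" N N inp a] by simp

text \<open>Variables: 0 is the index of the bit to be computed, 1 the run, 2 the round, 3 the level, 4 the point
  (sample number, or \<open>m ^ 5\<close> for the point to be classified), 5 the coordinate; \<open>n + 1\<close> is the coordinate
  that marks a discarded point.\<close>
locale code =
  fixes em en eP ea :: exp
begin

definition eQ :: "exp \<Rightarrow> exp" where "eQ r = XAdd (XMul (XV 1) (XMul em em)) r"
text \<open>The address of coordinate \<open>i\<close> of point \<open>s\<close> after
  \<open>l\<close> levels in global round \<open>q\<close>, in mixed radix with round and level as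
  leading digits. The m^5 + 1 points are the samples and the point to be classified.\<close>

definition eA :: "exp \<Rightarrow> exp \<Rightarrow> exp \<Rightarrow> exp \<Rightarrow> exp" where
  "eA q l s i = XAdd (XMul (XAdd (XMul (XAdd (XMul q em) l) (XAdd (epow em 5) X1)) s) em) i"
definition eBit :: "exp \<Rightarrow> exp \<Rightarrow> exp \<Rightarrow> exp \<Rightarrow> exp" where "eBit q l s i = XAt 0 (eA q l s i)"
definition eDead :: "exp \<Rightarrow> exp \<Rightarrow> exp \<Rightarrow> exp" where "eDead q l s = eBit q l s (XAdd en X1)"
text \<open>Sample \<open>s\<close> starts at \<open>eP\<close> + s (n + 2); the point to be
  classified starts at 0. The latter's label coordinate falls on a separator, which is not
  \<open>One\<close>, so its assumed label is False.\<close>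

definition eInit :: exp where
  "eInit = XMul (XLt (XV 5) (XAdd en X1))
     (XAt 1 (XAdd (XMul (XLt (XV 4) (epow em 5)) (XAdd eP (XMul (XV 4) (XAdd en (XAdd X1 X1))))) (XV 5)))"
text \<open>Coins are read from the end of the input, since the examples end at a place that depends
  on their number. The inner sum counts positions beyond s m + g and so produces N - 1 - (s m + g)
  without subtraction.\<close>

definition eTheta :: "exp \<Rightarrow> exp" where
  "eTheta s = XSum 10 em (XAt 1 (XSum 11 XLen (XLt (XAdd (XMul s em) (XV 10)) (XV 11))))"
definition ePlus :: "exp \<Rightarrow> exp" where
  "ePlus s = XSum 9 (XV 2) (XMul (eNot (eDead (eQ (XV 9)) ea s)) (eNot (eBit (eQ (XV 9)) ea s en)))"
definition eMinus :: "exp \<Rightarrow> exp" where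
  "eMinus s = XSum 9 (XV 2) (XMul (eNot (eDead (eQ (XV 9)) ea s)) (eBit (eQ (XV 9)) ea s en))"
definition eItem :: "exp \<Rightarrow> exp" where
  "eItem k = XAdd (XMul (XAdd (XMul (eQ (XV 2)) ea) (XV 3)) em) k"
definition eOk :: "exp \<Rightarrow> exp" where
  "eOk k = XMul (XLt (ePlus (eItem k)) (XAdd (eTheta (eItem k)) (eMinus (eItem k))))
     (XMul (eNot (eDead (eQ (XV 2)) (XV 3) (eItem k)))
       (eAll 8 en (XAdd (eNot (XMul (eNot (XLt (XMul (XV 8) ea) (XMul (XV 3) en))) (XLt (XMul (XV 8) ea) (XAdd (XMul (XV 3) en) en))))
         (eNot (eXor (eBit (eQ (XV 2)) (XV 3) (XV 4) (XV 8)) (eBit (eQ (XV 2)) (XV 3) (eItem k) (XV 8)))))))"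
definition eFirst :: exp where
  "eFirst = XMul (eOk (XV 6)) (eNot (XSum 7 (XV 6) (eOk (XV 7))))"
definition eUpd :: exp where
  "eUpd = XAdd
     (XMul (XLt (XV 5) (XAdd en X1)) (eXor (eBit (eQ (XV 2)) (XV 3) (XV 4) (XV 5))
        (XSum 6 em (XMul eFirst (eBit (eQ (XV 2)) (XV 3) (eItem (XV 6)) (XV 5))))))
     (XMul (eNot (XLt (XV 5) (XAdd en X1))) (XAdd (eDead (eQ (XV 2)) (XV 3) (XV 4)) (eNot (XSum 6 em eFirst))))"
text \<open>The language has no division, so the digits of the address are found by searching over
  all tuples; injectivity of the address leaves one match.\<close>

definition eBody :: exp where
  "eBody = XSum 1 em (XSum 2 (XMul em em) (XSum 4 (XAdd (epow em 5) X1) (XSum 5 (XAdd en (XAdd X1 X1))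
     (XAdd (XMul (eEq (XV 0) (eA (eQ (XV 2)) (XLt X1 X1) (XV 4) (XV 5))) eInit)
       (XSum 3 ea (XMul (eEq (XV 0) (eA (eQ (XV 2)) (XAdd (XV 3) X1) (XV 4) (XV 5))) eUpd))))))"
definition eVotes :: exp where
  "eVotes = XSum 1 em (XSum 2 (XMul em em) (XLt (ePlus (epow em 5)) (eMinus (epow em 5))))"
text \<open>Negated, since the evaluator accepts on value zero.\<close>

definition eOut :: exp where
  "eOut = eNot (XLt (XMul em (XMul em em)) (XAdd eVotes eVotes))"

lemma ok_body: "okexp em \<Longrightarrow> okexp en \<Longrightarrow> okexp eP \<Longrightarrow> okexp ea \<Longrightarrow> okexp eBody"
  by (simp add: eBody_def eUpd_def eFirst_def eOk_def eItem_def eMinus_def ePlus_def eTheta_def eInit_def eDead_def eBit_def eA_def eQ_def)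

lemma ok_out: "okexp em \<Longrightarrow> okexp en \<Longrightarrow> okexp eP \<Longrightarrow> okexp ea \<Longrightarrow> okexp eOut"
  by (simp add: eOut_def eVotes_def eMinus_def ePlus_def eDead_def eBit_def eA_def eQ_def)

end

text \<open>All addresses lie below m^11, so m^12 < N keeps every table entry and every intermediate
  value clear of the truncation.\<close>

locale code_run = code +
  fixes N :: nat and inp :: "nat \<Rightarrow> sym" and m n P0 a :: nat
  assumes N: "m ^ 12 < N" and m: "n + 4 \<le> m" "a + 2 \<le> m" "0 < a"
    and ev_em: "\<And>A e. ev N inp A em e = m" and ev_en: "\<And>A e. ev N inp A en e = n"
    and ev_eP: "\<And>A e. ev N inp A eP e = P0" and ev_ea: "\<And>A e. ev N inp A ea e = a"
    and fit: "P0 + (m ^ 5 + 1) * (n + 2) \<le> N"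
begin

text \<open>Round and level dominate the order, so a bit at level l + 1 depends on bits at smaller
  addresses only: level l of the same round and the last level of earlier rounds.\<close>

definition ad :: "nat \<Rightarrow> nat \<Rightarrow> nat \<Rightarrow> nat \<Rightarrow> nat" where
  "ad q l s i = ((q * m + l) * (m ^ 5 + 1) + s) * m + i"

lemma m4: "m \<ge> 4" using m by simp

lemma N1: "N \<ge> 1" using N by simp

lemma pow_le_N: "k \<le> 12 \<Longrightarrow> m ^ k \<le> N"
proof -
  assume "k \<le> 12"
  then have "m ^ k \<le> m ^ 12" using m4 by (intro power_increasing) auto
  then show ?thesis using N by simp
qed

lemma ad_bounds:
  assumes "q < m ^ 3" "l < m" "s \<le> m ^ 5" "i < m"
  shows "q * m + l < m ^ 4" "(q * m + l) * (m ^ 5 + 1) + s < m ^ 10" "ad q l s i < m ^ 11"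
proof -
  have "q * m + l < (q + 1) * m" using assms(2) by simp
  also have "\<dots> \<le> m ^ 3 * m" using assms(1) by (intro mult_le_mono1) simp
  finally show 1: "q * m + l < m ^ 4" by (simp add: eval_nat_numeral mult.commute)
  have "(q * m + l) * (m ^ 5 + 1) + s < (q * m + l + 1) * (m ^ 5 + 1)" using assms(3) by simp
  also have "\<dots> \<le> m ^ 4 * (m ^ 5 + 1)" using 1 by (intro mult_le_mono1) simp
  also have "\<dots> \<le> m ^ 4 * (m ^ 5 * m)" using m4 by (intro mult_le_mono2) (simp add: order_trans[OF _ mult_le_mono2[of 2 m]])
  finally show 2: "(q * m + l) * (m ^ 5 + 1) + s < m ^ 10" by (simp add: eval_nat_numeral)
  have "ad q l s i < ((q * m + l) * (m ^ 5 + 1) + s + 1) * m" using assms(4) by (simp add: ad_def)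
  also have "\<dots> \<le> m ^ 10 * m" using 2 by (intro mult_le_mono1) simp
  finally show "ad q l s i < m ^ 11" by (simp add: eval_nat_numeral mult.commute)
qed

lemma ad_N: "q < m ^ 3 \<Longrightarrow> l < m \<Longrightarrow> s \<le> m ^ 5 \<Longrightarrow> i < m \<Longrightarrow> ad q l s i < N"
  using ad_bounds(3)[of q l s i] pow_le_N[of 11] by simp

lemma ad_less:
  assumes "q' * m + l' < q * m + l" "s' \<le> m ^ 5" "i' < m"
  shows "ad q' l' s' i' < ad q l s i"
proof -
  have "(q' * m + l') * (m ^ 5 + 1) + s' < (q' * m + l' + 1) * (m ^ 5 + 1)" using assms(2) by simp
  also have "\<dots> \<le> (q * m + l) * (m ^ 5 + 1)" using assms(1) by (intro mult_le_mono1) simp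
  finally have "(q' * m + l') * (m ^ 5 + 1) + s' + 1 \<le> (q * m + l) * (m ^ 5 + 1) + s" by simp
  then have "((q' * m + l') * (m ^ 5 + 1) + s' + 1) * m \<le> ((q * m + l) * (m ^ 5 + 1) + s) * m" by (rule mult_le_mono1)
  then show ?thesis using assms(3) by (simp add: ad_def)
qed

lemma ad_inj:
  assumes "ad q l s i = ad q' l' s' i'" "l < m" "l' < m" "s \<le> m ^ 5" "s' \<le> m ^ 5" "i < m" "i' < m"
  shows "q = q' \<and> l = l' \<and> s = s' \<and> i = i'"
proof -
  have digit: "x = x' \<and> y = y'" if "x * b + y = x' * b + y'" "y < b" "y' < b" for x y x' y' b :: nat
  proof -
    have "(x * b + y) div b = x" "(x' * b + y') div b = x'" using that(2,3) by auto
    then show ?thesis using that(1) by simp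
  qed
  have 1: "(q * m + l) * (m ^ 5 + 1) + s = (q' * m + l') * (m ^ 5 + 1) + s' \<and> i = i'"
    by (rule digit[OF assms(1)[unfolded ad_def] assms(6,7)])
  have 2: "q * m + l = q' * m + l' \<and> s = s'"
    by (rule digit[OF conjunct1[OF 1]]) (use assms(4,5) in simp_all)
  have "q = q' \<and> l = l'" by (rule digit[OF conjunct1[OF 2] assms(2,3)])
  then show ?thesis using 1 2 by simp
qed

lemma q_bound: "j < m \<Longrightarrow> r < m * m \<Longrightarrow> j * (m * m) + r < m ^ 3"
proof -
  assume "j < m" "r < m * m"
  then have "j * (m * m) + r < (j + 1) * (m * m)" by simp
  also have "\<dots> \<le> m * (m * m)" using \<open>j < m\<close> by (intro mult_le_mono1) simp
  finally show ?thesis by (simp add: eval_nat_numeral)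
qed

lemma item_bound: "q < m ^ 3 \<Longrightarrow> l < a \<Longrightarrow> k < m \<Longrightarrow> (q * a + l) * m + k < m * (m * m * (a * m))"
proof -
  assume h: "q < m ^ 3" "l < a" "k < m"
  have "q * a + l < (q + 1) * a" using h by simp
  also have "\<dots> \<le> m ^ 3 * a" using h by (intro mult_le_mono1) simp
  finally have 1: "q * a + l + 1 \<le> m ^ 3 * a" by simp
  have "(q * a + l) * m + k < (q * a + l + 1) * m" using h by simp
  also have "\<dots> \<le> m ^ 3 * a * m" using 1 by (rule mult_le_mono1)
  finally show ?thesis by (simp add: eval_nat_numeral mult_ac)
qed

lemma items_bound: "m * (m * m * (a * m)) \<le> m ^ 5"
proof -
  have "m * (m * m * (a * m)) \<le> m * (m * m * (m * m))" using m by (intro mult_le_mono) auto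
  then show ?thesis by (simp add: eval_nat_numeral mult_ac)
qed

lemma ev_eQ:
  assumes "ev N inp A r e = rv" "e 1 < m" "rv < m * m"
  shows "ev N inp A (eQ r) e = e 1 * (m * m) + rv"
proof -
  have mm: "m * m \<le> N" using pow_le_N[of 2] by (simp add: power2_eq_square)
  have b: "e 1 * (m * m) + rv \<le> N" using q_bound[OF assms(2,3)] pow_le_N[of 3] by simp
  have e1: "e 1 \<le> N" using assms(2) mm by (meson le_trans less_imp_le le_square)
  show ?thesis unfolding eQ_def
    by (intro ev_add[OF N1] ev_mul[OF N1] ev_var[OF N1] ev_em assms(1) mm e1) (use b in auto)
qed

lemma ev_eA:
  assumes "ev N inp A q e = qv" "ev N inp A l e = lv" "ev N inp A s e = sv" "ev N inp A i e = iv"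
    "qv < m ^ 3" "lv < m" "sv \<le> m ^ 5" "iv < m"
  shows "ev N inp A (eA q l s i) e = ad qv lv sv iv"
proof -
  note b = ad_bounds[OF assms(5-8)]
  have "m ^ 5 + 1 \<le> m ^ 5 * 2" using m4 by simp
  also have "\<dots> \<le> m ^ 5 * m" using m4 by (intro mult_le_mono2) simp
  also have "\<dots> = m ^ 6" by (simp add: eval_nat_numeral)
  finally have p5: "m ^ 5 + 1 \<le> N" using pow_le_N[of 6] by simp
  have c: "qv * m + lv \<le> N" "(qv * m + lv) * (m ^ 5 + 1) + sv \<le> N" "ad qv lv sv iv \<le> N"
    using b pow_le_N[of 4] pow_le_N[of 10] pow_le_N[of 11] by simp_all
  show ?thesis unfolding eA_def ad_def
    by (intro ev_add[OF N1] ev_mul[OF N1] assms(1-4) ev_em ev_1[OF N1])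
      (use c p5 in \<open>auto simp: ad_def ev_pow[OF N1] ev_em\<close>)
qed

lemma tr_eBit:
  assumes "ev N inp A q e = qv" "ev N inp A l e = lv" "ev N inp A s e = sv" "ev N inp A i e = iv"
    "qv < m ^ 3" "lv < m" "sv \<le> m ^ 5" "iv < m"
  shows "tr N inp A (eBit q l s i) e \<longleftrightarrow> A (ad qv lv sv iv)"
    "ev N inp A (eBit q l s i) e = of_bool (A (ad qv lv sv iv))"
  using ad_N[OF assms(5-8)] unfolding eBit_def tr_at[OF N1] ev_at[OF N1] ev_eA[OF assms] by (simp_all add: att_def)

lemma ev_n1: "ev N inp A (XAdd en X1) e = n + 1"
  using m pow_le_N[of 1] by (intro ev_add[OF N1] ev_en ev_1[OF N1]) simp

lemma tr_eDead:
  assumes "ev N inp A q e = qv" "ev N inp A l e = lv" "ev N inp A s e = sv"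
    "qv < m ^ 3" "lv < m" "sv \<le> m ^ 5"
  shows "tr N inp A (eDead q l s) e \<longleftrightarrow> A (ad qv lv sv (n + 1))"
    "ev N inp A (eDead q l s) e = of_bool (A (ad qv lv sv (n + 1)))"
  unfolding eDead_def using tr_eBit[OF assms(1-3) ev_n1 assms(4-6)] m by auto

definition plus :: "(nat \<Rightarrow> bool) \<Rightarrow> nat \<Rightarrow> nat \<Rightarrow> nat \<Rightarrow> nat" where
  "plus A j r s = card {r'. r' < r \<and> \<not> A (ad (j * (m * m) + r') a s (n + 1)) \<and> \<not> A (ad (j * (m * m) + r') a s n)}"

definition minus :: "(nat \<Rightarrow> bool) \<Rightarrow> nat \<Rightarrow> nat \<Rightarrow> nat \<Rightarrow> nat" where
  "minus A j r s = card {r'. r' < r \<and> \<not> A (ad (j * (m * m) + r') a s (n + 1)) \<and> A (ad (j * (m * m) + r') a s n)}"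

lemma ev_plus_minus:
  assumes s: "\<And>i. ev N inp A s (e(9 := i)) = sv" "sv \<le> m ^ 5" and e: "e 1 < m" "e 2 \<le> m * m"
  shows "ev N inp A (ePlus s) e = plus A (e 1) (e 2) sv" "ev N inp A (eMinus s) e = minus A (e 1) (e 2) sv"
proof -
  have mm: "m * m \<le> N" using pow_le_N[of 2] by (simp add: power2_eq_square)
  have e2: "ev N inp A (XV 2) e = e 2" using e mm by simp
  have q: "ev N inp A (eQ (XV 9)) (e(9 := i)) = e 1 * (m * m) + i" if "i < e 2" for i
    using that e mm by (subst ev_eQ[of A _ _ i]) auto
  have qb: "e 1 * (m * m) + i < m ^ 3" if "i < e 2" for i using that e by (intro q_bound) auto
  have am: "a < m" "n < m" using m by auto
  show "ev N inp A (ePlus s) e = plus A (e 1) (e 2) sv" unfolding ePlus_def plus_def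
    by (intro ev_count[OF N1 e2] ev_mul01[OF N1])
      (simp_all add: ev_not[OF N1] tr_eDead(2)[OF q ev_ea s(1) qb am(1) s(2)] tr_eBit(2)[OF q ev_ea s(1) ev_en qb am(1) s(2) am(2)])
  show "ev N inp A (eMinus s) e = minus A (e 1) (e 2) sv" unfolding eMinus_def minus_def
    by (intro ev_count[OF N1 e2] ev_mul01[OF N1])
      (simp_all add: ev_not[OF N1] tr_eDead(2)[OF q ev_ea s(1) qb am(1) s(2)] tr_eBit(2)[OF q ev_ea s(1) ev_en qb am(1) s(2) am(2)])
qed

definition theta :: "nat \<Rightarrow> nat" where
  "theta s = card {g. g < m \<and> inp (N - 1 - (s * m + g)) = One}"

lemma ev_theta:
  assumes "\<And>g p. ev N inp A s (e(10 := g, 11 := p)) = sv" "sv < m ^ 5"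
  shows "ev N inp A (eTheta s) e = theta sv"
proof -
  have mN: "m \<le> N" using pow_le_N[of 1] by simp
  have b: "sv * m + g < N" if "g < m" for g
  proof -
    have "sv * m + g < (sv + 1) * m" using that by simp
    also have "\<dots> \<le> m ^ 5 * m" using assms(2) by (intro mult_le_mono1) simp
    also have "\<dots> = m ^ 6" by (simp add: eval_nat_numeral)
    finally show ?thesis using pow_le_N[of 6] by simp
  qed
  have u: "ev N inp A (XAdd (XMul s em) (XV 10)) (e(10 := g, 11 := p)) = sv * m + g" if "g < m" for g p
    using b[OF that] that mN by (intro ev_add[OF N1] ev_mul[OF N1] assms ev_em) auto
  have rd: "ev N inp A (XSum 11 XLen (XLt (XAdd (XMul s em) (XV 10)) (XV 11))) (e(10 := g)) = N - 1 - (sv * m + g)" if "g < m" for g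
  proof -
    have "ev N inp A (XSum 11 XLen (XLt (XAdd (XMul s em) (XV 10)) (XV 11))) (e(10 := g)) = card {p. p < N \<and> sv * m + g < p}"
    proof (intro ev_count[OF N1])
      fix p assume p: "p < N"
      show "ev N inp A (XLt (XAdd (XMul s em) (XV 10)) (XV 11)) ((e(10 := g))(11 := p)) = of_bool (sv * m + g < p)"
        unfolding ev_lt[OF N1] u[OF that] using p by simp
    qed simp
    also have "{p. p < N \<and> sv * m + g < p} = {sv * m + g<..<N}" by auto
    finally show ?thesis by (simp only: card_greaterThanLessThan diff_diff_left plus_1_eq_Suc)
  qed
  show ?thesis unfolding eTheta_def theta_def
  proof (rule ev_count[OF N1 ev_em])
    fix g assume g: "g < m"
    show "ev N inp A (XAt 1 (XSum 11 XLen (XLt (XAdd (XMul s em) (XV 10)) (XV 11)))) (e(10 := g)) =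
      of_bool (inp (N - 1 - (sv * m + g)) = One)"
      unfolding ev_at[OF N1] rd[OF g] using b[OF g] by (simp add: att_def)
  qed
qed

text \<open>Example k of the batch can serve as partner: accepted, not discarded, and in agreement
  on block \<open>l\<close>. Acceptance compares natural numbers, with the wrong guesses moved to
  the side of the threshold.\<close>

definition okit :: "(nat \<Rightarrow> bool) \<Rightarrow> nat \<Rightarrow> nat \<Rightarrow> nat \<Rightarrow> nat \<Rightarrow> nat \<Rightarrow> bool" where
  "okit A j r l s k \<longleftrightarrow> (let q = j * (m * m) + r; s' = (q * a + l) * m + k in
     plus A j r s' < theta s' + minus A j r s' \<and> \<not> A (ad q l s' (n + 1)) \<and>
     (\<forall>i<n. l * n \<le> i * a \<and> i * a < l * n + n \<longrightarrow> A (ad q l s i) = A (ad q l s' i)))"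

definition firstit :: "(nat \<Rightarrow> bool) \<Rightarrow> nat \<Rightarrow> nat \<Rightarrow> nat \<Rightarrow> nat \<Rightarrow> nat \<Rightarrow> bool" where
  "firstit A j r l s k \<longleftrightarrow> okit A j r l s k \<and> (\<forall>k'<k. \<not> okit A j r l s k')"

text \<open>At most one k is the first usable one, so the existential over k just looks up the
  partner's bit. Coordinate n + 1 records that the point is or becomes discarded.\<close>

definition upd :: "(nat \<Rightarrow> bool) \<Rightarrow> nat \<Rightarrow> nat \<Rightarrow> nat \<Rightarrow> nat \<Rightarrow> nat \<Rightarrow> bool" where
  "upd A j r l s i \<longleftrightarrow> (let q = j * (m * m) + r in
     if i \<le> n then A (ad q l s i) \<noteq> (\<exists>k<m. firstit A j r l s k \<and> A (ad q l ((q * a + l) * m + k) i))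
     else A (ad q l s (n + 1)) \<or> (\<forall>k<m. \<not> firstit A j r l s k))"

definition init :: "nat \<Rightarrow> nat \<Rightarrow> bool" where
  "init s i \<longleftrightarrow> i \<le> n \<and> inp ((if s < m ^ 5 then P0 + s * (n + 2) else 0) + i) = One"

definition good :: "(nat \<Rightarrow> nat) \<Rightarrow> bool" where
  "good e \<longleftrightarrow> e 1 < m \<and> e 2 < m * m \<and> e 3 < a \<and> e 4 \<le> m ^ 5"

lemma small_N: "m * m \<le> N" "m \<le> N" "a \<le> N" "m ^ 5 \<le> N" "m ^ 5 + 1 \<le> N" "n + 2 \<le> N"
proof -
  show "m * m \<le> N" "m \<le> N" "m ^ 5 \<le> N"
    using pow_le_N[of 2] pow_le_N[of 1] pow_le_N[of 5] by (simp_all add: power2_eq_square)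
  then show "a \<le> N" "n + 2 \<le> N" using m by simp_all
  have "m ^ 5 + 1 \<le> m ^ 5 * 2" using m4 by simp
  also have "\<dots> \<le> m ^ 5 * m" using m4 by (intro mult_le_mono2) simp
  also have "\<dots> = m ^ 6" by (simp add: eval_nat_numeral)
  finally show "m ^ 5 + 1 \<le> N" using pow_le_N[of 6] by simp
qed

lemma ev_Q2: "good e \<Longrightarrow> ev N inp A (eQ (XV 2)) e = e 1 * (m * m) + e 2"
  using small_N by (intro ev_eQ ev_var[OF N1]) (auto simp: good_def)

lemma Q2_bound: "good e \<Longrightarrow> e 1 * (m * m) + e 2 < m ^ 3"
  by (rule q_bound) (auto simp: good_def)

lemma ev_item:
  assumes "good e" "ev N inp A k e = kv" "kv < m"
  shows "ev N inp A (eItem k) e = ((e 1 * (m * m) + e 2) * a + e 3) * m + kv"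
    "((e 1 * (m * m) + e 2) * a + e 3) * m + kv < m ^ 5"
proof -
  have l: "e 3 < a" using assms(1) by (simp add: good_def)
  note ib = item_bound[OF Q2_bound[OF assms(1)] l assms(3)]
  show b: "((e 1 * (m * m) + e 2) * a + e 3) * m + kv < m ^ 5" using ib items_bound by linarith
  have b1: "(e 1 * (m * m) + e 2) * a + e 3 \<le> ((e 1 * (m * m) + e 2) * a + e 3) * m" using m4 by simp
  have e3: "e 3 \<le> N" using l small_N(3) by simp
  show "ev N inp A (eItem k) e = ((e 1 * (m * m) + e 2) * a + e 3) * m + kv"
    unfolding eItem_def
    by (intro ev_add[OF N1] ev_mul[OF N1] ev_Q2 ev_em ev_ea ev_var[OF N1] assms e3)
      (use b b1 small_N(4) in linarith)+
qed

text \<open>The expression \<open>k\<close> for the item number has to be insensitive to the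
  variables bound inside, 8 to 11, since it is evaluated under their binders.\<close>

lemma ev_ok:
  assumes g: "good e" and k: "\<And>x i. x \<in> {8, 9, 10, 11} \<Longrightarrow> ev N inp A k (e(x := i)) = kv"
    "\<And>i j. ev N inp A k (e(10 := i, 11 := j)) = kv" "ev N inp A k e = kv" "kv < m"
  shows "tr N inp A (eOk k) e \<longleftrightarrow> okit A (e 1) (e 2) (e 3) (e 4) kv"
    "ev N inp A (eOk k) e = of_bool (okit A (e 1) (e 2) (e 3) (e 4) kv)"
proof -
  let ?q = "e 1 * (m * m) + e 2"
  let ?s = "(?q * a + e 3) * m + kv"
  have gx: "good (e(x := i))" if "x \<ge> 5" for x i using g that by (simp add: good_def)
  have gxy: "good (e(x := i, y := j))" if "x \<ge> 5" "y \<ge> 5" for x i y j using g that by (simp add: good_def)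
  have it: "ev N inp A (eItem k) e = ?s" and sb: "?s < m ^ 5" using ev_item[OF g k(3,4)] by auto
  have it9: "ev N inp A (eItem k) (e(x := i)) = ?s" if "x \<in> {8, 9, 10, 11}" for x i
  proof -
    have "good (e(x := i))" using that by (intro gx) auto
    then show ?thesis using ev_item(1)[OF _ k(1)[OF that] k(4)] that by auto
  qed
  have it10: "ev N inp A (eItem k) (e(10 := i, 11 := j)) = ?s" for i j
    using ev_item(1)[OF gxy[of 10 11 i j] k(2,4)] by simp
  have e12: "e 1 < m" "e 2 \<le> m * m" "e 3 < a" "e 3 < m" "e 4 \<le> m ^ 5" using g m by (auto simp: good_def)
  have pm: "ev N inp A (ePlus (eItem k)) e = plus A (e 1) (e 2) ?s" "ev N inp A (eMinus (eItem k)) e = minus A (e 1) (e 2) ?s"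
    using it9[of 9] sb e12 by (intro ev_plus_minus; simp)+
  have th: "ev N inp A (eTheta (eItem k)) e = theta ?s" by (rule ev_theta[OF it10 sb])
  have "theta ?s \<le> card {..<m}" unfolding theta_def by (rule card_mono) auto
  moreover have "minus A (e 1) (e 2) ?s \<le> card {..<e 2}" unfolding minus_def by (rule card_mono) auto
  ultimately have "theta ?s + minus A (e 1) (e 2) ?s \<le> m + m * m" using e12 by simp
  also have "\<dots> \<le> 2 * (m * m)" using le_square[of m] by simp
  also have "\<dots> \<le> m * (m * m)" using m4 by (intro mult_le_mono1) simp
  also have "\<dots> \<le> N" using pow_le_N[of 3] by (simp add: eval_nat_numeral)
  finally have sum: "ev N inp A (XAdd (eTheta (eItem k)) (eMinus (eItem k))) e = theta ?s + minus A (e 1) (e 2) ?s"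
    by (intro ev_add[OF N1] th pm(2))
  have e3v: "ev N inp A (XV 3) e = e 3" using e12 small_N by simp
  have dead: "tr N inp A (eDead (eQ (XV 2)) (XV 3) (eItem k)) e \<longleftrightarrow> A (ad ?q (e 3) ?s (n + 1))"
    by (rule tr_eDead(1)[OF ev_Q2[OF g] e3v it Q2_bound[OF g] e12(4)]) (use sb in simp)
  have blk: "tr N inp A (XAdd (eNot (XMul (eNot (XLt (XMul (XV 8) ea) (XMul (XV 3) en))) (XLt (XMul (XV 8) ea) (XAdd (XMul (XV 3) en) en))))
         (eNot (eXor (eBit (eQ (XV 2)) (XV 3) (XV 4) (XV 8)) (eBit (eQ (XV 2)) (XV 3) (eItem k) (XV 8))))) (e(8 := i))
     \<longleftrightarrow> (e 3 * n \<le> i * a \<and> i * a < e 3 * n + n \<longrightarrow> A (ad ?q (e 3) (e 4) i) = A (ad ?q (e 3) ?s i))" if i: "i < n" for i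
  proof -
    let ?e = "e(8 := i)"
    have iN: "i < m" "i \<le> N" "i * a \<le> N" "e 3 * n + n \<le> N"
    proof -
      show im: "i < m" using i m by simp
      then show "i \<le> N" using small_N(2) by simp
      have "i * a \<le> m * m" using im m by (intro mult_le_mono) auto
      then show "i * a \<le> N" using small_N(1) by simp
      have "e 3 * n + n = (e 3 + 1) * n" by simp
      also have "\<dots> \<le> m * m" using e12(4) m by (intro mult_le_mono) auto
      finally show "e 3 * n + n \<le> N" using small_N(1) by simp
    qed
    have v: "ev N inp A (XV 3) ?e = e 3" "ev N inp A (XV 4) ?e = e 4" "ev N inp A (XV 8) ?e = i"
      using e12 small_N iN by simp_all
    have ia: "ev N inp A (XMul (XV 8) ea) ?e = i * a" by (intro ev_mul[OF N1] v ev_ea iN)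
    have ln: "ev N inp A (XMul (XV 3) en) ?e = e 3 * n" using iN by (intro ev_mul[OF N1] v ev_en) simp
    have lnn: "ev N inp A (XAdd (XMul (XV 3) en) en) ?e = e 3 * n + n" by (intro ev_add[OF N1] ln ev_en iN)
    have q: "ev N inp A (eQ (XV 2)) ?e = ?q" using ev_Q2[OF gx[of 8 i]] by simp
    have b1: "tr N inp A (eBit (eQ (XV 2)) (XV 3) (XV 4) (XV 8)) ?e \<longleftrightarrow> A (ad ?q (e 3) (e 4) i)"
      by (rule tr_eBit(1)[OF q v Q2_bound[OF g] e12(4,5) iN(1)])
    have b2: "tr N inp A (eBit (eQ (XV 2)) (XV 3) (eItem k) (XV 8)) ?e \<longleftrightarrow> A (ad ?q (e 3) ?s i)"
      by (rule tr_eBit(1)[OF q v(1) it9 v(3) Q2_bound[OF g] e12(4) _ iN(1)]) (use sb in auto)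
    show ?thesis unfolding tr_add[OF N1] tr_not[OF N1] tr_mul[OF N1] tr_lt[OF N1] tr_xor[OF N1] ia ln lnn b1 b2
      by (auto simp: not_less)
  qed
  show 1: "tr N inp A (eOk k) e \<longleftrightarrow> okit A (e 1) (e 2) (e 3) (e 4) kv"
    unfolding eOk_def tr_mul[OF N1] tr_lt[OF N1] tr_not[OF N1] tr_all[OF N1] pm(1) sum dead ev_en okit_def Let_def
    using blk by auto
  have "\<exists>p. ev N inp A (eOk k) e = of_bool p"
    unfolding eOk_def eAll_def
    by (rule exI, rule ev_mul01[OF N1], rule ev_lt[OF N1], rule ev_mul01[OF N1], rule ev_not[OF N1], rule ev_not[OF N1])
  then show "ev N inp A (eOk k) e = of_bool (okit A (e 1) (e 2) (e 3) (e 4) kv)"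
    using 1 by (elim exE) (simp only:, simp)
qed

end

lemma find_map_filter:
  shows "(\<And>i. i < length us \<Longrightarrow> \<not> (\<exists>w. \<phi> (us ! i) = Some w \<and> Q w)) \<Longrightarrow> find Q (List.map_filter \<phi> us) = None"
    and "k < length us \<Longrightarrow> \<phi> (us ! k) = Some w \<Longrightarrow> Q w \<Longrightarrow> (\<And>i. i < k \<Longrightarrow> \<not> (\<exists>w. \<phi> (us ! i) = Some w \<and> Q w)) \<Longrightarrow>
      find Q (List.map_filter \<phi> us) = Some w"
proof -
  show "(\<And>i. i < length us \<Longrightarrow> \<not> (\<exists>w. \<phi> (us ! i) = Some w \<and> Q w)) \<Longrightarrow> find Q (List.map_filter \<phi> us) = None"
  proof (induction us)
    case (Cons u us)
    have "find Q (List.map_filter \<phi> us) = None" using Cons.prems[of "Suc i" for i] by (intro Cons.IH) auto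
    then show ?case using Cons.prems[of 0] by (auto simp: map_filter_simps split: option.splits)
  qed (simp add: map_filter_simps)
  show "k < length us \<Longrightarrow> \<phi> (us ! k) = Some w \<Longrightarrow> Q w \<Longrightarrow> (\<And>i. i < k \<Longrightarrow> \<not> (\<exists>w. \<phi> (us ! i) = Some w \<and> Q w)) \<Longrightarrow>
      find Q (List.map_filter \<phi> us) = Some w"
  proof (induction us arbitrary: k)
    case (Cons u us)
    show ?case
    proof (cases k)
      case 0 then show ?thesis using Cons.prems by (simp add: map_filter_simps)
    next
      case (Suc k')
      have "find Q (List.map_filter \<phi> us) = Some w"
        using Cons.prems(1-3) Cons.prems(4)[of "Suc i" for i] by (intro Cons.IH[of k']) (auto simp: Suc)
      then show ?thesis using Cons.prems(4)[of 0] Suc by (auto simp: map_filter_simps split: option.splits)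
    qed
  qed simp
qed

lemma card_less_Suc_pred: "card {k. k < Suc r \<and> Q k} = card {k. k < r \<and> Q k} + of_bool (Q r)"
proof -
  have "{k. k < Suc r \<and> Q k} = {k. k < r \<and> Q k} \<union> (if Q r then {r} else {})" by (auto simp: less_Suc_eq)
  then show ?thesis by auto
qed

context code_run
begin

lemma tr_first:
  assumes g: "good e" and k: "e 6 < m"
  shows "tr N inp A eFirst e \<longleftrightarrow> firstit A (e 1) (e 2) (e 3) (e 4) (e 6)"
proof -
  have 6: "e 6 \<le> N" using k small_N by simp
  have ok6: "tr N inp A (eOk (XV 6)) e \<longleftrightarrow> okit A (e 1) (e 2) (e 3) (e 4) (e 6)"
    by (rule ev_ok(1)[OF g]) (use 6 k in auto)
  have ok7: "tr N inp A (eOk (XV 7)) (e(7 := i)) \<longleftrightarrow> okit A (e 1) (e 2) (e 3) (e 4) i" if "i < e 6" for i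
  proof -
    have g7: "good (e(7 := i))" using g by (simp add: good_def)
    have "tr N inp A (eOk (XV 7)) (e(7 := i)) \<longleftrightarrow>
        okit A ((e(7 := i)) 1) ((e(7 := i)) 2) ((e(7 := i)) 3) ((e(7 := i)) 4) i"
      by (rule ev_ok(1)[OF g7]) (use that 6 k in auto)
    then show ?thesis by simp
  qed
  have "ev N inp A (XV 6) e = e 6" using 6 by simp
  then show ?thesis unfolding eFirst_def tr_mul[OF N1] tr_not[OF N1] tr_sum[OF N1] ok6 firstit_def using ok7 by auto
qed

lemma tr_upd:
  assumes g: "good e" and i: "e 5 \<le> n + 1"
  shows "tr N inp A eUpd e \<longleftrightarrow> upd A (e 1) (e 2) (e 3) (e 4) (e 5)"
proof -
  let ?q = "e 1 * (m * m) + e 2"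
  have e: "e 3 < m" "e 4 \<le> m ^ 5" "e 5 < m" "e 3 \<le> N" "e 4 \<le> N" "e 5 \<le> N"
    using g i m small_N by (auto simp: good_def)
  have v: "ev N inp A (XV 3) e = e 3" "ev N inp A (XV 4) e = e 4" "ev N inp A (XV 5) e = e 5" using e by simp_all
  have n1: "ev N inp A (XAdd en X1) e = n + 1" by (rule ev_n1)
  have g6: "good (e(6 := k))" for k using g by (simp add: good_def)
  have b: "tr N inp A (eBit (eQ (XV 2)) (XV 3) (XV 4) (XV 5)) e \<longleftrightarrow> A (ad ?q (e 3) (e 4) (e 5))"
    by (rule tr_eBit(1)[OF ev_Q2[OF g] v Q2_bound[OF g] e(1-3)])
  have d: "tr N inp A (eDead (eQ (XV 2)) (XV 3) (XV 4)) e \<longleftrightarrow> A (ad ?q (e 3) (e 4) (n + 1))"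
    by (rule tr_eDead(1)[OF ev_Q2[OF g] v(1,2) Q2_bound[OF g] e(1,2)])
  have f: "tr N inp A eFirst (e(6 := k)) \<longleftrightarrow> firstit A (e 1) (e 2) (e 3) (e 4) k" if "k < m" for k
    using tr_first[OF g6[of k], of A] that by simp
  have bk: "tr N inp A (eBit (eQ (XV 2)) (XV 3) (eItem (XV 6)) (XV 5)) (e(6 := k)) \<longleftrightarrow> A (ad ?q (e 3) ((?q * a + e 3) * m + k) (e 5))"
    if k: "k < m" for k
  proof -
    let ?e = "e(6 := k)"
    have k6: "ev N inp A (XV 6) ?e = k" using k small_N by simp
    have it: "ev N inp A (eItem (XV 6)) ?e = (?q * a + e 3) * m + k" "(?q * a + e 3) * m + k < m ^ 5"
      using ev_item[OF g6 k6 k] by simp_all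
    have q: "ev N inp A (eQ (XV 2)) ?e = ?q" using ev_Q2[OF g6[of k]] by simp
    have v': "ev N inp A (XV 3) ?e = e 3" "ev N inp A (XV 5) ?e = e 5" using e by simp_all
    show ?thesis by (rule tr_eBit(1)[OF q v'(1) it(1) v'(2) Q2_bound[OF g] e(1) _ e(3)]) (use it(2) in simp)
  qed
  have i': "e 5 < n + 1 \<longleftrightarrow> e 5 \<le> n" by auto
  have S1: "tr N inp A (XSum 6 em (XMul eFirst (eBit (eQ (XV 2)) (XV 3) (eItem (XV 6)) (XV 5)))) e \<longleftrightarrow>
     (\<exists>k<m. firstit A (e 1) (e 2) (e 3) (e 4) k \<and> A (ad ?q (e 3) ((?q * a + e 3) * m + k) (e 5)))"
    unfolding tr_sum[OF N1] ev_em tr_mul[OF N1] by (intro ex_cong1 conj_cong refl) (simp_all only: f bk)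
  have S2: "tr N inp A (XSum 6 em eFirst) e \<longleftrightarrow> (\<exists>k<m. firstit A (e 1) (e 2) (e 3) (e 4) k)"
    unfolding tr_sum[OF N1] ev_em by (intro ex_cong1 conj_cong refl) (simp only: f)
  show ?thesis
    unfolding eUpd_def tr_add[OF N1] tr_mul[OF N1, of _ _ "XLt (XV 5) (XAdd en X1)"] tr_mul[OF N1, of _ _ "eNot (XLt (XV 5) (XAdd en X1))"]
      tr_lt[OF N1] tr_xor[OF N1] tr_not[OF N1] S1 S2 n1 v(3) b d upd_def Let_def i'
    by auto
qed

lemma tr_init:
  assumes "e 4 \<le> m ^ 5" "e 5 \<le> n + 1"
  shows "tr N inp A eInit e \<longleftrightarrow> init (e 4) (e 5)"
proof -
  let ?s = "e 4" and ?i = "e 5"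
  have sN: "?s \<le> N" "?i \<le> N" using assms small_N by auto
  have v: "ev N inp A (XV 4) e = ?s" "ev N inp A (XV 5) e = ?i" using sN by simp_all
  have n1: "ev N inp A (XAdd en X1) e = n + 1" by (rule ev_n1)
  have n2: "ev N inp A (XAdd en (XAdd X1 X1)) e = n + 2"
    using small_N(6) by (intro ev_add[OF N1] ev_en) (auto intro!: ev_add[OF N1] ev_1[OF N1])
  have p5: "ev N inp A (epow em 5) e = m ^ 5" using small_N by (simp add: ev_pow[OF N1] ev_em)
  have le: "P0 + (?s + 1) * (n + 2) \<le> N"
  proof -
    have "(?s + 1) * (n + 2) \<le> (m ^ 5 + 1) * (n + 2)" using assms by (intro mult_le_mono1) simp
    then show ?thesis using fit by linarith
  qed
  have sn: "P0 + ?s * (n + 2) \<le> N" "?s * (n + 2) \<le> N" using le by simp_all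
  have pos: "ev N inp A (XAdd eP (XMul (XV 4) (XAdd en (XAdd X1 X1)))) e = P0 + ?s * (n + 2)"
    by (intro ev_add[OF N1] ev_mul[OF N1] ev_eP v n2 sn)
  have lt: "ev N inp A (XLt (XV 4) (epow em 5)) e = of_bool (?s < m ^ 5)"
    unfolding ev_lt[OF N1] v p5 ..
  have mul: "ev N inp A (XMul (XLt (XV 4) (epow em 5)) (XAdd eP (XMul (XV 4) (XAdd en (XAdd X1 X1))))) e =
    of_bool (?s < m ^ 5) * (P0 + ?s * (n + 2))"
    using sn by (intro ev_mul[OF N1] lt pos) simp
  have addr: "ev N inp A (XAdd (XMul (XLt (XV 4) (epow em 5)) (XAdd eP (XMul (XV 4) (XAdd en (XAdd X1 X1))))) (XV 5)) e =
    of_bool (?s < m ^ 5) * (P0 + ?s * (n + 2)) + ?i"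
    using le assms by (intro ev_add[OF N1] mul v(2)) auto
  have "of_bool (?s < m ^ 5) * (P0 + ?s * (n + 2)) + ?i < N" if "?i \<le> n"
    using le that by auto
  then show ?thesis
    unfolding eInit_def tr_mul[OF N1] tr_lt[OF N1] tr_at[OF N1] addr n1 v(2) init_def by (auto simp: att_def)
qed

lemma tr_body:
  assumes t: "t < N"
  shows "tr N inp A eBody (\<lambda>_. t) \<longleftrightarrow> (\<exists>j<m. \<exists>r<m * m. \<exists>s<m ^ 5 + 1. \<exists>i<n + 2.
     (t = ad (j * (m * m) + r) 0 s i \<and> init s i) \<or>
     (\<exists>l<a. t = ad (j * (m * m) + r) (l + 1) s i \<and> upd A j r l s i))"
proof -
  have mm: "ev N inp A (XMul em em) e = m * m" for e by (intro ev_mul[OF N1] ev_em small_N)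
  have s5: "ev N inp A (XAdd (epow em 5) X1) e = m ^ 5 + 1" for e
    using small_N by (intro ev_add[OF N1] ev_1[OF N1]) (simp_all add: ev_pow[OF N1] ev_em)
  have n2: "ev N inp A (XAdd en (XAdd X1 X1)) e = n + 2" for e
    using small_N(6) by (intro ev_add[OF N1] ev_en) (auto intro!: ev_add[OF N1] ev_1[OF N1])
  have main: "tr N inp A (XAdd (XMul (eEq (XV 0) (eA (eQ (XV 2)) (XLt X1 X1) (XV 4) (XV 5))) eInit)
       (XSum 3 ea (XMul (eEq (XV 0) (eA (eQ (XV 2)) (XAdd (XV 3) X1) (XV 4) (XV 5))) eUpd))) ((\<lambda>_. t)(1 := j, 2 := r, 4 := s, 5 := i))
     \<longleftrightarrow> (t = ad (j * (m * m) + r) 0 s i \<and> init s i) \<or> (\<exists>l<a. t = ad (j * (m * m) + r) (l + 1) s i \<and> upd A j r l s i)"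
    if h: "j < m" "r < m * m" "s < m ^ 5 + 1" "i < n + 2" for j r s i
  proof -
    let ?e = "(\<lambda>_. t)(1 := j, 2 := r, 4 := s, 5 := i)"
    have b: "r \<le> N" "s \<le> N" "i \<le> N" "i < m" "s \<le> m ^ 5" using h small_N m by auto
    have qb: "j * (m * m) + r < m ^ 3" using h by (intro q_bound)
    have q: "ev N inp A (eQ (XV 2)) ?e = j * (m * m) + r" using h b by (subst ev_eQ[of A "XV 2" ?e r]) auto
    have v: "ev N inp A (XV 0) ?e = t" "ev N inp A (XV 4) ?e = s" "ev N inp A (XV 5) ?e = i" using b t by simp_all
    have z: "ev N inp A (XLt X1 X1) ?e = 0" by simp
    have a0: "ev N inp A (eA (eQ (XV 2)) (XLt X1 X1) (XV 4) (XV 5)) ?e = ad (j * (m * m) + r) 0 s i"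
      by (rule ev_eA[OF q z v(2,3) qb _ b(5,4)]) (use m in simp)
    have i0: "tr N inp A eInit ?e \<longleftrightarrow> init s i" using tr_init[of ?e A] h by simp
    have l: "tr N inp A (XMul (eEq (XV 0) (eA (eQ (XV 2)) (XAdd (XV 3) X1) (XV 4) (XV 5))) eUpd) (?e(3 := l)) \<longleftrightarrow>
       t = ad (j * (m * m) + r) (l + 1) s i \<and> upd A j r l s i" if l: "l < a" for l
    proof -
      let ?f = "?e(3 := l)"
      have g: "good ?f" using h l by (simp add: good_def)
      have lN: "l + 1 \<le> N" "l + 1 < m" using l m small_N by auto
      have q': "ev N inp A (eQ (XV 2)) ?f = j * (m * m) + r" using ev_Q2[OF g] by simp
      have v': "ev N inp A (XV 0) ?f = t" "ev N inp A (XV 4) ?f = s" "ev N inp A (XV 5) ?f = i" using b t by simp_all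
      have l1: "ev N inp A (XAdd (XV 3) X1) ?f = l + 1" using lN by (intro ev_add[OF N1] ev_1[OF N1]) auto
      have a1: "ev N inp A (eA (eQ (XV 2)) (XAdd (XV 3) X1) (XV 4) (XV 5)) ?f = ad (j * (m * m) + r) (l + 1) s i"
        by (rule ev_eA[OF q' l1 v'(2,3) qb lN(2) b(5,4)])
      have "tr N inp A eUpd ?f \<longleftrightarrow> upd A j r l s i" using tr_upd[OF g, of A] h by simp
      then show ?thesis unfolding tr_mul[OF N1] tr_eq[OF N1] a1 v'(1) by simp
    qed
    show ?thesis unfolding tr_add[OF N1] tr_mul[OF N1, of _ _ _ eInit] tr_eq[OF N1] tr_sum[OF N1] a0 v(1) i0 ev_ea
      using l by auto
  qed
  show ?thesis unfolding eBody_def tr_sum[OF N1] ev_em mm s5 n2 using main by (simp only: cong: conj_cong)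
qed

abbreviation Mem :: "nat \<Rightarrow> bool" where "Mem \<equiv> memo N inp eBody N"

text \<open>The update reads the current level of its own round and the final level of earlier
  rounds of the same run, all at addresses below level l + 1. Hence the partly filled table gives
  the same result as the complete one.\<close>

lemma upd_cong:
  assumes eq: "\<And>u. u < ad (j * (m * m) + r) (l + 1) 0 0 \<Longrightarrow> A u = A' u"
    and h: "j < m" "r < m * m" "l < a" "s \<le> m ^ 5" "i \<le> n + 1"
  shows "upd A j r l s i = upd A' j r l s i"
proof -
  let ?q = "j * (m * m) + r"
  have cur: "A (ad ?q l s' i') = A' (ad ?q l s' i')" if "s' \<le> m ^ 5" "i' \<le> n + 1" for s' i'
    by (rule eq, rule ad_less) (use that m in auto)
  have old: "A (ad (j * (m * m) + r') a s' i') = A' (ad (j * (m * m) + r') a s' i')"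
    if "r' < r" "s' \<le> m ^ 5" "i' \<le> n + 1" for r' s' i'
  proof (rule eq, rule ad_less)
    have "(j * (m * m) + r') * m + a < (j * (m * m) + r' + 1) * m" using m by simp
    also have "\<dots> \<le> ?q * m" using that(1) by (intro mult_le_mono1) simp
    finally show "(j * (m * m) + r') * m + a < ?q * m + (l + 1)" by simp
  qed (use that m in auto)
  have it: "(?q * a + l) * m + k \<le> m ^ 5" if "k < m" for k
    using item_bound[OF q_bound[OF h(1,2)] h(3) that] items_bound by linarith
  have pm: "plus A j r s' = plus A' j r s'" "minus A j r s' = minus A' j r s'" if "s' \<le> m ^ 5" for s'
    unfolding plus_def minus_def using old that by (auto intro!: arg_cong[where f = card])
  have ok: "okit A j r l s k = okit A' j r l s k" if "k < m" for k
    unfolding okit_def Let_def using pm[OF it[OF that]] cur[OF it[OF that]] cur[OF h(4)] by auto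
  have fi: "firstit A j r l s k = firstit A' j r l s k" if "k < m" for k
    unfolding firstit_def using ok that by auto
  show ?thesis unfolding upd_def Let_def using fi cur[OF it] cur[OF h(4)] h(5) by auto
qed

text \<open>Addresses with level digit 0 match only the first disjunct of the table body, the others
  having level digit at least 1.\<close>

lemma Mem_init:
  assumes "j < m" "r < m * m" "s \<le> m ^ 5" "i \<le> n + 1"
  shows "Mem (ad (j * (m * m) + r) 0 s i) \<longleftrightarrow> init s i"
proof -
  let ?t = "ad (j * (m * m) + r) 0 s i"
  have im: "i < m" using assms m by simp
  have tN: "?t < N" using assms m by (intro ad_N q_bound) auto
  have inj: "?t = ad (j' * (m * m) + r') l' s' i' \<longleftrightarrow> j' * (m * m) + r' = j * (m * m) + r \<and> l' = 0 \<and> s' = s \<and> i' = i"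
    if "l' < m" "s' < m ^ 5 + 1" "i' < n + 2" for j' r' l' s' i'
    using ad_inj[of "j * (m * m) + r" 0 s i "j' * (m * m) + r'" l' s' i'] that assms m im by auto
  have "Mem ?t \<longleftrightarrow> tr N inp (memo N inp eBody ?t) eBody (\<lambda>_. ?t)" using memo_at[OF tN] by simp
  also have "\<dots> \<longleftrightarrow> init s i"
    unfolding tr_body[OF tN]
  proof
    assume "init s i"
    then show "\<exists>j'<m. \<exists>r'<m * m. \<exists>s'<m ^ 5 + 1. \<exists>i'<n + 2. (?t = ad (j' * (m * m) + r') 0 s' i' \<and> init s' i') \<or>
       (\<exists>l<a. ?t = ad (j' * (m * m) + r') (l + 1) s' i' \<and> upd (memo N inp eBody ?t) j' r' l s' i')"
      using assms by (intro exI[of _ j] exI[of _ r] exI[of _ s] exI[of _ i] conjI disjI1) auto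
  next
    assume "\<exists>j'<m. \<exists>r'<m * m. \<exists>s'<m ^ 5 + 1. \<exists>i'<n + 2. (?t = ad (j' * (m * m) + r') 0 s' i' \<and> init s' i') \<or>
       (\<exists>l<a. ?t = ad (j' * (m * m) + r') (l + 1) s' i' \<and> upd (memo N inp eBody ?t) j' r' l s' i')"
    then obtain j' r' s' i' where h: "j' < m" "r' < m * m" "s' < m ^ 5 + 1" "i' < n + 2"
      "(?t = ad (j' * (m * m) + r') 0 s' i' \<and> init s' i') \<or>
       (\<exists>l<a. ?t = ad (j' * (m * m) + r') (l + 1) s' i' \<and> upd (memo N inp eBody ?t) j' r' l s' i')" by blast
    from h(5) show "init s i"
    proof
      assume "?t = ad (j' * (m * m) + r') 0 s' i' \<and> init s' i'"
      then show ?thesis using inj[of 0 s' i' j' r'] h(1-4) m by auto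
    next
      assume "\<exists>l<a. ?t = ad (j' * (m * m) + r') (l + 1) s' i' \<and> upd (memo N inp eBody ?t) j' r' l s' i'"
      then obtain l where l: "l < a" "?t = ad (j' * (m * m) + r') (l + 1) s' i'" by blast
      then have "l + 1 < m" using m by simp
      then show ?thesis using inj[of "l + 1" s' i' j' r'] h(1-4) l by auto
    qed
  qed
  finally show ?thesis .
qed

text \<open>The digits of the address are unique, so the search in the table body finds this update
  alone, and \<open>upd_cong\<close> replaces the partial table by the final one.\<close>

lemma Mem_step:
  assumes h: "j < m" "r < m * m" "l < a" "s \<le> m ^ 5" "i \<le> n + 1"
  shows "Mem (ad (j * (m * m) + r) (l + 1) s i) \<longleftrightarrow> upd Mem j r l s i"
proof -
  let ?t = "ad (j * (m * m) + r) (l + 1) s i"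
  let ?M = "memo N inp eBody ?t"
  have im: "i < m" "l + 1 < m" using h m by simp_all
  have tN: "?t < N" using h im by (intro ad_N q_bound) auto
  have digit: "j' = j \<and> r' = r" if "j' * (m * m) + r' = j * (m * m) + r" "r' < m * m" for j' r'
  proof -
    have gen: "(x * b + y) div b = x" if "y < b" for x y b :: nat using that by simp
    have "(j' * (m * m) + r') div (m * m) = j'" "(j * (m * m) + r) div (m * m) = j"
      by (rule gen, fact that(2), rule gen, fact h(2))
    then show ?thesis using that(1) by simp
  qed
  have inj: "j' = j \<and> r' = r \<and> l' = l + 1 \<and> s' = s \<and> i' = i"
    if "?t = ad (j' * (m * m) + r') l' s' i'" "l' < m" "s' < m ^ 5 + 1" "i' < n + 2" "r' < m * m" for j' r' l' s' i'
  proof -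
    have "s' \<le> m ^ 5" "i' < m" using that(3,4) m by simp_all
    from ad_inj[OF that(1) im(2) that(2) h(4) this(1) im(1) this(2)] digit[of j' r'] that(5)
    show ?thesis by simp
  qed
  have "Mem ?t \<longleftrightarrow> tr N inp ?M eBody (\<lambda>_. ?t)" using memo_at[OF tN] by simp
  also have "\<dots> \<longleftrightarrow> upd ?M j r l s i"
    unfolding tr_body[OF tN]
  proof
    assume "upd ?M j r l s i"
    then show "\<exists>j'<m. \<exists>r'<m * m. \<exists>s'<m ^ 5 + 1. \<exists>i'<n + 2. (?t = ad (j' * (m * m) + r') 0 s' i' \<and> init s' i') \<or>
       (\<exists>l<a. ?t = ad (j' * (m * m) + r') (l + 1) s' i' \<and> upd ?M j' r' l s' i')"
      using h by (intro exI[of _ j] exI[of _ r] exI[of _ s] exI[of _ i] conjI disjI2 exI[of _ l]) auto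
  next
    assume "\<exists>j'<m. \<exists>r'<m * m. \<exists>s'<m ^ 5 + 1. \<exists>i'<n + 2. (?t = ad (j' * (m * m) + r') 0 s' i' \<and> init s' i') \<or>
       (\<exists>l<a. ?t = ad (j' * (m * m) + r') (l + 1) s' i' \<and> upd ?M j' r' l s' i')"
    then obtain j' r' s' i' where k: "j' < m" "r' < m * m" "s' < m ^ 5 + 1" "i' < n + 2"
      "(?t = ad (j' * (m * m) + r') 0 s' i' \<and> init s' i') \<or>
       (\<exists>l<a. ?t = ad (j' * (m * m) + r') (l + 1) s' i' \<and> upd ?M j' r' l s' i')" by blast
    from k(5) show "upd ?M j r l s i"
    proof
      assume "?t = ad (j' * (m * m) + r') 0 s' i' \<and> init s' i'"
      then show ?thesis using inj[of j' r' 0 s' i'] k(2-4) m(3) im(2) by linarith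
    next
      assume "\<exists>l<a. ?t = ad (j' * (m * m) + r') (l + 1) s' i' \<and> upd ?M j' r' l s' i'"
      then obtain l' where l: "l' < a" "?t = ad (j' * (m * m) + r') (l' + 1) s' i'" "upd ?M j' r' l' s' i'" by blast
      then have "l' + 1 < m" using m by simp
      then have "j' = j \<and> r' = r \<and> l' + 1 = l + 1 \<and> s' = s \<and> i' = i"
        using inj[of j' r' "l' + 1" s' i'] k(2-4) l(2) by blast
      then show ?thesis using l(3) by simp
    qed
  qed
  also have "\<dots> \<longleftrightarrow> upd Mem j r l s i"
  proof (rule upd_cong[OF _ h])
    fix u assume "u < ad (j * (m * m) + r) (l + 1) 0 0"
    also have "\<dots> \<le> ?t" by (simp add: ad_def add_mult_distrib)
    finally show "?M u = Mem u" using tN by (intro memo_below) auto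
  qed
  finally show ?thesis .
qed

end

lemma chunk_map_upt:
  assumes "(i + 1) * k \<le> len" "(b + 1) * len \<le> M"
  shows "chunk k i (chunk len b (map f [0..<M])) = map f [b * len + i * k..<b * len + i * k + k]"
proof -
  have 1: "b * len + len \<le> M" "i * k + k \<le> len" using assms by simp_all
  have "chunk len b (map f [0..<M]) = map f [b * len..<b * len + len]"
    unfolding chunk_def drop_map take_map drop_upt using 1 by (simp add: take_upt)
  then show ?thesis
    unfolding chunk_def using 1 by (simp add: drop_map take_map drop_upt take_upt)
qed

text \<open>Ties the input string to the objects of the analysis: the point to be classified at the
  front, labelled examples from \<open>P0\<close> on, thresholds as counts of ones.\<close>

locale code_spec = code_run +
  fixes it :: "nat \<Rightarrow> item" and x :: "bool list"
  assumes x: "length x = n" "\<And>i. i < n \<Longrightarrow> inp i = One \<longleftrightarrow> x ! i" "inp n \<noteq> One"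
    and it_len: "\<And>s. s < m ^ 5 \<Longrightarrow> length (fst (it s)) = Suc n"
    and it_bit: "\<And>s i. s < m ^ 5 \<Longrightarrow> i \<le> n \<Longrightarrow> inp (P0 + s * (n + 2) + i) = One \<longleftrightarrow> fst (it s) ! i"
    and it_theta: "\<And>s. s < m ^ 5 \<Longrightarrow> snd (it s) = theta s"
begin

definition point :: "nat \<Rightarrow> bool list" where
  "point s = (if s < m ^ 5 then fst (it s) else x @ [False])"

lemma length_point: "length (point s) = Suc n"
  by (simp add: point_def it_len x)

lemma init_point: "i \<le> n \<Longrightarrow> init s i \<longleftrightarrow> point s ! i"
  using x it_bit[of s i] by (auto simp: init_def point_def nth_append le_less)

text \<open>Decodes a stretch of the table into what \<open>reduce\<close> returns, the mark at
  coordinate n + 1 standing for \<open>None\<close>.\<close>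

definition repr :: "nat \<Rightarrow> nat \<Rightarrow> nat \<Rightarrow> bool list option" where
  "repr q l s = (if Mem (ad q l s (n + 1)) then None else Some (map (\<lambda>i. Mem (ad q l s i)) [0..<Suc n]))"

definition batch :: "nat \<Rightarrow> nat \<Rightarrow> nat \<Rightarrow> item list" where
  "batch j r l = chunk m (r * a + l) (chunk (m * m * (a * m)) j (map it [0..<m * (m * m * (a * m))]))"

lemma batch_eq:
  assumes "j < m" "r < m * m" "l < a"
  shows "batch j r l = map (\<lambda>k. it (((j * (m * m) + r) * a + l) * m + k)) [0..<m]"
proof -
  have "r * a + l + 1 \<le> (r + 1) * a" using assms(3) by simp
  also have "\<dots> \<le> m * m * a" using assms(2) by (intro mult_le_mono1) simp
  finally have "(r * a + l + 1) * m \<le> m * m * a * m" by (rule mult_le_mono1)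
  moreover have "(j + 1) * (m * m * (a * m)) \<le> m * (m * m * (a * m))" using assms(1) by (intro mult_le_mono1) simp
  ultimately have "batch j r l = map it [j * (m * m * (a * m)) + (r * a + l) * m..<j * (m * m * (a * m)) + (r * a + l) * m + m]"
    unfolding batch_def by (intro chunk_map_upt) (simp_all add: mult.assoc)
  also have "j * (m * m * (a * m)) + (r * a + l) * m = ((j * (m * m) + r) * a + l) * m"
    by (simp add: algebra_simps)
  also have "[((j * (m * m) + r) * a + l) * m..<((j * (m * m) + r) * a + l) * m + m]
      = map (\<lambda>k. ((j * (m * m) + r) * a + l) * m + k) [0..<m]"
    by (rule nth_equalityI) auto
  finally show ?thesis by simp
qed

text \<open>Induction over rounds, with an inner induction over levels: acceptance in a round uses
  margins of earlier rounds, and reduction at a level uses reduction of all examples at the previous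
  one.\<close>

lemma margin_Mem:
  assumes j: "j < m"
  shows "r \<le> m * m \<Longrightarrow> s \<le> m ^ 5 \<Longrightarrow>
    margin n a (batch j) r (point s) = int (plus Mem j r s) - int (minus Mem j r s)"
proof (induction r arbitrary: s)
  case 0 show ?case by (simp add: plus_def minus_def)
next
  case (Suc r)
  have r: "r < m * m" using Suc.prems by simp
  let ?q = "j * (m * m) + r"
  define acc where "acc = (\<lambda>y. margin n a (batch j) r (fst y) < int (snd y))"
  have sk: "(?q * a + l) * m + k < m ^ 5" if "l < a" "k < m" for l k
    using item_bound[OF q_bound[OF j r] that] items_bound by linarith
  have acc: "acc (it s') \<longleftrightarrow> plus Mem j r s' < theta s' + minus Mem j r s'" if "s' < m ^ 5" for s'
    using Suc.IH[of s'] Suc.prems that by (auto simp: acc_def point_def it_theta)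
  \<comment> \<open>This must be proved for all points \<open>s\<close> at once, because the
    partner's reduction is a table entry of the same level for another point.\<close>
  have red: "l \<le> a \<Longrightarrow> s \<le> m ^ 5 \<Longrightarrow> reduce n a (batch j r) acc l (point s) = repr ?q l s" for l s
  proof (induction l arbitrary: s)
    case 0
    have "\<not> Mem (ad ?q 0 s (n + 1))" using Mem_init[OF j r 0(2), of "n + 1"] by (simp add: init_def)
    moreover have "point s = map (\<lambda>i. Mem (ad ?q 0 s i)) [0..<Suc n]"
    proof (rule nth_equalityI)
      fix i assume "i < length (point s)"
      then have "i \<le> n" by (simp add: length_point)
      then show "point s ! i = map (\<lambda>i. Mem (ad ?q 0 s i)) [0..<Suc n] ! i"
        using Mem_init[OF j r 0(2), of i] init_point by (simp add: nth_append del: upt_Suc)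
    qed (simp add: length_point)
    ultimately show ?case by (simp add: repr_def del: upt_Suc)
  next
    case (Suc l)
    have l: "l < a" using Suc.prems by simp
    let ?\<phi> = "\<lambda>y. if acc y then reduce n a (batch j r) acc l (fst y) else None"
    let ?s = "\<lambda>k. (?q * a + l) * m + k"
    let ?us = "batch j r l"
    have us: "length ?us = m" "\<And>k. k < m \<Longrightarrow> ?us ! k = it (?s k)" by (simp_all add: batch_eq[OF j r l])
    have phi: "?\<phi> (it (?s k)) = (if acc (it (?s k)) then repr ?q l (?s k) else None)" if "k < m" for k
      using Suc.IH[of "?s k"] sk[OF l that] l by (simp add: point_def)
    have u: "reduce n a (batch j r) acc l (point s) = repr ?q l s" using Suc by simp
    show ?case
    proof (cases "Mem (ad ?q l s (n + 1))")
      case True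
      then have "Mem (ad ?q (l + 1) s (n + 1))" using Mem_step[OF j r l Suc.prems(2), of "n + 1"] by (simp add: upd_def Let_def)
      then show ?thesis using True u by (simp add: repr_def)
    next
      case live: False
      define v where "v = map (\<lambda>i. Mem (ad ?q l s i)) [0..<Suc n]"
      have v: "reduce n a (batch j r) acc l (point s) = Some v" using u live by (simp add: repr_def v_def)
      have vn: "v ! i = Mem (ad ?q l s i)" if "i \<le> n" for i using that by (simp add: v_def nth_append del: upt_Suc)
      have hit: "(\<exists>w. ?\<phi> (?us ! k) = Some w \<and> agree n a l v w) \<longleftrightarrow> okit Mem j r l s k" if k: "k < m" for k
      proof -
        have "(\<exists>w. ?\<phi> (?us ! k) = Some w \<and> agree n a l v w) \<longleftrightarrow> acc (it (?s k)) \<and> \<not> Mem (ad ?q l (?s k) (n + 1)) \<and>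
          agree n a l v (map (\<lambda>i. Mem (ad ?q l (?s k) i)) [0..<Suc n])"
          unfolding us(2)[OF k] phi[OF k] by (auto simp: repr_def simp del: upt_Suc)
        also have "\<dots> \<longleftrightarrow> okit Mem j r l s k"
          unfolding okit_def Let_def acc[OF sk[OF l k]] agree_def using vn
          by (auto simp: add.commute nth_append simp del: upt_Suc)
        finally show ?thesis .
      qed
      show ?thesis
      proof (cases "\<exists>k<m. firstit Mem j r l s k")
        case False
        have "\<not> okit Mem j r l s k" if "k < m" for k
          using that
        proof (induction k rule: less_induct)
          case (less k) then show ?case using False by (auto simp: firstit_def)
        qed
        then have "find (\<lambda>w. agree n a l v w) (List.map_filter ?\<phi> ?us) = None"
          using hit us(1) by (intro find_map_filter(1)) simp
        then have 1: "reduce n a (batch j r) acc (Suc l) (point s) = None" using v by (simp add: rstep_def)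
        have "Mem (ad ?q (l + 1) s (n + 1))" using Mem_step[OF j r l Suc.prems(2), of "n + 1"] False
          by (auto simp: upd_def Let_def)
        then show ?thesis unfolding 1 by (simp add: repr_def)
      next
        case True
        then obtain k where k: "k < m" "firstit Mem j r l s k" by blast
        define w where "w = map (\<lambda>i. Mem (ad ?q l (?s k) i)) [0..<Suc n]"
        have okk: "okit Mem j r l s k" "\<And>k'. k' < k \<Longrightarrow> \<not> okit Mem j r l s k'" using k(2) by (auto simp: firstit_def)
        have "\<not> Mem (ad ?q l (?s k) (n + 1))" "acc (it (?s k))"
          using okk(1) acc[OF sk[OF l k(1)]] by (auto simp: okit_def Let_def)
        then have w: "?\<phi> (?us ! k) = Some w" unfolding us(2)[OF k(1)] phi[OF k(1)] by (simp add: repr_def w_def)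
        have "find (\<lambda>w. agree n a l v w) (List.map_filter ?\<phi> ?us) = Some w"
        proof (rule find_map_filter(2)[where k = k])
          show "agree n a l v w" using hit[OF k(1)] okk(1) w by auto
          show "\<not> (\<exists>w. ?\<phi> (?us ! i) = Some w \<and> agree n a l v w)" if "i < k" for i
            using hit[of i] okk(2)[OF that] that k(1) by auto
        qed (use k us w in simp_all)
        then have 1: "reduce n a (batch j r) acc (Suc l) (point s) = Some (xorv v w)" using v by (simp add: rstep_def)
        have uniq: "firstit Mem j r l s k' \<longleftrightarrow> k' = k" for k'
          using k(2) unfolding firstit_def by (metis linorder_neqE_nat)
        have dead: "\<not> Mem (ad ?q (l + 1) s (n + 1))"
          using Mem_step[OF j r l Suc.prems(2), of "n + 1"] live k(1) by (auto simp: upd_def Let_def uniq)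
        have "xorv v w = map (\<lambda>i. Mem (ad ?q (l + 1) s i)) [0..<Suc n]"
        proof (rule nth_equalityI)
          fix i assume "i < length (xorv v w)"
          then have i: "i \<le> n" by (simp add: v_def w_def)
          have "xorv v w ! i = (v ! i \<noteq> w ! i)" using i by (intro nth_xorv) (simp_all add: v_def w_def)
          also have "\<dots> = Mem (ad ?q (l + 1) s i)"
            using Mem_step[OF j r l Suc.prems(2), of i] i k(1) vn[OF i]
            by (simp add: upd_def Let_def uniq w_def nth_append del: upt_Suc)
          finally show "xorv v w ! i = map (\<lambda>i. Mem (ad ?q (l + 1) s i)) [0..<Suc n] ! i"
            using i by (simp add: nth_append del: upt_Suc)
        qed (simp add: v_def w_def)
        then show ?thesis unfolding 1 using dead by (simp add: repr_def del: upt_Suc)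
      qed
    qed
  qed
  have "val n (reduce n a (batch j r) acc a (point s)) =
     of_bool (\<not> Mem (ad ?q a s (n + 1)) \<and> \<not> Mem (ad ?q a s n)) - of_bool (\<not> Mem (ad ?q a s (n + 1)) \<and> Mem (ad ?q a s n))"
    unfolding red[OF le_refl Suc.prems(2)] by (auto simp: repr_def nth_append simp del: upt_Suc)
  moreover have "plus Mem j (Suc r) s = plus Mem j r s + of_bool (\<not> Mem (ad ?q a s (n + 1)) \<and> \<not> Mem (ad ?q a s n))"
    "minus Mem j (Suc r) s = minus Mem j r s + of_bool (\<not> Mem (ad ?q a s (n + 1)) \<and> Mem (ad ?q a s n))"
    unfolding plus_def minus_def by (rule card_less_Suc_pred)+
  ultimately show ?case using Suc.IH[of s] Suc.prems by (simp add: acc_def)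
qed

text \<open>The vote count is at most m^3, so neither it nor its double is truncated, and each vote
  is the sign of a margin already identified by \<open>margin_Mem\<close>.\<close>

theorem program_correct:
  "ev N inp Mem eOut (\<lambda>_. N) = 0 \<longleftrightarrow> predict n a m (map it [0..<m * (m * m * (a * m))]) x"
proof -
  have mm: "ev N inp Mem (XMul em em) e = m * m" for e by (intro ev_mul[OF N1] ev_em small_N)
  have m3: "m * (m * m) \<le> N" using pow_le_N[of 3] by (simp add: eval_nat_numeral)
  let ?B = "\<lambda>j r. plus Mem j r (m ^ 5) < minus Mem j r (m ^ 5)"
  have inner: "ev N inp Mem (XSum 2 (XMul em em) (XLt (ePlus (epow em 5)) (eMinus (epow em 5)))) ((\<lambda>_. N)(1 := j)) =
     (\<Sum>r<m * m. of_bool (?B j r))" if j: "j < m" for j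
  proof -
    have "ev N inp Mem (XSum 2 (XMul em em) (XLt (ePlus (epow em 5)) (eMinus (epow em 5)))) ((\<lambda>_. N)(1 := j))
      = card {r. r < m * m \<and> ?B j r}"
    proof (rule ev_count[OF N1 mm])
      fix r assume r: "r < m * m"
      let ?e = "((\<lambda>_::nat. N)(1 := j))(2 := r)"
      have p5: "ev N inp Mem (epow em 5) e = m ^ 5" for e using small_N by (simp add: ev_pow[OF N1] ev_em)
      have e: "?e 1 = j" "?e 2 = r" by simp_all
      have "ev N inp Mem (ePlus (epow em 5)) ?e = plus Mem (?e 1) (?e 2) (m ^ 5)"
        "ev N inp Mem (eMinus (epow em 5)) ?e = minus Mem (?e 1) (?e 2) (m ^ 5)"
        using j r by (intro ev_plus_minus p5; simp)+
      then show "ev N inp Mem (XLt (ePlus (epow em 5)) (eMinus (epow em 5))) ?e = of_bool (?B j r)"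
        unfolding ev_lt[OF N1] e by simp
    qed
    then show ?thesis by (simp add: Int_def lessThan_def)
  qed
  define V where "V = (\<Sum>j<m. \<Sum>r<m * m. of_bool (?B j r) :: nat)"
  have "V \<le> (\<Sum>j<m. \<Sum>r<m * m. 1)" unfolding V_def by (intro sum_mono) simp
  then have Vle: "V \<le> m * (m * m)" by simp
  have "(\<Sum>j<m. ev N inp Mem (XSum 2 (XMul em em) (XLt (ePlus (epow em 5)) (eMinus (epow em 5)))) ((\<lambda>_. N)(1 := j))) = V"
    unfolding V_def by (rule sum.cong) (simp_all only: inner lessThan_iff)
  then have votes: "ev N inp Mem eVotes (\<lambda>_. N) = V"
    unfolding eVotes_def ev.simps(7)[of _ _ _ 1] ev_em using Vle m3 by simp
  have "m * (m * m) * 2 \<le> m * (m * m) * m" using m4 by (intro mult_le_mono2) simp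
  also have "\<dots> \<le> N" using pow_le_N[of 4] by (simp add: eval_nat_numeral mult_ac)
  finally have "V + V \<le> N" using Vle by linarith
  then have "ev N inp Mem (XAdd eVotes eVotes) (\<lambda>_. N) = V + V" by (intro ev_add[OF N1] votes)
  moreover have "ev N inp Mem (XMul em (XMul em em)) (\<lambda>_. N) = m * (m * m)"
    by (intro ev_mul[OF N1] ev_em mm m3)
  ultimately have "ev N inp Mem eOut (\<lambda>_. N) = 0 \<longleftrightarrow> m * (m * m) < V + V"
    unfolding eOut_def ev_not[OF N1] ev_lt[OF N1] by simp
  also have "V = votes n a m (map it [0..<m * (m * m * (a * m))]) x"
    unfolding V_def votes_def
  proof (intro sum.cong refl arg_cong[where f = of_bool])
    fix j r assume "j \<in> {..<m}" "r \<in> {..<m * m}"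
    then have "margin n a (batch j) r (point (m ^ 5)) = int (plus Mem j r (m ^ 5)) - int (minus Mem j r (m ^ 5))"
      by (intro margin_Mem) auto
    then show "?B j r = (margin n a (\<lambda>r l. chunk m (r * a + l) (chunk (m * m * (a * m)) j (map it [0..<m * (m * m * (a * m))]))) r (x @ [False]) < 0)"
      by (simp add: batch_def[abs_def] point_def)
  qed
  finally show ?thesis by (simp only: predict_def mult_2)
qed

end

section \<open>Binomial thresholds from coin tosses\<close>

text \<open>Needed because the program reads its coins from the end of the string.\<close>

lemma EE_iid_rev:
  assumes "fin D" shows "EE (iid k D) (\<lambda>xs. g (rev xs)) = EE (iid k D) g"
proof (induction k arbitrary: g)
  case 0 show ?case by (simp add: EE_def)
next
  case (Suc k)
  have "EE (iid (Suc k) D) (\<lambda>xs. g (rev xs)) = EE D (\<lambda>x. EE (iid k D) (\<lambda>xs. g (rev xs @ [x])))"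
    by (simp only: EE_iid_Suc[OF assms] rev.simps)
  also have "\<dots> = EE D (\<lambda>x. EE (iid k D) (\<lambda>xs. g (xs @ [x])))" by (simp only: Suc[of "\<lambda>xs. g (xs @ [_])"])
  also have "\<dots> = EE (iid k D) (\<lambda>xs. EE (iid 1 D) (\<lambda>ys. g (xs @ ys)))"
    by (subst EE_swap) (simp only: One_nat_def EE_iid_Suc[OF assms] EE_iid_0)
  also have "\<dots> = EE (iid (Suc k) D) g" by (simp only: EE_iid_append[OF assms, symmetric]) simp
  finally show ?case .
qed

definition ones :: "bool list \<Rightarrow> nat" where "ones ys = length (filter id ys)"

definition binom :: "nat \<Rightarrow> nat pmf" where "binom m = map_pmf ones (iid m (bernoulli_pmf (1/2)))"

lemma fin_bern: "fin (bernoulli_pmf (1/2))" by (rule finite)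

text \<open>Counting ones in consecutive disjoint blocks of coins gives independent binomial
  variables.\<close>

lemma EE_blocks:
  "EE (iid (M * m) (bernoulli_pmf (1/2))) (\<lambda>r. g (map (\<lambda>s. ones (chunk m s r)) [0..<M])) = EE (iid M (binom m)) g"
proof (induction M arbitrary: g)
  case 0 show ?case by (simp add: EE_def)
next
  case (Suc M)
  let ?B = "bernoulli_pmf (1/2)"
  have fb: "fin (iid m ?B)" by (rule fin_iid) (rule fin_bern)
  have fb': "fin (binom m)" using fb by (simp add: binom_def)
  have "EE (iid (m + M * m) ?B) (\<lambda>r. g (map (\<lambda>s. ones (chunk m s r)) [0..<Suc M]))
    = EE (iid m ?B) (\<lambda>xs. EE (iid (M * m) ?B) (\<lambda>ys. g (ones xs # map (\<lambda>s. ones (chunk m s ys)) [0..<M])))"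
    unfolding EE_iid_append[OF fin_bern]
  proof (intro EE_cong)
    fix xs ys assume "xs \<in> set_pmf (iid m ?B)"
    then have l: "length xs = m" by (simp add: set_iid)
    have "map (\<lambda>s. ones (chunk m s (xs @ ys))) [0..<Suc M] = ones (chunk m 0 (xs @ ys)) # map (\<lambda>s. ones (chunk m (Suc s) (xs @ ys))) [0..<M]"
      by (simp only: upt_conv_Cons[of 0 "Suc M"] map_Suc_upt[symmetric] list.map(2) map_map comp_def zero_less_Suc)
    also have "chunk m 0 (xs @ ys) = xs" using l by (simp add: chunk_def)
    also have "(\<lambda>s. ones (chunk m (Suc s) (xs @ ys))) = (\<lambda>s. ones (chunk m s ys))"
      using chunk_append2[of xs 1 m _ ys] l by simp
    finally show "g (map (\<lambda>s. ones (chunk m s (xs @ ys))) [0..<Suc M]) = g (ones xs # map (\<lambda>s. ones (chunk m s ys)) [0..<M])" by (simp only:)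
  qed
  also have "\<dots> = EE (iid m ?B) (\<lambda>xs. EE (iid M (binom m)) (\<lambda>ts. g (ones xs # ts)))"
    by (simp only: Suc[of "\<lambda>ts. g (ones _ # ts)"])
  also have "\<dots> = EE (iid (Suc M) (binom m)) g"
    unfolding EE_iid_Suc[OF fb'] by (simp add: binom_def EE_map[OF fb])
  finally show ?case by simp
qed

lemma EE_zip:
  assumes "fin A" "fin B"
  shows "EE (iid k A) (\<lambda>xs. EE (iid k B) (\<lambda>ts. g (map2 F xs ts))) = EE (iid k (map_pmf (\<lambda>(x, t). F x t) (pair_pmf A B))) g"
proof (induction k arbitrary: g)
  case 0 show ?case by (simp add: EE_def)
next
  case (Suc k)
  let ?P = "map_pmf (\<lambda>(x, t). F x t) (pair_pmf A B)"
  have fP: "fin ?P" using assms by simp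
  have "EE (iid (Suc k) A) (\<lambda>xs. EE (iid (Suc k) B) (\<lambda>ts. g (map2 F xs ts)))
    = EE A (\<lambda>x. EE (iid k A) (\<lambda>xs. EE B (\<lambda>t. EE (iid k B) (\<lambda>ts. g (F x t # map2 F xs ts)))))"
    by (simp only: EE_iid_Suc assms zip_Cons_Cons list.map(2) prod.case)
  also have "\<dots> = EE A (\<lambda>x. EE B (\<lambda>t. EE (iid k A) (\<lambda>xs. EE (iid k B) (\<lambda>ts. g (F x t # map2 F xs ts)))))"
    by (subst EE_swap) (rule refl)
  also have "\<dots> = EE A (\<lambda>x. EE B (\<lambda>t. EE (iid k ?P) (\<lambda>zs. g (F x t # zs))))"
    by (simp only: Suc[of "\<lambda>zs. g (F _ _ # zs)"])
  also have "\<dots> = EE (iid (Suc k) ?P) g"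
    unfolding EE_iid_Suc[OF fP] using assms by (simp add: EE_map EE_pair)
  finally show ?case .
qed

text \<open>The recursion on the first coin is Pascal's rule.\<close>

lemma pmf_binom: "pmf (binom m) k = real (m choose k) / 2 ^ m"
proof (induction m arbitrary: k)
  case 0 show ?case by (cases k) (auto simp: binom_def ones_def)
next
  case (Suc m)
  let ?B = "bernoulli_pmf (1/2)"
  have "binom (Suc m) = bind_pmf ?B (\<lambda>b. map_pmf (\<lambda>t. (if b then 1 else 0) + t) (binom m))"
    by (simp add: binom_def map_bind_pmf pmf.map_comp comp_def ones_def cong: if_cong)
      (intro bind_pmf_cong refl map_pmf_cong, simp)
  moreover have "map_pmf (\<lambda>t. (if b then 1 else 0) + t) (binom m) = (if b then map_pmf Suc (binom m) else binom m)" for b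
    by (cases b) (simp_all add: pmf.map_ident[unfolded id_def] cong: map_pmf_cong)
  ultimately have "binom (Suc m) = bind_pmf ?B (\<lambda>b. if b then map_pmf Suc (binom m) else binom m)" by (simp only:)
  then have "pmf (binom (Suc m)) k = (1/2) * pmf (map_pmf Suc (binom m)) k + (1/2) * pmf (binom m) k"
    by (simp add: pmf_bind integral_measure_pmf_real[where A = UNIV] UNIV_bool)
  also have "pmf (map_pmf Suc (binom m)) k = (if k = 0 then 0 else pmf (binom m) (k - 1))"
  proof (cases k)
    case 0
    have "0 \<notin> set_pmf (map_pmf Suc (binom m))" by auto
    then show ?thesis using 0 by (simp add: pmf_eq_0_set_pmf)
  next
    case (Suc k')
    have "pmf (map_pmf Suc (binom m)) (Suc k') = pmf (binom m) k'" by (rule pmf_map_inj') simp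
    then show ?thesis using Suc by simp
  qed
  finally show ?case using Suc by (cases k) (simp_all add: field_simps)
qed

text \<open>The ratio of consecutive central coefficients is 2 (2j + 1) / (j + 1), and (2j + 1)(2j +
  3) is at most 4 (j + 1)^2.\<close>

lemma central_binomial_sq: "((2 * j) choose j)\<^sup>2 * (2 * j + 1) \<le> 16 ^ j"
proof (induction j)
  case (Suc j)
  let ?c = "(2 * j) choose j" and ?d = "(2 * Suc j) choose Suc j"
  have A: "Suc j * ?d = 2 * (2 * j + 1) * ?c"
  proof -
    have "Suc j * (Suc (Suc (2 * j)) choose Suc j) = Suc (Suc (2 * j)) * (Suc (2 * j) choose j)"
      by (rule Suc_times_binomial)
    moreover have "Suc j * (Suc (2 * j) choose j) = Suc (2 * j) * ?c"
    proof -
      have "(Suc (2 * j) choose j) = (Suc (2 * j) choose Suc j)" by (subst binomial_symmetric) auto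
      then show ?thesis using Suc_times_binomial[of j "2 * j"] by simp
    qed
    ultimately have "Suc j * (Suc j * ?d) = Suc j * (2 * (2 * j + 1) * ?c)"
      by (simp add: algebra_simps)
    then show ?thesis by (simp only: mult_cancel1) simp
  qed
  have gen: "q\<^sup>2 * (d\<^sup>2 * (p + 2)) \<le> q\<^sup>2 * (16 * X)"
    if "q * d = 2 * p * c" "c\<^sup>2 * p \<le> X" "p * (p + 2) \<le> 4 * q\<^sup>2" for q d p c X :: nat
  proof -
    have "q\<^sup>2 * (d\<^sup>2 * (p + 2)) = (q * d)\<^sup>2 * (p + 2)" by (simp add: power_mult_distrib distrib_left)
    also have "\<dots> = 4 * (p * (p + 2)) * (c\<^sup>2 * p)" unfolding that(1) by (simp add: power2_eq_square algebra_simps)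
    also have "\<dots> \<le> 4 * (4 * q\<^sup>2) * X" by (intro mult_le_mono that order_refl)
    finally show ?thesis by (simp add: mult_ac)
  qed
  have "(Suc j)\<^sup>2 * (?d\<^sup>2 * (2 * j + 1 + 2)) \<le> (Suc j)\<^sup>2 * (16 * 16 ^ j)"
    by (rule gen[OF A Suc]) (simp add: power2_eq_square)
  then have "?d\<^sup>2 * (2 * j + 1 + 2) \<le> 16 * 16 ^ j" by (simp only: mult_le_cancel1) simp
  moreover have "2 * j + 1 + 2 = 2 * Suc j + 1" by simp
  ultimately show ?case by (simp only: power_Suc)
qed simp

text \<open>The largest probability is the central one. For odd m it equals the central probability
  for m + 1, the even coefficient being twice the odd one.\<close>

lemma pmf_binom_le:
  assumes "m > 0" shows "pmf (binom m) k \<le> 1 / sqrt (real m)"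
proof -
  have ev: "real ((2 * j) choose j) / 4 ^ j \<le> 1 / sqrt (real (2 * j + 1))" for j
  proof -
    have "(real ((2 * j) choose j))\<^sup>2 * real (2 * j + 1) \<le> 16 ^ j"
      using central_binomial_sq[of j] by (metis of_nat_le_iff of_nat_mult of_nat_numeral of_nat_power)
    then have "sqrt ((real ((2 * j) choose j))\<^sup>2 * real (2 * j + 1)) \<le> sqrt (16 ^ j)" by (rule real_sqrt_le_mono)
    moreover have "sqrt (16 ^ j) = 4 ^ j" by (rule real_sqrt_unique) (simp_all add: power_mult[symmetric] power2_eq_square power_mult_distrib[symmetric])
    ultimately have "real ((2 * j) choose j) * sqrt (real (2 * j + 1)) \<le> 4 ^ j" by (simp add: real_sqrt_mult)
    then show ?thesis by (simp add: field_simps)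
  qed
  have "pmf (binom m) k \<le> real (m choose (m div 2)) / 2 ^ m"
    unfolding pmf_binom by (intro divide_right_mono) (simp_all add: binomial_maximum)
  also have "\<dots> \<le> 1 / sqrt (real m)"
  proof (cases "even m")
    case True
    then obtain j where j: "m = 2 * j" by auto
    have "real (m choose (m div 2)) / 2 ^ m \<le> 1 / sqrt (real (2 * j + 1))" using ev[of j] by (simp add: j power_mult)
    also have "\<dots> \<le> 1 / sqrt (real m)" using assms by (intro divide_left_mono) (auto simp: j)
    finally show ?thesis .
  next
    case False
    then obtain j where j: "m = 2 * j + 1" by (auto elim: oddE)
    have "(2 * Suc j) choose Suc j = (Suc (2 * j) choose j) + (Suc (2 * j) choose Suc j)" by simp
    also have "(Suc (2 * j) choose Suc j) = (Suc (2 * j) choose j)" by (subst binomial_symmetric) auto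
    finally have "real ((2 * Suc j) choose Suc j) = 2 * real (m choose (m div 2))" by (simp add: j)
    then have "real (m choose (m div 2)) / 2 ^ m = real ((2 * Suc j) choose Suc j) / 4 ^ Suc j"
      by (simp add: j power_mult)
    also have "\<dots> \<le> 1 / sqrt (real (2 * Suc j + 1))" by (rule ev)
    also have "\<dots> \<le> 1 / sqrt (real m)" by (intro divide_left_mono) (auto simp: j)
    finally show ?thesis .
  qed
  finally show ?thesis .
qed

lemma set_binom: "set_pmf (binom m) \<subseteq> {..m}"
  by (auto simp: binom_def ones_def set_iid)

lemma pmf_binom_0: "m > 0 \<Longrightarrow> pmf (binom m) 0 \<le> 1 / 2"
  by (cases m) (auto simp: pmf_binom field_simps one_le_power)

definition samples :: "nat \<Rightarrow> (bool list \<times> bool) list \<Rightarrow> bool list \<Rightarrow> nat \<Rightarrow> item" where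
  "samples m smp r s = (fst (smp ! s) @ [snd (smp ! s)], ones (chunk m s (rev r)))"

text \<open>Transfers the analysis from independent labelled items to the real input of the learner,
  T examples and T coins: the first M examples are used, each with m coins of its own.\<close>

lemma EE_samples:
  assumes D: "fin D" and le: "M \<le> T" "M * m \<le> T"
  shows "EE (pair_pmf (iid T (map_pmf (\<lambda>x. (x, f x)) D)) (iid T (bernoulli_pmf (1/2))))
     (\<lambda>(smp, r). g (map (samples m smp r) [0..<M])) = EE (iid M (labelled D f (binom m))) g"
proof -
  let ?A = "map_pmf (\<lambda>x. (x, f x)) D" and ?B = "bernoulli_pmf (1/2)"
  let ?F = "\<lambda>s t. (fst s @ [snd s], t)"
  have fA: "fin ?A" using D by simp
  have fb: "fin (binom m)" using fin_bern by (simp add: binom_def)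
  let ?h = "\<lambda>smp r. g (map2 ?F smp (map (\<lambda>s. ones (chunk m s r)) [0..<M]))"
  have "EE (pair_pmf (iid T ?A) (iid T ?B)) (\<lambda>(smp, r). g (map (samples m smp r) [0..<M]))
    = EE (iid T ?A) (\<lambda>smp. EE (iid T ?B) (\<lambda>r. ?h (take M smp) (take (M * m) (rev r))))"
    unfolding EE_pair[OF fin_iid[OF fA] fin_iid[OF fin_bern]] prod.case
  proof (intro EE_cong)
    fix smp r assume smp: "smp \<in> set_pmf (iid T ?A)" and r: "r \<in> set_pmf (iid T ?B)"
    then have l: "length smp = T" "length (rev r) = T" by (simp_all add: set_iid)
    have ch: "chunk m s (take (M * m) (rev r)) = chunk m s (rev r)" if "s < M" for s
    proof -
      have "s * m + m \<le> M * m" using that by (metis Suc_leI add.commute mult_Suc mult_le_mono1)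
      then show ?thesis by (simp add: chunk_def drop_take take_take)
    qed
    have "map (samples m smp r) [0..<M] = map2 ?F (take M smp) (map (\<lambda>s. ones (chunk m s (take (M * m) (rev r)))) [0..<M])"
      by (rule nth_equalityI) (use l le in \<open>simp_all add: samples_def ch\<close>)
    then show "g (map (samples m smp r) [0..<M]) = ?h (take M smp) (take (M * m) (rev r))" by simp
  qed
  also have "\<dots> = EE (iid M ?A) (\<lambda>smp. EE (iid (M * m) ?B) (\<lambda>r. ?h smp r))"
    unfolding EE_iid_rev[OF fin_bern, of T "\<lambda>r. ?h _ (take (M * m) r)"]
      EE_iid_take[OF fin_bern le(2), of "?h _"] EE_iid_take[OF fA le(1), of "\<lambda>smp. EE (iid (M * m) ?B) (\<lambda>r. ?h smp r)"] ..
  also have "\<dots> = EE (iid M ?A) (\<lambda>smp. EE (iid M (binom m)) (\<lambda>ts. g (map2 ?F smp ts)))"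
    unfolding EE_blocks[of M m "\<lambda>ts. g (map2 ?F _ ts)"] ..
  also have "\<dots> = EE (iid M (map_pmf (\<lambda>(x, t). ?F x t) (pair_pmf ?A (binom m)))) g"
    by (rule EE_zip[OF fA fb])
  also have "map_pmf (\<lambda>(x, t). ?F x t) (pair_pmf ?A (binom m)) = labelled D f (binom m)"
    unfolding labelled_def pair_map_pmf1 pmf.map_comp by (rule arg_cong[where f = "\<lambda>h. map_pmf h _"]) auto
  finally show ?thesis .
qed

section \<open>Reading the parameters off the input string\<close>

fun econst :: "nat \<Rightarrow> exp" where
  "econst 0 = XLt X1 X1"
| "econst (Suc k) = XAdd (econst k) X1"

lemma ev_const: "N \<ge> 1 \<Longrightarrow> ev N inp A (econst k) e = min N k"
  by (induction k) auto

text \<open>The position of separator number k, counted from 0: the number of positions up to and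
  including which at most k separators occur.\<close>

definition ePos :: "nat \<Rightarrow> exp" where
  "ePos k = XSum 21 XLen (XLt (XSum 22 (XAdd (XV 21) X1) (XAt 2 (XV 22))) (econst (Suc k)))"

text \<open>The largest m with m^12 < N. The batch size is thus computed from the length of the data
  alone, without \<epsilon>, \<delta> or the constants of the time bound.\<close>

definition eM :: exp where
  "eM = XSum 20 XLen (XLt (epow (XAdd (XV 20) X1) 12) XLen)"

text \<open>Power-of-two test through divisors: every divisor above 1 is even.\<close>

definition ePow2 :: "exp \<Rightarrow> exp" where
  "ePow2 p = eAll 24 (XAdd p X1) (eAll 25 (XAdd p X1)
     (XAdd (XAdd (eNot (eEq (XMul (XV 24) (XV 25)) p)) (eNot (XLt X1 (XV 24))))
       (XSum 26 (XV 24) (eEq (XAdd (XV 26) (XV 26)) (XV 24)))))"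

definition eLg :: exp where
  "eLg = XSum 23 (ePos 0) (ePow2 (XAdd (XV 23) X1))"

text \<open>The number of levels, 1 + (binary length of n) div \<kappa>; the quotient is the number
  of positive multiples of \<kappa> up to that length.\<close>

definition eDiv :: "nat \<Rightarrow> exp" where
  "eDiv \<kappa> = XAdd X1 (XSum 27 eLg (eNot (XLt eLg (XMul (econst \<kappa>) (XAdd (XV 27) X1)))))"

lemma ok_params [simp]: "okexp (econst k)" "okexp (ePos k)" "okexp eM" "okexp (eDiv \<kappa>)"
proof -
  show 1: "okexp (econst k)" for k by (induction k) auto
  show 2: "okexp (ePos k)" for k using 1 by (simp add: ePos_def del: econst.simps)
  show "okexp eM" by (simp only: eM_def okexp.simps ok_derived)
  have "okexp eLg" using 2 by (simp add: eLg_def ePow2_def)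
  then show "okexp (eDiv \<kappa>)" using 1 by (simp add: eDiv_def)
qed

text \<open>Halving keeps the divisor condition, and a divisor of a power of two is again a power of
  two.\<close>

lemma pow2_iff: "p > 0 \<Longrightarrow> (\<forall>d e. d * e = p \<longrightarrow> 1 < d \<longrightarrow> even d) \<longleftrightarrow> (\<exists>i. p = 2 ^ i)" for p :: nat
proof
  assume "p > 0" "\<forall>d e. d * e = p \<longrightarrow> 1 < d \<longrightarrow> even d"
  then show "\<exists>i. p = 2 ^ i"
  proof (induction p rule: less_induct)
    case (less p)
    show ?case
    proof (cases "p = 1")
      case True then show ?thesis by (intro exI[of _ 0]) simp
    next
      case False
      then have "even p" using less.prems(1) less.prems(2)[rule_format, of p 1] by simp
      then obtain q where q: "p = 2 * q" by auto
      have "\<exists>i. q = 2 ^ i"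
      proof (rule less.IH)
        show "\<forall>d e. d * e = q \<longrightarrow> 1 < d \<longrightarrow> even d"
        proof (intro allI impI)
          fix d e assume "d * e = q" "1 < d"
          then show "even d" using less.prems(2)[rule_format, of d "2 * e"] q by simp
        qed
      qed (use less.prems(1) q in simp_all)
      then show ?thesis using q by (metis power_Suc)
    qed
  qed
next
  assume "\<exists>i. p = 2 ^ i"
  then obtain i where i: "p = 2 ^ i" by blast
  show "\<forall>d e. d * e = p \<longrightarrow> 1 < d \<longrightarrow> even d"
  proof (intro allI impI)
    fix d e assume "d * e = p" "1 < d"
    then have "d dvd 2 ^ i" using i by (metis dvd_triv_left)
    then obtain j where "d = 2 ^ j" using divides_primepow_nat[OF two_is_prime_nat] by blast
    then show "even d" using \<open>1 < d\<close> by (cases j) auto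
  qed
qed

text \<open>The binary length of n; it exceeds the floor of the logarithm by one.\<close>

definition lg :: "nat \<Rightarrow> nat" where "lg n = card {i. 2 ^ i \<le> n}"

lemma lg_set: "{i. 2 ^ i \<le> n} = {..<lg n}"
proof -
  have "{i. 2 ^ i \<le> n} \<subseteq> {..n}" by (auto intro: less_imp_le order_trans[OF less_imp_le[OF less_exp]])
  then have fin: "finite {i. 2 ^ i \<le> n}" by (rule finite_subset) simp
  have down: "j \<in> {i. 2 ^ i \<le> n}" if "j \<le> i" "i \<in> {i. 2 ^ i \<le> n}" for i j
    using that order_trans[OF power_increasing[OF that(1), of "2::nat"]] by simp
  obtain k where k: "{i. 2 ^ i \<le> n} = {..<k}"
  proof (cases "{i. 2 ^ i \<le> n} = {}")
    case False
    have "{i. 2 ^ i \<le> n} = {..<Suc (Max {i. 2 ^ i \<le> n})}"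
      using Max_in[OF fin False] Max_ge[OF fin] down by (fastforce simp: less_Suc_eq_le)
    then show ?thesis using that by blast
  qed (use that[of 0] in simp)
  then show ?thesis by (simp add: lg_def)
qed

lemma lg_le: "lg n \<le> n"
proof -
  have "{..<lg n} \<subseteq> {..<n}"
    unfolding lg_set[symmetric] by (auto intro: less_le_trans[OF less_exp])
  then show ?thesis by simp
qed

lemma lg_powers: "card {i. i < n \<and> (\<exists>j. i + 1 = 2 ^ j)} = lg n"
proof -
  have "bij_betw (\<lambda>j. 2 ^ j - 1 :: nat) {j. 2 ^ j \<le> n} {i. i < n \<and> (\<exists>j. i + 1 = (2::nat) ^ j)}"
  proof (rule bij_betw_imageI)
    show "inj_on (\<lambda>j. 2 ^ j - 1 :: nat) {j. 2 ^ j \<le> n}"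
    proof (rule inj_onI)
      fix j k assume "2 ^ j - 1 = (2 ^ k - 1 :: nat)"
      moreover have "(2::nat) ^ j > 0" "(2::nat) ^ k > 0" by simp_all
      ultimately have "(2::nat) ^ j = 2 ^ k" by linarith
      then show "j = k" by simp
    qed
    show "(\<lambda>j. 2 ^ j - 1 :: nat) ` {j. 2 ^ j \<le> n} = {i. i < n \<and> (\<exists>j. i + 1 = (2::nat) ^ j)}"
    proof (intro set_eqI iffI)
      fix i assume "i \<in> (\<lambda>j. 2 ^ j - 1 :: nat) ` {j. 2 ^ j \<le> n}"
      then obtain j where j: "2 ^ j \<le> n" "i = 2 ^ j - 1" by blast
      moreover have "(2::nat) ^ j > 0" by simp
      ultimately have "i < n" "i + 1 = 2 ^ j" by linarith+
      then show "i \<in> {i. i < n \<and> (\<exists>j. i + 1 = (2::nat) ^ j)}" by blast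
    next
      fix i assume "i \<in> {i. i < n \<and> (\<exists>j. i + 1 = (2::nat) ^ j)}"
      then obtain j where j: "i < n" "i + 1 = 2 ^ j" by blast
      then have "2 ^ j \<le> n" "i = 2 ^ j - 1" by linarith+
      then show "i \<in> (\<lambda>j. 2 ^ j - 1 :: nat) ` {j. 2 ^ j \<le> n}" by blast
    qed
  qed
  then show ?thesis unfolding lg_def by (rule bij_betw_same_card[symmetric])
qed

lemma card_multiples:
  assumes "\<kappa> > 0" shows "card {i. i < l \<and> \<not> l < \<kappa> * (i + 1)} = l div \<kappa>"
proof -
  have "{i. i < l \<and> \<not> l < \<kappa> * (i + 1)} = {..<l div \<kappa>}"
  proof (intro set_eqI iffI)
    fix i assume "i \<in> {i. i < l \<and> \<not> l < \<kappa> * (i + 1)}"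
    then have "(i + 1) * \<kappa> \<le> l" by (simp add: mult.commute)
    then have "i + 1 \<le> l div \<kappa>" using assms by (simp add: less_eq_div_iff_mult_less_eq)
    then show "i \<in> {..<l div \<kappa>}" by simp
  next
    fix i assume "i \<in> {..<l div \<kappa>}"
    then have "i + 1 \<le> l div \<kappa>" by simp
    then have 1: "(i + 1) * \<kappa> \<le> l" using assms by (simp add: less_eq_div_iff_mult_less_eq)
    have "(i + 1) * 1 \<le> (i + 1) * \<kappa>" using assms by (intro mult_le_mono2) simp
    then show "i \<in> {i. i < l \<and> \<not> l < \<kappa> * (i + 1)}" using 1 by (simp add: mult.commute)
  qed
  then show ?thesis by simp
qed

lemma ev_M:
  assumes "m ^ 12 < N" "N \<le> (m + 1) ^ 12"
  shows "ev N inp A eM e = m"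
proof -
  have N1: "N \<ge> 1" using assms by simp
  have "ev N inp A eM e = card {i. i < N \<and> (i + 1) ^ 12 < N}"
    unfolding eM_def
  proof (rule ev_count[OF N1])
    fix i assume "i < N"
    then have "ev N inp A (XAdd (XV 20) X1) (e(20 := i)) = i + 1" using N1 by simp
    then have p: "ev N inp A (epow (XAdd (XV 20) X1) 12) (e(20 := i)) = min N ((i + 1) ^ 12)"
      by (simp only: ev_pow[OF N1])
    show "ev N inp A (XLt (epow (XAdd (XV 20) X1) 12) XLen) (e(20 := i)) = of_bool ((i + 1) ^ 12 < N)"
      unfolding ev_lt[OF N1] p by (simp add: min_less_iff_conj del: epow.simps)
  qed simp
  also have "{i. i < N \<and> (i + 1) ^ 12 < N} = {..<m}"
  proof (intro set_eqI iffI)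
    fix i assume "i \<in> {i. i < N \<and> (i + 1) ^ 12 < N}"
    then have "(i + 1) ^ 12 < (m + 1) ^ 12" using assms(2) by (simp del: power_Suc)
    then have "i + 1 < m + 1" by (rule power_less_imp_less_base) simp
    then show "i \<in> {..<m}" by simp
  next
    fix i assume "i \<in> {..<m}"
    then have "(i + 1) ^ 12 \<le> m ^ 12" by (intro power_mono) auto
    then have 1: "(i + 1) ^ 12 < N" using assms(1) by (rule le_less_trans)
    have "i < (i + 1) ^ 12" by (rule less_le_trans[OF _ self_le_power]) auto
    then have "i < N" using 1 by (rule less_trans)
    then show "i \<in> {i. i < N \<and> (i + 1) ^ 12 < N}" using 1 by (rule_tac CollectI) (rule conjI)
  qed
  finally show ?thesis by simp
qed

lemma ev_Pos:
  assumes u: "u = B @ [Sep] @ C" and k: "card {i. i < length B \<and> B ! i = Sep} = k" "k < N"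
    and N: "N = length u" and inp: "\<And>i. i < N \<Longrightarrow> inp i = u ! i"
  shows "ev N inp A (ePos k) e = length B"
proof -
  have N1: "N \<ge> 1" using N u by simp
  let ?c = "\<lambda>j. card {i. i < j + 1 \<and> inp i = Sep}"
  have "ev N inp A (ePos k) e = card {j. j < N \<and> ?c j < Suc k}"
    unfolding ePos_def
  proof (rule ev_count[OF N1])
    fix j assume j: "j < N"
    have "ev N inp A (XSum 22 (XAdd (XV 21) X1) (XAt 2 (XV 22))) (e(21 := j)) = ?c j"
      by (rule ev_count[OF N1]) (use j N1 in \<open>auto simp: ev_at[OF N1] att_def\<close>)
    then show "ev N inp A (XLt (XSum 22 (XAdd (XV 21) X1) (XAt 2 (XV 22))) (econst (Suc k))) (e(21 := j)) = of_bool (?c j < Suc k)"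
      unfolding ev_lt[OF N1] ev_const[OF N1] using k(2) by simp
  qed simp
  also have "{j. j < N \<and> ?c j < Suc k} = {..<length B}"
  proof (intro set_eqI iffI)
    fix j assume j: "j \<in> {j. j < N \<and> ?c j < Suc k}"
    show "j \<in> {..<length B}"
    proof (rule ccontr)
      assume "j \<notin> {..<length B}"
      then have "insert (length B) {i. i < length B \<and> B ! i = Sep} \<subseteq> {i. i < j + 1 \<and> inp i = Sep}"
        using j inp N u by (auto simp: nth_append)
      then have "card (insert (length B) {i. i < length B \<and> B ! i = Sep}) \<le> ?c j" by (rule card_mono[rotated]) simp
      then show False using j k(1) by simp
    qed
  next
    fix j assume j: "j \<in> {..<length B}"
    then have "{i. i < j + 1 \<and> inp i = Sep} \<subseteq> {i. i < length B \<and> B ! i = Sep}"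
      using inp N u by (auto simp: nth_append)
    then have "?c j \<le> k" unfolding k(1)[symmetric] by (rule card_mono[rotated]) simp
    then show "j \<in> {j. j < N \<and> ?c j < Suc k}" using j N u by simp
  qed
  finally show ?thesis by simp
qed

lemma tr_Pow2:
  assumes "N \<ge> 1"
    "ev N inp A q e = p" "\<And>d d' d''. ev N inp A q (e(24 := d)) = p" "\<And>d d'. ev N inp A q (e(24 := d, 25 := d')) = p"
    "0 < p" "p < N"
  shows "tr N inp A (ePow2 q) e \<longleftrightarrow> (\<exists>i. p = 2 ^ i)"
proof -
  note N1 = assms(1)
  have "tr N inp A (ePow2 q) e \<longleftrightarrow> (\<forall>d<p + 1. \<forall>d'<p + 1. d * d' \<noteq> p \<or> \<not> 1 < d \<or> (\<exists>h<d. h + h = d))"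
  proof -
    have q1: "ev N inp A (XAdd q X1) e = p + 1" "ev N inp A (XAdd q X1) (e(24 := d)) = p + 1" for d
      using assms by simp_all
    have 1: "tr N inp A (XAdd (XAdd (eNot (eEq (XMul (XV 24) (XV 25)) q)) (eNot (XLt X1 (XV 24))))
       (XSum 26 (XV 24) (eEq (XAdd (XV 26) (XV 26)) (XV 24)))) (e(24 := d, 25 := d')) \<longleftrightarrow>
       d * d' \<noteq> p \<or> \<not> 1 < d \<or> (\<exists>h<d. h + h = d)" if d: "d < p + 1" "d' < p + 1" for d d'
    proof -
      let ?e = "e(24 := d, 25 := d')"
      have dN: "d < N" "d' < N" using d assms by auto
      have a: "ev N inp A (XMul (XV 24) (XV 25)) ?e = p \<longleftrightarrow> d * d' = p"
        using dN assms(6) by (auto simp: min_def)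
      have b: "ev N inp A (XV 24) ?e = d" "ev N inp A X1 ?e = 1" using dN by simp_all
      have c: "(\<exists>h<d. ev N inp A (XAdd (XV 26) (XV 26)) (?e(26 := h)) = ev N inp A (XV 24) (?e(26 := h))) \<longleftrightarrow> (\<exists>h<d. h + h = d)"
        using dN by (intro ex_cong1 conj_cong refl) (auto simp: min_def)
      show ?thesis
        unfolding tr_add[OF N1] tr_not[OF N1] tr_eq[OF N1] tr_sum[OF N1] tr_lt[OF N1] assms(4) a b c by blast
    qed
    show ?thesis unfolding ePow2_def tr_all[OF N1] q1 by (intro all_cong1 imp_cong refl 1)
  qed
  also have "\<dots> \<longleftrightarrow> (\<forall>d e. d * e = p \<longrightarrow> 1 < d \<longrightarrow> even d)"
  proof
    assume L: "\<forall>d<p + 1. \<forall>d'<p + 1. d * d' \<noteq> p \<or> \<not> 1 < d \<or> (\<exists>h<d. h + h = d)"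
    show "\<forall>d e. d * e = p \<longrightarrow> 1 < d \<longrightarrow> even d"
    proof (intro allI impI)
      fix d e assume de: "d * e = p" "1 < d"
      then have "d \<le> p" "e \<le> p" using assms(5) by (metis dvd_imp_le dvd_triv_left dvd_triv_right)+
      then obtain h where "h + h = d" using L[rule_format, of d e] de by auto
      then show "even d" by (metis even_add)
    qed
  next
    assume R: "\<forall>d e. d * e = p \<longrightarrow> 1 < d \<longrightarrow> even d"
    show "\<forall>d<p + 1. \<forall>d'<p + 1. d * d' \<noteq> p \<or> \<not> 1 < d \<or> (\<exists>h<d. h + h = d)"
    proof (intro allI impI)
      fix d d' :: nat
      show "d * d' \<noteq> p \<or> \<not> 1 < d \<or> (\<exists>h<d. h + h = d)"
      proof (cases "d * d' = p \<and> 1 < d")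
        case True
        then have "even d" using R by blast
        then obtain h where "d = 2 * h" by auto
        then have "h < d" "h + h = d" using True by auto
        then show ?thesis by blast
      qed auto
    qed
  qed
  also have "\<dots> \<longleftrightarrow> (\<exists>i. p = 2 ^ i)" by (rule pow2_iff[OF assms(5)])
  finally show ?thesis .
qed

lemma ev_Pow2: "N \<ge> 1 \<Longrightarrow> ev N inp A (ePow2 q) e = of_bool (tr N inp A (ePow2 q) e)"
  unfolding ePow2_def eAll_def by (simp only: ev_not) simp

lemma ev_Lg:
  assumes n: "\<And>e. ev N inp A (ePos 0) e = n" and N: "n < N"
  shows "ev N inp A eLg e = lg n"
proof -
  have N1: "N \<ge> 1" using N by simp
  have "ev N inp A eLg e = card {i. i < n \<and> (\<exists>j. i + 1 = 2 ^ j)}"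
    unfolding eLg_def
  proof (rule ev_count[OF N1 n])
    fix i assume i: "i < n"
    show "ev N inp A (ePow2 (XAdd (XV 23) X1)) (e(23 := i)) = of_bool (\<exists>j. i + 1 = 2 ^ j)"
      by (subst ev_Pow2[OF N1], subst tr_Pow2[where p = "i + 1", OF N1]) (use i N in auto)
  qed
  then show ?thesis by (simp only: lg_powers)
qed

lemma ev_Div:
  assumes n: "\<And>e. ev N inp A (ePos 0) e = n" and N: "n + 2 < N" and \<kappa>: "\<kappa> > 0"
  shows "ev N inp A (eDiv \<kappa>) e = 1 + lg n div \<kappa>"
proof -
  have N1: "N \<ge> 1" using N by simp
  have lgN: "ev N inp A eLg e = lg n" for e using n N by (intro ev_Lg) auto
  have l: "lg n < N" using lg_le[of n] N by simp
  have "ev N inp A (XSum 27 eLg (eNot (XLt eLg (XMul (econst \<kappa>) (XAdd (XV 27) X1))))) e = card {i. i < lg n \<and> \<not> lg n < \<kappa> * (i + 1)}"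
  proof (rule ev_count[OF N1 lgN])
    fix i assume i: "i < lg n"
    have "ev N inp A (XAdd (XV 27) X1) (e(27 := i)) = i + 1" using i l by simp
    then have "ev N inp A (XMul (econst \<kappa>) (XAdd (XV 27) X1)) (e(27 := i)) = min N (\<kappa> * (i + 1))"
      unfolding ev.simps(5) ev_const[OF N1] by (simp only: min_mult_min)
    then show "ev N inp A (eNot (XLt eLg (XMul (econst \<kappa>) (XAdd (XV 27) X1)))) (e(27 := i)) = of_bool (\<not> lg n < \<kappa> * (i + 1))"
      unfolding ev_not[OF N1] ev_lt[OF N1] lgN using l by simp
  qed
  also have "\<dots> = lg n div \<kappa>" by (rule card_multiples[OF \<kappa>])
  finally have s: "ev N inp A (XSum 27 eLg (eNot (XLt eLg (XMul (econst \<kappa>) (XAdd (XV 27) X1))))) e = lg n div \<kappa>" .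
  have "lg n div \<kappa> \<le> lg n" by simp
  then show ?thesis unfolding eDiv_def using lg_le[of n] N by (intro ev_add[OF N1] ev_1[OF N1] s) linarith
qed

lemma nth_concat_blocks:
  assumes "s < length xss" "\<And>xs. xs \<in> set xss \<Longrightarrow> length xs = k" "i < k"
  shows "concat xss ! (s * k + i) = xss ! s ! i"
  using assms
proof (induction xss arbitrary: s)
  case (Cons ys xss)
  then show ?case by (cases s) (auto simp: nth_append add.assoc)
qed simp

lemma length_concat_blocks: "(\<And>xs. xs \<in> set xss \<Longrightarrow> length xs = k) \<Longrightarrow> length (concat xss) = length xss * k"
  by (induction xss) auto

lemma card_Sep_append:
  "card {i. i < length (B @ C) \<and> (B @ C) ! i = Sep} = card {i. i < length B \<and> B ! i = Sep} + card {i. i < length C \<and> C ! i = Sep}"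
  unfolding length_filter_conv_card[of "\<lambda>s. s = Sep", symmetric] by simp

lemma card_Sep_1: "card {i. i < length [Sep] \<and> [Sep] ! i = Sep} = 1"
  unfolding length_filter_conv_card[of "\<lambda>s. s = Sep", symmetric] by simp

lemma card_Sep_0: "Sep \<notin> set B \<Longrightarrow> card {i. i < length B \<and> B ! i = Sep} = 0"
  unfolding length_filter_conv_card[of "\<lambda>s. s = Sep", symmetric] by (simp add: filter_empty_conv) metis

lemma Sep_enc_bits: "Sep \<notin> set (enc_bits x)" by (auto simp: enc_bits_def)

lemma ones_chunk:
  assumes "s * m + m \<le> length xs"
  shows "ones (chunk m s xs) = card {g. g < m \<and> xs ! (s * m + g)}"
  unfolding ones_def chunk_def length_filter_conv_card using assms
  by (intro arg_cong[where f = card]) auto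

definition eProg :: "nat \<Rightarrow> exp" where
  "eProg \<kappa> = code.eBody eM (ePos 0) (XAdd (ePos 3) X1) (eDiv \<kappa>)"
definition eAns :: "nat \<Rightarrow> exp" where
  "eAns \<kappa> = code.eOut eM (ePos 0) (eDiv \<kappa>)"

lemma ok_prog: "okexp (eProg \<kappa>)" "okexp (eAns \<kappa>)"
  unfolding eProg_def eAns_def by (intro code.ok_body code.ok_out[where eP = X1]; simp)+

text \<open>Only the layout of the string has to be checked. The bound m^6 <= T provides enough
  examples (fewer than m^5 + 1 are addressed) and m coins for each of them.\<close>

theorem interpreter_correct:
  assumes smp: "length smp = T" "\<And>s. s \<in> set smp \<Longrightarrow> length (fst s) = n"
    and r: "length r = T" and x: "length x = n"
    and u: "u = enc_bits x @ [Sep] @ learner_input n \<epsilon> \<delta> smp r"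
    and N: "N = length u" and inp: "inp = (\<lambda>i. if i < length u then u ! i else Blank)"
    and m: "m ^ 12 < N" "N \<le> (m + 1) ^ 12" "n + 4 \<le> m" "1 + lg n div \<kappa> + 2 \<le> m" "m ^ 6 \<le> T"
    and \<kappa>: "\<kappa> > 0" and a: "a = 1 + lg n div \<kappa>"
  shows "ev N inp (memo N inp (eProg \<kappa>) N) (eAns \<kappa>) (\<lambda>_. N) = 0 \<longleftrightarrow>
    predict n a m (map (samples m smp r) [0..<m * (m * m * (a * m))]) x"
proof -
  define eb where "eb = enc_bits (bin (nat \<lceil>1 / \<epsilon>\<rceil>))"
  define db where "db = enc_bits (bin (nat \<lceil>1 / \<delta>\<rceil>))"
  define blk where "blk = map (\<lambda>(x, y). enc_bits x @ enc_bits [y] @ [Sep]) smp"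
  define H where "H = enc_bits x @ [Sep] @ replicate n One @ [Sep] @ eb @ [Sep] @ db"
  have u': "u = H @ [Sep] @ concat blk @ [Sep] @ enc_bits r"
    unfolding u learner_input_def H_def eb_def db_def blk_def by simp
  have lb: "length xs = n + 2" if "xs \<in> set blk" for xs
    using that smp(2) by (auto simp: blk_def enc_bits_def)
  have blk: "length (concat blk) = T * (n + 2)" using length_concat_blocks[of blk "n + 2"] lb smp by (simp add: blk_def)
  define P0 where "P0 = length H + 1"
  have Nl: "N = P0 + T * (n + 2) + 1 + T" by (simp add: N u' P0_def blk r enc_bits_def)
  have m4: "m \<ge> 4" using m by simp
  have "m \<le> m ^ 12" by (rule self_le_power) (use m4 in auto)
  then have mN: "m < N" using m(1) by (rule le_less_trans)
  have N1: "N \<ge> 1" using mN by simp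
  have inp': "inp i = u ! i" if "i < N" for i using that by (simp add: inp N)
  have H0: "Sep \<notin> set eb" "Sep \<notin> set db" "Sep \<notin> set (replicate n One)" by (auto simp: eb_def db_def Sep_enc_bits)
  \<comment> \<open>Before the examples come the point, n in unary, and the codes of the two
    accuracy parameters: four fields, so the examples start after separator number 3.\<close>
  have cH: "card {i. i < length H \<and> H ! i = Sep} = 3"
    unfolding H_def card_Sep_append card_Sep_1 card_Sep_0[OF H0(1)] card_Sep_0[OF H0(2)] card_Sep_0[OF H0(3)] card_Sep_0[OF Sep_enc_bits] by simp
  have en: "ev N inp A (ePos 0) e = n" for A e
  proof -
    have "ev N inp A (ePos 0) e = length (enc_bits x)"
      by (rule ev_Pos[where C = "learner_input n \<epsilon> \<delta> smp r" and u = u]) (use u card_Sep_0[OF Sep_enc_bits] N N1 inp' in auto)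
    then show ?thesis by (simp add: enc_bits_def x)
  qed
  have eP: "ev N inp A (XAdd (ePos 3) X1) e = P0" for A e
  proof -
    have "ev N inp A (ePos 3) e = length H"
      by (rule ev_Pos[where C = "concat blk @ [Sep] @ enc_bits r" and u = u]) (use u' cH N N1 inp' mN m4 in auto)
    then show ?thesis unfolding P0_def by (intro ev_add[OF N1] ev_1[OF N1]) (use Nl P0_def in auto)
  qed
  have m5: "m ^ 5 < T"
  proof -
    have "m ^ 5 * 1 < m ^ 5 * m" using m4 by (intro mult_strict_left_mono) auto
    also have "\<dots> = m ^ 6" by (simp add: eval_nat_numeral mult_ac)
    finally show ?thesis using m(5) by simp
  qed
  have fit: "P0 + (m ^ 5 + 1) * (n + 2) \<le> N"
  proof -
    have "(m ^ 5 + 1) * (n + 2) \<le> T * (n + 2)" using m5 by (intro mult_le_mono1) simp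
    then show ?thesis using Nl by simp
  qed
  interpret code_run eM "ePos 0" "XAdd (ePos 3) X1" "eDiv \<kappa>" N inp m n P0 a
  proof
    show "ev N inp A eM e = m" for A e by (rule ev_M[OF m(1,2)])
    show "ev N inp A (eDiv \<kappa>) e = a" for A e unfolding a by (rule ev_Div[OF en _ \<kappa>]) (use mN m in simp)
  qed (use m a en eP fit in auto)
  interpret code_spec eM "ePos 0" "XAdd (ePos 3) X1" "eDiv \<kappa>" N inp m n P0 a "samples m smp r" x
  proof
    show "length x = n" by (rule x)
    show "inp i = One \<longleftrightarrow> x ! i" if "i < n" for i
      using that x mN m by (subst inp') (auto simp: u nth_append enc_bits_def)
    show "inp n \<noteq> One"
      using x mN m by (subst inp') (auto simp: u nth_append enc_bits_def)
    fix s assume "s < m ^ 5"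
    then have s: "s < T" using m5 by simp
    have ls: "length (fst (smp ! s)) = n" using smp s by simp
    then show "length (fst (samples m smp r s)) = Suc n" by (simp add: samples_def)
    show "inp (P0 + s * (n + 2) + i) = One \<longleftrightarrow> fst (samples m smp r s) ! i" if i: "i \<le> n" for i
    proof -
      have "s * (n + 2) + i < (s + 1) * (n + 2)" using i by simp
      also have "\<dots> \<le> T * (n + 2)" using s by (intro mult_le_mono1) simp
      finally have b: "s * (n + 2) + i < T * (n + 2)" .
      then have "inp (P0 + s * (n + 2) + i) = u ! (P0 + (s * (n + 2) + i))"
        using Nl by (subst inp') (simp_all add: add.assoc)
      also have "\<dots> = concat blk ! (s * (n + 2) + i)"
        using b blk by (simp add: u' P0_def nth_append add.assoc)
      also have "\<dots> = blk ! s ! i" using s i smp by (intro nth_concat_blocks lb) (auto simp: blk_def)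
      finally have 1: "inp (P0 + s * (n + 2) + i) = blk ! s ! i" .
      obtain xs y where xy: "smp ! s = (xs, y)" by fastforce
      have "blk ! s = enc_bits xs @ enc_bits [y] @ [Sep]" using s smp(1) xy by (simp add: blk_def)
      then show ?thesis unfolding 1 samples_def using ls i xy by (auto simp: enc_bits_def nth_append)
    qed
    show "snd (samples m smp r s) = theta s"
    proof -
      have "(s + 1) * m \<le> m ^ 5 * m" using \<open>s < m ^ 5\<close> by (intro mult_le_mono1) simp
      also have "\<dots> = m ^ 6" by (simp add: eval_nat_numeral mult_ac)
      finally have b: "s * m + m \<le> T" using \<open>m ^ 6 \<le> T\<close> by simp
      have "inp (N - 1 - (s * m + g)) = One \<longleftrightarrow> rev r ! (s * m + g)" if "g < m" for g
      proof -
        have k: "s * m + g < T" using b that by simp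
        have "inp (N - 1 - (s * m + g)) = u ! (N - 1 - (s * m + g))" using Nl by (intro inp') simp
        also have "\<dots> = rev u ! (s * m + g)" using k Nl \<open>N = length u\<close> by (subst rev_nth) auto
        also have "\<dots> = rev (enc_bits r) ! (s * m + g)" using k r by (simp add: u' nth_append enc_bits_def)
        also have "\<dots> = (if rev r ! (s * m + g) then One else Zero)" using k r by (simp add: enc_bits_def rev_map)
        finally show ?thesis by simp
      qed
      then have "theta s = card {g. g < m \<and> rev r ! (s * m + g)}" unfolding theta_def by (intro arg_cong[where f = card]) auto
      then show ?thesis using ones_chunk[of s m "rev r"] b r by (simp add: samples_def)
    qed
  qed
  show ?thesis using program_correct unfolding eProg_def eAns_def .
qed

section \<open>Choice of parameters and sample size\<close>

lemma card_block: "a > 0 \<Longrightarrow> card (block n a l) \<le> n div a + 1"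
proof (cases "block n a l = {}")
  case False
  assume a: "a > 0"
  obtain i0 where i0: "i0 \<in> block n a l" "\<And>i. i \<in> block n a l \<Longrightarrow> i0 \<le> i"
    using LeastI_ex[of "\<lambda>i. i \<in> block n a l"] Least_le[of "\<lambda>i. i \<in> block n a l"] False that by (meson ex_in_conv)
  have "block n a l \<subseteq> {i0..i0 + n div a}"
  proof
    fix i assume i: "i \<in> block n a l"
    then have "i * a \<le> i0 * a + n" using i0(1) by (simp add: block_def)
    then have "(i - i0) * a \<le> n" by (simp add: diff_mult_distrib)
    then have "i - i0 \<le> n div a" using a by (simp add: less_eq_div_iff_mult_less_eq)
    then show "i \<in> {i0..i0 + n div a}" using i0(2)[OF i] by simp
  qed
  then have "card (block n a l) \<le> card {i0..i0 + n div a}" by (rule card_mono[rotated]) simp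
  then show ?thesis by simp
qed simp

lemma lg_bounds:
  assumes "n \<ge> 1" shows "log 2 (real n) \<le> real (lg n)" "2 ^ lg n \<le> 2 * n"
proof -
  have "lg n \<notin> {i. 2 ^ i \<le> n}" by (simp only: lg_set) simp
  then have "n < 2 ^ lg n" by simp
  then show "log 2 (real n) \<le> real (lg n)" using assms by (intro log2_of_power_le) auto
  show "2 ^ lg n \<le> 2 * n"
  proof (cases "lg n")
    case (Suc k)
    then have "k \<in> {i. 2 ^ i \<le> n}" by (simp only: lg_set) simp
    then show ?thesis using Suc by simp
  qed (use assms in simp)
qed

text \<open>The number of elimination levels: small enough that 2^\<open>height\<close> stays below
  a small power of n, large enough that a block has O(n / log n) coordinates.\<close>

definition height :: "nat \<Rightarrow> nat \<Rightarrow> nat" where "height \<kappa> n = 1 + lg n div \<kappa>"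

text \<open>The correlation \<eta> guaranteed by \<open>parity_correlation\<close> for s = n^(2 -
  \<gamma>).\<close>

definition corr :: "real \<Rightarrow> nat \<Rightarrow> real" where
  "corr \<gamma> n = 1 / (16 * (2 * real n powr (2 - \<gamma>) + 1) ^ nat \<lceil>12 * sqrt (real n powr (2 - \<gamma>))\<rceil>)"

text \<open>The bound on buckets per level divided by the bias left after all levels; up to a factor
  of order 1 / \<epsilon> this is the batch size at which the bucket loss becomes harmless.\<close>

definition cost :: "real \<Rightarrow> nat \<Rightarrow> nat \<Rightarrow> real" where
  "cost \<gamma> \<kappa> n = 2 ^ (n div height \<kappa> n + 1) / (corr \<gamma> n / 2) ^ (2 ^ height \<kappa> n)"

text \<open>The logarithm splits into the block length, about \<kappa> n / log n, and
  2^\<open>height\<close> times log (2 / \<open>corr\<close>). The latter product is of order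
  n^(\<gamma>/4) times n^(1 - \<gamma>/2) log n.\<close>

lemma log_cost:
  assumes \<gamma>: "0 < \<gamma>" "\<gamma> \<le> 1" and \<kappa>: "real \<kappa> \<ge> 4 / \<gamma>" and n: "n \<ge> 2"
  shows "log 2 (cost \<gamma> \<kappa> n) \<le> real \<kappa> * (real n / log 2 (real n)) + 1 +
    124 * real n powr (1 - \<gamma> / 4) * (1 + log 2 (real n))"
proof -
  let ?n = "real n" and ?a = "height \<kappa> n" and ?s = "real n powr (2 - \<gamma>)"
  let ?K = "nat \<lceil>12 * sqrt ?s\<rceil>"
  have n1: "?n \<ge> 1" "log 2 ?n \<ge> 1" using n by (simp_all add: le_log_iff)
  have \<kappa>0: "\<kappa> > 0" using \<kappa> \<gamma> by (cases "\<kappa> = 0") (auto simp: divide_le_0_iff)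
  have s1: "?s \<ge> 1" using n1 \<gamma> by (simp add: ge_one_powr_ge_zero)
  have s2: "?s \<le> ?n\<^sup>2" using n1 \<gamma> powr_mono[of "2 - \<gamma>" 2 ?n] by simp
  have "real (lg n) \<le> real \<kappa> * real ?a"
  proof -
    have "lg n < \<kappa> * (lg n div \<kappa> + 1)" using \<kappa>0 by (simp add: dividend_less_times_div)
    then have "lg n \<le> \<kappa> * ?a" by (simp add: height_def)
    then show ?thesis by (metis of_nat_le_iff of_nat_mult)
  qed
  then have al: "log 2 ?n \<le> real \<kappa> * real ?a" using lg_bounds(1)[of n] n by simp
  have a0: "real ?a > 0" by (simp add: height_def)
  have "real (n div ?a + 1) \<le> ?n / real ?a + 1" by (simp add: of_nat_div_le_of_nat)
  also have "?n / real ?a \<le> real \<kappa> * (?n / log 2 ?n)"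
    using al n1 a0 mult_left_mono[OF al, of ?n] by (simp add: field_simps)
  finally have b: "real (n div ?a + 1) \<le> real \<kappa> * (?n / log 2 ?n) + 1" by simp
  \<comment> \<open>Since \<kappa> >= 4 / \<gamma>, the quotient of the binary length by \<kappa> is
    at most \<gamma>/4 of that length, and 2 to the binary length is at most 2 n.\<close>
  have A: "(2::real) ^ ?a \<le> 4 * ?n powr (\<gamma> / 4)"
  proof -
    have "real (lg n div \<kappa>) \<le> real (lg n) * (1 / real \<kappa>)" using of_nat_div_le_of_nat[of "lg n" \<kappa>] by simp
    also have "\<dots> \<le> real (lg n) * (\<gamma> / 4)" using \<kappa> \<gamma> \<kappa>0 by (intro mult_left_mono) (auto simp: field_simps)
    finally have "(2::real) powr real (lg n div \<kappa>) \<le> 2 powr (real (lg n) * (\<gamma> / 4))" by simp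
    also have "\<dots> = (2 ^ lg n) powr (\<gamma> / 4)"
      by (simp only: powr_powr[symmetric]) (simp add: powr_realpow)
    also have "\<dots> \<le> (2 * ?n) powr (\<gamma> / 4)"
    proof (rule powr_mono2)
      show "(2::real) ^ lg n \<le> 2 * ?n" using lg_bounds(2)[of n] n
        using of_nat_mono[of "2 ^ lg n" "2 * n", where 'a = real] by simp
    qed (use \<gamma> in auto)
    also have "\<dots> = 2 powr (\<gamma> / 4) * ?n powr (\<gamma> / 4)" using n1 by (simp add: powr_mult)
    also have "\<dots> \<le> 2 powr 1 * ?n powr (\<gamma> / 4)" using \<gamma> by (intro mult_right_mono powr_mono) auto
    finally show ?thesis by (simp add: height_def powr_realpow)
  qed
  have "sqrt ?s = ?n powr ((2 - \<gamma>) * (1 / 2))" by (simp add: powr_half_sqrt[symmetric] powr_powr)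
  then have sq: "sqrt ?s = ?n powr (1 - \<gamma> / 2)" by (simp add: field_simps)
  have q1: "?n powr (1 - \<gamma> / 2) \<ge> 1" using n1 \<gamma> by (simp add: ge_one_powr_ge_zero)
  have "real ?K \<le> 12 * sqrt ?s + 1" by (simp add: of_nat_nat)
  then have K: "real ?K \<le> 13 * ?n powr (1 - \<gamma> / 2)" using q1 sq by linarith
  have "log 2 (2 * ?s + 1) \<le> log 2 (4 * ?n\<^sup>2)" using s1 s2 by (intro log_mono) auto
  also have "\<dots> = 2 + 2 * log 2 ?n" using n1 log_pow_cancel[of 2 2] by (simp add: log_mult log_nat_power)
  finally have L: "log 2 (2 * ?s + 1) \<le> 2 + 2 * log 2 ?n" .
  have L0: "log 2 (2 * ?s + 1) \<ge> 0" using s1 by simp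
  have "log 2 (2 / corr \<gamma> n) = log 2 (32 * (2 * ?s + 1) ^ ?K)" by (simp add: corr_def)
  also have "\<dots> = 5 + real ?K * log 2 (2 * ?s + 1)"
    using s1 log_pow_cancel[of 2 5] by (simp add: log_mult log_nat_power)
  also have "\<dots> \<le> 5 + (13 * ?n powr (1 - \<gamma> / 2)) * (2 + 2 * log 2 ?n)"
    using K L L0 by (intro add_left_mono mult_mono) auto
  also have "\<dots> \<le> 31 * ?n powr (1 - \<gamma> / 2) * (1 + log 2 ?n)"
  proof -
    have "1 * 1 \<le> ?n powr (1 - \<gamma> / 2) * (1 + log 2 ?n)" using q1 n1 by (intro mult_mono) auto
    then show ?thesis by (simp add: algebra_simps)
  qed
  finally have E: "log 2 (2 / corr \<gamma> n) \<le> 31 * ?n powr (1 - \<gamma> / 2) * (1 + log 2 ?n)" .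
  have c0: "corr \<gamma> n > 0" using s1 by (simp add: corr_def zero_less_power add_pos_pos)
  have "cost \<gamma> \<kappa> n = 2 ^ (n div ?a + 1) * (2 / corr \<gamma> n) ^ (2 ^ ?a)" by (simp add: cost_def power_divide)
  then have "log 2 (cost \<gamma> \<kappa> n) = log 2 (2 ^ (n div ?a + 1)) + log 2 ((2 / corr \<gamma> n) ^ (2 ^ ?a))"
    using c0 by (simp only: log_mult zero_less_power zero_less_divide_iff zero_less_numeral) (simp add: log_mult)
  also have "\<dots> = real (n div ?a + 1) + 2 ^ ?a * log 2 (2 / corr \<gamma> n)"
    using c0 log_nat_power[of "2 / corr \<gamma> n" 2 "2 ^ ?a"] log_pow_cancel[of 2 "n div ?a + 1"] by simp
  also have "\<dots> \<le> real \<kappa> * (?n / log 2 ?n) + 1 + (4 * ?n powr (\<gamma> / 4)) * (31 * ?n powr (1 - \<gamma> / 2) * (1 + log 2 ?n))"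
    using b A E n1 by (intro add_mono mult_mono order_trans[OF mult_left_mono[OF E] mult_right_mono[OF A]]) auto
  also have "(4 * ?n powr (\<gamma> / 4)) * (31 * ?n powr (1 - \<gamma> / 2) * (1 + log 2 ?n))
      = 124 * (?n powr (\<gamma> / 4) * ?n powr (1 - \<gamma> / 2)) * (1 + log 2 ?n)" by simp
  also have "?n powr (\<gamma> / 4) * ?n powr (1 - \<gamma> / 2) = ?n powr (1 - \<gamma> / 4)"
    by (simp add: powr_add[symmetric])
  finally show ?thesis .
qed

lemma cost_pos: "cost \<gamma> \<kappa> n > 0"
proof -
  have "(2 * real n powr (2 - \<gamma>) + 1) ^ k > 0" for k by (intro zero_less_power add_nonneg_pos) auto
  then show ?thesis by (simp add: cost_def corr_def)
qed

text \<open>The second term of \<open>log_cost\<close> is o(n / log n), so eventually one more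
  factor of the base covers it; the finitely many small n are absorbed in \<open>C\<close>.\<close>

lemma cost_bound:
  assumes \<gamma>: "0 < \<gamma>" "\<gamma> \<le> 1" and \<kappa>: "real \<kappa> \<ge> 4 / \<gamma>"
  shows "\<exists>C. \<forall>n. cost \<gamma> \<kappa> n \<le> C * (2 powr (real n / log 2 (real n))) ^ (\<kappa> + 1)"
proof -
  have "eventually (\<lambda>n::nat. 1 + 124 * real n powr (1 - \<gamma> / 4) * (1 + log 2 (real n)) \<le> real n / log 2 (real n)) at_top"
    using \<gamma> by real_asymp
  then obtain n0 where n0: "\<And>n. n \<ge> n0 \<Longrightarrow> 1 + 124 * real n powr (1 - \<gamma> / 4) * (1 + log 2 (real n)) \<le> real n / log 2 (real n)"
    by (auto simp: eventually_at_top_linorder)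
  let ?W = "\<lambda>n. (2 powr (real n / log 2 (real n))) ^ (\<kappa> + 1)"
  define C where "C = 1 + (\<Sum>n<n0 + 2. cost \<gamma> \<kappa> n / ?W n)"
  have pos: "cost \<gamma> \<kappa> n / ?W n \<ge> 0" for n using cost_pos[of \<gamma> \<kappa> n] by simp
  have C1: "1 \<le> C" unfolding C_def le_add_same_cancel1 by (intro sum_nonneg pos)
  have "cost \<gamma> \<kappa> n \<le> C * ?W n" for n
  proof (cases "n < n0 + 2")
    case True
    then have "cost \<gamma> \<kappa> n / ?W n \<le> (\<Sum>n<n0 + 2. cost \<gamma> \<kappa> n / ?W n)"
      by (intro member_le_sum pos) auto
    then have "cost \<gamma> \<kappa> n / ?W n \<le> C" by (simp add: C_def)
    then show ?thesis by (simp add: pos_divide_le_eq)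
  next
    case False
    then have n: "n \<ge> 2" "n \<ge> n0" by auto
    have "log 2 (cost \<gamma> \<kappa> n) \<le> (real \<kappa> + 1) * (real n / log 2 (real n))"
      unfolding distrib_right mult_1_left using log_cost[OF \<gamma> \<kappa> n(1)] n0[OF n(2)] by linarith
    then have "cost \<gamma> \<kappa> n \<le> 2 powr ((real \<kappa> + 1) * (real n / log 2 (real n)))"
      using cost_pos[of \<gamma> \<kappa> n] by (simp add: log_le_iff)
    also have "\<dots> = ?W n"
      by (subst powr_realpow[symmetric]) (simp, simp add: powr_powr mult.commute add.commute del: powr_realpow)
    also have "\<dots> = 1 * ?W n" by simp
    also have "\<dots> \<le> C * ?W n"
      using C1 by (intro mult_right_mono) simp_all
    finally show ?thesis .
  qed
  then show ?thesis by blast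
qed

lemma cost_lower:
  assumes "0 < \<gamma>" "\<gamma> \<le> 1" "n \<ge> 1"
  shows "32 * (2 * real n + 1) \<le> cost \<gamma> \<kappa> n" "2 / (corr \<gamma> n / 2) ^ (2 ^ height \<kappa> n) \<le> cost \<gamma> \<kappa> n"
    "0 < corr \<gamma> n" "corr \<gamma> n \<le> 1"
proof -
  let ?s = "real n powr (2 - \<gamma>)"
  have "real n powr 1 \<le> ?s" using assms by (intro powr_mono) auto
  then have s: "real n \<le> ?s" using assms by simp
  let ?K = "nat \<lceil>12 * sqrt ?s\<rceil>"
  have K: "?K \<ge> 1" using s assms by (simp add: Suc_le_eq)
  have "(2 * ?s + 1) ^ 1 \<le> (2 * ?s + 1) ^ ?K" using K s by (intro power_increasing) auto
  then have p: "2 * real n + 1 \<le> (2 * ?s + 1) ^ ?K" using s by simp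
  show c: "0 < corr \<gamma> n" using p by (simp add: corr_def)
  have "1 \<le> (2 * ?s + 1) ^ ?K" using s by (intro one_le_power) auto
  then show c1: "corr \<gamma> n \<le> 1" unfolding corr_def by (subst divide_le_eq_1_pos; linarith)
  have b: "(corr \<gamma> n / 2) ^ (2 ^ height \<kappa> n) > 0" using c by simp
  have "(corr \<gamma> n / 2) ^ (2 ^ height \<kappa> n) \<le> (corr \<gamma> n / 2) ^ 1" using c c1 by (intro power_decreasing) auto
  then have "2 / (corr \<gamma> n / 2) \<le> 2 / (corr \<gamma> n / 2) ^ (2 ^ height \<kappa> n)" using b c by (intro divide_left_mono) auto
  moreover show d: "2 / (corr \<gamma> n / 2) ^ (2 ^ height \<kappa> n) \<le> cost \<gamma> \<kappa> n"
    unfolding cost_def using b by (intro divide_right_mono) auto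
  moreover have "32 * (2 * real n + 1) \<le> 64 * (2 * ?s + 1) ^ ?K" by (rule mult_mono[OF _ p]) simp_all
  then have "32 * (2 * real n + 1) \<le> 2 / (corr \<gamma> n / 2)" by (simp add: corr_def)
  ultimately show "32 * (2 * real n + 1) \<le> cost \<gamma> \<kappa> n" by (meson order_trans)
qed

text \<open>Instance of \<open>learner_correct\<close> with binomial thresholds (H = m, \<alpha> = 1
  / sqrt m), error \<epsilon> / 32 for the bucket loss and \<mu> = \<epsilon> / 8. The square in the
  bound on m is forced by the tie probability, which decays only like 1 / sqrt m.\<close>

lemma learner_bounds:
  assumes \<gamma>: "0 < \<gamma>" "\<gamma> \<le> 1" and n: "n \<ge> 1" and \<epsilon>: "\<epsilon> > 0" and \<delta>: "\<delta> > 0"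
    and X: "1 \<le> X" "1 / \<epsilon> \<le> X" "log 2 (1 / \<delta>) \<le> X"
    and m: "1600 * (cost \<gamma> \<kappa> n * X)\<^sup>2 \<le> real m" and a: "a = height \<kappa> n"
    and f: "f \<in> formula_xor n (real n powr (2 - \<gamma>))" and D: "set_pmf D \<subseteq> {x. length x = n}"
  shows "measure_pmf.prob (iid (m * (m * m * (a * m))) (labelled D f (binom m)))
     {zs. measure_pmf.prob D {x. predict n a m zs x \<noteq> f x} \<le> \<epsilon>} \<ge> 1 - \<delta>"
proof -
  let ?Y = "cost \<gamma> \<kappa> n" and ?s = "real n powr (2 - \<gamma>)"
  define \<beta> where "\<beta> = (corr \<gamma> n / 2) ^ (2 ^ a)"
  note lower = cost_lower(1,2)[OF \<gamma> n, of \<kappa>] cost_lower(3)[OF \<gamma> n]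
  have \<beta>: "\<beta> > 0" using lower(3) by (simp add: \<beta>_def)
  have "1 \<le> 32 * (2 * real n + 1)" by simp
  then have Y1: "?Y \<ge> 1" using lower(1) by (rule order_trans)
  have Y\<beta>: "2 / \<beta> \<le> ?Y" using lower(2) by (simp add: \<beta>_def a)
  have "?Y = 2 ^ (n div a + 1) / \<beta>" by (simp only: cost_def \<beta>_def a)
  then have Yb: "2 ^ (n div a + 1) = ?Y * \<beta>" using \<beta> by simp
  have e1: "1 \<le> \<epsilon> * X" using X(2) \<epsilon> by (simp add: field_simps)
  have YX: "1 * 1 \<le> ?Y * X" using Y1 X by (intro mult_mono) auto
  have sq: "?Y * X \<le> (?Y * X)\<^sup>2" by (rule self_le_power) (use YX in auto)
  have mp: "real m \<ge> 1600 * (?Y * X)" using m sq by linarith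
  have "0 < real m" using mp YX by linarith
  then have m0: "m > 0" by simp
  \<comment> \<open>40^2 = 1600; a factor 32 would be enough for the share \<epsilon> / 32.\<close>
  have rt: "40 * (?Y * X) \<le> sqrt (real m)"
    by (rule real_le_rsqrt) (use m in \<open>simp add: power_mult_distrib\<close>)
  have rt0: "sqrt (real m) > 0" using m0 by simp
  have "1 - exp (- 2 * (\<epsilon> / 8) * real m) \<le> measure_pmf.prob (iid (m * (m * m * (a * m))) (labelled D f (binom m)))
     {zs. measure_pmf.prob D {x. predict n a m zs x \<noteq> f x} \<le> 8 * (\<epsilon> / 8)}"
  proof (rule learner_correct[OF f D, where K = "nat \<lceil>12 * sqrt ?s\<rceil>" and b = "n div a + 1" and \<eta> = "corr \<gamma> n"
        and H = m and \<alpha> = "1 / sqrt (real m)" and \<epsilon> = "\<epsilon> / 32"])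
    show "12 * sqrt ?s \<le> real (nat \<lceil>12 * sqrt ?s\<rceil>)" by linarith
    show "m > 0" by (rule m0)
    show a0: "a > 0" by (simp add: a height_def)
    show "card (block n a l) \<le> n div a + 1" for l by (rule card_block[OF a0])
    show "corr \<gamma> n = 1 / (16 * (2 * ?s + 1) ^ nat \<lceil>12 * sqrt ?s\<rceil>)" by (simp add: corr_def)
    show "set_pmf (binom m) \<subseteq> {..m}" by (rule set_binom)
    show "pmf (binom m) k \<le> 1 / sqrt (real m)" for k by (rule pmf_binom_le[OF m0])
    show "pmf (binom m) 0 \<le> 1 / 2" by (rule pmf_binom_0[OF m0])
    show "\<epsilon> / 32 > 0" using \<epsilon> by simp
    have "32 * ?Y * 1 \<le> 32 * ?Y * (\<epsilon> * X)" using e1 Y1 by (intro mult_left_mono) auto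
    also have "\<dots> = \<epsilon> * (32 * (?Y * X))" by simp
    also have "\<dots> \<le> \<epsilon> * real m" using mp YX \<epsilon> by (intro mult_left_mono) auto
    finally have "?Y * \<beta> \<le> (\<epsilon> / 32 * real m) * \<beta>" using \<beta> by (intro mult_right_mono) auto
    then show "2 ^ (n div a + 1) / real m \<le> \<epsilon> / 32 * (corr \<gamma> n / 2) ^ (2 ^ a)"
      unfolding Yb \<beta>_def[symmetric] using m0 by (simp add: field_simps)
    have "real m / real (m * m) = 1 / real m" using m0 by simp
    also have "\<dots> \<le> 1 / sqrt (real m)"
    proof -
      have "sqrt (real m) * 1 \<le> sqrt (real m) * sqrt (real m)" using m0 by (intro mult_left_mono) auto
      then have "sqrt (real m) \<le> real m" by simp
      then show ?thesis using rt0 by (intro divide_left_mono) auto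
    qed
    finally have "(real m / real (m * m) + 1 / sqrt (real m)) / \<beta> \<le> (2 / sqrt (real m)) / \<beta>"
      using \<beta> by (intro divide_right_mono) auto
    also have "\<dots> = (2 / \<beta>) / sqrt (real m)" by simp
    also have "\<dots> \<le> ?Y / sqrt (real m)" using Y\<beta> rt0 by (intro divide_right_mono) auto
    also have "\<dots> \<le> \<epsilon> / 32"
    proof -
      have "32 * ?Y * 1 \<le> 32 * ?Y * (\<epsilon> * X)" using e1 Y1 by (intro mult_left_mono) auto
      also have "\<dots> = \<epsilon> * (32 * (?Y * X))" by simp
      also have "\<dots> \<le> \<epsilon> * sqrt (real m)" using rt YX \<epsilon> by (intro mult_left_mono) auto
      finally show ?thesis using rt0 by (simp add: field_simps)
    qed
    finally have q: "(real m / real (m * m) + 1 / sqrt (real m)) / \<beta> \<le> \<epsilon> / 32" .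
    have "2 * (\<epsilon> / 32 + q) \<le> \<epsilon> / 8" if "q \<le> \<epsilon> / 32" for q using that by simp
    from this[OF q] show "2 * (\<epsilon> / 32 + (real m / real (m * m) + 1 / sqrt (real m)) / (corr \<gamma> n / 2) ^ 2 ^ a) \<le> \<epsilon> / 8"
      unfolding \<beta>_def .
  qed
  moreover have "exp (- 2 * (\<epsilon> / 8) * real m) \<le> \<delta>"
  proof -
    \<comment> \<open>The natural logarithm is at most the binary one for \<delta> < 1, and it is
      not positive otherwise.\<close>
    have "ln (1 / \<delta>) \<le> X"
    proof (cases "\<delta> \<ge> 1")
      case True then show ?thesis using X(1) \<delta> by (simp add: ln_div) (meson ln_ge_zero le_minus_iff order_trans neg_le_0_iff_le zero_le_one)
    next
      case False
      then have l0: "ln (1 / \<delta>) \<ge> 0" using \<delta> by simp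
      have "ln (2::real) \<le> 1" using ln_le_minus_one[of 2] by simp
      then have "ln (1 / \<delta>) * ln 2 \<le> ln (1 / \<delta>) * 1" using l0 by (intro mult_left_mono)
      then have "ln (1 / \<delta>) \<le> ln (1 / \<delta>) / ln 2" by (simp add: field_simps)
      then show ?thesis using X(3) by (simp add: log_def)
    qed
    also have "X \<le> (2 * (\<epsilon> / 8)) * (1600 * (?Y * X)\<^sup>2)"
    proof -
      have "X * X \<le> (?Y * X)\<^sup>2" using Y1 X power_mono[of X "?Y * X" 2] by (simp add: power2_eq_square)
      then have "\<epsilon> * (X * X) \<le> \<epsilon> * (?Y * X)\<^sup>2" using \<epsilon> by (intro mult_left_mono) auto
      moreover have "1 * X \<le> \<epsilon> * X * X" using e1 X by (intro mult_right_mono) auto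
      ultimately have "X \<le> \<epsilon> * (?Y * X)\<^sup>2" by (simp only: mult.assoc mult_1)
      also have "\<dots> \<le> 400 * (\<epsilon> * (?Y * X)\<^sup>2)" using \<epsilon> by simp
      finally show ?thesis by simp
    qed
    also have "\<dots> \<le> (2 * (\<epsilon> / 8)) * real m" using m \<epsilon> by (intro mult_left_mono) auto
    finally have "exp (- 2 * (\<epsilon> / 8) * real m) \<le> exp (- ln (1 / \<delta>))" by simp
    then show ?thesis using \<delta> by (simp add: ln_div)
  qed
  ultimately show ?thesis by simp
qed

lemma length_bin: "k \<ge> 1 \<Longrightarrow> 2 ^ length (bin k) \<le> 2 * k"
proof (induction k rule: less_induct)
  case (less k)
  show ?case
  proof (cases "k = 1")
    case False
    then have "2 ^ length (bin (k div 2)) \<le> 2 * (k div 2)" using less by (intro less.IH) auto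
    then show ?thesis using less.prems by (subst bin.simps) simp
  qed simp
qed

lemma length_bin_ceiling:
  assumes "z > 0" "1 \<le> X" "log 2 (1 / z) \<le> X"
  shows "real (length (bin (nat \<lceil>1 / z\<rceil>))) \<le> 3 * X"
proof -
  let ?k = "nat \<lceil>1 / z\<rceil>" and ?l = "length (bin (nat \<lceil>1 / z\<rceil>))"
  have k: "?k \<ge> 1" using assms(1) by (simp add: Suc_le_eq)
  have "real (2 ^ ?l) \<le> real (2 * ?k)" using length_bin[OF k] by (simp only: of_nat_le_iff)
  also have "\<dots> \<le> 2 * (1 / z + 1)" using assms(1) by (simp add: of_nat_nat) linarith
  finally have e: "2 ^ ?l \<le> 2 * (1 / z + 1)" by simp
  have "2 * (1 / z + 1) \<le> 2 powr (2 + X)"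
  proof (cases "z \<ge> 1")
    case True
    then have "2 * (1 / z + 1) \<le> 4" using assms(1) by (simp add: field_simps)
    also have "(4::real) = 2 powr 2" by simp
    also have "\<dots> \<le> 2 powr (2 + X)" using assms(2) by (intro powr_mono) auto
    finally show ?thesis .
  next
    case False
    then have "2 * (1 / z + 1) \<le> 4 * (1 / z)" using assms(1) by (simp add: field_simps)
    also have "4 * (1 / z) = 4 * 2 powr (log 2 (1 / z))" using assms(1) by simp
    also have "\<dots> \<le> 4 * 2 powr X" using assms(3) by (intro mult_left_mono powr_mono) auto
    also have "\<dots> = 2 powr (2 + X)" by (simp add: powr_add)
    finally show ?thesis .
  qed
  then have "2 powr (real ?l) \<le> 2 powr (2 + X)" using e by (simp add: powr_realpow)
  then have "real ?l \<le> 2 + X" by simp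
  then show ?thesis using assms(2) by simp
qed

lemma root_exists:
  assumes "(N::nat) > 0" shows "\<exists>m. m ^ 12 < N \<and> N \<le> (m + 1) ^ 12"
proof -
  define m where "m = (LEAST m. N \<le> (m + 1) ^ 12)"
  have "N \<le> (N + 1) ^ 12" using self_le_power[of "N + 1" 12] by simp
  then have "N \<le> (m + 1) ^ 12" unfolding m_def by (rule LeastI)
  moreover have "m ^ 12 < N"
  proof (cases m)
    case (Suc k)
    then have "\<not> N \<le> (k + 1) ^ 12" using not_less_Least[of k "\<lambda>m. N \<le> (m + 1) ^ 12"] by (simp add: m_def)
    then show ?thesis using Suc by simp
  qed (use assms in simp)
  ultimately show ?thesis by blast
qed

text \<open>The batch size m is the twelfth root of the string length N, which lies between T and T
  m. The lower bound makes m at least R, the upper one makes m^6 fit into T.\<close>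

lemma scale_exists:
  assumes T: "(R + 2) ^ 12 < real T + 1" and R: "2 * real n + 5 + 6 * X \<le> R" "1 \<le> X" "1 \<le> n"
    and l: "real le \<le> 3 * X" "real ld \<le> 3 * X" and N: "N = 2 * n + 5 + le + ld + T * (n + 3)"
  shows "\<exists>m. m ^ 12 < N \<and> N \<le> (m + 1) ^ 12 \<and> R \<le> real m \<and> n + 4 \<le> m \<and> m ^ 6 \<le> T"
proof -
  obtain m where m: "m ^ 12 < N" "N \<le> (m + 1) ^ 12" using root_exists[of N] N by auto
  have R0: "R \<ge> 13" using R by simp
  have "T * 1 \<le> T * (n + 3)" by (intro mult_le_mono2) simp
  then have "T + 1 \<le> N" using N by linarith
  then have "T + 1 \<le> (m + 1) ^ 12" using m(2) by simp
  then have "real (T + 1) \<le> real ((m + 1) ^ 12)" by (simp only: of_nat_le_iff)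
  then have "real T + 1 \<le> (real m + 1) ^ 12" by (simp only: of_nat_add of_nat_1 of_nat_power)
  then have "(R + 2) ^ 12 < (real m + 1) ^ 12" using T by (rule less_le_trans[rotated])
  then have "R + 2 < real m + 1" by (rule power_less_imp_less_base) simp
  then have mR: "R + 1 < real m" by simp
  then have nm: "n + 4 \<le> m" using R by linarith
  have "R + 2 \<le> (R + 2) ^ 12" using R0 by (intro self_le_power) auto
  then have "R + 1 < real T" using T by linarith
  then have "real (2 * n + 5 + le + ld) \<le> real T" using R l by simp
  then have "2 * n + 5 + le + ld \<le> T" by (simp only: of_nat_le_iff)
  then have "N \<le> T + T * (n + 3)" using N by linarith
  also have "\<dots> = T * (n + 4)" by (simp add: algebra_simps)
  also have "\<dots> \<le> T * m" using nm by (rule mult_le_mono2)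
  \<comment> \<open>Cancelling one factor m in m^12 < N <= T m leaves m^11 <= T.\<close>
  finally have "m ^ 11 * m \<le> T * m" using m(1) by (simp add: power_Suc2[of m 11, symmetric])
  then have "m ^ 11 \<le> T" using nm by simp
  moreover have "m ^ 6 \<le> m ^ 11" using nm by (intro power_increasing) auto
  ultimately have "m ^ 6 \<le> T" by linarith
  then show ?thesis using m mR nm by (intro exI[of _ m]) auto
qed

declare bin.simps [simp del]

section \<open>Assembly: the halting learner and the final theorem\<close>

text \<open>The learner itself: it halts in one step and leaves its input as the hypothesis.\<close>

definition halting :: tm where
  "halting = \<lparr>tm_states = 2, tm_trans = \<lambda>q s. (1, s, MvS)\<rparr>"

lemma run_halting:
  assumes "T \<ge> 1" "Blank \<notin> set w" shows "tm_run halting T w = Some w"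
proof -
  obtain t where T: "T = Suc t" using assms(1) by (cases T) auto
  let ?t = "\<lambda>i. if 0 \<le> i \<and> nat i < length w then w ! nat i else Blank"
  have "(tm_step halting ^^ T) (tm_init w) = (1, ?t, 0)"
    unfolding T
  proof (induction t)
    case 0 show ?case by (simp add: tm_init_def tm_step_def halting_def mv_def)
  qed (simp add: tm_step_def)
  moreover have "(LEAST i. ?t (int i) = Blank) = length w"
    by (rule Least_equality) (use assms(2) in \<open>auto simp: not_less[symmetric] in_set_conv_nth\<close>)
  then have "tape_out ?t = w" unfolding tape_out_def by (intro nth_equalityI) auto
  ultimately show ?thesis by (simp add: tm_run_def)
qed

lemma Blank_learner_input: "Blank \<notin> set (learner_input n \<epsilon> \<delta> smp r)"
  by (auto simp: learner_input_def enc_bits_def)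

lemma length_learner_input:
  assumes "length smp = T" "\<And>s. s \<in> set smp \<Longrightarrow> length (fst s) = n" "length r = T"
  shows "length (learner_input n \<epsilon> \<delta> smp r) =
    n + 4 + length (bin (nat \<lceil>1 / \<epsilon>\<rceil>)) + length (bin (nat \<lceil>1 / \<delta>\<rceil>)) + T * (n + 2) + T"
proof -
  have "length (concat (map (\<lambda>(x, y). enc_bits x @ enc_bits [y] @ [Sep]) smp)) = length smp * (n + 2)"
    using length_concat_blocks[of "map (\<lambda>(x, y). enc_bits x @ enc_bits [y] @ [Sep]) smp" "n + 2"] assms(2)
    by (force simp: enc_bits_def)
  then show ?thesis using assms by (simp add: learner_input_def enc_bits_def)
qed

lemma formula_xor_mono: "s \<le> s' \<Longrightarrow> formula_xor n s \<subseteq> formula_xor n s'"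
  unfolding formula_xor_def by (blast intro: order_trans)

text \<open>The power of zero is zero while every formula has a leaf, so the case n = 0 is vacuous
  and n >= 1 may be assumed.\<close>

lemma formula_xor_0: "formula_xor 0 (0 powr p) = {}"
proof -
  have "leaves F \<ge> 1" for F by (induction F) auto
  then have "\<not> real (leaves F) \<le> 0" for F by (metis not_one_le_zero of_nat_le_0_iff)
  then show ?thesis by (simp add: formula_xor_def)
qed

lemma prob_cong_support:
  assumes "\<And>x. x \<in> set_pmf D \<Longrightarrow> x \<in> A \<longleftrightarrow> x \<in> B"
  shows "measure_pmf.prob D A = measure_pmf.prob D B"
proof -
  have "A \<inter> set_pmf D = B \<inter> set_pmf D" using assms by blast
  then show ?thesis using measure_Int_set_pmf by metis
qed

theorem theorem6p1:
  fixes \<gamma> :: real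
  assumes "\<gamma> > 0"
  shows "\<exists>(L :: tm) (E :: tm) (c :: real) (k :: nat) (d :: real) (j :: nat).
    tm_wf L \<and> tm_wf E \<and>
    (\<forall>w x. tm_run E (nat \<lfloor>d * real (length w + length x + 1) ^ j\<rfloor>)
                   (enc_bits x @ [Sep] @ w) \<noteq> None) \<and>
    (\<forall>n \<epsilon> \<delta>. \<epsilon> > 0 \<longrightarrow> \<delta> > 0 \<longrightarrow>
      (let T = nat \<lfloor>learn_time c k n \<epsilon> \<delta>\<rfloor> in
        (\<forall>smp r. length smp = T \<longrightarrow> (\<forall>s \<in> set smp. length (fst s) = n) \<longrightarrow>
            length r = T \<longrightarrow> tm_run L T (learner_input n \<epsilon> \<delta> smp r) \<noteq> None) \<and>
        (\<forall>f D. f \<in> formula_xor n (real n powr (2 - \<gamma>)) \<longrightarrow>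
            set_pmf D \<subseteq> {x. length x = n} \<longrightarrow>
            measure_pmf.prob
              (pair_pmf (iid T (map_pmf (\<lambda>x. (x, f x)) D)) (iid T (bernoulli_pmf (1/2))))
              {(smp, r). \<exists>w. tm_run L T (learner_input n \<epsilon> \<delta> smp r) = Some w \<and>
                 measure_pmf.prob D
                   {x. hyp E (\<lambda>m. nat \<lfloor>d * real (m + 1) ^ j\<rfloor>) w x \<noteq> f x} \<le> \<epsilon>}
            \<ge> 1 - \<delta>)))"
proof -
  \<comment> \<open>For \<gamma> above 1 the class with exponent 2 - 1 is larger, so capping
    \<gamma> at 1 loses nothing and satisfies the cost lemmas.\<close>
  define \<gamma>' where "\<gamma>' = min \<gamma> 1"
  have \<gamma>': "0 < \<gamma>'" "\<gamma>' \<le> 1" using assms by (auto simp: \<gamma>'_def)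
  define \<kappa> where "\<kappa> = nat \<lceil>4 / \<gamma>'\<rceil>"
  have \<kappa>: "real \<kappa> \<ge> 4 / \<gamma>'" by (simp add: \<kappa>_def real_nat_ceiling_ge)
  have \<kappa>0: "\<kappa> > 0" using \<gamma>' by (simp add: \<kappa>_def)
  obtain C where C: "\<And>n. cost \<gamma>' \<kappa> n \<le> C * (2 powr (real n / log 2 (real n))) ^ (\<kappa> + 1)"
    using cost_bound[OF \<gamma>' \<kappa>] by blast
  obtain E kE where E: "tm_wf E" and runE: "\<And>u N inp T. N = length (takeWhile (\<lambda>s. s \<noteq> Blank) u) \<Longrightarrow>
     inp = (\<lambda>i. if i < length u then u ! i else Blank) \<Longrightarrow> T \<ge> (N + 2) ^ kE \<Longrightarrow>
     tm_run E T u = Some (if ev N inp (memo N inp (eProg \<kappa>) N) (eAns \<kappa>) (\<lambda>_. N) = 0 then [One] else [])"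
    using evaluator_exists[OF ok_prog[of \<kappa>]] by blast
  \<comment> \<open>The evaluator needs (N + 2)^\<open>kE\<close> steps, and N + 2 is at most 3 (|w|
    + |x| + 1).\<close>
  define d where "d = (3::real) ^ kE"
  define bud where "bud = (\<lambda>m. nat \<lfloor>d * real (m + 1) ^ kE\<rfloor>)"
  have bud: "bud m = (3 * (m + 1)) ^ kE" for m
  proof -
    have "d * real (m + 1) ^ kE = real ((3 * (m + 1)) ^ kE)" by (simp add: d_def power_mult_distrib[symmetric])
    then show ?thesis unfolding bud_def by (simp only: floor_of_nat nat_int)
  qed
  have runE': "tm_run E (bud (length w + length x)) (enc_bits x @ [Sep] @ w) =
     Some (if ev N inp (memo N inp (eProg \<kappa>) N) (eAns \<kappa>) (\<lambda>_. N) = 0 then [One] else [])"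
    if "N = length (takeWhile (\<lambda>s. s \<noteq> Blank) (enc_bits x @ [Sep] @ w))"
      "inp = (\<lambda>i. if i < length (enc_bits x @ [Sep] @ w) then (enc_bits x @ [Sep] @ w) ! i else Blank)" for w x N inp
  proof (rule runE[OF that])
    have "N \<le> length (enc_bits x @ [Sep] @ w)" unfolding that(1) by (rule length_takeWhile_le)
    then have "N + 2 \<le> 3 * (length w + length x + 1)" by (simp add: enc_bits_def)
    then show "(N + 2) ^ kE \<le> bud (length w + length x)" unfolding bud by (intro power_mono) auto
  qed
  \<comment> \<open>These constants are fitted so that (R + 2)^12 <= c X^k, where R is the batch
    size demanded by \<open>learner_bounds\<close>: a twelfth power because m is a twelfth root, a
    square from R, and \<kappa> + 2 factors from \<open>cost\<close> times X.\<close>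
  define C0 where "C0 = 1600 * C\<^sup>2"
  define c where "c = (C0 + 2) ^ 12"
  define k where "k = 12 * (2 * (\<kappa> + 2))"
  have C0: "C0 \<ge> 0" by (simp add: C0_def)
  have c1: "c \<ge> 1" unfolding c_def using C0 by (intro one_le_power) auto
  have main: "let T = nat \<lfloor>learn_time c k n \<epsilon> \<delta>\<rfloor> in
        (\<forall>smp r. length smp = T \<longrightarrow> (\<forall>s \<in> set smp. length (fst s) = n) \<longrightarrow>
            length r = T \<longrightarrow> tm_run halting T (learner_input n \<epsilon> \<delta> smp r) \<noteq> None) \<and>
        (\<forall>f D. f \<in> formula_xor n (real n powr (2 - \<gamma>)) \<longrightarrow>
            set_pmf D \<subseteq> {x. length x = n} \<longrightarrow>
            measure_pmf.prob
              (pair_pmf (iid T (map_pmf (\<lambda>x. (x, f x)) D)) (iid T (bernoulli_pmf (1/2))))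
              {(smp, r). \<exists>w. tm_run halting T (learner_input n \<epsilon> \<delta> smp r) = Some w \<and>
                 measure_pmf.prob D {x. hyp E bud w x \<noteq> f x} \<le> \<epsilon>}
            \<ge> 1 - \<delta>)" if \<epsilon>: "\<epsilon> > 0" and \<delta>: "\<delta> > 0" for n \<epsilon> \<delta>
  proof -
    define W where "W = 2 powr (real n / log 2 (real n))"
    define X where "X = W + 1 / \<epsilon> + max 1 (log 2 (1 / \<delta>))"
    define T where "T = nat \<lfloor>learn_time c k n \<epsilon> \<delta>\<rfloor>"
    have W0: "W > 0" by (simp add: W_def)
    have e0: "1 / \<epsilon> > 0" using \<epsilon> by simp
    have X: "1 \<le> X" "1 / \<epsilon> \<le> X" "log 2 (1 / \<delta>) \<le> X" "W \<le> X"
      unfolding X_def using W0 e0 by linarith+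
    have lt: "learn_time c k n \<epsilon> \<delta> = c * X ^ k" by (simp add: learn_time_def X_def W_def)
    have "1 * 1 \<le> c * X ^ k" using c1 X by (intro mult_mono one_le_power) auto
    then have T1: "T \<ge> 1" unfolding T_def lt by (simp add: le_nat_floor)
    have Tlt: "c * X ^ k < real T + 1" unfolding T_def lt using \<open>1 * 1 \<le> c * X ^ k\<close> by linarith
    have runL: "tm_run halting T (learner_input n \<epsilon> \<delta> smp r) = Some (learner_input n \<epsilon> \<delta> smp r)" for smp r
      by (rule run_halting[OF T1 Blank_learner_input])
    have "1 - \<delta> \<le> measure_pmf.prob (pair_pmf (iid T (map_pmf (\<lambda>x. (x, f x)) D)) (iid T (bernoulli_pmf (1/2))))
         {(smp, r). measure_pmf.prob D {x. hyp E bud (learner_input n \<epsilon> \<delta> smp r) x \<noteq> f x} \<le> \<epsilon>}"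
      if f: "f \<in> formula_xor n (real n powr (2 - \<gamma>))" and D: "set_pmf D \<subseteq> {x. length x = n}" for f D
    proof -
      have n: "n \<ge> 1" using f formula_xor_0 by (cases n) auto
      have "real n powr (2 - \<gamma>) \<le> real n powr (2 - \<gamma>')" using n by (intro powr_mono) (auto simp: \<gamma>'_def)
      then have f': "f \<in> formula_xor n (real n powr (2 - \<gamma>'))" using f formula_xor_mono by blast
      \<comment> \<open>The least batch size for which \<open>learner_bounds\<close> gives error
        \<epsilon> and confidence \<delta>.\<close>
      define R where "R = 1600 * (cost \<gamma>' \<kappa> n * X)\<^sup>2"
      define a where "a = height \<kappa> n"
      let ?Y = "cost \<gamma>' \<kappa> n"
      have Y32: "32 * (2 * real n + 1) \<le> ?Y" by (rule cost_lower(1)[OF \<gamma>' n])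
      have Y: "?Y \<ge> real n" "?Y \<ge> 1" using Y32 n by auto
      have Rlow: "2 * real n + 5 + 6 * X \<le> R"
      proof -
        have "real n * 1 \<le> ?Y * X" using Y X n by (intro mult_mono) auto
        moreover have "1 * X \<le> ?Y * X" using Y X by (intro mult_right_mono) auto
        moreover have yx: "1 * 1 \<le> ?Y * X" using Y X by (intro mult_mono) auto
        moreover have "?Y * X \<le> (?Y * X)\<^sup>2" by (rule self_le_power) (use yx in auto)
        ultimately show ?thesis unfolding R_def by linarith
      qed
      \<comment> \<open>All of W, 1 / \<epsilon> and log (1 / \<delta>) are below X, so R is at most
        a constant times a power of X.\<close>
      have Rup: "(R + 2) ^ 12 < real T + 1"
      proof -
        have "?Y * X \<le> (C * W ^ (\<kappa> + 1)) * X" using C[of n] X by (intro mult_right_mono) (auto simp: W_def)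
        also have "\<dots> \<le> \<bar>C\<bar> * X ^ (\<kappa> + 1) * X"
          using X W0 by (intro mult_right_mono mult_mono power_mono) auto
        finally have "?Y * X \<le> \<bar>C\<bar> * X ^ (\<kappa> + 2)" by (simp add: mult_ac)
        then have "(?Y * X)\<^sup>2 \<le> (\<bar>C\<bar> * X ^ (\<kappa> + 2))\<^sup>2" using Y X by (intro power_mono) auto
        also have "\<dots> = C\<^sup>2 * X ^ (2 * (\<kappa> + 2))" by (simp only: power_mult_distrib power_mult[symmetric] power2_abs mult.commute)
        finally have "R \<le> C0 * X ^ (2 * (\<kappa> + 2))" by (simp add: R_def C0_def)
        moreover have "1 \<le> X ^ (2 * (\<kappa> + 2))" using X by (intro one_le_power)
        ultimately have "R + 2 \<le> (C0 + 2) * X ^ (2 * (\<kappa> + 2))" unfolding distrib_right by linarith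
        then have "(R + 2) ^ 12 \<le> ((C0 + 2) * X ^ (2 * (\<kappa> + 2))) ^ 12"
          by (rule power_mono) (simp add: R_def)
        also have "\<dots> = c * X ^ k" by (simp only: c_def k_def power_mult_distrib power_mult[symmetric] mult.commute)
        finally show ?thesis using Tlt by simp
      qed
      define le ld where "le = length (bin (nat \<lceil>1 / \<epsilon>\<rceil>))" and "ld = length (bin (nat \<lceil>1 / \<delta>\<rceil>))"
      have le: "real le \<le> 3 * X"
      proof -
        have "log 2 (1 / \<epsilon>) \<le> log 2 X" using X e0 by simp
        also have "\<dots> \<le> X"
        proof -
          have "X \<le> real (Suc (nat \<lfloor>X\<rfloor>))" using X(1) by linarith
          also have "\<dots> \<le> real (2 ^ nat \<lfloor>X\<rfloor>)" by (subst of_nat_le_iff) (rule Suc_leI[OF less_exp])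
          also have "\<dots> = 2 powr real (nat \<lfloor>X\<rfloor>)" by (simp add: powr_realpow)
          also have "\<dots> \<le> 2 powr X" using X(1) by (intro powr_mono) linarith+
          finally show ?thesis using X(1) by (simp add: log_le_iff)
        qed
        finally show ?thesis unfolding le_def by (rule length_bin_ceiling[OF \<epsilon> X(1)])
      qed
      have ld: "real ld \<le> 3 * X" unfolding ld_def by (rule length_bin_ceiling[OF \<delta> X(1,3)])
      define N where "N = 2 * n + 5 + le + ld + T * (n + 3)"
      obtain m where m: "m ^ 12 < N" "N \<le> (m + 1) ^ 12" "R \<le> real m" "n + 4 \<le> m" "m ^ 6 \<le> T"
        using scale_exists[OF Rup Rlow X(1) n le ld N_def] by blast
      have an: "a \<le> n + 1" unfolding a_def height_def using lg_le[of n] by (simp add: div_le_dividend le_trans[OF div_le_dividend])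
      define M where "M = m * (m * m * (a * m))"
      have M: "M * m \<le> T" "M \<le> T"
      proof -
        have "M * m \<le> m * (m * m * (m * m)) * m" unfolding M_def using an m(4) by (intro mult_le_mono) auto
        also have "\<dots> = m ^ 6" by (simp add: eval_nat_numeral)
        finally show 1: "M * m \<le> T" using m(5) by simp
        have "M \<le> M * m" using m(4) by simp
        then show "M \<le> T" using 1 by (rule le_trans)
      qed
      have finD: "fin D" using D finite_lists_length_eq[of "UNIV :: bool set" n] by (auto intro: finite_subset)
      let ?P = "pair_pmf (iid T (map_pmf (\<lambda>x. (x, f x)) D)) (iid T (bernoulli_pmf (1/2)))"
      let ?g = "\<lambda>zs. of_bool (measure_pmf.prob D {x. predict n a m zs x \<noteq> f x} \<le> \<epsilon>) :: real"
      \<comment> \<open>For actual examples the string has length N and no blanks, so the evaluator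
        simulates the analysed predictor exactly; this is claimed on the supports only.\<close>
      have hyp_iff: "hyp E bud (learner_input n \<epsilon> \<delta> smp r) x \<longleftrightarrow> predict n a m (map (samples m smp r) [0..<M]) x"
        if sr: "smp \<in> set_pmf (iid T (map_pmf (\<lambda>x. (x, f x)) D))" "r \<in> set_pmf (iid T (bernoulli_pmf (1/2)))"
          and x: "x \<in> set_pmf D" for smp r x
      proof -
        let ?w = "learner_input n \<epsilon> \<delta> smp r"
        let ?u = "enc_bits x @ [Sep] @ ?w"
        let ?inp = "\<lambda>i. if i < length ?u then ?u ! i else Blank"
        have s: "length smp = T" "\<And>s. s \<in> set smp \<Longrightarrow> length (fst s) = n" "length r = T" "length x = n"
          using sr x D by (auto simp: set_iid)
        have N: "N = length ?u"
          using length_learner_input[OF s(1-3), of \<epsilon> \<delta>] s(4) by (simp add: N_def le_def ld_def enc_bits_def algebra_simps)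
        have "Blank \<notin> set ?u" using Blank_learner_input[of n \<epsilon> \<delta> smp r] by (auto simp: enc_bits_def)
        then have "takeWhile (\<lambda>s. s \<noteq> Blank) ?u = ?u" unfolding takeWhile_eq_all_conv by metis
        then have "N = length (takeWhile (\<lambda>s. s \<noteq> Blank) ?u)" using N by (simp only:)
        from runE'[OF this refl] have "hyp E bud ?w x \<longleftrightarrow> ev N ?inp (memo N ?inp (eProg \<kappa>) N) (eAns \<kappa>) (\<lambda>_. N) = 0"
          by (simp only: hyp_def) simp
        also have "\<dots> \<longleftrightarrow> predict n a m (map (samples m smp r) [0..<M]) x"
          unfolding M_def
          by (rule interpreter_correct[OF s refl N refl m(1,2,4) _ m(5) \<kappa>0])
            (use an m(4) in \<open>simp_all add: a_def height_def\<close>)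
        finally show ?thesis .
      qed
      \<comment> \<open>From here the good event is carried from independent labelled items to the
        pair of examples and coins, and then from the predictor to the hypothesis.\<close>
      have "1 - \<delta> \<le> measure_pmf.prob (iid M (labelled D f (binom m))) {zs. measure_pmf.prob D {x. predict n a m zs x \<noteq> f x} \<le> \<epsilon>}"
        unfolding M_def by (rule learner_bounds[OF \<gamma>' n \<epsilon> \<delta> X(1-3) m(3)[unfolded R_def] a_def f' D])
      also have "\<dots> = EE (iid M (labelled D f (binom m))) ?g"
        using finD fin_bern by (subst EE_prob) (auto simp: labelled_def binom_def)
      also have "\<dots> = EE ?P (\<lambda>(smp, r). ?g (map (samples m smp r) [0..<M]))"
        by (rule EE_samples[OF finD M(2,1), symmetric])
      also have "\<dots> = EE ?P (\<lambda>z. of_bool (z \<in> {(smp, r). measure_pmf.prob D {x. hyp E bud (learner_input n \<epsilon> \<delta> smp r) x \<noteq> f x} \<le> \<epsilon>}))"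
      proof (rule EE_cong)
        fix z assume "z \<in> set_pmf ?P"
        then obtain smp r where z: "z = (smp, r)" and sr: "smp \<in> set_pmf (iid T (map_pmf (\<lambda>x. (x, f x)) D))" "r \<in> set_pmf (iid T (bernoulli_pmf (1/2)))"
          unfolding set_pair_pmf by blast
        have "measure_pmf.prob D {x. hyp E bud (learner_input n \<epsilon> \<delta> smp r) x \<noteq> f x} =
          measure_pmf.prob D {x. predict n a m (map (samples m smp r) [0..<M]) x \<noteq> f x}"
          by (rule prob_cong_support) (simp add: hyp_iff[OF sr])
        then show "(case z of (smp, r) \<Rightarrow> ?g (map (samples m smp r) [0..<M])) =
          of_bool (z \<in> {(smp, r). measure_pmf.prob D {x. hyp E bud (learner_input n \<epsilon> \<delta> smp r) x \<noteq> f x} \<le> \<epsilon>})"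
          by (simp add: z)
      qed
      also have "\<dots> = measure_pmf.prob ?P {(smp, r). measure_pmf.prob D {x. hyp E bud (learner_input n \<epsilon> \<delta> smp r) x \<noteq> f x} \<le> \<epsilon>}"
        using finD fin_bern by (subst EE_prob) auto
      finally show ?thesis .
    qed
    then show ?thesis unfolding T_def[symmetric] Let_def by (simp add: runL)
  qed
  have tot: "tm_run E (nat \<lfloor>d * real (length w + length x + 1) ^ kE\<rfloor>) (enc_bits x @ [Sep] @ w) \<noteq> None" for w x
    using runE'[OF refl refl, of w x] unfolding bud_def by simp
  have "tm_wf halting" by (simp add: tm_wf_def halting_def)
  then show ?thesis using E tot main unfolding bud_def
    by (intro exI[of _ halting] exI[of _ E] exI[of _ c] exI[of _ k] exI[of _ d] exI[of _ kE] conjI allI impI)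
qed

end
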